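(* Let $(G,H)$ be a face instance of multicommodity flow satisfying the cut condition, and let $t$ be the maximum number of terminals on any face. Then $(O(\log t)\,G,H)$ is feasible; i.e., the flow-cut gap of $(G,H)$ is $O(\log t)$.
   Context: $G=(V,E)$ is a planar graph with fixed embedding and capacities $c:E\to\mathbb{Z}_{\ge0}$; $H$ is a demand multigraph on $V$ with each edge of demand $1$. $(G,H)$ is feasible if there is an assignment of nonnegative reals to paths in $G$ so that each demand edge $uv$ receives total value $1$ on $u$–$v$ paths and each supply edge $e$ is used by total value at most $c(e)$. The cut condition is $\delta_G(S)\ge\delta_H(S)$ for all $S\subseteq V$, where $\delta_G(S)$ is total capacity of edges leaving $S$ and $\delta_H(S)$ the number of demand edges leaving $S$. $kG$ denotes $G$ with capacities multiplied by $k$. A face instance is one where for every demand edge $uv$ there is a face containing both $u$ and $v$; each demand is associated with one such face. Terminals on a face are the endpoints of demands associated with that face. *)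

theory Defs
  imports "HOL-Analysis.Analysis"
begin

text \<open>
  A graph together with a fixed planar embedding is a plane graph: its vertices are points of the
  plane, and each edge is (the point set of) an arc joining two distinct vertices.  Parallel edges
  are different arcs with the same two ends.  The ends of an edge \<open>e\<close> are the two points of
  \<open>e \<inter> V\<close>, because the relative interior of an edge contains no vertex.  The graph
  need not be connected.
\<close>

definition plane_graph :: "complex set \<Rightarrow> complex set set \<Rightarrow> bool" where
  "plane_graph V E \<longleftrightarrow>
     finite V \<and> finite E \<and>
     (\<forall>e\<in>E. \<exists>g. arc g \<and> path_image g = e \<and> e \<inter> V = {pathstart g, pathfinish g}) \<and>
     (\<forall>e\<in>E. \<forall>e'\<in>E. e \<noteq> e' \<longrightarrow> e \<inter> e' \<subseteq> V)"

definition faces :: "complex set \<Rightarrow> complex set set \<Rightarrow> complex set set" where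
  "faces V E = components (- (V \<union> \<Union>E))"

text \<open>
  A demand multigraph on \<open>V\<close> has edge set \<open>D\<close>, and \<open>h d\<close> is the pair of ends of the
  demand edge \<open>d\<close>, listed in an arbitrary order.  Demand edges and vertices range over fixed types,
  so that a constant can be quantified outside of all instances.
\<close>

definition demand_multigraph :: "complex set \<Rightarrow> nat set \<Rightarrow> (nat \<Rightarrow> complex \<times> complex) \<Rightarrow> bool" where
  "demand_multigraph V D h \<longleftrightarrow> finite D \<and> (\<forall>d\<in>D. fst (h d) \<in> V \<and> snd (h d) \<in> V)"

definition supply_cut ::
    "complex set \<Rightarrow> complex set set \<Rightarrow> (complex set \<Rightarrow> nat) \<Rightarrow> complex set \<Rightarrow> nat" where
  "supply_cut V E c S = (\<Sum>e | e \<in> E \<and> e \<inter> V \<inter> S \<noteq> {} \<and> e \<inter> V - S \<noteq> {}. c e)"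

definition demand_cut :: "nat set \<Rightarrow> (nat \<Rightarrow> complex \<times> complex) \<Rightarrow> complex set \<Rightarrow> nat" where
  "demand_cut D h S = card {d \<in> D. (fst (h d) \<in> S) \<noteq> (snd (h d) \<in> S)}"

definition cut_condition ::
    "complex set \<Rightarrow> complex set set \<Rightarrow> (complex set \<Rightarrow> nat) \<Rightarrow>
     nat set \<Rightarrow> (nat \<Rightarrow> complex \<times> complex) \<Rightarrow> bool" where
  "cut_condition V E c D h \<longleftrightarrow> (\<forall>S\<subseteq>V. supply_cut V E c S \<ge> demand_cut D h S)"

text \<open>
  A path is given by its vertex sequence, without repetitions, and its edge sequence; the latter is
  needed because of parallel edges.
\<close>

definition paths_between ::
    "complex set \<Rightarrow> complex set set \<Rightarrow> complex \<Rightarrow> complex \<Rightarrow> (complex list \<times> complex set list) set"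
  where
  "paths_between V E u v =
     {(vs, es). length vs = Suc (length es) \<and> hd vs = u \<and> last vs = v \<and>
        distinct vs \<and> set vs \<subseteq> V \<and> set es \<subseteq> E \<and>
        (\<forall>i<length es. es ! i \<inter> V = {vs ! i, vs ! Suc i})}"

lemma finite_paths_between:
  assumes "finite V" "finite E"
  shows "finite (paths_between V E u v)"
proof (rule finite_subset)
  show "paths_between V E u v \<subseteq>
      {vs. set vs \<subseteq> V \<and> length vs \<le> card V} \<times> {es. set es \<subseteq> E \<and> length es \<le> card V}"
  proof
    fix p assume "p \<in> paths_between V E u v"
    then obtain vs es where p: "p = (vs, es)" "length vs = Suc (length es)" "distinct vs"
        "set vs \<subseteq> V" "set es \<subseteq> E"
      unfolding paths_between_def by auto
    have "length vs \<le> card V"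
      using card_mono[OF assms(1) p(4)] distinct_card[OF p(3)] by simp
    with p show "p \<in> {vs. set vs \<subseteq> V \<and> length vs \<le> card V} \<times>
        {es. set es \<subseteq> E \<and> length es \<le> card V}"
      by auto
  qed
  show "finite ({vs. set vs \<subseteq> V \<and> length vs \<le> card V} \<times>
      {es. set es \<subseteq> E \<and> length es \<le> card V})"
    using assms by (intro finite_cartesian_product finite_lists_length_le)
qed

text \<open>
  \<open>f d P\<close> is the amount of demand \<open>d\<close> routed on the path \<open>P\<close>; separate indexing by
  \<open>d\<close> makes parallel demand edges receive one unit each.  Capacities are real here, since
  they are also multiplied by real factors.
\<close>

definition feasible ::
    "complex set \<Rightarrow> complex set set \<Rightarrow> (complex set \<Rightarrow> real) \<Rightarrow>
     nat set \<Rightarrow> (nat \<Rightarrow> complex \<times> complex) \<Rightarrow> bool" where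
  "feasible V E c D h \<longleftrightarrow>
     (\<exists>f :: nat \<Rightarrow> complex list \<times> complex set list \<Rightarrow> real.
        (\<forall>d\<in>D. \<forall>P\<in>paths_between V E (fst (h d)) (snd (h d)). f d P \<ge> 0) \<and>
        (\<forall>d\<in>D. (\<Sum>P\<in>paths_between V E (fst (h d)) (snd (h d)). f d P) = 1) \<and>
        (\<forall>e\<in>E. (\<Sum>d\<in>D. \<Sum>P | P \<in> paths_between V E (fst (h d)) (snd (h d)) \<and> e \<in> set (snd P).
                   f d P) \<le> c e))"

text \<open>
  The least factor by which the capacities of an instance satisfying the cut condition have to be
  multiplied to make it feasible.
\<close>

definition flow_cut_gap ::
    "complex set \<Rightarrow> complex set set \<Rightarrow> (complex set \<Rightarrow> nat) \<Rightarrow>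
     nat set \<Rightarrow> (nat \<Rightarrow> complex \<times> complex) \<Rightarrow> real" where
  "flow_cut_gap V E c D h = Inf {k. 0 \<le> k \<and> feasible V E (\<lambda>e. k * real (c e)) D h}"

text \<open>
  The face associated with the demand \<open>d\<close> is \<open>\<phi> d\<close>.  Faces are open, so the vertices
  on a face are those in its frontier.
\<close>

definition face_instance ::
    "complex set \<Rightarrow> complex set set \<Rightarrow> nat set \<Rightarrow> (nat \<Rightarrow> complex \<times> complex) \<Rightarrow>
     (nat \<Rightarrow> complex set) \<Rightarrow> bool" where
  "face_instance V E D h \<phi> \<longleftrightarrow>
     (\<forall>d\<in>D. \<phi> d \<in> faces V E \<and> fst (h d) \<in> frontier (\<phi> d) \<and> snd (h d) \<in> frontier (\<phi> d))"

definition face_terminals ::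
    "nat set \<Rightarrow> (nat \<Rightarrow> complex \<times> complex) \<Rightarrow> (nat \<Rightarrow> complex set) \<Rightarrow>
     complex set \<Rightarrow> complex set" where
  "face_terminals D h \<phi> F = (\<Union>d\<in>{d \<in> D. \<phi> d = F}. {fst (h d), snd (h d)})"

definition max_face_terminals ::
    "complex set \<Rightarrow> complex set set \<Rightarrow> nat set \<Rightarrow> (nat \<Rightarrow> complex \<times> complex) \<Rightarrow>
     (nat \<Rightarrow> complex set) \<Rightarrow> nat" where
  "max_face_terminals V E D h \<phi> = Max ((\<lambda>F. card (face_terminals D h \<phi> F)) ` faces V E)"

text \<open>The maximum is taken over a finite nonempty set of numbers.\<close>

lemma face_terminal_counts_finite_nonempty:
  assumes "plane_graph V E" "demand_multigraph V D h"
  shows "finite ((\<lambda>F. card (face_terminals D h \<phi> F)) ` faces V E)"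
    and "(\<lambda>F. card (face_terminals D h \<phi> F)) ` faces V E \<noteq> {}"
proof -
  have V: "finite V" and E: "finite E" and arcs: "\<And>e. e \<in> E \<Longrightarrow> \<exists>g. arc g \<and> path_image g = e"
    using assms(1) unfolding plane_graph_def by fast+
  have "card (face_terminals D h \<phi> F) \<le> card V" for F
  proof (rule card_mono[OF V])
    show "face_terminals D h \<phi> F \<subseteq> V"
      using assms(2) unfolding face_terminals_def demand_multigraph_def by auto
  qed
  then have "(\<lambda>F. card (face_terminals D h \<phi> F)) ` faces V E \<subseteq> {..card V}"
    by auto
  then show "finite ((\<lambda>F. card (face_terminals D h \<phi> F)) ` faces V E)"
    by (rule finite_subset) simp
  have "bounded e" if "e \<in> E" for e
  proof -
    obtain g where "arc g" "path_image g = e"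
      using arcs[OF \<open>e \<in> E\<close>] by (elim exE conjE)
    then show ?thesis
      using bounded_arc_image[of g] by simp
  qed
  then have "bounded (V \<union> \<Union>E)"
    using V E by (simp add: finite_imp_bounded bounded_Union)
  then have "V \<union> \<Union>E \<noteq> UNIV"
    using not_bounded_UNIV[where 'a = complex] by (intro notI) (simp only:)
  then have "- (V \<union> \<Union>E) \<noteq> {}"
    by (simp only: Compl_eq_Diff_UNIV) blast
  then show "(\<lambda>F. card (face_terminals D h \<phi> F)) ` faces V E \<noteq> {}"
    unfolding faces_def by (simp add: components_eq_empty)
qed

end

theory Submission
  imports Defs
begin

text \<open>By linear programming duality it suffices to bound \<open>\<Sum>d. dist l d\<close> by \<open>O(log t) * (\<Sum>e. c e * l e)\<close> for
  all edge lengths \<open>l \<ge> 0\<close>, where \<open>dist\<close> may be taken as the length of a shortest edge set with the right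
  odd-degree vertices.

  If the demands can be drawn inside their faces without crossings, then supply and demand edges together form
  a plane graph. In its dual the cut condition says that the weights \<open>c\<close> on supply and \<open>-1\<close> on demand edges
  are conservative, and the theorem on packing cuts in bipartite graphs bounds the sum of the distances
  by \<open>\<Sum>e. c e * l e\<close> without any loss.

  In general, place a hub in every face and join it to the terminals; the dual of this graph gives the
  cyclic order of the terminals, and the shores of a minimal cut are intervals in it. A dyadic subdivision of each
  order splits the demands into \<open>O(log t)\<close> levels, on each of which all demands cross the middle of disjoint
  blocks. The demands of one block are replaced by nested chords, which turn left ends into right ends, followed by a
  permutation of the right ends. A permutation whose load at position \<open>q\<close> is \<open>h q\<close> is dominated by three
  non-crossing matchings whose load is at most \<open>h\<close>: the positions are cut into intervals of length about
  \<open>h / 4\<close>, distances are averaged over intervals, and antidiagonal matchings within an interval or between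
  neighbouring ones carry the averages. No interval is crossed more often by the new chords than by the
  old demands, so they inherit the cut condition, and each level costs only a constant factor.\<close>

section \<open>Cuts and edge sets of odd degree\<close>

text \<open>Everything is counted modulo 2. Paths, cycles and connectedness are replaced by edge
  sets with prescribed odd vertices, since such sets add up by symmetric difference and are
  orthogonal to cuts; in \<open>bdry\<close> a loop counts twice and vanishes. Duality then needs
  neither orientations nor rotation systems: topology has to show that the cuts of the face graph
  are exactly the even sets of the plane graph, by the Jordan curve theorem and Janiszewski's
  theorem. Chords inside a face are never drawn; they are inserted into the abstract dual of the
  graph with hubs.

  Two obstacles shape the rest. A terminal is only known to be a limit of points of its face, and
  the interval property of minimal cuts needs a connected graph. So the bound is proved for
  connected graphs and applied to every component, where no face may gain terminals.

  The constant: a level costs 144 = 4 * 36, for four chord systems per block and a loss of at most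
  36, and at most \<open>2 * log 2 t\<close> levels are needed once \<open>t\<close> is at least
  2.\<close>

definition bdry :: "('e \<Rightarrow> 'v) \<Rightarrow> ('e \<Rightarrow> 'v) \<Rightarrow> 'e set \<Rightarrow> 'v set" where
  "bdry a b J = {v. odd (card {e \<in> J. a e = v} + card {e \<in> J. b e = v})}"

definition cut :: "('e \<Rightarrow> 'v) \<Rightarrow> ('e \<Rightarrow> 'v) \<Rightarrow> 'e set \<Rightarrow> 'v set \<Rightarrow> 'e set" where
  "cut a b X Y = {e \<in> X. (a e \<in> Y) \<noteq> (b e \<in> Y)}"

lemma odd_card_sym_diff:
  assumes "finite A" "finite B"
  shows "odd (card (sym_diff A B)) \<longleftrightarrow> odd (card A) \<noteq> odd (card B)"
proof -
  have "card (sym_diff A B) = card (A - B) + card (B - A)"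
    using assms by (intro card_Un_disjoint) auto
  moreover have "card A = card (A - B) + card (A \<inter> B)"
    by (subst card_Un_disjoint[symmetric]) (use assms in \<open>auto intro!: arg_cong[of _ _ card]\<close>)
  moreover have "card B = card (B - A) + card (A \<inter> B)"
    by (subst card_Un_disjoint[symmetric]) (use assms in \<open>auto intro!: arg_cong[of _ _ card]\<close>)
  ultimately show ?thesis by auto
qed

lemma bdry_empty [simp]: "bdry a b {} = {}"
  by (simp add: bdry_def)

lemma bdry_sym_diff:
  assumes "finite J" "finite K"
  shows "bdry a b (sym_diff J K) = sym_diff (bdry a b J) (bdry a b K)"
proof (rule set_eqI)
  fix v
  have *: "odd (card {e \<in> sym_diff J K. f e = v}) \<longleftrightarrow>
      odd (card {e \<in> J. f e = v}) \<noteq> odd (card {e \<in> K. f e = v})" for f :: "'a \<Rightarrow> 'b"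
  proof -
    have "{e \<in> sym_diff J K. f e = v} = sym_diff {e \<in> J. f e = v} {e \<in> K. f e = v}" by blast
    then show ?thesis
      using odd_card_sym_diff[of "{e \<in> J. f e = v}" "{e \<in> K. f e = v}"] assms by simp
  qed
  show "v \<in> bdry a b (sym_diff J K) \<longleftrightarrow> v \<in> sym_diff (bdry a b J) (bdry a b K)"
    unfolding bdry_def using *[of a] *[of b] by simp blast
qed

lemma bdry_single:
  fixes a b :: "'e \<Rightarrow> 'v"
  shows "bdry a b {e} = sym_diff {a e} {b e}"
proof -
  have "{x. x = e \<and> f x = v} = (if f e = v then {e} else {})" for f :: "'e \<Rightarrow> 'v" and v by auto
  then show ?thesis by (auto simp: bdry_def)
qed

lemma bdry_insert:
  assumes "finite J" "e \<notin> J"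
  shows "bdry a b (insert e J) = sym_diff (sym_diff {a e} {b e}) (bdry a b J)"
proof -
  have "insert e J = sym_diff {e} J" using assms by auto
  then show ?thesis using bdry_sym_diff[of "{e}" J a b] assms bdry_single[of a b e] by simp
qed

lemma bdry_Un:
  assumes "finite J" "finite K" "J \<inter> K = {}"
  shows "bdry a b (J \<union> K) = sym_diff (bdry a b J) (bdry a b K)"
proof -
  have "J \<union> K = sym_diff J K" using assms by auto
  then show ?thesis using bdry_sym_diff[OF assms(1,2)] by metis
qed

lemma bdry_Diff:
  assumes "finite J" "K \<subseteq> J"
  shows "bdry a b (J - K) = sym_diff (bdry a b J) (bdry a b K)"
proof -
  have "J - K = sym_diff J K" using assms by auto
  then show ?thesis using bdry_sym_diff[of J K a b] assms finite_subset by metis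
qed

lemma bdry_subset: "bdry a b J \<subseteq> a ` J \<union> b ` J"
proof
  fix v assume "v \<in> bdry a b J"
  then have "card {e \<in> J. a e = v} \<noteq> 0 \<or> card {e \<in> J. b e = v} \<noteq> 0"
    unfolding bdry_def by (metis (no_types, lifting) even_zero add_0 mem_Collect_eq)
  then have "{e \<in> J. a e = v} \<noteq> {} \<or> {e \<in> J. b e = v} \<noteq> {}"
    by (metis card.empty)
  then show "v \<in> a ` J \<union> b ` J" by auto
qed

lemma finite_bdry: "finite J \<Longrightarrow> finite (bdry a b J)"
  using bdry_subset finite_subset by (metis finite_UnI finite_imageI)

lemma finite_cut: "finite X \<Longrightarrow> finite (cut a b X Y)"
  by (simp add: cut_def)

lemma cut_subset: "cut a b X Y \<subseteq> X"
  by (auto simp: cut_def)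

text \<open>Boundary and coboundary are adjoint modulo 2: an edge is in the cut exactly when one of
  its ends is in \<open>Y\<close>, so both parities change together as edges are added. Most duality
  and connectedness arguments below are instances of this.\<close>

lemma odd_card_Int_cut:
  assumes "finite J" "J \<subseteq> X"
  shows "odd (card (J \<inter> cut a b X Y)) \<longleftrightarrow> odd (card (bdry a b J \<inter> Y))"
  using assms
proof (induction J)
  case empty
  then show ?case by simp
next
  case (insert e J)
  let ?s = "sym_diff {a e} {b e}"
  have "bdry a b (insert e J) \<inter> Y = sym_diff (?s \<inter> Y) (bdry a b J \<inter> Y)"
    using bdry_insert[of J e a b] insert by blast
  then have 1: "odd (card (bdry a b (insert e J) \<inter> Y)) \<longleftrightarrow>
      odd (card (?s \<inter> Y)) \<noteq> odd (card (bdry a b J \<inter> Y))"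
    using odd_card_sym_diff[of "?s \<inter> Y" "bdry a b J \<inter> Y"] finite_bdry[of J a b] insert by simp
  have 2: "odd (card (?s \<inter> Y)) \<longleftrightarrow> (a e \<in> Y) \<noteq> (b e \<in> Y)"
  proof (cases "a e = b e")
    case False
    then have "?s \<inter> Y = (if a e \<in> Y then {a e} else {}) \<union> (if b e \<in> Y then {b e} else {})" by auto
    then show ?thesis using False by auto
  qed auto
  have 3: "insert e J \<inter> cut a b X Y = (if (a e \<in> Y) \<noteq> (b e \<in> Y) then insert e (J \<inter> cut a b X Y)
     else J \<inter> cut a b X Y)"
    using insert by (auto simp: cut_def)
  have "odd (card (insert e J \<inter> cut a b X Y)) \<longleftrightarrow>
      ((a e \<in> Y) \<noteq> (b e \<in> Y)) \<noteq> odd (card (J \<inter> cut a b X Y))"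
    unfolding 3 using insert by auto
  then show ?case using 1 2 insert.IH insert.prems by blast
qed

lemma cut_sym_diff: "cut a b X (sym_diff Y Z) = sym_diff (cut a b X Y) (cut a b X Z)"
  by (auto simp: cut_def)

lemma cut_empty [simp]: "cut a b X {} = {}"
  by (auto simp: cut_def)

text \<open>The vertices that can be joined to \<open>o1\<close> inside \<open>J\<close> form a set that no edge of \<open>J\<close> leaves,
  so it contains an even number of odd vertices.\<close>

lemma exists_subjoin:
  assumes "finite J" "o1 \<in> bdry a b J"
  obtains J1 o2 where "J1 \<subseteq> J" "o2 \<in> bdry a b J" "o2 \<noteq> o1" "bdry a b J1 = {o1, o2}"
proof -
  define R where "R = {v. \<exists>J1\<subseteq>J. bdry a b J1 = sym_diff {o1} {v}}"
  have fin: "finite K" if "K \<subseteq> J" for K using that assms finite_subset by blast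
  have step: "(a e \<in> R) = (b e \<in> R)" if "e \<in> J" for e
  proof -
    have *: "w \<in> R" if "v \<in> R" "sym_diff {a e} {b e} = sym_diff {v} {w}" for v w
    proof -
      obtain K where K: "K \<subseteq> J" "bdry a b K = sym_diff {o1} {v}" using \<open>v \<in> R\<close> by (auto simp: R_def)
      have "bdry a b (sym_diff K {e}) = sym_diff (sym_diff {o1} {v}) (sym_diff {v} {w})"
        using bdry_sym_diff[of K "{e}" a b] fin K bdry_single[of a b e] that by simp
      also have "\<dots> = sym_diff {o1} {w}" by auto
      finally show ?thesis using K \<open>e \<in> J\<close> unfolding R_def by (intro CollectI exI[of _ "sym_diff K {e}"]) auto
    qed
    show ?thesis using *[of "a e" "b e"] *[of "b e" "a e"] by (metis Un_commute)
  qed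
  then have "J \<inter> cut a b J R = {}" by (auto simp: cut_def)
  then have ev: "even (card (bdry a b J \<inter> R))" using odd_card_Int_cut[of J J a b R] assms by auto
  have "o1 \<in> R" unfolding R_def by (intro CollectI exI[of _ "{}"]) auto
  have "bdry a b J \<inter> R \<noteq> {o1}" using ev by auto
  then obtain o2 where o2: "o2 \<in> bdry a b J" "o2 \<in> R" "o2 \<noteq> o1" using assms \<open>o1 \<in> R\<close> by blast
  then obtain J1 where "J1 \<subseteq> J" "bdry a b J1 = sym_diff {o1} {o2}" by (auto simp: R_def)
  then show ?thesis using that[of J1 o2] o2 by auto
qed

section \<open>Conservative edge weights\<close>

definition sgn_sum :: "'e set \<Rightarrow> 'e set \<Rightarrow> int" where
  "sgn_sum N J = (\<Sum>x\<in>J. if x \<in> N then - 1 else 1)"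

lemma sgn_sum_Un: "finite J \<Longrightarrow> finite K \<Longrightarrow> J \<inter> K = {} \<Longrightarrow> sgn_sum N (J \<union> K) = sgn_sum N J + sgn_sum N K"
  by (simp add: sgn_sum_def sum.union_disjoint)

lemma sgn_sum_Diff: "finite J \<Longrightarrow> K \<subseteq> J \<Longrightarrow> sgn_sum N (J - K) = sgn_sum N J - sgn_sum N K"
  by (simp add: sgn_sum_def sum_diff)

lemma sgn_sum_insert: "finite J \<Longrightarrow> x \<notin> J \<Longrightarrow> sgn_sum N (insert x J) = (if x \<in> N then - 1 else 1) + sgn_sum N J"
  by (simp add: sgn_sum_def)

lemma sgn_sum_remove: "finite J \<Longrightarrow> x \<in> J \<Longrightarrow> sgn_sum N (J - {x}) = sgn_sum N J - (if x \<in> N then - 1 else 1)"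
  by (simp add: sgn_sum_def sum_diff1)

text \<open>Switching: reversing the signs on \<open>C\<close> only translates weights, with
  \<open>J\<close> replaced by its symmetric difference with \<open>C\<close>. For an even
  \<open>C\<close> of weight 0 this is a weight-preserving bijection on joins with given ends, so
  conservativeness and minimality survive.\<close>

lemma sgn_sum_switch:
  assumes "finite J" "finite C"
  shows "sgn_sum (sym_diff N C) J = sgn_sum N (sym_diff J C) - sgn_sum N C"
proof -
  have J: "J = (J - C) \<union> (J \<inter> C)" and C: "C = (C - J) \<union> (J \<inter> C)" by auto
  have 1: "sgn_sum (sym_diff N C) (J - C) = sgn_sum N (J - C)"
    unfolding sgn_sum_def by (rule sum.cong) auto
  have 2: "sgn_sum (sym_diff N C) (J \<inter> C) = - sgn_sum N (J \<inter> C)"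
    unfolding sgn_sum_def sum_negf[symmetric] by (rule sum.cong) auto
  have 3: "sgn_sum (sym_diff N C) J = sgn_sum N (J - C) - sgn_sum N (J \<inter> C)"
    by (subst J, subst sgn_sum_Un) (use assms 1 2 in auto)
  have 4: "sgn_sum N (sym_diff J C) = sgn_sum N (J - C) + sgn_sum N (C - J)"
    by (rule sgn_sum_Un) (use assms in auto)
  have 5: "sgn_sum N C = sgn_sum N (C - J) + sgn_sum N (J \<inter> C)"
    by (subst C, subst sgn_sum_Un) (use assms in auto)
  show ?thesis using 3 4 5 by simp
qed

lemma even_sgn_sum: "finite J \<Longrightarrow> even (sgn_sum N J) \<longleftrightarrow> even (card J)"
proof (induction J rule: finite_induct)
  case (insert x J)
  then show ?case by (auto simp: sgn_sum_insert)
qed (simp add: sgn_sum_def)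

text \<open>Even edge sets are disjoint unions of cycles, so this says that no cycle has negative
  weight.\<close>

definition conservative :: "('e \<Rightarrow> 'v) \<Rightarrow> ('e \<Rightarrow> 'v) \<Rightarrow> 'e set \<Rightarrow> 'e set \<Rightarrow> bool" where
  "conservative a b X N \<longleftrightarrow> (\<forall>Z\<subseteq>X. bdry a b Z = {} \<longrightarrow> 0 \<le> sgn_sum N Z)"

abbreviation star :: "('e \<Rightarrow> 'v) \<Rightarrow> ('e \<Rightarrow> 'v) \<Rightarrow> 'e set \<Rightarrow> 'v \<Rightarrow> 'e set" where
  "star a b X v \<equiv> cut a b X {v}"

lemma bdry_eq_star: "finite J \<Longrightarrow> v \<in> bdry a b J \<longleftrightarrow> odd (card (star a b J v))"
  using odd_card_Int_cut[of J J a b "{v}"] cut_subset[of a b J "{v}"]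
  by (cases "v \<in> bdry a b J") (auto simp: inf.absorb2 Int_absorb1)

text \<open>With the edges at \<open>v\<close> removed, either \<open>s\<close> is still joined to
  another odd vertex, which can only be a neighbour of \<open>v\<close>, or \<open>s\<close> became
  even by losing an edge to \<open>v\<close>. In both cases a single edge back to \<open>v\<close>
  completes the join.\<close>

lemma subjoin_one_edge:
  assumes "finite J" "bdry a b J = {s, v}" "s \<noteq> v"
  obtains J1 where "J1 \<subseteq> J" "bdry a b J1 = {s, v}" "card (star a b J1 v) = 1"
proof -
  note result = that
  define K where "K = star a b J v"
  define J0 where "J0 = J - K"
  have KJ: "K \<subseteq> J" and fK: "finite K" and fJ0: "finite J0"
    using assms cut_subset[of a b J "{v}"] finite_cut[of J] by (auto simp: K_def J0_def)
  have st0: "star a b J0 v = {}" by (auto simp: J0_def K_def cut_def)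
  have vJ0: "v \<notin> bdry a b J0" using bdry_eq_star[OF fJ0, of v a b] st0 by simp
  have bJ0: "bdry a b J0 = sym_diff {s, v} (bdry a b K)"
    using bdry_Diff[OF assms(1) KJ, of a b] assms(2) by (simp add: J0_def)
  have *: thesis if e: "e \<in> K" and sd: "sym_diff {a e} {b e} = {v, w}" and w: "w \<noteq> v"
    and J1: "J1 \<subseteq> J0" "bdry a b J1 = sym_diff {s} {w}" for e w J1
  proof -
    have fJ1: "finite J1" using J1 fJ0 finite_subset by blast
    have eJ1: "e \<notin> J1" using e J1 by (auto simp: J0_def)
    show thesis
    proof (rule result[of "insert e J1"])
      show "insert e J1 \<subseteq> J" using e J1 KJ by (auto simp: J0_def)
      show "bdry a b (insert e J1) = {s, v}"
        unfolding bdry_insert[OF fJ1 eJ1] sd J1(2) using w assms(3) by auto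
      have "star a b (insert e J1) v = {e}"
        using st0 J1 e by (auto simp: cut_def K_def)
      then show "card (star a b (insert e J1) v) = 1" by simp
    qed
  qed
  show thesis
  proof (cases "s \<in> bdry a b J0")
    case True
    obtain J1 o2 where o: "J1 \<subseteq> J0" "o2 \<in> bdry a b J0" "o2 \<noteq> s" "bdry a b J1 = {s, o2}"
      using exists_subjoin[OF fJ0 True] by metis
    have "o2 \<noteq> v" using o vJ0 by auto
    then have "o2 \<in> bdry a b K" using o bJ0 by auto
    then obtain e where "e \<in> K" "o2 = a e \<or> o2 = b e" using bdry_subset[of a b K] by blast
    then have "sym_diff {a e} {b e} = {v, o2}" using \<open>o2 \<noteq> v\<close> by (auto simp: K_def cut_def)
    then show thesis using *[of e o2 J1] o \<open>e \<in> K\<close> \<open>o2 \<noteq> v\<close> by auto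
  next
    case False
    then have "s \<in> bdry a b K" using bJ0 assms(3) by auto
    then obtain e where "e \<in> K" "s = a e \<or> s = b e" using bdry_subset[of a b K] by blast
    then have "sym_diff {a e} {b e} = {v, s}" using assms(3) by (auto simp: K_def cut_def)
    then show thesis using *[of e s "{}"] \<open>e \<in> K\<close> assms(3) by auto
  qed
qed

text \<open>A minimal join reaching the nearest vertex \<open>v\<close> can be taken to use one edge
  at \<open>v\<close>. Toggling any edge between \<open>v\<close> and a neighbour \<open>w\<close>
  turns it into a join from \<open>s\<close> to \<open>w\<close>, which may not be lighter; hence at
  \<open>v\<close> the join consists of exactly the negative edges, and there is one.\<close>

lemma star_of_nearest_vertex:
  assumes X: "finite X" and con: "conservative a b X N" and J: "J \<subseteq> X" "bdry a b J = {s, v}" "s \<noteq> v"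
    and min: "\<And>K w. K \<subseteq> X \<Longrightarrow> bdry a b K = sym_diff {s} {w} \<Longrightarrow> sgn_sum N J \<le> sgn_sum N K"
  shows "card (N \<inter> star a b X v) = 1"
proof -
  have fJ: "finite J" using J X finite_subset by blast
  obtain J1 where J1: "J1 \<subseteq> J" "bdry a b J1 = {s, v}" "card (star a b J1 v) = 1"
    using subjoin_one_edge[OF fJ J(2,3)] by metis
  have fJ1: "finite J1" using J1 fJ finite_subset by blast
  have "bdry a b (J - J1) = {}" using bdry_Diff[OF fJ J1(1), of a b] J1 J by simp
  then have "0 \<le> sgn_sum N (J - J1)" using con J unfolding conservative_def by blast
  then have le: "sgn_sum N J1 \<le> sgn_sum N J" using sgn_sum_Diff[OF fJ J1(1)] by simp
  have "star a b J1 v = N \<inter> star a b X v"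
  proof (rule set_eqI)
    fix e
    show "e \<in> star a b J1 v \<longleftrightarrow> e \<in> N \<inter> star a b X v"
    proof (cases "e \<in> star a b X v")
      case True
      then have "e \<in> X" "sym_diff {a e} {b e} = {v, if a e = v then b e else a e}"
        "(if a e = v then b e else a e) \<noteq> v"
        by (auto simp: cut_def)
      then obtain w where w: "sym_diff {a e} {b e} = {v, w}" "w \<noteq> v" "e \<in> X" by blast
      have sd: "sym_diff {v, w} {s, v} = sym_diff {s} {w}" using w J by auto
      have "e \<in> J1 \<longleftrightarrow> e \<in> N"
      proof (rule ccontr)
        assume neg: "\<not> (e \<in> J1 \<longleftrightarrow> e \<in> N)"
        show False
        proof (cases "e \<in> J1")
          case True
          have "bdry a b (J1 - {e}) = sym_diff {s} {w}"
            using bdry_Diff[OF fJ1, of "{e}" a b] True bdry_single[of a b e] w sd J1 by auto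
          then have "sgn_sum N J \<le> sgn_sum N (J1 - {e})" using min[of "J1 - {e}" w] J1 J by auto
          then show False using sgn_sum_remove[OF fJ1 True, of N] neg True le by auto
        next
          case False
          have "bdry a b (insert e J1) = sym_diff {s} {w}"
            using bdry_insert[OF fJ1 False, of a b] w sd J1 by auto
          then have "sgn_sum N J \<le> sgn_sum N (insert e J1)" using min[of "insert e J1" w] J1 J w by auto
          then show False using sgn_sum_insert[OF fJ1 False, of N] neg False le by auto
        qed
      qed
      then show ?thesis using True by (auto simp: cut_def)
    qed (use J1 J in \<open>auto simp: cut_def\<close>)
  qed
  then show ?thesis using J1 by simp
qed

text \<open>This excludes the danger in contracting the star of \<open>v\<close>: a negative join
  \<open>Z\<close> between two neighbours of \<open>v\<close> would become a negative cycle.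
  Completed by \<open>f1\<close> and \<open>f2\<close> it is an even set of nonnegative and, by the
  colouring, even weight; so this weight is 0 and both edges are positive. Switching along this set
  preserves all assumptions about \<open>v\<close> but creates two negative edges at
  \<open>v\<close>.\<close>

lemma conservative_contract_join:
  assumes X: "finite X" and con: "conservative a b X N" and J: "J \<subseteq> X" "bdry a b J = {s, v}" "s \<noteq> v"
    and min: "\<And>K w. K \<subseteq> X \<Longrightarrow> bdry a b K = sym_diff {s} {w} \<Longrightarrow> sgn_sum N J \<le> sgn_sum N K"
    and col: "\<And>e. e \<in> X \<Longrightarrow> col (a e) \<noteq> (col (b e) :: bool)"
    and Z: "Z \<subseteq> X - star a b X v"
    and f: "f1 \<in> star a b X v" "f2 \<in> star a b X v" "f1 \<noteq> f2" "bdry a b Z = bdry a b {f1, f2}"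
  shows "0 \<le> sgn_sum N Z"
proof -
  define C where "C = Z \<union> {f1, f2}"
  have fZ: "finite Z" using Z X finite_subset by blast
  have disj: "Z \<inter> {f1, f2} = {}" using Z f by auto
  have CX: "C \<subseteq> X" using Z f by (auto simp: C_def cut_def)
  have fC: "finite C" using fZ by (simp add: C_def)
  have bC: "bdry a b C = {}" unfolding C_def using bdry_Un[OF fZ _ disj, of a b] f by simp
  have wC: "sgn_sum N C = sgn_sum N Z + sgn_sum N {f1, f2}"
    unfolding C_def by (rule sgn_sum_Un) (use fZ disj in auto)
  have nC: "0 \<le> sgn_sum N C" using con CX bC unfolding conservative_def by blast
  have w2: "sgn_sum N {f1, f2} = (if f1 \<in> N then - 1 else 1) + (if f2 \<in> N then - 1 else 1)"
    using f by (simp add: sgn_sum_def)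
  show ?thesis
  proof (rule ccontr)
    assume neg: "\<not> 0 \<le> sgn_sum N Z"
    have f12: "f1 \<notin> N" "f2 \<notin> N" using neg nC wC w2 by (auto split: if_splits)
    have "C \<inter> cut a b X {v. col v} = C" using CX col by (auto simp: cut_def)
    then have "even (card C)" using odd_card_Int_cut[OF fC CX, of a b "{v. col v}"] bC by auto
    then have "even (sgn_sum N C)" using even_sgn_sum[OF fC] by blast
    then have C0: "sgn_sum N C = 0" using neg nC wC w2 f12 by (auto elim!: evenE)
    have fin: "finite K" if "K \<subseteq> X" for K using that X finite_subset by blast
    have fJ: "finite J" using fin J by blast
    let ?N = "sym_diff N C" and ?J = "sym_diff J C"
    have sw: "sgn_sum ?N K = sgn_sum N (sym_diff K C)" if "K \<subseteq> X" for K
      using sgn_sum_switch[OF fin[OF that] fC, of N] C0 by simp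
    have bsw: "bdry a b (sym_diff K C) = bdry a b K" if "K \<subseteq> X" for K
      using bdry_sym_diff[OF fin[OF that] fC, of a b] bC by simp
    have sub: "sym_diff K C \<subseteq> X" if "K \<subseteq> X" for K using that CX by blast
    have JJ: "sym_diff ?J C = J" by auto
    have 1: "card (N \<inter> star a b X v) = 1" using star_of_nearest_vertex[OF X con J min] .
    have 2: "card (?N \<inter> star a b X v) = 1"
    proof (rule star_of_nearest_vertex[OF X])
      show "conservative a b X ?N" unfolding conservative_def
      proof (intro allI impI)
        fix K assume K: "K \<subseteq> X" "bdry a b K = {}"
        have "0 \<le> sgn_sum N (sym_diff K C)"
          using con sub[OF K(1)] bsw[OF K(1)] K(2) unfolding conservative_def by simp
        then show "0 \<le> sgn_sum ?N K" using sw[OF K(1)] by simp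
      qed
      show "?J \<subseteq> X" by (rule sub[OF J(1)])
      show "bdry a b ?J = {s, v}" using bsw[OF J(1)] J(2) by simp
      show "s \<noteq> v" by (rule J(3))
      fix K w assume K: "K \<subseteq> X" "bdry a b K = sym_diff {s} {w}"
      have "sgn_sum N J \<le> sgn_sum N (sym_diff K C)"
        using min[of "sym_diff K C" w] sub[OF K(1)] bsw[OF K(1)] K(2) by simp
      then show "sgn_sum ?N ?J \<le> sgn_sum ?N K" using sw[OF K(1)] sw[OF sub[OF J(1)]] JJ by simp
    qed
    have "{f1, f2} \<subseteq> ?N \<inter> star a b X v" using f f12 by (auto simp: C_def)
    then have "card {f1, f2} \<le> card (?N \<inter> star a b X v)" using finite_cut[OF X, of a b "{v}"]
      by (intro card_mono) auto
    then show False using 2 f by simp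
  qed
qed

text \<open>Sebo's and Frank's argument: contract the star of a vertex at minimal distance from an end of a negative edge.\<close>

theorem conservative_disjoint_cuts:
  fixes a b :: "'e \<Rightarrow> 'v" and col :: "'v \<Rightarrow> bool"
  assumes "finite X" "N \<subseteq> X" "conservative a b X N" "\<And>e. e \<in> X \<Longrightarrow> col (a e) \<noteq> col (b e)"
  shows "\<exists>Y. (\<forall>n\<in>N. cut a b X (Y n) \<inter> N = {n}) \<and>
    (\<forall>n\<in>N. \<forall>m\<in>N. n \<noteq> m \<longrightarrow> cut a b X (Y n) \<inter> cut a b X (Y m) = {})"
  using assms
proof (induction "card X" arbitrary: X N a b rule: less_induct)
  case less
  note X = less.prems(1) and NX = less.prems(2) and con = less.prems(3) and col = less.prems(4)
  show ?case
  proof (cases "N = {}")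
    case False
    then obtain n0 where n0: "n0 \<in> N" "n0 \<in> X" using NX by auto
    define s where "s = a n0"
    \<comment> \<open>The far end \<open>w\<close> is left free, so a minimizer ends at a nearest
      vertex. The single negative edge \<open>n0\<close> competes, which makes the minimum negative
      and the far end different from \<open>s\<close>.\<close>
    define Js where "Js = {J. J \<subseteq> X \<and> (\<exists>w. bdry a b J = sym_diff {s} {w})}"
    have fin: "finite K" if "K \<subseteq> X" for K using that X finite_subset by blast
    have "Js \<subseteq> Pow X" by (auto simp: Js_def)
    then have "finite Js" using X finite_subset by blast
    moreover have n0J: "{n0} \<in> Js" using n0 by (auto simp: Js_def s_def bdry_single)
    ultimately obtain J where J: "J \<in> Js" and Jmin: "\<And>K. K \<in> Js \<Longrightarrow> sgn_sum N J \<le> sgn_sum N K"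
      using ex_is_arg_min_if_finite[of Js "sgn_sum N"] by (auto simp: is_arg_min_linorder)
    then obtain v where JX: "J \<subseteq> X" and bJ': "bdry a b J = sym_diff {s} {v}" by (auto simp: Js_def)
    have "sgn_sum N {n0} = - 1" using n0 by (simp add: sgn_sum_def)
    then have "sgn_sum N J < 0" using Jmin[OF n0J] by simp
    have sv: "s \<noteq> v"
    proof
      assume "s = v"
      then have "bdry a b J = {}" using bJ' by simp
      then have "0 \<le> sgn_sum N J" using con JX unfolding conservative_def by blast
      then show False using \<open>sgn_sum N J < 0\<close> by simp
    qed
    then have bJ: "bdry a b J = {s, v}" using bJ' by auto
    have min: "sgn_sum N J \<le> sgn_sum N K" if "K \<subseteq> X" "bdry a b K = sym_diff {s} {w}" for K w
      using Jmin[of K] that by (auto simp: Js_def)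
    define D where "D = star a b X v"
    have DX: "D \<subseteq> X" and fD: "finite D" unfolding D_def by (rule cut_subset, rule finite_cut[OF X])
    have "card (N \<inter> D) = 1" unfolding D_def using star_of_nearest_vertex[OF X con JX bJ sv min] .
    then obtain n1 where n1: "N \<inter> D = {n1}" using card_1_singletonE by blast
    define other where "other e = (if a e = v then b e else a e)" for e
    have other: "sym_diff {a e} {b e} = {v, other e}" "other e \<noteq> v" if "e \<in> D" for e
      using that by (auto simp: D_def cut_def other_def)
    define Ob where "Ob = other ` D"
    define v0 where "v0 = other n1"
    have v0: "v0 \<in> Ob" "v0 \<noteq> v" "v \<notin> Ob" using n1 other by (auto simp: Ob_def v0_def)
    \<comment> \<open>Contraction of the star: all neighbours of \<open>v\<close> become
      \<open>v0\<close>. The vertex \<open>v\<close> itself loses all its edges, since the colouring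
      forbids loops, and stays behind isolated.\<close>
    define \<pi> where "\<pi> w = (if w \<in> Ob then v0 else w)" for w
    define X' where "X' = X - D"
    define a' where "a' = \<pi> \<circ> a"
    define b' where "b' = \<pi> \<circ> b"
    have colO: "col w = (\<not> col v)" if "w \<in> Ob" for w
      using that col DX by (auto simp: Ob_def D_def cut_def other_def split: if_splits)
    have col\<pi>: "col (\<pi> w) = col w" for w using colO v0 by (auto simp: \<pi>_def)
    have cutpb: "cut a' b' Q Y = cut a b Q {w. \<pi> w \<in> Y}" for Q Y
      by (auto simp: cut_def a'_def b'_def)
    have con': "conservative a' b' X' (N - {n1})" unfolding conservative_def
    proof (intro allI impI)
      fix Z assume "Z \<subseteq> X'" "bdry a' b' Z = {}"
      have "finite Z" using \<open>Z \<subseteq> X'\<close> fin X'_def by blast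
      \<comment> \<open>Before contraction, an even set of the contracted graph has odd vertices
        only among the neighbours of \<open>v\<close>. Joins between two neighbours are split off
        one by one, each of nonnegative weight, until an even set remains.\<close>
      have key: "bdry a b Z \<subseteq> Ob \<Longrightarrow> Z \<subseteq> X' \<Longrightarrow> 0 \<le> sgn_sum N Z" for Z
      proof (induction "card Z" arbitrary: Z rule: less_induct)
        case (less Z)
        have fZ: "finite Z" using less fin X'_def by blast
        have ZX: "Z \<subseteq> X" "Z \<subseteq> X - D" using less X'_def by auto
        show ?case
        proof (cases "bdry a b Z = {}")
          case True
          then show ?thesis using con ZX unfolding conservative_def by blast
        next
          case False
          then obtain o1 where "o1 \<in> bdry a b Z" by blast
          then obtain Z1 o2 where Z1: "Z1 \<subseteq> Z" "o2 \<in> bdry a b Z" "o2 \<noteq> o1" "bdry a b Z1 = {o1, o2}"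
            using exists_subjoin[OF fZ] by metis
          have "o1 \<in> Ob" "o2 \<in> Ob" using less.prems \<open>o1 \<in> bdry a b Z\<close> Z1 by auto
          then obtain f1 f2 where f: "f1 \<in> D" "f2 \<in> D" "other f1 = o1" "other f2 = o2" by (auto simp: Ob_def)
          have ff: "f1 \<noteq> f2" using f Z1 by auto
          have "bdry a b {f1, f2} = sym_diff {v, o1} {v, o2}"
            using bdry_insert[of "{f2}" f1 a b] ff bdry_single[of a b f2] other f by simp
          also have "\<dots> = {o1, o2}" using other(2)[OF f(1)] other(2)[OF f(2)] f Z1 by auto
          finally have "bdry a b Z1 = bdry a b {f1, f2}" using Z1 by simp
          moreover have "Z1 \<subseteq> X - star a b X v" using Z1 ZX by (auto simp: D_def)
          ultimately have p: "0 \<le> sgn_sum N Z1"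
            using f(1,2)[unfolded D_def] ff min col
            by (intro conservative_contract_join[OF X con JX bJ sv, of col Z1 f1 f2]) blast+
          have "Z1 \<noteq> {}" using Z1 by auto
          then have "card (Z - Z1) < card Z" using Z1 fZ by (intro psubset_card_mono) auto
          moreover have "bdry a b (Z - Z1) \<subseteq> Ob"
            using bdry_Diff[OF fZ Z1(1), of a b] Z1 less.prems \<open>o1 \<in> Ob\<close> \<open>o2 \<in> Ob\<close> by auto
          moreover have "Z - Z1 \<subseteq> X'" using less.prems by blast
          ultimately have "0 \<le> sgn_sum N (Z - Z1)" using less.hyps[of "Z - Z1"] by simp
          then show ?thesis using p sgn_sum_Diff[OF fZ Z1(1), of N] by simp
        qed
      qed
      have "w \<in> Ob" if "w \<in> bdry a b Z" for w
      proof (rule ccontr)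
        assume "w \<notin> Ob"
        then have "star a' b' Z w = star a b Z w"
          unfolding cutpb using v0 by (auto simp: cut_def \<pi>_def)
        then show False
          using bdry_eq_star[OF \<open>finite Z\<close>, of w a b] bdry_eq_star[OF \<open>finite Z\<close>, of w a' b'] that
            \<open>bdry a' b' Z = {}\<close> by simp
      qed
      then have "0 \<le> sgn_sum N Z" using key \<open>Z \<subseteq> X'\<close> by blast
      moreover have "sgn_sum (N - {n1}) Z = sgn_sum N Z" unfolding sgn_sum_def
        using \<open>Z \<subseteq> X'\<close> n1 by (intro sum.cong) (auto simp: X'_def)
      ultimately show "0 \<le> sgn_sum (N - {n1}) Z" by simp
    qed
    have "D \<noteq> {}" using n1 by auto
    then have "card X' < card X" using DX X unfolding X'_def by (intro psubset_card_mono) auto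
    moreover have "finite X'" using X by (simp add: X'_def)
    moreover have "N - {n1} \<subseteq> X'" using NX n1 by (auto simp: X'_def)
    moreover have "col (a' e) \<noteq> col (b' e)" if "e \<in> X'" for e
      using that col by (simp add: a'_def b'_def col\<pi> X'_def)
    ultimately have "\<exists>Y. (\<forall>n\<in>N - {n1}. cut a' b' X' (Y n) \<inter> (N - {n1}) = {n}) \<and>
        (\<forall>n\<in>N - {n1}. \<forall>m\<in>N - {n1}. n \<noteq> m \<longrightarrow> cut a' b' X' (Y n) \<inter> cut a' b' X' (Y m) = {})"
      using con' by (intro less.hyps) auto
    then obtain Y where Y: "\<forall>n\<in>N - {n1}. cut a' b' X' (Y n) \<inter> (N - {n1}) = {n}"
        "\<forall>n\<in>N - {n1}. \<forall>m\<in>N - {n1}. n \<noteq> m \<longrightarrow> cut a' b' X' (Y n) \<inter> cut a' b' X' (Y m) = {}"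
      by (elim exE conjE)
    note Y1 = Y(1)[rule_format] and Y2 = Y(2)[rule_format]
    \<comment> \<open>The star of \<open>v\<close> serves \<open>n1\<close>. The other cuts are
      pulled back along the contraction, with \<open>v\<close> put on the side of \<open>v0\<close>
      so that no edge of the star is cut.\<close>
    define Y' where "Y' n = (if n = n1 then {v} else
        {w. w \<noteq> v \<and> \<pi> w \<in> Y n} \<union> (if v0 \<in> Y n then {v} else {}))" for n
    have c1: "cut a b X (Y' n1) = D" by (simp add: Y'_def D_def)
    have c2: "cut a b X (Y' n) = cut a' b' X' (Y n)" if "n \<noteq> n1" for n
    proof (rule set_eqI)
      fix e
      have in\<pi>: "w \<in> Y' n \<longleftrightarrow> \<pi> w \<in> Y n" if "w \<noteq> v" for w using that \<open>n \<noteq> n1\<close> by (auto simp: Y'_def)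
      have inY: "v \<in> Y' n \<longleftrightarrow> v0 \<in> Y n" using \<open>n \<noteq> n1\<close> by (auto simp: Y'_def)
      show "e \<in> cut a b X (Y' n) \<longleftrightarrow> e \<in> cut a' b' X' (Y n)"
      proof (cases "e \<in> D")
        case True
        have "other e \<in> Ob" "other e \<noteq> v" using True other by (auto simp: Ob_def)
        then have "(other e \<in> Y' n) = (v \<in> Y' n)" using in\<pi> inY by (simp add: \<pi>_def)
        then have "(a e \<in> Y' n) = (b e \<in> Y' n)" using True by (auto simp: other_def D_def cut_def split: if_splits)
        then show ?thesis using True by (simp add: cut_def X'_def)
      next
        case False
        show ?thesis
        proof (cases "e \<in> X")
          case True
          then have "(a e = v) = (b e = v)" using False by (auto simp: D_def cut_def)
          moreover have "a e \<noteq> b e" using col[OF True] by metis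
          ultimately have "a e \<noteq> v" "b e \<noteq> v" by auto
          then show ?thesis using False in\<pi> by (auto simp: cut_def X'_def a'_def b'_def)
        qed (auto simp: cut_def X'_def)
      qed
    qed
    have dj: "cut a' b' X' Q \<inter> D = {}" for Q by (auto simp: cut_def X'_def)
    have "n1 \<in> N" using n1 by auto
    show ?thesis
    proof (intro exI[of _ Y'] conjI ballI impI)
      fix n assume n: "n \<in> N"
      show "cut a b X (Y' n) \<inter> N = {n}"
      proof (cases "n = n1")
        case True
        then show ?thesis using c1 n1 by auto
      next
        case False
        have "n1 \<in> D" using n1 by blast
        then have "n1 \<notin> cut a' b' X' (Y n)" using dj by blast
        then show ?thesis using c2[OF False] Y1[of n] n False by blast
      qed
      fix m assume m: "m \<in> N" "n \<noteq> m"
      show "cut a b X (Y' n) \<inter> cut a b X (Y' m) = {}"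
        using c1 c2[of n] c2[of m] dj[of "Y n"] dj[of "Y m"] Y2[of n m] n m
        by (cases "n = n1"; cases "m = n1") auto
    qed
  qed auto
qed

section \<open>Abstract duals of graphs\<close>

definition linked :: "('e \<Rightarrow> 'v) \<Rightarrow> ('e \<Rightarrow> 'v) \<Rightarrow> 'e set \<Rightarrow> 'v \<Rightarrow> 'v \<Rightarrow> bool" where
  "linked p q E u v \<longleftrightarrow> (\<exists>J\<subseteq>E. bdry p q J = sym_diff {u} {v})"

text \<open>For unlinked vertices this is the minimum of the empty set.\<close>

definition jdist :: "('e \<Rightarrow> 'v) \<Rightarrow> ('e \<Rightarrow> 'v) \<Rightarrow> 'e set \<Rightarrow> ('e \<Rightarrow> real) \<Rightarrow> 'v \<Rightarrow> 'v \<Rightarrow> real" where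
  "jdist p q E l u v = Min (sum l ` {J. J \<subseteq> E \<and> bdry p q J = sym_diff {u} {v}})"

lemma finite_joins: "finite E \<Longrightarrow> finite {J. J \<subseteq> E \<and> bdry p q J = sym_diff {u} {v}}"
  by (rule finite_subset[of _ "Pow E"]) auto

lemma jdist_le:
  assumes "finite E" "J \<subseteq> E" "bdry p q J = sym_diff {u} {v}"
  shows "jdist p q E l u v \<le> sum l J"
  unfolding jdist_def using assms by (intro Min_le finite_imageI finite_joins) auto

lemma jdist_obtain:
  assumes "finite E" "linked p q E u v"
  obtains J where "J \<subseteq> E" "bdry p q J = sym_diff {u} {v}" "jdist p q E l u v = sum l J"
proof -
  have "{J. J \<subseteq> E \<and> bdry p q J = sym_diff {u} {v}} \<noteq> {}" using assms(2) by (auto simp: linked_def)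
  then have "jdist p q E l u v \<in> sum l ` {J. J \<subseteq> E \<and> bdry p q J = sym_diff {u} {v}}"
    unfolding jdist_def using assms(1) by (intro Min_in finite_imageI finite_joins) auto
  then show thesis using that by auto
qed

lemma linked_refl: "linked p q E u u"
  unfolding linked_def by (intro exI[of _ "{}"]) auto

lemma linked_sym: "linked p q E u v \<Longrightarrow> linked p q E v u"
  unfolding linked_def by (simp add: Un_commute)

lemma bdry_join_trans:
  assumes "finite E" "J \<subseteq> E" "bdry p q J = sym_diff {u} {v}" "K \<subseteq> E" "bdry p q K = sym_diff {v} {w}"
  shows "bdry p q (sym_diff J K) = sym_diff {u} {w}"
proof -
  have "finite J" "finite K" using assms(1,2,4) by (auto intro: finite_subset)
  then have "bdry p q (sym_diff J K) = sym_diff (sym_diff {u} {v}) (sym_diff {v} {w})"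
    using bdry_sym_diff[of J K p q] assms by simp
  also have "\<dots> = sym_diff {u} {w}" by auto
  finally show ?thesis .
qed

lemma linked_trans:
  assumes "finite E" "linked p q E u v" "linked p q E v w"
  shows "linked p q E u w"
proof -
  obtain J K where "J \<subseteq> E" "bdry p q J = sym_diff {u} {v}" "K \<subseteq> E" "bdry p q K = sym_diff {v} {w}"
    using assms(2,3) unfolding linked_def by (elim exE conjE)
  then show ?thesis using bdry_join_trans[OF assms(1), of J p q u v K w] unfolding linked_def
    by (intro exI[of _ "sym_diff J K"]) auto
qed

lemma linked_edge: "e \<in> E \<Longrightarrow> linked p q E (p e) (q e)"
  unfolding linked_def by (intro exI[of _ "{e}"]) (simp add: bdry_single)

lemma jdist_commute: "jdist p q E l u v = jdist p q E l v u"
  unfolding jdist_def by (simp add: Un_commute)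

lemma jdist_nonneg:
  assumes "finite E" "linked p q E u v" "\<And>e. e \<in> E \<Longrightarrow> 0 \<le> l e"
  shows "0 \<le> jdist p q E l u v"
proof -
  obtain J where J: "J \<subseteq> E" "jdist p q E l u v = sum l J"
    using jdist_obtain[OF assms(1,2), of l] by metis
  show ?thesis unfolding J(2) using J(1) assms(3) by (intro sum_nonneg) blast
qed

lemma jdist_refl:
  assumes "finite E" "\<And>e. e \<in> E \<Longrightarrow> 0 \<le> l e"
  shows "jdist p q E l u u = 0"
proof (rule antisym)
  show "jdist p q E l u u \<le> 0" using jdist_le[OF assms(1), of "{}" p q u u l] by simp
  show "0 \<le> jdist p q E l u u" by (rule jdist_nonneg[OF assms(1) linked_refl assms(2)])
qed

lemma jdist_triangle:
  assumes "finite E" "linked p q E u v" "linked p q E v w" "\<And>e. e \<in> E \<Longrightarrow> 0 \<le> l e"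
  shows "jdist p q E l u w \<le> jdist p q E l u v + jdist p q E l v w"
proof -
  obtain J where J: "J \<subseteq> E" "bdry p q J = sym_diff {u} {v}" "jdist p q E l u v = sum l J"
    using jdist_obtain[OF assms(1,2)] by metis
  obtain K where K: "K \<subseteq> E" "bdry p q K = sym_diff {v} {w}" "jdist p q E l v w = sum l K"
    using jdist_obtain[OF assms(1,3)] by metis
  have fin: "finite J" "finite K" using J(1) K(1) assms(1) by (auto intro: finite_subset)
  have "jdist p q E l u w \<le> sum l (sym_diff J K)"
    by (rule jdist_le[OF assms(1) _ bdry_join_trans[OF assms(1) J(1,2) K(1,2)]]) (use J(1) K(1) in blast)
  also have "\<dots> \<le> sum l (J \<union> K)" using fin J(1) K(1) assms(4) by (intro sum_mono2) auto
  also have "\<dots> \<le> sum l J + sum l K"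
  proof -
    have "0 \<le> sum l (J \<inter> K)" using J(1) assms(4) by (intro sum_nonneg) blast
    then show ?thesis using sum.union_inter[OF fin, of l] by linarith
  qed
  finally show ?thesis using J(3) K(3) by simp
qed

text \<open>\<open>(a, b)\<close> is an abstract dual of the graph \<open>(p, q)\<close> on the edge set \<open>X\<close>.\<close>

definition dual_pair :: "'e set \<Rightarrow> ('e \<Rightarrow> 'v) \<Rightarrow> ('e \<Rightarrow> 'v) \<Rightarrow> ('e \<Rightarrow> 'w) \<Rightarrow> ('e \<Rightarrow> 'w) \<Rightarrow> bool" where
  "dual_pair X p q a b \<longleftrightarrow> (\<forall>Y. bdry p q (cut a b X Y) = {}) \<and>
     (\<forall>Z\<subseteq>X. bdry p q Z = {} \<longrightarrow> (\<exists>Y. Z = cut a b X Y))"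

text \<open>Duality in the opposite direction. \<open>Z\<close> meets every even primal set evenly,
  since these are dual cuts; so the parity of the part of \<open>Z\<close> on a join depends only on
  the ends of the join. Measured from a root in every component, this parity defines the required
  shore.\<close>

lemma dual_even_is_cut:
  assumes "finite X" "dual_pair X p q a b" "Z \<subseteq> X" "bdry a b Z = {}"
  obtains S where "Z = cut p q X S"
proof -
  note result = that
  have fin: "finite K" if "K \<subseteq> X" for K using that assms(1) by (rule finite_subset)
  have ev: "even (card (Z \<inter> K))" if K: "K \<subseteq> X" "bdry p q K = {}" for K
  proof -
    obtain Y where "K = cut a b X Y" using assms(2) K unfolding dual_pair_def by meson
    then show ?thesis using odd_card_Int_cut[OF fin[OF assms(3)] assms(3), of a b Y] assms(4) by auto
  qed
  \<comment> \<open>The choice depends only on the class of \<open>v\<close>, so linked vertices get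
    the same root.\<close>
  define root where "root v = (SOME u. linked p q X v u)" for v
  have root: "linked p q X v (root v)" for v unfolding root_def by (rule someI[of _ v]) (rule linked_refl)
  have root_eq: "root u = root v" if "linked p q X u v" for u v
  proof -
    have "linked p q X u w \<longleftrightarrow> linked p q X v w" for w
      using linked_trans[OF assms(1) that, of w] linked_trans[OF assms(1) linked_sym[OF that], of w] by blast
    then have "linked p q X u = linked p q X v" by blast
    then show ?thesis by (simp only: root_def)
  qed
  have wd: "odd (card (J \<inter> Z)) = odd (card (K \<inter> Z))"
    if "J \<subseteq> X" "K \<subseteq> X" "bdry p q J = bdry p q K" for J K
  proof -
    have "bdry p q (sym_diff J K) = {}" using bdry_sym_diff[of J K p q] that fin by simp
    then have "even (card (Z \<inter> sym_diff J K))" using ev[of "sym_diff J K"] that by blast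
    moreover have "Z \<inter> sym_diff J K = sym_diff (J \<inter> Z) (K \<inter> Z)" by auto
    ultimately show ?thesis using odd_card_sym_diff[of "J \<inter> Z" "K \<inter> Z"] fin that by auto
  qed
  define S where "S = {v. \<exists>J\<subseteq>X. bdry p q J = sym_diff {root v} {v} \<and> odd (card (J \<inter> Z))}"
  have S: "v \<in> S \<longleftrightarrow> odd (card (J \<inter> Z))" if "J \<subseteq> X" "bdry p q J = sym_diff {root v} {v}" for v J
  proof
    assume "v \<in> S"
    then obtain K where K: "K \<subseteq> X" "bdry p q K = sym_diff {root v} {v}" "odd (card (K \<inter> Z))"
      unfolding S_def by blast
    then show "odd (card (J \<inter> Z))" using wd[of J K] that by simp
  next
    assume "odd (card (J \<inter> Z))"
    then show "v \<in> S" unfolding S_def using that by blast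
  qed
  have "Z = cut p q X S"
  proof (rule set_eqI)
    fix e
    show "e \<in> Z \<longleftrightarrow> e \<in> cut p q X S"
    proof (cases "e \<in> X")
      case True
      obtain J where J: "J \<subseteq> X" "bdry p q J = sym_diff {root (p e)} {p e}"
        using linked_sym[OF root[of "p e"]] unfolding linked_def by blast
      have be: "bdry p q {e} = sym_diff {p e} {q e}" by (rule bdry_single)
      have r: "root (p e) = root (q e)" by (rule root_eq) (rule linked_edge[OF True])
      have "bdry p q (sym_diff J {e}) = sym_diff {root (q e)} {q e}"
        using bdry_join_trans[OF assms(1) J, of "{e}" "q e"] be True r by simp
      then have q: "q e \<in> S \<longleftrightarrow> odd (card (sym_diff J {e} \<inter> Z))" using J True by (intro S) auto
      have pS: "p e \<in> S \<longleftrightarrow> odd (card (J \<inter> Z))" using J by (rule S)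
      have "sym_diff J {e} \<inter> Z = sym_diff (J \<inter> Z) ({e} \<inter> Z)" by auto
      then have "q e \<in> S \<longleftrightarrow> odd (card (J \<inter> Z)) \<noteq> odd (card ({e} \<inter> Z))"
        using q odd_card_sym_diff[of "J \<inter> Z" "{e} \<inter> Z"] fin[OF J(1)] by simp
      then show ?thesis using pS True by (cases "e \<in> Z") (auto simp: cut_def)
    qed (use assms(3) in \<open>auto simp: cut_def\<close>)
  qed
  then show thesis by (rule result)
qed

lemma odd_card_changes: "odd (card {i. i < m \<and> f i \<noteq> f (Suc i)}) \<longleftrightarrow> f 0 \<noteq> (f m :: bool)"
proof (induction m)
  case (Suc m)
  have "{i. i < Suc m \<and> f i \<noteq> f (Suc i)} =
      (if f m \<noteq> f (Suc m) then insert m {i. i < m \<and> f i \<noteq> f (Suc i)} else {i. i < m \<and> f i \<noteq> f (Suc i)})"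
    by (auto simp: less_Suc_eq)
  then show ?case using Suc by auto
qed simp

section \<open>The demand bound by subdivision of the dual\<close>

context
  fixes E N :: "'e set" and p q :: "'e \<Rightarrow> 'v" and a b :: "'e \<Rightarrow> 'w" and c :: "'e \<Rightarrow> nat" and M :: nat
  assumes fin: "finite E" "finite N" and disj: "E \<inter> N = {}" and M: "0 < M"
    and dual: "dual_pair (E \<union> N) p q a b"
    and cutc: "\<And>S. card (cut p q N S) \<le> (\<Sum>e\<in>cut p q E S. c e)"
begin

text \<open>Capacities are scaled by \<open>2 * M\<close> and made positive; an edge of the dual becomes a path of that many
  edges, which makes the dual bipartite.\<close>

definition mul :: "'e \<Rightarrow> nat" where
  "mul x = (if x \<in> N then 2 * M else 2 * (M * c x + 1))"

definition subdiv :: "'e \<Rightarrow> nat \<Rightarrow> 'w + 'e \<times> nat" where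
  "subdiv x i = (if i = 0 then Inl (a x) else if i = mul x then Inl (b x) else Inr (x, i))"

definition sub_a :: "'e \<times> nat \<Rightarrow> 'w + 'e \<times> nat" where "sub_a = (\<lambda>(x, i). subdiv x i)"
definition sub_b :: "'e \<times> nat \<Rightarrow> 'w + 'e \<times> nat" where "sub_b = (\<lambda>(x, i). subdiv x (Suc i))"
definition sub_edges :: "'e set \<Rightarrow> ('e \<times> nat) set" where "sub_edges Z = (SIGMA x:Z. {..<mul x})"

lemma mul_pos: "0 < mul x" and mul_even: "even (mul x)"
  using M by (auto simp: mul_def)

lemma finite_sub_edges: "finite Z \<Longrightarrow> finite (sub_edges Z)"
  by (simp add: sub_edges_def)

text \<open>Inner vertices of a subdivided edge have degree two, so an even set contains the whole
  path of an edge or nothing of it.\<close>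

lemma sub_even:
  assumes Z': "Z' \<subseteq> sub_edges (E \<union> N)" "bdry sub_a sub_b Z' = {}"
  obtains Z where "Z \<subseteq> E \<union> N" "bdry a b Z = {}" "Z' = sub_edges Z"
proof -
  have finZ': "finite Z'" using Z' finite_sub_edges fin finite_subset by (metis finite_UnI)
  have step: "(x, Suc i) \<in> Z' \<longleftrightarrow> (x, i) \<in> Z'" if "Suc i < mul x" for x i
  proof -
    have "even (card (star sub_a sub_b Z' (Inr (x, Suc i))))"
      using bdry_eq_star[OF finZ', of "Inr (x, Suc i)" sub_a sub_b] Z' by simp
    moreover have "star sub_a sub_b Z' (Inr (x, Suc i)) = Z' \<inter> {(x, i), (x, Suc i)}"
      using that by (auto simp: cut_def sub_a_def sub_b_def subdiv_def split: if_splits)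
    moreover have "card (Z' \<inter> {(x, i), (x, Suc i)}) = (if (x, i) \<in> Z' then 1 else 0) + (if (x, Suc i) \<in> Z' then 1 else 0)"
      by auto
    ultimately show ?thesis by (auto split: if_splits)
  qed
  have all: "(x, i) \<in> Z' \<longleftrightarrow> (x, 0) \<in> Z'" if "i < mul x" for x i
    using that by (induction i) (auto simp: step)
  define Z where "Z = {x. (x, 0) \<in> Z'}"
  have ZX: "Z \<subseteq> E \<union> N" using Z' by (auto simp: Z_def sub_edges_def)
  have Z'eq: "Z' = sub_edges Z"
  proof (rule set_eqI)
    fix y show "y \<in> Z' \<longleftrightarrow> y \<in> sub_edges Z"
      using Z'(1) all[of "snd y" "fst y"] by (cases y) (auto simp: sub_edges_def Z_def)
  qed
  have finZ: "finite Z" using ZX fin finite_subset by blast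
  have "bdry a b Z = {}"
  proof (rule ccontr)
    assume "bdry a b Z \<noteq> {}"
    then obtain w where w: "w \<in> bdry a b Z" by blast
    \<comment> \<open>\<open>w\<close> together with the inner vertices of all paths starting at
      \<open>w\<close>: only the last edge of a path can leave this set, and it does so when exactly
      one end of the dual edge is \<open>w\<close>.\<close>
    define Y :: "('w + 'e \<times> nat) set" where "Y = Inl ` {w} \<union> {Inr (x, i) | x i. a x = w}"
    have "cut sub_a sub_b Z' Y = (\<lambda>x. (x, mul x - 1)) ` star a b Z w"
    proof (rule set_eqI)
      fix y :: "'e \<times> nat" obtain x i where y: "y = (x, i)" by (cases y)
      have 1: "subdiv x i \<in> Y \<longleftrightarrow> a x = w" if "i < mul x"
        using that by (auto simp: subdiv_def Y_def)
      have 2: "subdiv x (Suc i) \<in> Y \<longleftrightarrow> (if Suc i = mul x then b x = w else a x = w)" if "i < mul x"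
        using that by (auto simp: subdiv_def Y_def)
      show "y \<in> cut sub_a sub_b Z' Y \<longleftrightarrow> y \<in> (\<lambda>x. (x, mul x - 1)) ` star a b Z w"
      proof (cases "x \<in> Z \<and> i < mul x")
        case True
        then have "y \<in> cut sub_a sub_b Z' Y \<longleftrightarrow> Suc i = mul x \<and> (a x = w) \<noteq> (b x = w)"
          using 1 2 Z'eq by (auto simp: cut_def sub_a_def sub_b_def y sub_edges_def)
        then show ?thesis using True by (auto simp: y image_iff cut_def)
      next
        case False
        then show ?thesis using Z'eq mul_pos[of x] by (auto simp: cut_def y sub_edges_def)
      qed
    qed
    then have "card (cut sub_a sub_b Z' Y) = card (star a b Z w)"
      by (simp add: card_image inj_on_def)
    moreover have "odd (card (star a b Z w))" using bdry_eq_star[OF finZ] w by metis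
    moreover have "Z' \<inter> cut sub_a sub_b Z' Y = cut sub_a sub_b Z' Y" by (auto simp: cut_def)
    ultimately show False using odd_card_Int_cut[OF finZ', of Z' sub_a sub_b Y] Z' by auto
  qed
  then show thesis using that ZX Z'eq by blast
qed

text \<open>By duality an even set is a subdivided primal cut; its weight is \<open>2 * M\<close>
  times the surplus of supply over demand, plus 2 for every supply edge in it.\<close>

lemma sub_conservative: "conservative sub_a sub_b (sub_edges (E \<union> N)) (sub_edges N)"
  unfolding conservative_def
proof (intro allI impI)
  fix Z' assume Z': "Z' \<subseteq> sub_edges (E \<union> N)" "bdry sub_a sub_b Z' = {}"
  obtain Z where Z: "Z \<subseteq> E \<union> N" "bdry a b Z = {}" "Z' = sub_edges Z" using sub_even[OF Z'] by metis
  obtain S where S: "Z = cut p q (E \<union> N) S"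
    using dual_even_is_cut[OF _ dual Z(1,2)] fin by (metis finite_UnI)
  have ZE: "Z \<inter> E = cut p q E S" and ZN: "Z \<inter> N = cut p q N S" using S disj by (auto simp: cut_def)
  have finZ: "finite Z" using Z fin finite_subset by blast
  have "sgn_sum (sub_edges N) Z' = (\<Sum>x\<in>Z. \<Sum>i<mul x. if (x, i) \<in> sub_edges N then - 1 else 1)"
    unfolding sgn_sum_def Z(3) sub_edges_def using finZ by (subst sum.Sigma) (auto intro!: sum.cong)
  also have "\<dots> = (\<Sum>x\<in>Z. if x \<in> N then - int (mul x) else int (mul x))"
    by (intro sum.cong refl) (auto simp: sub_edges_def)
  also have "\<dots> = (\<Sum>x\<in>(Z \<inter> E) \<union> (Z \<inter> N). if x \<in> N then - int (mul x) else int (mul x))"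
    using Z by (intro sum.cong) auto
  also have "\<dots> = (\<Sum>x\<in>Z \<inter> E. if x \<in> N then - int (mul x) else int (mul x)) +
      (\<Sum>x\<in>Z \<inter> N. if x \<in> N then - int (mul x) else int (mul x))"
    using disj finZ by (intro sum.union_disjoint) auto
  also have "(\<Sum>x\<in>Z \<inter> N. if x \<in> N then - int (mul x) else int (mul x)) = - int (2 * M * card (Z \<inter> N))"
    by (simp add: mul_def)
  also have "(\<Sum>x\<in>Z \<inter> E. if x \<in> N then - int (mul x) else int (mul x)) =
      (\<Sum>x\<in>Z \<inter> E. 2 * int M * int (c x) + 2)"
    using disj by (intro sum.cong) (auto simp: mul_def)
  also have "\<dots> = 2 * int M * int (\<Sum>x\<in>Z \<inter> E. c x) + 2 * int (card (Z \<inter> E))"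
    by (simp add: sum.distrib sum_distrib_left)
  finally have eq: "sgn_sum (sub_edges N) Z' =
      2 * int M * int (\<Sum>x\<in>Z \<inter> E. c x) + 2 * int (card (Z \<inter> E)) - int (2 * M * card (Z \<inter> N))" by simp
  have "M * card (Z \<inter> N) \<le> M * (\<Sum>x\<in>Z \<inter> E. c x)" using cutc[of S] ZE ZN by simp
  then have "int (2 * M * card (Z \<inter> N)) \<le> 2 * int M * int (\<Sum>x\<in>Z \<inter> E. c x)"
    by (metis (mono_tags, opaque_lifting) mult.assoc mult_le_mono2 of_nat_le_iff of_nat_mult of_nat_numeral)
  then show "0 \<le> sgn_sum (sub_edges N) Z'" using eq by linarith
qed

text \<open>Each of the \<open>2 * M\<close> unit edges of a demand receives its own cut of the
  subdivided dual. The dual edges whose ends it separates form an even primal set containing this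
  one demand, so the supply edges in it join the ends of the demand. Disjointness bounds the use of
  a supply edge by the number of its unit edges.\<close>

lemma scaled_demand_bound:
  assumes l: "\<And>e. e \<in> E \<Longrightarrow> 0 \<le> l e"
  shows "real M * (\<Sum>n\<in>N. jdist p q E l (p n) (q n)) \<le> (\<Sum>e\<in>E. real (M * c e + 1) * l e)"
proof -
  let ?X = "sub_edges (E \<union> N)" and ?N = "sub_edges N"
  have finX: "finite ?X" and finN: "finite ?N" using fin finite_sub_edges by auto
  \<comment> \<open>Colours alternate along the paths; original vertices count as even positions,
    which fits at both ends because \<open>mul x\<close> is even.\<close>
  define col where "col v = (case v of Inl w \<Rightarrow> False | Inr (x, i) \<Rightarrow> odd i)" for v :: "'w + 'e \<times> nat"
  have "col (subdiv x i) = odd i" if "i \<le> mul x" for x i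
    using that mul_even[of x] by (auto simp: col_def subdiv_def)
  then have col: "col (sub_a y) \<noteq> col (sub_b y)" if "y \<in> ?X" for y
    using that by (auto simp: sub_edges_def sub_a_def sub_b_def)
  have "?N \<subseteq> ?X" by (auto simp: sub_edges_def)
  then have "\<exists>Y. (\<forall>n\<in>?N. cut sub_a sub_b ?X (Y n) \<inter> ?N = {n}) \<and>
      (\<forall>n\<in>?N. \<forall>m\<in>?N. n \<noteq> m \<longrightarrow> cut sub_a sub_b ?X (Y n) \<inter> cut sub_a sub_b ?X (Y m) = {})"
    by (rule conservative_disjoint_cuts[OF finX _ sub_conservative, where col = col]) (rule col)
  then
  obtain Y where Y: "\<forall>n\<in>?N. cut sub_a sub_b ?X (Y n) \<inter> ?N = {n}"
      "\<forall>n\<in>?N. \<forall>m\<in>?N. n \<noteq> m \<longrightarrow> cut sub_a sub_b ?X (Y n) \<inter> cut sub_a sub_b ?X (Y m) = {}"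
    by (elim exE conjE)
  define K where "K y = cut sub_a sub_b ?X (Y y)" for y
  have bound: "jdist p q E l (p n) (q n) \<le> (\<Sum>e\<in>E. real (card {j. (e, j) \<in> K (n, i)}) * l e)"
    if ni: "(n, i) \<in> ?N" for n i
  proof -
    let ?Y = "Y (n, i)"
    \<comment> \<open>A path changes sides of \<open>?Y\<close> an odd number of times exactly when
      its ends are on different sides.\<close>
    have cK: "odd (card {j. (x, j) \<in> K (n, i)}) \<longleftrightarrow> x \<in> cut a b (E \<union> N) {w. Inl w \<in> ?Y}" if "x \<in> E \<union> N" for x
    proof -
      have "{j. (x, j) \<in> K (n, i)} = {j. j < mul x \<and> (subdiv x j \<in> ?Y) \<noteq> (subdiv x (Suc j) \<in> ?Y)}"
        using that by (auto simp: K_def cut_def sub_edges_def sub_a_def sub_b_def)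
      then show ?thesis using odd_card_changes[of "mul x" "\<lambda>j. subdiv x j \<in> ?Y"] that mul_pos[of x]
        by (simp add: cut_def subdiv_def)
    qed
    define Z where "Z = cut a b (E \<union> N) {w. Inl w \<in> ?Y}"
    have KN: "K (n, i) \<inter> ?N = {(n, i)}" using Y(1) ni by (simp add: K_def)
    have "n \<in> N" using ni by (auto simp: sub_edges_def)
    have "{j. (n, j) \<in> K (n, i)} = {i}"
    proof -
      have "(n, j) \<in> ?N" if "(n, j) \<in> K (n, i)" for j
        using that \<open>n \<in> N\<close> by (auto simp: K_def cut_def sub_edges_def)
      then show ?thesis using KN by blast
    qed
    then have nZ: "n \<in> Z" using cK[of n] \<open>n \<in> N\<close> by (simp add: Z_def)
    have ZN: "n' = n" if "n' \<in> Z" "n' \<in> N" for n'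
    proof -
      have "{j. (n', j) \<in> K (n, i)} \<noteq> {}" using cK[of n'] that by (auto simp: Z_def intro: ccontr)
      then obtain j where "(n', j) \<in> K (n, i)" by blast
      moreover have "(n', j) \<in> ?N" using calculation that by (auto simp: K_def cut_def sub_edges_def)
      ultimately show ?thesis using KN by blast
    qed
    have ZX: "Z \<subseteq> E \<union> N" by (auto simp: Z_def cut_def)
    then have finZ: "finite Z" using fin finite_subset by blast
    have "bdry p q Z = {}" using dual by (simp add: dual_pair_def Z_def)
    then have "bdry p q (Z - {n}) = sym_diff {p n} {q n}"
      using bdry_Diff[OF finZ, of "{n}" p q] nZ bdry_single[of p q n] by simp
    moreover have ZE: "Z - {n} \<subseteq> E" using ZX ZN by blast
    ultimately have "jdist p q E l (p n) (q n) \<le> sum l (Z - {n})" by (intro jdist_le[OF fin(1)])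
    also have "\<dots> = (\<Sum>e\<in>Z - {n}. 1 * l e)" by simp
    also have "\<dots> \<le> (\<Sum>e\<in>Z - {n}. real (card {j. (e, j) \<in> K (n, i)}) * l e)"
    proof (intro sum_mono mult_right_mono)
      fix e assume e: "e \<in> Z - {n}"
      then have "odd (card {j. (e, j) \<in> K (n, i)})" using cK[of e] ZX by (auto simp: Z_def)
      then have "0 < card {j. (e, j) \<in> K (n, i)}" by (rule odd_pos)
      then show "1 \<le> real (card {j. (e, j) \<in> K (n, i)})" by linarith
      show "0 \<le> l e" using l e ZE by blast
    qed
    also have "\<dots> \<le> (\<Sum>e\<in>E. real (card {j. (e, j) \<in> K (n, i)}) * l e)"
      using fin ZE l by (intro sum_mono2) auto
    finally show ?thesis .
  qed
  have "real (2 * M) * (\<Sum>n\<in>N. jdist p q E l (p n) (q n)) = (\<Sum>n\<in>N. \<Sum>i<mul n. jdist p q E l (p n) (q n))"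
    by (simp add: mul_def sum_distrib_left)
  also have "\<dots> = (\<Sum>(n, i)\<in>?N. jdist p q E l (p n) (q n))"
    unfolding sub_edges_def using fin by (subst sum.Sigma) auto
  also have "\<dots> \<le> (\<Sum>y\<in>?N. \<Sum>e\<in>E. real (card {j. (e, j) \<in> K y}) * l e)"
    using bound by (intro sum_mono) auto
  also have "\<dots> = (\<Sum>e\<in>E. (\<Sum>y\<in>?N. real (card {j. (e, j) \<in> K y})) * l e)"
    by (subst sum.swap) (simp add: sum_distrib_right)
  also have "\<dots> \<le> (\<Sum>e\<in>E. real (mul e) * l e)"
  proof (intro sum_mono mult_right_mono)
    fix e assume e: "e \<in> E"
    have sub: "{j. (e, j) \<in> K y} \<subseteq> {..<mul e}" for y by (auto simp: K_def cut_def sub_edges_def)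
    then have finK: "finite {j. (e, j) \<in> K y}" for y using finite_subset by blast
    have "K y \<inter> K z = {}" if "y \<in> ?N" "z \<in> ?N" "y \<noteq> z" for y z
      using Y(2) that unfolding K_def by blast
    then have "{j. (e, j) \<in> K y} \<inter> {j. (e, j) \<in> K z} = {}" if "y \<in> ?N" "z \<in> ?N" "y \<noteq> z" for y z
      using that by blast
    then have "(\<Sum>y\<in>?N. card {j. (e, j) \<in> K y}) = card (\<Union>y\<in>?N. {j. (e, j) \<in> K y})"
      using finN finK by (intro card_UN_disjoint[symmetric]) blast+
    also have "\<dots> \<le> card {..<mul e}" using sub by (intro card_mono) auto
    finally show "(\<Sum>y\<in>?N. real (card {j. (e, j) \<in> K y})) \<le> real (mul e)"
      by (metis card_lessThan of_nat_le_iff of_nat_sum)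
    show "0 \<le> l e" using l e .
  qed
  also have "\<dots> = 2 * (\<Sum>e\<in>E. real (M * c e + 1) * l e)"
    unfolding sum_distrib_left using disj by (intro sum.cong) (auto simp: mul_def)
  finally show ?thesis by simp
qed

end

text \<open>The extra units of capacity contribute \<open>sum l E\<close> independently of
  \<open>M\<close>, so any violation would outgrow this error for large \<open>M\<close>.\<close>

theorem dual_pair_demand_bound:
  assumes "finite E" "finite N" "E \<inter> N = {}" "dual_pair (E \<union> N) p q a b"
    and "\<And>S. card (cut p q N S) \<le> (\<Sum>e\<in>cut p q E S. c e)"
    and l: "\<And>e. e \<in> E \<Longrightarrow> 0 \<le> l e"
  shows "(\<Sum>n\<in>N. jdist p q E l (p n) (q n)) \<le> (\<Sum>e\<in>E. real (c e) * l e)"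
proof (rule ccontr)
  let ?A = "\<Sum>n\<in>N. jdist p q E l (p n) (q n)" and ?B = "\<Sum>e\<in>E. real (c e) * l e"
  assume "\<not> ?A \<le> ?B"
  then have pos: "0 < ?A - ?B" by simp
  obtain M :: nat where M: "sum l E < real M * (?A - ?B)" using ex_less_of_nat_mult[OF pos] by blast
  have "0 < M"
  proof (rule ccontr)
    assume "\<not> 0 < M"
    then have "sum l E < 0" using M by simp
    then show False using sum_nonneg[of E l] l by simp
  qed
  have "real M * ?A \<le> (\<Sum>e\<in>E. real (M * c e + 1) * l e)"
    by (rule scaled_demand_bound[OF assms(1-3) \<open>0 < M\<close> assms(4,5) l])
  also have "\<dots> = (\<Sum>e\<in>E. real M * (real (c e) * l e) + l e)"
    by (simp add: algebra_simps)
  also have "\<dots> = real M * ?B + sum l E" by (simp add: sum.distrib sum_distrib_left)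
  finally show False using M by (simp add: algebra_simps)
qed

section \<open>Duals of plane graphs with fat vertices\<close>

text \<open>The far end \<open>v\<close> is fixed and the path grows at its front; \<open>vs\<close>
  lists the vertices from the current end \<open>u\<close> to \<open>v\<close>.\<close>

inductive spath :: "('e \<Rightarrow> 'v) \<Rightarrow> ('e \<Rightarrow> 'v) \<Rightarrow> 'e set \<Rightarrow> 'v \<Rightarrow> 'v \<Rightarrow> 'e list \<Rightarrow> 'v list \<Rightarrow> bool"
  for p q E v where
  start: "spath p q E v v [] [v]"
| step: "spath p q E v u es vs \<Longrightarrow> e \<in> E \<Longrightarrow> {p e, q e} = {w, u} \<Longrightarrow> w \<notin> set vs \<Longrightarrow>
    spath p q E v w (e # es) (w # vs)"

lemma spath_vertex: "spath p q E v u es vs \<Longrightarrow> w \<in> set vs \<Longrightarrow> \<exists>es vs. spath p q E v w es vs"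
proof (induction rule: spath.induct)
  case start
  then show ?case using spath.start[of p q E v] by auto
next
  case (step u es vs e w')
  then show ?case using spath.step[OF step.hyps(1-4)] by (cases "w = w'") auto
qed

lemma spath_facts:
  assumes "spath p q E v u es vs"
  shows "u \<in> set vs" "v \<in> set vs" "set es \<subseteq> E" "\<And>e. e \<in> set es \<Longrightarrow> p e \<in> set vs \<and> q e \<in> set vs"
  using assms by (induction rule: spath.induct) (auto simp: doubleton_eq_iff)

lemma spath_bdry: "spath p q E v u es vs \<Longrightarrow> bdry p q (set es) = sym_diff {u} {v}"
proof (induction rule: spath.induct)
  case start
  then show ?case by simp
next
  case (step u es vs e w)
  have e: "e \<notin> set es" using spath_facts(4)[OF step.hyps(1), of e] step.hyps(3,4) by (auto simp: doubleton_eq_iff)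
  have "u \<noteq> w" using spath_facts(1)[OF step.hyps(1)] step.hyps(4) by auto
  then have sd: "sym_diff {p e} {q e} = {w, u}" using step.hyps(3) by (auto simp: doubleton_eq_iff)
  have vw: "v \<noteq> w" using spath_facts(2)[OF step.hyps(1)] step.hyps(4) by auto
  show ?case using bdry_insert[of "set es" e p q] e sd step.IH \<open>u \<noteq> w\<close> vw by auto
qed

text \<open>The vertices with a simple path to \<open>v\<close> form a set that no edge leaves: a
  new vertex either extends the path or already lies on it. Parity of the join puts \<open>u\<close>
  into this set.\<close>

lemma linked_imp_spath:
  assumes "finite E" "linked p q E u v"
  shows "\<exists>es vs. spath p q E v u es vs"
proof -
  define R where "R = {u. \<exists>es vs. spath p q E v u es vs}"
  obtain J where J: "J \<subseteq> E" "bdry p q J = sym_diff {u} {v}" using assms(2) unfolding linked_def by (elim exE conjE)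
  have finJ: "finite J" using J(1) assms(1) by (rule finite_subset)
  have step: "w \<in> R" if w': "w' \<in> R" "e \<in> E" "{p e, q e} = {w, w'}" for w w' e
  proof -
    obtain es vs where s: "spath p q E v w' es vs" using w'(1) by (auto simp: R_def)
    show ?thesis
    proof (cases "w \<in> set vs")
      case True
      then show ?thesis using spath_vertex[OF s] by (simp add: R_def)
    next
      case False
      then show ?thesis using spath.step[OF s w'(2,3)] by (auto simp: R_def)
    qed
  qed
  have "(p e \<in> R) = (q e \<in> R)" if "e \<in> E" for e
    using step[of "p e" e "q e"] step[of "q e" e "p e"] that by (auto simp: insert_commute)
  then have "J \<inter> cut p q J R = {}" using J(1) by (auto simp: cut_def)
  then have ev: "even (card (bdry p q J \<inter> R))" using odd_card_Int_cut[OF finJ, of J p q R] by auto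
  have "v \<in> R" using spath.start[of p q E v] by (auto simp: R_def)
  have "u \<in> R"
  proof (rule ccontr)
    assume "u \<notin> R"
    then have "bdry p q J \<inter> R = {v}" using J(2) \<open>v \<in> R\<close> by auto
    then show False using ev by simp
  qed
  then show ?thesis by (simp add: R_def)
qed

definition arc_between :: "complex set \<Rightarrow> complex \<Rightarrow> complex \<Rightarrow> bool" where
  "arc_between A x y \<longleftrightarrow> (x = y \<and> A = {x}) \<or>
     (\<exists>g. arc g \<and> path_image g = A \<and> pathstart g = x \<and> pathfinish g = y)"

lemma arc_between_ends: "arc_between A x y \<Longrightarrow> x \<in> A \<and> y \<in> A"
  unfolding arc_between_def using pathfinish_in_path_image pathstart_in_path_image by fastforce

lemma arc_between_join:
  assumes "arc_between A x y" "arc_between A' y z" "A \<inter> A' = {y}"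
  shows "arc_between (A \<union> A') x z"
proof -
  consider "x = y" "A = {x}" | "y = z" "A' = {y}"
    | g g' where "arc g" "path_image g = A" "pathstart g = x" "pathfinish g = y"
      "arc g'" "path_image g' = A'" "pathstart g' = y" "pathfinish g' = z"
    using assms(1,2) unfolding arc_between_def by (elim disjE exE conjE)
  then show ?thesis
  proof cases
    case 1
    then have "A \<union> A' = A'" using assms(3) by auto
    then show ?thesis using 1 assms(2) by simp
  next
    case 2
    then have "A \<union> A' = A" using assms(3) by auto
    then show ?thesis using 2 assms(1) by simp
  next
    case 3
    have "arc (g +++ g')" using 3 assms(3) by (intro arc_join) auto
    moreover have "path_image (g +++ g') = A \<union> A'" using 3 by (simp add: path_image_join)
    moreover have "pathstart (g +++ g') = x" "pathfinish (g +++ g') = z" using 3 by auto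
    ultimately show ?thesis unfolding arc_between_def by (intro disjI2 exI[of _ "g +++ g'"] conjI)
  qed
qed

lemma arc_between_sym: "arc_between A x y \<Longrightarrow> arc_between A y x"
  unfolding arc_between_def
  by (elim disjE exE, simp, intro disjI2)
    (metis arc_reversepath path_image_reversepath pathfinish_reversepath pathstart_reversepath)

lemma path_connected_arc_between:
  assumes "path_connected S" "x \<in> S" "y \<in> S"
  obtains A where "A \<subseteq> S" "arc_between A x y"
proof (cases "x = y")
  case True
  then show ?thesis using that[of "{x}"] assms by (auto simp: arc_between_def)
next
  case False
  then obtain g where "arc g" "path_image g \<subseteq> S" "pathstart g = x" "pathfinish g = y"
    using assms path_connected_arcwise by metis
  then show ?thesis using that[of "path_image g"] by (auto simp: arc_between_def)
qed

text \<open>A plane graph whose vertices are disjoint path-connected compact sets.\<close>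

locale blob_graph =
  fixes I :: "'i set" and B :: "'i \<Rightarrow> complex set" and X :: "'x set" and \<gamma> :: "'x \<Rightarrow> real \<Rightarrow> complex"
    and p q :: "'x \<Rightarrow> 'i"
  assumes fin: "finite I" "finite X"
    and blob: "\<And>i. i \<in> I \<Longrightarrow> compact (B i)" "\<And>i. i \<in> I \<Longrightarrow> path_connected (B i)"
    and blob_disj: "\<And>i j. i \<in> I \<Longrightarrow> j \<in> I \<Longrightarrow> i \<noteq> j \<Longrightarrow> B i \<inter> B j = {}"
    and arcs: "\<And>x. x \<in> X \<Longrightarrow> arc (\<gamma> x)"
    and ends: "\<And>x. x \<in> X \<Longrightarrow> p x \<in> I" "\<And>x. x \<in> X \<Longrightarrow> q x \<in> I" "\<And>x. x \<in> X \<Longrightarrow> p x \<noteq> q x"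
    and ends_in: "\<And>x. x \<in> X \<Longrightarrow> pathstart (\<gamma> x) \<in> B (p x)" "\<And>x. x \<in> X \<Longrightarrow> pathfinish (\<gamma> x) \<in> B (q x)"
    and arc_blob: "\<And>x i. x \<in> X \<Longrightarrow> i \<in> I \<Longrightarrow> path_image (\<gamma> x) \<inter> B i \<subseteq> {pathstart (\<gamma> x), pathfinish (\<gamma> x)}"
    and arc_arc: "\<And>x y. x \<in> X \<Longrightarrow> y \<in> X \<Longrightarrow> x \<noteq> y \<Longrightarrow> path_image (\<gamma> x) \<inter> path_image (\<gamma> y) \<subseteq> (\<Union>i\<in>I. B i)"
begin

definition pts :: "'x set \<Rightarrow> complex set" where
  "pts Z = (\<Union>i\<in>I. B i) \<union> (\<Union>x\<in>Z. path_image (\<gamma> x))"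

definition inner :: "'x \<Rightarrow> complex set" where
  "inner x = path_image (\<gamma> x) - {pathstart (\<gamma> x), pathfinish (\<gamma> x)}"

text \<open>The faces into which the removal of the edge \<open>x\<close> from the complement splits a face of the rest.\<close>

definition nb :: "'x \<Rightarrow> complex set set" where
  "nb x = {F \<in> components (- pts X). \<exists>u\<in>F. \<exists>z\<in>inner x. connected_component (- pts (X - {x})) u z}"

lemma compact_arc: "x \<in> X \<Longrightarrow> compact (path_image (\<gamma> x))"
  using arcs by (simp add: arc_imp_path compact_path_image)

lemma compact_pts: "Z \<subseteq> X \<Longrightarrow> compact (pts Z)"
  unfolding pts_def using fin blob compact_arc finite_subset[of Z X]
  by (intro compact_Un compact_UN) auto

lemma pts_mono: "Z \<subseteq> Z' \<Longrightarrow> pts Z \<subseteq> pts Z'"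
  by (auto simp: pts_def)

lemma pts_insert: "pts (insert x Z) = pts Z \<union> path_image (\<gamma> x)"
  by (auto simp: pts_def)

lemma connected_component_pts_mono:
  "connected_component (- pts Z') u v \<Longrightarrow> Z \<subseteq> Z' \<Longrightarrow> connected_component (- pts Z) u v"
  using connected_component_of_subset pts_mono by (metis Compl_subset_Compl_iff)

lemma arc_blob_end:
  assumes "x \<in> X" "i \<in> I" "z \<in> path_image (\<gamma> x)" "z \<in> B i"
  shows "(z = pathstart (\<gamma> x) \<and> i = p x) \<or> (z = pathfinish (\<gamma> x) \<and> i = q x)"
proof -
  have "z = pathstart (\<gamma> x) \<or> z = pathfinish (\<gamma> x)" using arc_blob[of x i] assms by blast
  then show ?thesis using ends_in[OF assms(1)] ends[OF assms(1)] blob_disj[OF assms(2)] assms(4) by blast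
qed

lemma arc_arc_end:
  assumes "x \<in> X" "y \<in> X" "x \<noteq> y" "z \<in> path_image (\<gamma> x)" "z \<in> path_image (\<gamma> y)"
  obtains i where "i \<in> I" "z \<in> B i" "i = p x \<and> z = pathstart (\<gamma> x) \<or> i = q x \<and> z = pathfinish (\<gamma> x)"
    "i = p y \<and> z = pathstart (\<gamma> y) \<or> i = q y \<and> z = pathfinish (\<gamma> y)"
proof -
  obtain i where "i \<in> I" "z \<in> B i" using arc_arc[OF assms(1-3)] assms(4,5) by blast
  then show thesis using that[of i] arc_blob_end[of x i z] arc_blob_end[of y i z] assms by blast
qed

lemma inner_disjoint:
  assumes "x \<in> X" "z \<in> inner x" "Z \<subseteq> X" "x \<notin> Z"
  shows "z \<notin> pts Z"
proof
  assume "z \<in> pts Z"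
  then consider i where "i \<in> I" "z \<in> B i" | y where "y \<in> Z" "z \<in> path_image (\<gamma> y)" by (auto simp: pts_def)
  then show False
  proof cases
    case 1
    then show False using arc_blob_end[of x i z] assms by (auto simp: inner_def)
  next
    case 2
    then have "y \<in> X" "x \<noteq> y" "z \<in> path_image (\<gamma> x)" using assms by (auto simp: inner_def)
    then show False using arc_arc_end[of x y z] 2 assms(1,2) by (metis DiffE inner_def insertCI)
  qed
qed

lemma path_image_minus_pts: "x \<in> X \<Longrightarrow> z \<in> path_image (\<gamma> x) \<Longrightarrow> z \<notin> (\<Union>i\<in>I. B i) \<Longrightarrow> z \<in> inner x"
  using ends_in[of x] ends[of x] by (auto simp: inner_def)

lemma inner_nonempty_connected:
  assumes "x \<in> X"
  shows "inner x \<noteq> {}" "connected (inner x)"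
proof -
  show "connected (inner x)" unfolding inner_def using arcs[OF assms]
    by (simp add: arc_imp_simple_path connected_simple_path_endless)
  show "inner x \<noteq> {}" unfolding inner_def using arcs[OF assms]
    by (simp add: arc_imp_simple_path simple_path_endless nonempty_simple_path_endless)
qed

lemma inner_connected_component:
  assumes "x \<in> X" "z \<in> inner x" "w \<in> inner x" "Z \<subseteq> X" "x \<notin> Z"
  shows "connected_component (- pts Z) z w"
  unfolding connected_component_def
  using inner_nonempty_connected(2)[OF assms(1)] inner_disjoint[OF assms(1) _ assms(4,5)] assms(2,3)
  by (intro exI[of _ "inner x"]) auto

lemma nearby:
  assumes "x \<in> X" "z \<in> inner x"
  obtains r where "0 < r" "\<And>u. u \<in> ball z r \<Longrightarrow> connected_component (- pts (X - {x})) u z"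
proof -
  have "open (- pts (X - {x}))" using compact_pts[of "X - {x}"] by (simp add: compact_imp_closed open_Compl)
  moreover have "z \<in> - pts (X - {x})" using inner_disjoint[OF assms, of "X - {x}"] by auto
  ultimately obtain r where r: "0 < r" "ball z r \<subseteq> - pts (X - {x})" using openE by blast
  have "connected_component (- pts (X - {x})) u z" if "u \<in> ball z r" for u
    unfolding connected_component_def using r that by (intro exI[of _ "ball z r"]) auto
  then show thesis using that r by blast
qed

text \<open>The rest of the graph falls into the part linked to \<open>p x\<close> and the remaining
  part, two disjoint compact sets. The arc of \<open>x\<close> has one point in common with each,
  and an arc alone separates nothing; so Janiszewski's theorem applies when the two parts are added
  to it in turn.\<close>

lemma bridge_nonseparating:
  assumes "Z \<subseteq> X" "x \<in> X" "x \<notin> Z" "\<not> linked p q Z (p x) (q x)"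
    and uv: "connected_component (- pts Z) u v" "u \<notin> path_image (\<gamma> x)" "v \<notin> path_image (\<gamma> x)"
  shows "connected_component (- pts (insert x Z)) u v"
proof -
  define R where "R = {i. linked p q Z (p x) i}"
  have finZ: "finite Z" using assms(1) fin(2) by (rule finite_subset)
  have R: "p z \<in> R \<longleftrightarrow> q z \<in> R" if "z \<in> Z" for z
    using linked_trans[OF finZ, of p q "p x"] linked_edge[OF that, of p q]
      linked_sym[OF linked_edge[OF that, of p q]] unfolding R_def by blast
  have pR: "p x \<in> R" "q x \<notin> R" using assms(4) linked_refl[of p q Z] by (auto simp: R_def)
  let ?e = "path_image (\<gamma> x)"
  \<comment> \<open>An edge is filed under its end \<open>p z\<close>; both ends of an edge of
    \<open>Z\<close> are on the same side of \<open>R\<close>.\<close>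
  define P where "P S = (\<Union>i\<in>I \<inter> S. B i) \<union> (\<Union>z\<in>{z \<in> Z. p z \<in> S}. path_image (\<gamma> z))" for S
  have un: "pts Z = P R \<union> P (- R)" by (auto simp: pts_def P_def)
  have comp: "compact (P S)" for S unfolding P_def
    using fin finZ blob compact_arc assms(1) by (intro compact_Un compact_UN) auto
  have in_blob: "\<exists>i\<in>I \<inter> S. z \<in> B i" if z: "z \<in> ?e" "z \<in> P S" and S: "S = R \<or> S = - R" for z S
  proof -
    consider i where "i \<in> I \<inter> S" "z \<in> B i" | y where "y \<in> Z" "p y \<in> S" "z \<in> path_image (\<gamma> y)"
      using z by (auto simp: P_def)
    then show ?thesis
    proof cases
      case 2
      have "x \<noteq> y" "y \<in> X" using 2 assms by auto
      then obtain i where "i \<in> I" "z \<in> B i" "i = p y \<or> i = q y"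
        using arc_arc_end[OF assms(2) _ _ z(1) 2(3)] by metis
      moreover have "i \<in> S" using calculation R[OF 2(1)] 2(2) S by auto
      ultimately show ?thesis by blast
    qed blast
  qed
  have e1: "P R \<inter> ?e = {pathstart (\<gamma> x)}"
  proof (intro equalityI subsetI)
    fix z assume "z \<in> P R \<inter> ?e"
    then have "\<exists>i\<in>I \<inter> R. z \<in> B i" using in_blob[of z R] by simp
    then obtain i where "i \<in> I" "i \<in> R" "z \<in> B i" by blast
    then show "z \<in> {pathstart (\<gamma> x)}" using arc_blob_end[OF assms(2), of i z] pR \<open>z \<in> P R \<inter> ?e\<close> by auto
  next
    fix z assume "z \<in> {pathstart (\<gamma> x)}"
    moreover have "pathstart (\<gamma> x) \<in> P R"
      unfolding P_def using pR(1) ends_in(1)[OF assms(2)] ends(1)[OF assms(2)] by blast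
    ultimately show "z \<in> P R \<inter> ?e" by (simp add: pathstart_in_path_image)
  qed
  have e2: "(P R \<union> ?e) \<inter> P (- R) = {pathfinish (\<gamma> x)}"
  proof (intro equalityI subsetI)
    fix z assume z: "z \<in> (P R \<union> ?e) \<inter> P (- R)"
    have "P R \<inter> P (- R) = {}"
    proof (rule ccontr)
      assume "P R \<inter> P (- R) \<noteq> {}"
      then obtain z where z: "z \<in> P R" "z \<in> P (- R)" by blast
      have blobR: "\<exists>i\<in>I. z \<in> B i \<and> i \<in> S" if zS: "z \<in> P S" "i' \<in> I" "z \<in> B i'" "S = R \<or> S = - R" for S i'
      proof -
        consider i where "i \<in> I \<inter> S" "z \<in> B i" | y where "y \<in> Z" "p y \<in> S" "z \<in> path_image (\<gamma> y)"
          using zS(1) by (auto simp: P_def)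
        then show ?thesis
        proof cases
          case 2
          then have "i' = p y \<or> i' = q y" using arc_blob_end[of y i' z] zS(2,3) assms by blast
          then show ?thesis using zS R[OF 2(1)] 2(2) by auto
        qed blast
      qed
      have "\<exists>i\<in>I. z \<in> B i"
      proof (rule ccontr)
        assume no: "\<not> (\<exists>i\<in>I. z \<in> B i)"
        then obtain y y' where y: "y \<in> Z" "p y \<in> R" "z \<in> path_image (\<gamma> y)" "y' \<in> Z" "p y' \<in> - R" "z \<in> path_image (\<gamma> y')"
          using z by (auto simp: P_def)
        then have "y \<noteq> y'" by auto
        then show False using arc_arc[of y y'] y assms(1) no by blast
      qed
      then obtain i where i: "i \<in> I" "z \<in> B i" by blast
      obtain j where j: "j \<in> I" "z \<in> B j" "j \<in> R" using blobR[OF z(1) i] by blast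
      obtain k where k: "k \<in> I" "z \<in> B k" "k \<in> - R" using blobR[OF z(2) i] by blast
      show False using blob_disj[OF j(1) k(1)] j k by blast
    qed
    then have "z \<in> ?e" "z \<in> P (- R)" using z by auto
    then have "\<exists>i\<in>I \<inter> - R. z \<in> B i" using in_blob[of z "- R"] by simp
    then obtain i where "i \<in> I" "i \<in> - R" "z \<in> B i" by blast
    then show "z \<in> {pathfinish (\<gamma> x)}" using arc_blob_end[OF assms(2), of i z] pR \<open>z \<in> ?e\<close> by auto
  next
    fix z assume "z \<in> {pathfinish (\<gamma> x)}"
    moreover have "pathfinish (\<gamma> x) \<in> P (- R)"
      unfolding P_def using pR(2) ends_in(2)[OF assms(2)] ends(2)[OF assms(2)] by blast
    ultimately show "z \<in> (P R \<union> ?e) \<inter> P (- R)" by (simp add: pathfinish_in_path_image)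
  qed
  have "connected_component (- P R) u v"
    using connected_component_of_subset[OF uv(1)] un by blast
  moreover have "connected_component (- ?e) u v"
    using connected_arc_complement[OF arcs[OF assms(2)]] uv by (simp add: connected_iff_connected_component)
  ultimately have 1: "connected_component (- (P R \<union> ?e)) u v"
    by (intro Janiszewski) (simp_all add: comp compact_arc[OF assms(2)] e1 compact_imp_closed)
  have "connected_component (- P (- R)) u v"
    using connected_component_of_subset[OF uv(1)] un by blast
  then have "connected_component (- ((P R \<union> ?e) \<union> P (- R))) u v"
    by (intro Janiszewski[OF _ _ _ 1]) (simp_all add: comp compact_arc[OF assms(2)] e2 compact_imp_closed compact_Un)
  moreover have "(P R \<union> ?e) \<union> P (- R) = pts (insert x Z)" unfolding pts_insert un by (simp add: Un_ac)
  ultimately show ?thesis by simp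
qed

text \<open>The edges of a simple path are connected by arcs inside the fat vertices; distinctness
  of the vertices keeps the pieces from meeting except at the joints. The edge arcs are contained
  completely, so that every edge of a cycle lies on the resulting Jordan curve.\<close>

lemma spath_arc:
  assumes "spath p q X v u es vs" "set vs \<subseteq> I" "\<alpha> \<in> B u" "\<beta> \<in> B v"
  shows "\<exists>A. arc_between A \<alpha> \<beta> \<and> A \<subseteq> (\<Union>i\<in>set vs. B i) \<union> (\<Union>z\<in>set es. path_image (\<gamma> z)) \<and>
    (\<forall>z\<in>set es. path_image (\<gamma> z) \<subseteq> A)"
  using assms
proof (induction arbitrary: \<alpha> rule: spath.induct)
  case start
  then have "v \<in> I" "\<alpha> \<in> B v" "\<beta> \<in> B v" by simp_all
  then obtain A where "A \<subseteq> B v" "arc_between A \<alpha> \<beta>"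
    using path_connected_arc_between[OF blob(2)[of v]] by metis
  then show ?case by (intro exI[of _ A]) simp
next
  case (step u es vs e w)
  have w: "w \<in> I" "set vs \<subseteq> I" using step.prems by auto
  have uvs: "u \<in> set vs" using spath_facts(1)[OF step.hyps(1)] .
  obtain s s' where s: "s \<in> B w" "s' \<in> B u" "arc_between (path_image (\<gamma> e)) s s'"
    "{s, s'} = {pathstart (\<gamma> e), pathfinish (\<gamma> e)}"
  proof (cases "p e = w")
    case True
    then have "q e = u" using step.hyps by (auto simp: doubleton_eq_iff)
    then show thesis using that[of "pathstart (\<gamma> e)" "pathfinish (\<gamma> e)"] True ends_in[OF step.hyps(2)] arcs[OF step.hyps(2)]
      unfolding arc_between_def by blast
  next
    case False
    then have "q e = w" "p e = u" using step.hyps by (auto simp: doubleton_eq_iff)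
    then show thesis using that[of "pathfinish (\<gamma> e)" "pathstart (\<gamma> e)"] ends_in[OF step.hyps(2)] arcs[OF step.hyps(2)]
      arc_between_sym[of "path_image (\<gamma> e)" "pathstart (\<gamma> e)" "pathfinish (\<gamma> e)"]
      unfolding arc_between_def by blast
  qed
  obtain A' where A': "arc_between A' s' \<beta>" "A' \<subseteq> (\<Union>i\<in>set vs. B i) \<union> (\<Union>z\<in>set es. path_image (\<gamma> z))"
    "\<forall>z\<in>set es. path_image (\<gamma> z) \<subseteq> A'"
    using step.IH[OF w(2) s(2) step.prems(3)] by blast
  obtain A0 where A0: "A0 \<subseteq> B w" "arc_between A0 \<alpha> s"
    using path_connected_arc_between[OF blob(2)[OF w(1)] step.prems(2) s(1)] by blast
  have inA: "\<exists>i\<in>set vs. z \<in> B i" if "z \<in> A'" "z \<in> B j" "j \<in> I" for z j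
  proof -
    consider i where "i \<in> set vs" "z \<in> B i" | y where "y \<in> set es" "z \<in> path_image (\<gamma> y)" using A'(2) \<open>z \<in> A'\<close> by blast
    then show ?thesis
    proof cases
      case 2
      have "y \<in> X" using spath_facts(3)[OF step.hyps(1)] 2 by blast
      then have "j = p y \<or> j = q y" using arc_blob_end[of y j z] 2 that by blast
      then show ?thesis using spath_facts(4)[OF step.hyps(1) 2(1)] that by auto
    qed blast
  qed
  have wdis: "z \<notin> A'" if zw: "z \<in> B w" for z
  proof
    assume "z \<in> A'"
    then obtain i where "i \<in> set vs" "z \<in> B i" using inA[OF _ zw w(1)] by blast
    then show False using blob_disj[of i w] zw w step.hyps(4) by blast
  qed
  have e_end: "z = s \<or> z = s'" if "z \<in> path_image (\<gamma> e)" "z \<in> B i" "i \<in> I" for z i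
    using arc_blob[OF step.hyps(2) that(3)] that s(4) by blast
  have 1: "A0 \<inter> path_image (\<gamma> e) = {s}"
  proof (intro equalityI subsetI)
    fix z assume z: "z \<in> A0 \<inter> path_image (\<gamma> e)"
    then have "z \<in> B w" using A0 by blast
    then have "z = s \<or> z = s'" using e_end z w by blast
    moreover have "s' \<notin> B w" using s(2) blob_disj[of u w] uvs w step.hyps(4) by blast
    ultimately show "z \<in> {s}" using \<open>z \<in> B w\<close> by auto
  qed (use arc_between_ends[OF A0(2)] arc_between_ends[OF s(3)] in blast)
  have 2: "(A0 \<union> path_image (\<gamma> e)) \<inter> A' = {s'}"
  proof (intro equalityI subsetI)
    fix z assume z: "z \<in> (A0 \<union> path_image (\<gamma> e)) \<inter> A'"
    then have "z \<notin> B w" using wdis by blast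
    then have ze: "z \<in> path_image (\<gamma> e)" using z A0 by blast
    have "\<exists>i\<in>I. z \<in> B i"
    proof -
      consider i where "i \<in> set vs" "z \<in> B i" | y where "y \<in> set es" "z \<in> path_image (\<gamma> y)" using A'(2) z by blast
      then show ?thesis
      proof cases
        case 2
        have "y \<in> X" using spath_facts(3)[OF step.hyps(1)] 2 by blast
        moreover have "e \<noteq> y" using spath_facts(4)[OF step.hyps(1) 2(1)] step.hyps(3,4) by (auto simp: doubleton_eq_iff)
        ultimately show ?thesis using arc_arc[OF step.hyps(2), of y] ze 2 by blast
      qed (use w in blast)
    qed
    then have "z = s \<or> z = s'" using e_end ze by blast
    then show "z \<in> {s'}" using s(1) \<open>z \<notin> B w\<close> by blast
  next
    fix z assume "z \<in> {s'}"
    then have "z = s'" by simp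
    have "s' \<in> A'" using arc_between_ends[OF A'(1)] by blast
    moreover have "s' \<in> path_image (\<gamma> e)" using arc_between_ends[OF s(3)] by blast
    ultimately show "z \<in> (A0 \<union> path_image (\<gamma> e)) \<inter> A'" using \<open>z = s'\<close> by simp
  qed
  have r1: "arc_between (A0 \<union> path_image (\<gamma> e) \<union> A') \<alpha> \<beta>"
    by (rule arc_between_join[OF arc_between_join[OF A0(2) s(3) 1] A'(1) 2])
  have r2: "A0 \<union> path_image (\<gamma> e) \<union> A' \<subseteq> (\<Union>i\<in>set (w # vs). B i) \<union> (\<Union>z\<in>set (e # es). path_image (\<gamma> z))"
  proof
    fix z assume "z \<in> A0 \<union> path_image (\<gamma> e) \<union> A'"
    then consider "z \<in> A0" | "z \<in> path_image (\<gamma> e)" | "z \<in> A'" by (elim UnE)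
    then show "z \<in> (\<Union>i\<in>set (w # vs). B i) \<union> (\<Union>z\<in>set (e # es). path_image (\<gamma> z))"
      using A0(1) A'(2) by cases auto
  qed
  have r3: "\<forall>z\<in>set (e # es). path_image (\<gamma> z) \<subseteq> A0 \<union> path_image (\<gamma> e) \<union> A'"
    using A'(3) by auto
  show ?case
    by (rule exI[of _ "A0 \<union> path_image (\<gamma> e) \<union> A'"]) (rule conjI[OF r1 conjI[OF r2 r3]])
qed

text \<open>The arc \<open>A\<close> is kept apart from the arc of \<open>x\<close>: it is the
  connected common part of the curve and the remaining graph that Janiszewski's theorem asks
  for.\<close>

lemma cycle_curve:
  assumes x: "x \<in> X" "x \<notin> set es" and sp: "spath p q X (q x) (p x) es vs"
  obtains A c where "simple_path c" "pathfinish c = pathstart c" "path_image c = path_image (\<gamma> x) \<union> A"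
    "connected A" "A \<subseteq> pts (set es)" "\<And>z. z \<in> set es \<Longrightarrow> path_image (\<gamma> z) \<subseteq> A"
    "pathstart (\<gamma> x) \<in> A" "pathfinish (\<gamma> x) \<in> A"
proof -
  let ?s = "pathstart (\<gamma> x)" and ?t = "pathfinish (\<gamma> x)"
  have esX: "set es \<subseteq> X" using spath_facts(3)[OF sp] .
  have vsI: "set vs \<subseteq> I" using sp ends(2)[OF x(1)]
  proof (induction rule: spath.induct)
    case (step u es vs e w)
    then have "w = p e \<or> w = q e" by (auto simp: doubleton_eq_iff)
    then show ?case using step ends by auto
  qed simp
  obtain A where A: "arc_between A ?s ?t" "A \<subseteq> (\<Union>i\<in>set vs. B i) \<union> (\<Union>z\<in>set es. path_image (\<gamma> z))"
    "\<forall>z\<in>set es. path_image (\<gamma> z) \<subseteq> A"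
    using spath_arc[OF sp vsI ends_in(1)[OF x(1)] ends_in(2)[OF x(1)]] by (elim exE conjE)
  have st: "?s \<noteq> ?t" using arc_distinct_ends[OF arcs[OF x(1)]] by simp
  then obtain g where g: "arc g" "path_image g = A" "pathstart g = ?s" "pathfinish g = ?t"
    using A(1) unfolding arc_between_def by blast
  have int: "path_image (\<gamma> x) \<inter> A \<subseteq> {?s, ?t}"
  proof
    fix z assume z: "z \<in> path_image (\<gamma> x) \<inter> A"
    then consider i where "i \<in> set vs" "z \<in> B i" | y where "y \<in> set es" "z \<in> path_image (\<gamma> y)" using A(2) by blast
    then show "z \<in> {?s, ?t}"
    proof cases
      case 1
      then show ?thesis using arc_blob[OF x(1), of i] vsI z by blast
    next
      case 2
      then have "y \<in> X" "x \<noteq> y" using x esX by auto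
      then show ?thesis using arc_arc_end[OF x(1), of y z] z 2 by (metis IntD1 insertCI)
    qed
  qed
  define c where "c = \<gamma> x +++ reversepath g"
  have c: "simple_path c"
    unfolding c_def
    by (rule simple_path_join_loop) (use g arcs[OF x(1)] int in \<open>auto simp: arc_reversepath\<close>)
  have im: "path_image c = path_image (\<gamma> x) \<union> A" unfolding c_def using g by (simp add: path_image_join)
  have "connected A" using g by (metis arc_imp_path connected_path_image)
  moreover have "A \<subseteq> pts (set es)" unfolding pts_def using A(2) vsI by blast
  moreover have "pathfinish c = pathstart c" unfolding c_def using g by simp
  moreover have "?s \<in> A" "?t \<in> A" using arc_between_ends[OF A(1)] by auto
  ultimately show thesis using that[OF c _ im] A(3) by blast
qed

text \<open>Without \<open>x\<close> the graph meets the curve exactly in the connected set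
  \<open>A\<close>. So two points separated by neither of them are not separated by their union,
  which is the whole graph.\<close>

lemma same_side_connected:
  assumes x: "x \<in> X" "x \<notin> set es" and es: "set es \<subseteq> X"
    and c: "path c" "path_image c = path_image (\<gamma> x) \<union> A"
    and A: "connected A" "A \<subseteq> pts (set es)" "pathstart (\<gamma> x) \<in> A" "pathfinish (\<gamma> x) \<in> A"
    and uv: "connected_component (- pts (X - {x})) u v" "connected_component (- path_image c) u v"
  shows "connected_component (- pts X) u v"
proof -
  have sub: "pts (set es) \<subseteq> pts (X - {x})" using x es by (intro pts_mono) auto
  have "path_image (\<gamma> x) \<inter> pts (X - {x}) \<subseteq> {pathstart (\<gamma> x), pathfinish (\<gamma> x)}"
  proof
    fix z assume z: "z \<in> path_image (\<gamma> x) \<inter> pts (X - {x})"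
    then have "z \<notin> inner x" using inner_disjoint[OF x(1), of z "X - {x}"] by auto
    then show "z \<in> {pathstart (\<gamma> x), pathfinish (\<gamma> x)}" using z by (auto simp: inner_def)
  qed
  then have "pts (X - {x}) \<inter> path_image c = A" using A sub c(2) by blast
  moreover have "closed (path_image c)" using c(1) by (simp add: closed_path_image)
  ultimately have "connected_component (- (pts (X - {x}) \<union> path_image c)) u v"
    using A(1) compact_pts[of "X - {x}"] uv by (intro Janiszewski) auto
  moreover have "pts (X - {x}) \<union> path_image c = pts X"
  proof -
    have "A \<subseteq> pts (X - {x})" using A(2) sub by (rule subset_trans)
    moreover have "pts X = pts (X - {x}) \<union> path_image (\<gamma> x)" using x(1) pts_insert[of x "X - {x}"] by (simp add: insert_absorb)
    ultimately show ?thesis using c(2) by blast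
  qed
  ultimately show ?thesis by simp
qed

section \<open>The faces on the two sides of an edge\<close>

lemma face_facts:
  assumes "F \<in> components (- pts X)"
  shows "open F" "connected F" "F \<noteq> {}" "F \<subseteq> - pts X"
proof -
  have "open (- pts X)" using compact_pts[of X] by (simp add: compact_imp_closed open_Compl)
  then show "open F" using assms by (rule open_components)
  show "connected F" "F \<noteq> {}" "F \<subseteq> - pts X"
    using in_components_connected[OF assms] in_components_nonempty[OF assms] in_components_subset[OF assms] by auto
qed

lemma face_unique:
  assumes "F \<in> components (- pts X)" "F' \<in> components (- pts X)" "u \<in> F" "v \<in> F'" "connected_component (- pts X) u v"
  shows "F = F'"
proof -
  obtain T where T: "connected T" "T \<subseteq> - pts X" "u \<in> T" "v \<in> T" using assms(5) unfolding connected_component_def by blast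
  have "T \<subseteq> F" using components_maximal[OF assms(1) T(1,2)] T assms(3) by blast
  then show ?thesis using components_nonoverlap[OF assms(1,2)] T assms(4) by blast
qed

lemma point_face:
  assumes "u \<notin> pts X"
  obtains F where "F \<in> components (- pts X)" "u \<in> F"
  using assms by (metis ComplI UnionE Union_components)

lemma nbI:
  assumes "x \<in> X" "z \<in> inner x" "connected_component (- pts (X - {x})) u z" "u \<in> F" "F \<in> components (- pts X)"
  shows "F \<in> nb x"
  unfolding nb_def using assms by blast

lemma nb_connected:
  assumes x: "x \<in> X" and F: "F \<in> nb x" "F' \<in> nb x"
  obtains u v where "u \<in> F" "v \<in> F'" "connected_component (- pts (X - {x})) u v" "u \<notin> pts X" "v \<notin> pts X"
proof -
  obtain u z where u: "u \<in> F" "z \<in> inner x" "connected_component (- pts (X - {x})) u z" using F(1) by (auto simp: nb_def)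
  obtain v z' where v: "v \<in> F'" "z' \<in> inner x" "connected_component (- pts (X - {x})) v z'" using F(2) by (auto simp: nb_def)
  have "connected_component (- pts (X - {x})) z z'"
    using inner_connected_component[OF x u(2) v(2), of "X - {x}"] by auto
  then have "connected_component (- pts (X - {x})) u v"
    using u(3) v(3) connected_component_trans connected_component_sym by metis
  moreover have "u \<notin> pts X" "v \<notin> pts X" using u v face_facts(4) F by (auto simp: nb_def)
  ultimately show thesis using that u v by blast
qed

lemma connected_one_side:
  fixes c :: "real \<Rightarrow> complex"
  assumes c: "simple_path c" "pathfinish c = pathstart c" and T: "connected T" "T \<inter> path_image c = {}"
  shows "T \<subseteq> inside (path_image c) \<or> T \<subseteq> outside (path_image c)"
proof -
  have jo: "open (inside (path_image c))" "open (outside (path_image c))"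
    using Jordan_inside_outside[OF c] by auto
  have dj: "inside (path_image c) \<inter> outside (path_image c) = {}" by (rule inside_Int_outside)
  have cov: "T \<subseteq> inside (path_image c) \<union> outside (path_image c)" using T(2) inside_Un_outside by blast
  have "inside (path_image c) \<inter> outside (path_image c) \<inter> T = {}" using dj by simp
  then have "inside (path_image c) \<inter> T = {} \<or> outside (path_image c) \<inter> T = {}"
    using connectedD[OF T(1) jo _ cov] by simp
  then show ?thesis using cov by blast
qed

text \<open>By the Jordan curve theorem an interior point of \<open>x\<close> is a limit of points
  on either side of the curve; close to that point nothing of the graph except \<open>x\<close>
  interferes.\<close>

lemma curve_both_sides:
  assumes x: "x \<in> X" and c: "simple_path c" "pathfinish c = pathstart c" "path_image (\<gamma> x) \<subseteq> path_image c"
    "path_image c \<subseteq> pts X"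
  obtains F F' where "F \<in> nb x" "F' \<in> nb x" "F \<subseteq> inside (path_image c)" "F' \<subseteq> outside (path_image c)"
proof -
  obtain z where z: "z \<in> inner x" using inner_nonempty_connected(1)[OF x] by blast
  obtain r where r: "0 < r" "\<And>u. u \<in> ball z r \<Longrightarrow> connected_component (- pts (X - {x})) u z"
    using nearby[OF x z] by metis
  have zc: "z \<in> path_image c" using z c(3) by (auto simp: inner_def)
  have side: "\<exists>F\<in>nb x. F \<subseteq> S" if S: "S = inside (path_image c) \<or> S = outside (path_image c)" for S
  proof -
    have "frontier S = path_image c"
      using S Jordan_inside_outside[OF c(1,2)] by auto
    then have "z \<in> closure S" using zc by (auto simp: frontier_def)
    then obtain u where u: "u \<in> S" "dist u z < r" using r(1) by (auto simp: closure_approachable)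
    have "u \<in> ball z r" using u(2) by (simp add: dist_commute)
    then have cu: "connected_component (- pts (X - {x})) u z" by (rule r(2))
    then have "u \<notin> pts (X - {x})" using connected_component_in by blast
    moreover have "u \<notin> path_image c" using u(1) S inside_no_overlap outside_no_overlap by blast
    ultimately have "u \<notin> pts X" using c(3) x pts_insert[of x "X - {x}"] by (auto simp: insert_absorb)
    then obtain F where F: "F \<in> components (- pts X)" "u \<in> F" using point_face by metis
    have "F \<inter> path_image c = {}" using face_facts(4)[OF F(1)] c(4) by blast
    then have "F \<subseteq> inside (path_image c) \<or> F \<subseteq> outside (path_image c)"
      by (rule connected_one_side[OF c(1,2) face_facts(2)[OF F(1)]])
    then have "F \<subseteq> S" using S F(2) u(1) inside_Int_outside[of "path_image c"] by blast
    then show ?thesis using nbI[OF x z cu F(2,1)] by blast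
  qed
  show thesis using side[of "inside (path_image c)"] side[of "outside (path_image c)"] that by blast
qed

text \<open>An edge on a cycle has one face on each side of a Jordan curve, and a bridge separates
  nothing. In the case \<open>nb x = {}\<close> equal ends make the edge a loop of the dual, as for
  a bridge.\<close>

lemma nb_pair:
  assumes x: "x \<in> X"
  shows "\<exists>F F'. (nb x = {F, F'} \<and> (linked p q (X - {x}) (p x) (q x) \<or> F = F')) \<or> (nb x = {} \<and> F = F')"
proof (cases "linked p q (X - {x}) (p x) (q x)")
  case True
  obtain es vs where sp: "spath p q (X - {x}) (q x) (p x) es vs"
    using linked_imp_spath[OF _ True] fin by auto
  have es: "set es \<subseteq> X - {x}" using spath_facts(3)[OF sp] .
  have sp': "spath p q X (q x) (p x) es vs" using sp
    by (induction rule: spath.induct) (auto intro: spath.intros)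
  have xes: "x \<notin> set es" using es by blast
  obtain A c where c: "simple_path c" "pathfinish c = pathstart c" "path_image c = path_image (\<gamma> x) \<union> A"
    and A: "connected A" "A \<subseteq> pts (set es)" "pathstart (\<gamma> x) \<in> A" "pathfinish (\<gamma> x) \<in> A"
    using cycle_curve[OF x xes sp'] by metis
  have cX: "path_image c \<subseteq> pts X"
  proof -
    have "A \<subseteq> pts X" using A(2) pts_mono[of "set es" X] es by blast
    moreover have "path_image (\<gamma> x) \<subseteq> pts X" using x by (auto simp: pts_def)
    ultimately show ?thesis using c(3) by blast
  qed
  obtain F F' where F: "F \<in> nb x" "F' \<in> nb x" "F \<subseteq> inside (path_image c)" "F' \<subseteq> outside (path_image c)"
    using curve_both_sides[OF x c(1,2) _ cX] c(3) by blast
  have same: "G = G'" if G: "G \<in> nb x" "G' \<in> nb x" "G \<subseteq> S" "G' \<subseteq> S"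
    and S: "connected S" "S \<subseteq> - path_image c" for G G' S
  proof -
    obtain u v where uv: "u \<in> G" "v \<in> G'" "connected_component (- pts (X - {x})) u v"
      using nb_connected[OF x G(1,2)] by metis
    have "connected_component (- path_image c) u v" unfolding connected_component_def
      using S uv G by (intro exI[of _ S]) auto
    then have "connected_component (- pts X) u v"
      using same_side_connected[OF x xes _ simple_path_imp_path[OF c(1)] c(3) A uv(3)] es by blast
    then show ?thesis using face_unique[of G G' u v] uv G by (auto simp: nb_def)
  qed
  have io: "connected (inside (path_image c))" "connected (outside (path_image c))"
    using Jordan_inside_outside[OF c(1,2)] by auto
  have un: "inside (path_image c) \<union> outside (path_image c) = - path_image c" by (rule inside_Un_outside)
  have "G = F \<or> G = F'" if G: "G \<in> nb x" for G
  proof -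
    have GC: "connected G" "G \<noteq> {}" "G \<subseteq> - path_image c" using G cX face_facts[of G] by (auto simp: nb_def)
    have "G \<subseteq> inside (path_image c) \<or> G \<subseteq> outside (path_image c)"
      using connected_one_side[OF c(1,2) GC(1)] GC(3) by blast
    moreover have "inside (path_image c) \<subseteq> - path_image c" "outside (path_image c) \<subseteq> - path_image c" using un by blast+
    ultimately show ?thesis using same[OF G F(1) _ F(3) io(1)] same[OF G F(2) _ F(4) io(2)] by blast
  qed
  then have "nb x = {F, F'}" using F by blast
  then show ?thesis using True by blast
next
  case False
  have "F = F'" if F: "F \<in> nb x" "F' \<in> nb x" for F F'
  proof -
    obtain u v where uv: "u \<in> F" "v \<in> F'" "connected_component (- pts (X - {x})) u v" "u \<notin> pts X" "v \<notin> pts X"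
      using nb_connected[OF x F] by metis
    have "u \<notin> path_image (\<gamma> x)" "v \<notin> path_image (\<gamma> x)" using uv x by (auto simp: pts_def)
    then have "connected_component (- pts (insert x (X - {x}))) u v"
      using bridge_nonseparating[of "X - {x}" x u v] x False uv(3) by blast
    then have "connected_component (- pts X) u v" using x by (simp add: insert_absorb)
    then show ?thesis using face_unique[of F F' u v] uv F by (auto simp: nb_def)
  qed
  then have "nb x = {} \<or> (\<exists>F. nb x = {F})" by blast
  then show ?thesis by auto
qed

section \<open>The dual graph on the faces\<close>

definition dual_ends :: "'x \<Rightarrow> complex set \<times> complex set" where
  "dual_ends x = (SOME (F, F'). (nb x = {F, F'} \<and> (linked p q (X - {x}) (p x) (q x) \<or> F = F')) \<or> (nb x = {} \<and> F = F'))"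

definition da :: "'x \<Rightarrow> complex set" where "da x = fst (dual_ends x)"
definition db :: "'x \<Rightarrow> complex set" where "db x = snd (dual_ends x)"

lemma dual_ends:
  assumes "x \<in> X"
  shows "(nb x = {da x, db x} \<and> (linked p q (X - {x}) (p x) (q x) \<or> da x = db x)) \<or> (nb x = {} \<and> da x = db x)"
proof -
  obtain F F' where "(nb x = {F, F'} \<and> (linked p q (X - {x}) (p x) (q x) \<or> F = F')) \<or> (nb x = {} \<and> F = F')"
    using nb_pair[OF assms] by (elim exE)
  then have "case (F, F') of (F, F') \<Rightarrow>
      (nb x = {F, F'} \<and> (linked p q (X - {x}) (p x) (q x) \<or> F = F')) \<or> (nb x = {} \<and> F = F')" by simp
  from someI[of "\<lambda>(F, F'). (nb x = {F, F'} \<and> (linked p q (X - {x}) (p x) (q x) \<or> F = F')) \<or> (nb x = {} \<and> F = F')", OF this]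
  show ?thesis unfolding da_def db_def dual_ends_def by (simp add: case_prod_beta)
qed

text \<open>The faces inside the Jordan curve form the shore. Edges of the cycle have faces on both
  sides of the curve; the faces at any other edge are on one side, as they can be connected across
  that edge without meeting the curve.\<close>

lemma cycle_is_dual_cut:
  assumes x: "x \<in> X" "x \<notin> set es" and sp: "spath p q X (q x) (p x) es vs"
  obtains Y where "insert x (set es) = cut da db X Y"
proof -
  have es: "set es \<subseteq> X" using spath_facts(3)[OF sp] .
  obtain A c where c: "simple_path c" "pathfinish c = pathstart c" "path_image c = path_image (\<gamma> x) \<union> A"
    and A: "A \<subseteq> pts (set es)" "\<And>z. z \<in> set es \<Longrightarrow> path_image (\<gamma> z) \<subseteq> A"
    using cycle_curve[OF x sp] by metis
  let ?C = "insert x (set es)"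
  have cC: "path_image c \<subseteq> pts ?C" using A(1) c(3) by (auto simp: pts_def)
  have CX: "?C \<subseteq> X" using es x by blast
  have cX: "path_image c \<subseteq> pts X" using cC pts_mono[OF CX] by (rule subset_trans)
  have sub: "path_image (\<gamma> y) \<subseteq> path_image c" if "y \<in> ?C" for y using that A(2) c(3) by blast
  have dj: "inside (path_image c) \<inter> outside (path_image c) = {}" by (rule inside_Int_outside)
  define Y where "Y = {F. F \<subseteq> inside (path_image c)}"
  have "y \<in> cut da db X Y \<longleftrightarrow> y \<in> ?C" if y: "y \<in> X" for y
  proof (cases "y \<in> ?C")
    case True
    obtain F F' where F: "F \<in> nb y" "F' \<in> nb y" "F \<subseteq> inside (path_image c)" "F' \<subseteq> outside (path_image c)"
      using curve_both_sides[OF y c(1,2) sub[OF True] cX] by metis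
    have "F \<in> Y" using F by (simp add: Y_def)
    moreover have "F' \<noteq> {}" using F(2) face_facts(3)[of F'] by (simp add: nb_def)
    then have "F' \<notin> Y" using F(4) dj unfolding Y_def by blast
    moreover have "nb y = {da y, db y}" using dual_ends[OF y] F by auto
    ultimately show ?thesis using F y True by (auto simp: cut_def)
  next
    case False
    have "F \<in> Y" if F: "F \<in> nb y" "F' \<in> nb y" "F' \<in> Y" for F F'
    proof -
      obtain u v where uv: "u \<in> F" "v \<in> F'" "connected_component (- pts (X - {y})) u v"
        using nb_connected[OF y F(1,2)] by metis
      have "pts ?C \<subseteq> pts (X - {y})" using False CX by (intro pts_mono) auto
      then have cn: "connected_component (- path_image c) u v"
        using connected_component_of_subset[OF uv(3)] cC by blast
      have vin: "v \<in> inside (path_image c)" using uv F(3) by (auto simp: Y_def)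
      have FF: "F \<in> components (- pts X)" using F(1) by (simp add: nb_def)
      have "w \<in> inside (path_image c)" if w: "w \<in> F" for w
      proof -
        have "connected_component (- pts X) w u" unfolding connected_component_def
          using face_facts(2,4)[OF FF] w uv(1) by (intro exI[of _ F]) auto
        then have "connected_component (- path_image c) w u"
          using connected_component_of_subset cX by (metis Compl_subset_Compl_iff)
        then have "connected_component (- path_image c) w v" using cn connected_component_trans by metis
        then obtain T where T: "connected T" "T \<subseteq> - path_image c" "w \<in> T" "v \<in> T" unfolding connected_component_def by blast
        have "T \<subseteq> inside (path_image c) \<or> T \<subseteq> outside (path_image c)"
          using connected_one_side[OF c(1,2) T(1)] T(2) by blast
        then show ?thesis using T(3,4) vin dj by blast
      qed
      then show ?thesis by (auto simp: Y_def)
    qed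
    note nbY = this
    have "da y \<in> Y \<longleftrightarrow> db y \<in> Y"
    proof (cases "nb y = {da y, db y}")
      case True
      then have "da y \<in> nb y" "db y \<in> nb y" by auto
      then show ?thesis using nbY by blast
    next
      case False
      then have "da y = db y" using dual_ends[OF y] by blast
      then show ?thesis by simp
    qed
    then show ?thesis using False by (auto simp: cut_def)
  qed
  then have "?C = cut da db X Y" using CX by (auto simp: cut_def)
  then show thesis using that by blast
qed

text \<open>The faces in \<open>Y\<close> are separated from the other faces by the edges of the cut of \<open>Y\<close> alone, while an edge
  that lies on no cycle of the cut separates nothing.\<close>

lemma dual_cut_edge_on_cycle:
  assumes x: "x \<in> cut da db X Y"
  shows "linked p q (cut da db X Y - {x}) (p x) (q x)"
proof (rule ccontr)
  define C where "C = cut da db X Y"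
  assume nl: "\<not> linked p q (cut da db X Y - {x}) (p x) (q x)"
  have CX: "C \<subseteq> X" and xX: "x \<in> X" and xC: "x \<in> C" using x by (auto simp: C_def cut_def)
  have ne: "da x \<noteq> db x" using x by (auto simp: cut_def)
  then have nbx: "nb x = {da x, db x}" using dual_ends[OF xX] by auto
  have "da x \<in> Y \<longleftrightarrow> db x \<notin> Y" using x by (auto simp: cut_def)
  then obtain F F' where F: "F \<in> nb x" "F' \<in> nb x" "F \<in> Y" "F' \<notin> Y" using nbx by blast
  obtain u v where uv: "u \<in> F" "v \<in> F'" "connected_component (- pts (X - {x})) u v" "u \<notin> pts X" "v \<notin> pts X"
    using nb_connected[OF xX F(1,2)] by metis
  have "u \<notin> path_image (\<gamma> x)" "v \<notin> path_image (\<gamma> x)" using uv xX by (auto simp: pts_def)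
  moreover have "connected_component (- pts (C - {x})) u v"
    using connected_component_pts_mono[OF uv(3)] CX by blast
  ultimately have "connected_component (- pts (insert x (C - {x}))) u v"
    using bridge_nonseparating[of "C - {x}" x u v] xX CX nl unfolding C_def by blast
  then have "connected_component (- pts C) u v" using xC by (simp add: insert_absorb)
  then obtain T where T: "connected T" "T \<subseteq> - pts C" "u \<in> T" "v \<in> T" unfolding connected_component_def by blast
  \<comment> \<open>The faces of one class together with the interiors of the edges outside the cut
    that border them. Both such sets are open, because the faces at an uncut edge are in the same
    class, and they would disconnect \<open>T\<close>.\<close>
  define Q where "Q P = (\<Union>{F \<in> components (- pts X). P F}) \<union> (\<Union>y\<in>{y \<in> X - C. P (da y)}. inner y)" for P
  have opn: "open (Q P)" if P: "P = (\<lambda>F. F \<in> Y) \<or> P = (\<lambda>F. F \<notin> Y)" for P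
    unfolding open_contains_ball
  proof
    fix w assume "w \<in> Q P"
    then consider G where "G \<in> components (- pts X)" "P G" "w \<in> G" | y where "y \<in> X" "y \<notin> C" "P (da y)" "w \<in> inner y"
      by (auto simp: Q_def)
    then show "\<exists>r>0. ball w r \<subseteq> Q P"
    proof cases
      case 1
      then obtain r where "r > 0" "ball w r \<subseteq> G" using face_facts(1) openE by blast
      then show ?thesis using 1 unfolding Q_def by blast
    next
      case 2
      obtain r where r: "0 < r" "\<And>u. u \<in> ball w r \<Longrightarrow> connected_component (- pts (X - {y})) u w"
        using nearby[OF 2(1,4)] by metis
      have "u' \<in> Q P" if u': "u' \<in> ball w r" for u'
      proof -
        have cu: "connected_component (- pts (X - {y})) u' w" using r(2)[OF u'] .
        then have nu: "u' \<notin> pts (X - {y})" using connected_component_in by blast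
        show ?thesis
        proof (cases "u' \<in> path_image (\<gamma> y)")
          case True
          then have "u' \<in> inner y" using path_image_minus_pts[OF 2(1) True] nu by (auto simp: pts_def)
          then show ?thesis using 2 unfolding Q_def by blast
        next
          case False
          then have "u' \<notin> pts X" using nu pts_insert[of y "X - {y}"] 2(1) by (auto simp: insert_absorb)
          then obtain G where G: "G \<in> components (- pts X)" "u' \<in> G" using point_face by metis
          have "G \<in> nb y" using nbI[OF 2(1,4) cu G(2,1)] .
          then have "G = da y \<or> G = db y" using dual_ends[OF 2(1)] by auto
          moreover have "da y \<in> Y \<longleftrightarrow> db y \<in> Y" using 2(1,2) by (auto simp: C_def cut_def)
          ultimately have "P G" using P 2(3) by auto
          then show ?thesis using G unfolding Q_def by blast
        qed
      qed
      then show ?thesis using r(1) by blast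
    qed
  qed
  let ?P = "\<lambda>F. F \<in> Y" and ?P' = "\<lambda>F. F \<notin> Y"
  have cover: "T \<subseteq> Q ?P \<union> Q ?P'"
  proof
    fix w assume "w \<in> T"
    then have w: "w \<notin> pts C" using T by blast
    show "w \<in> Q ?P \<union> Q ?P'"
    proof (cases "w \<in> pts X")
      case True
      then obtain y where y: "y \<in> X" "w \<in> path_image (\<gamma> y)" using w by (auto simp: pts_def)
      then have "y \<notin> C" "w \<in> inner y" using w path_image_minus_pts[OF y] by (auto simp: pts_def)
      then show ?thesis using y(1) unfolding Q_def by blast
    next
      case False
      then obtain G where "G \<in> components (- pts X)" "w \<in> G" using point_face by metis
      then show ?thesis unfolding Q_def by blast
    qed
  qed
  have disj: "Q ?P \<inter> Q ?P' = {}"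
  proof (rule ccontr)
    assume "Q ?P \<inter> Q ?P' \<noteq> {}"
    then obtain w where w: "w \<in> Q ?P" "w \<in> Q ?P'" by blast
    have innerX: "y \<in> X \<Longrightarrow> w \<in> inner y \<Longrightarrow> w \<in> pts X" for y by (auto simp: inner_def pts_def)
    consider G where "G \<in> components (- pts X)" "G \<in> Y" "w \<in> G" | y where "y \<in> X" "da y \<in> Y" "w \<in> inner y"
      using w(1) by (auto simp: Q_def)
    then show False
    proof cases
      case 1
      then have "w \<notin> pts X" using face_facts(4) by blast
      then obtain G' where "G' \<in> components (- pts X)" "G' \<notin> Y" "w \<in> G'" using w(2) innerX unfolding Q_def by blast
      then show False using 1 components_nonoverlap by blast
    next
      case 2
      then have wX: "w \<in> pts X" using innerX by blast
      then obtain y' where y': "y' \<in> X" "da y' \<notin> Y" "w \<in> inner y'" using w(2) face_facts(4) unfolding Q_def by blast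
      then have "y \<noteq> y'" using 2 by auto
      then show False using inner_disjoint[OF 2(1,3), of "{y'}"] y' by (auto simp: pts_def inner_def)
    qed
  qed
  have comps: "F \<in> components (- pts X)" "F' \<in> components (- pts X)" using F by (auto simp: nb_def)
  have "u \<in> Q ?P" "v \<in> Q ?P'" using comps F uv unfolding Q_def by blast+
  then show False
    using connectedD[OF T(1) opn[of ?P] opn[of ?P']] cover disj T by blast
qed

text \<open>Simple cycles are both even sets and dual cuts, and both classes are closed under
  symmetric difference. So it suffices to find a cycle through a given edge inside any dual cut or
  even set and to remove it.\<close>

theorem dual_pair_faces: "dual_pair X p q da db"
  unfolding dual_pair_def
proof (intro conjI allI impI)
  have cyc: "\<exists>C1 Y1. x \<in> C1 \<and> C1 \<subseteq> C \<and> C1 = cut da db X Y1 \<and> bdry p q C1 = {}"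
    if C: "C \<subseteq> X" "x \<in> C" "linked p q (C - {x}) (p x) (q x)" for C x
  proof -
    have "finite (C - {x})" using C(1) fin(2) by (auto intro: finite_subset)
    then obtain es vs where sp: "spath p q (C - {x}) (q x) (p x) es vs" using linked_imp_spath[OF _ C(3)] by auto
    have es: "set es \<subseteq> C - {x}" using spath_facts(3)[OF sp] .
    have "spath p q X (q x) (p x) es vs" using sp
      by (induction rule: spath.induct) (use C(1) in \<open>auto intro: spath.intros\<close>)
    then obtain Y1 where Y1: "insert x (set es) = cut da db X Y1" using cycle_is_dual_cut[of x es vs] C es by blast
    have "x \<notin> set es" using es by blast
    then have "bdry p q (insert x (set es)) = sym_diff (sym_diff {p x} {q x}) (sym_diff {p x} {q x})"
      using bdry_insert[of "set es" x p q] spath_bdry[OF sp] by simp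
    then have "bdry p q (insert x (set es)) = {}" by simp
    then show ?thesis using Y1 es C(2) by (intro exI[of _ "insert x (set es)"] exI[of _ Y1]) auto
  qed
  have fc: "finite C" if "C \<subseteq> X" for C using that fin(2) by (rule finite_subset)
  show "bdry p q (cut da db X Y) = {}" for Y
  proof (induction "card (cut da db X Y)" arbitrary: Y rule: less_induct)
    case (less Y)
    show ?case
    proof (cases "cut da db X Y = {}")
      case False
      let ?C = "cut da db X Y"
      obtain x where x: "x \<in> ?C" using False by blast
      have CX: "?C \<subseteq> X" by (rule cut_subset)
      obtain C1 Y1 where C1: "x \<in> C1" "C1 \<subseteq> ?C" "C1 = cut da db X Y1" "bdry p q C1 = {}"
        using cyc[OF CX x dual_cut_edge_on_cycle[OF x]] by (elim exE conjE)
      have d: "cut da db X (sym_diff Y Y1) = ?C - C1" using C1(2,3) cut_sym_diff[of da db X Y Y1] by blast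
      have "card (?C - C1) < card ?C" using C1 x fc[OF CX] by (intro psubset_card_mono) auto
      then have "bdry p q (?C - C1) = {}" using less[of "sym_diff Y Y1"] d by simp
      then show ?thesis using bdry_Diff[OF fc[OF CX] C1(2), of p q] C1(4) by simp
    qed simp
  qed
  show "\<exists>Y. Z = cut da db X Y" if "Z \<subseteq> X" "bdry p q Z = {}" for Z
    using that
  proof (induction "card Z" arbitrary: Z rule: less_induct)
    case (less Z)
    note Z = less.prems
    show ?case
    proof (cases "Z = {}")
      case True
      then show ?thesis by (intro exI[of _ "{}"]) simp
    next
      case False
      then obtain x where x: "x \<in> Z" by blast
      have "bdry p q (Z - {x}) = sym_diff {p x} {q x}"
        using bdry_Diff[OF fc[OF Z(1)], of "{x}" p q] x Z(2) bdry_single[of p q x] by simp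
      then have "linked p q (Z - {x}) (p x) (q x)" unfolding linked_def by blast
      from cyc[OF Z(1) x this]
      obtain C1 Y1 where C1: "x \<in> C1" "C1 \<subseteq> Z" "C1 = cut da db X Y1" "bdry p q C1 = {}"
        by (elim exE conjE)
      have "card (Z - C1) < card Z" using C1 x fc[OF Z(1)] by (intro psubset_card_mono) auto
      moreover have "bdry p q (Z - C1) = {}" using bdry_Diff[OF fc[OF Z(1)] C1(2), of p q] C1(4) Z(2) by simp
      moreover have "Z - C1 \<subseteq> X" using Z(1) by blast
      ultimately have "\<exists>Y2. Z - C1 = cut da db X Y2" using less.hyps[of "Z - C1"] by simp
      then obtain Y2 where "Z - C1 = cut da db X Y2" ..
      then have "Z = cut da db X (sym_diff Y2 Y1)" using C1(2,3) cut_sym_diff[of da db X Y2 Y1] by blast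
      then show ?thesis by blast
    qed
  qed
qed

end

section \<open>Hubs inside faces\<close>

text \<open>Provides the hub of a face: faces are open, whereas fat vertices have to be
  compact.\<close>

lemma compact_path_connected_hull:
  fixes S :: "'a::real_normed_vector set"
  assumes "path_connected S" "finite P" "P \<subseteq> S"
  obtains Q where "P \<subseteq> Q" "Q \<subseteq> S" "compact Q" "path_connected Q"
proof -
  have "\<exists>Q. P \<subseteq> Q \<and> Q \<subseteq> S \<and> compact Q \<and> path_connected Q" using assms(2,3)
  proof (induction P rule: finite_induct)
    case empty
    then show ?case by (intro exI[of _ "{}"]) (simp add: path_connected_empty)
  next
    case (insert x P)
    then obtain Q where Q: "P \<subseteq> Q" "Q \<subseteq> S" "compact Q" "path_connected Q" by blast
    show ?case
    proof (cases "Q = {}")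
      case True
      then show ?thesis using Q insert.prems by (intro exI[of _ "{x}"]) auto
    next
      case False
      then obtain y where y: "y \<in> Q" by blast
      then obtain g where g: "path g" "path_image g \<subseteq> S" "pathstart g = x" "pathfinish g = y"
        using assms(1) Q(2) insert.prems unfolding path_connected_def by blast
      have "y \<in> Q \<inter> path_image g" using y g(4) pathfinish_in_path_image by blast
      then have "path_connected (Q \<union> path_image g)"
        using Q(4) g(1) by (intro path_connected_Un) (auto simp: path_connected_path_image)
      moreover have "compact (Q \<union> path_image g)" using Q(3) g(1) by (intro compact_Un compact_path_image)
      moreover have "x \<in> path_image g" using g(3) pathstart_in_path_image by blast
      ultimately show ?thesis using Q g(2) by (intro exI[of _ "Q \<union> path_image g"]) auto
    qed
  qed
  then show thesis using that by blast
qed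

text \<open>Stop at the first point in \<open>B\<close> and start at the last point in
  \<open>A\<close> before it.\<close>

lemma arc_first_hit:
  fixes h :: "real \<Rightarrow> complex"
  assumes h: "arc h" and A: "closed A" "pathstart h \<in> A" and B: "closed B" "pathfinish h \<in> B" and AB: "A \<inter> B = {}"
  obtains k where "arc k" "path_image k \<subseteq> path_image h" "path_image k \<inter> A = {pathstart k}" "path_image k \<inter> B = {pathfinish k}"
proof -
  have cont: "continuous_on {0..1} h" using h by (simp add: arc_def path_def)
  define B' where "B' = {0..1} \<inter> h -` B"
  have clB: "closed B'" unfolding B'_def by (rule continuous_closed_preimage[OF cont _ B(1)]) simp
  have "1 \<in> B'" using B(2) by (auto simp: B'_def pathfinish_def)
  then have neB: "B' \<noteq> {}" by blast
  have B'b: "bdd_below B'" by (auto simp: B'_def)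
  have t1: "Inf B' \<in> B'" by (rule closed_contains_Inf[OF neB B'b clB])
  define t1 where "t1 = Inf B'"
  have t1': "0 \<le> t1" "t1 \<le> 1" "h t1 \<in> B" using t1 by (auto simp: B'_def t1_def)
  have t1min: "t1 \<le> t" if "0 \<le> t" "t \<le> 1" "h t \<in> B" for t
    unfolding t1_def using that B'b by (intro cInf_lower) (auto simp: B'_def)
  define A' where "A' = {0..t1} \<inter> h -` A"
  have "continuous_on {0..t1} h" using cont t1' by (rule_tac continuous_on_subset) auto
  then have clA: "closed A'" unfolding A'_def by (rule continuous_closed_preimage[OF _ _ A(1)]) simp
  have "0 \<in> A'" using A(2) t1' by (auto simp: A'_def pathstart_def)
  then have neA: "A' \<noteq> {}" by blast
  have A'b: "bdd_above A'" by (auto simp: A'_def)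
  have t0: "Sup A' \<in> A'" by (rule closed_contains_Sup[OF neA A'b clA])
  define t0 where "t0 = Sup A'"
  have t0': "0 \<le> t0" "t0 \<le> t1" "h t0 \<in> A" using t0 by (auto simp: A'_def t0_def)
  have t0max: "t \<le> t0" if "0 \<le> t" "t \<le> t1" "h t \<in> A" for t
    unfolding t0_def using that A'b by (intro cSup_upper) (auto simp: A'_def)
  have ne: "t0 \<noteq> t1" using t0' t1' AB by auto
  define k where "k = subpath t0 t1 h"
  have im: "path_image k = h ` {t0..t1}" unfolding k_def using t0' t1' by (simp add: path_image_subpath)
  have st: "pathstart k = h t0" "pathfinish k = h t1" unfolding k_def by simp_all
  show thesis
  proof (rule that[of k])
    show "arc k" unfolding k_def using h t0' t1' ne by (intro arc_subpath_arc) auto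
    show "path_image k \<subseteq> path_image h" using im t0' t1' by (auto simp: path_image_def[of h])
    show "path_image k \<inter> A = {pathstart k}"
      unfolding im st using t0' t1' t0max by (auto intro!: arg_cong[of _ _ h] antisym)
    show "path_image k \<inter> B = {pathfinish k}"
      unfolding im st using t0' t1' t1min by (auto intro!: arg_cong[of _ _ h] antisym)
  qed
qed

section \<open>Plane graphs with thickened vertices\<close>

definition edge_arc :: "complex set \<Rightarrow> complex set \<Rightarrow> real \<Rightarrow> complex" where
  "edge_arc V e = (SOME g. arc g \<and> path_image g = e \<and> e \<inter> V = {pathstart g, pathfinish g})"

definition end0 :: "complex set \<Rightarrow> complex set \<Rightarrow> complex" where "end0 V e = pathstart (edge_arc V e)"
definition end1 :: "complex set \<Rightarrow> complex set \<Rightarrow> complex" where "end1 V e = pathfinish (edge_arc V e)"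

lemma edge_arc:
  assumes "plane_graph V E" "e \<in> E"
  shows "arc (edge_arc V e)" "path_image (edge_arc V e) = e" "e \<inter> V = {end0 V e, end1 V e}" "end0 V e \<noteq> end1 V e"
    "end0 V e \<in> V" "end1 V e \<in> V"
proof -
  have "\<exists>g. arc g \<and> path_image g = e \<and> e \<inter> V = {pathstart g, pathfinish g}"
    using assms unfolding plane_graph_def by blast
  from someI_ex[OF this]
  have *: "arc (edge_arc V e) \<and> path_image (edge_arc V e) = e \<and> e \<inter> V = {end0 V e, end1 V e}"
    unfolding edge_arc_def end0_def end1_def .
  then show "arc (edge_arc V e)" "path_image (edge_arc V e) = e" "e \<inter> V = {end0 V e, end1 V e}" by auto
  then show "end0 V e \<in> V" "end1 V e \<in> V" by auto
  show "end0 V e \<noteq> end1 V e" using * arc_distinct_ends unfolding end0_def end1_def by metis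
qed

lemma uniform_near_ends:
  fixes g :: "real \<Rightarrow> complex"
  assumes "path g" "0 < \<epsilon>"
  obtains s where "0 < s" "s < 1/2" "\<And>x. 0 \<le> x \<Longrightarrow> x \<le> s \<Longrightarrow> dist (g x) (g 0) < \<epsilon>"
    "\<And>x. 1 - s \<le> x \<Longrightarrow> x \<le> 1 \<Longrightarrow> dist (g x) (g 1) < \<epsilon>"
proof -
  have "uniformly_continuous_on {0..1} g"
    using assms(1) by (intro compact_uniformly_continuous) (auto simp: path_def)
  then obtain d where d: "0 < d" "\<And>x y. x \<in> {0..1} \<Longrightarrow> y \<in> {0..1} \<Longrightarrow> dist y x < d \<Longrightarrow> dist (g y) (g x) < \<epsilon>"
    using assms(2) unfolding uniformly_continuous_on_def by metis
  define s where "s = min (d / 2) (1 / 3)"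
  show thesis
  proof (rule that[of s])
    show "0 < s" "s < 1/2" using d(1) by (auto simp: s_def)
    fix x :: real
    show "dist (g x) (g 0) < \<epsilon>" if "0 \<le> x" "x \<le> s"
      using that d(1) by (intro d(2)) (auto simp: s_def dist_real_def)
    show "dist (g x) (g 1) < \<epsilon>" if "1 - s \<le> x" "x \<le> 1"
      using that d(1) by (intro d(2)) (auto simp: s_def dist_real_def)
  qed
qed

lemma separation_radius:
  fixes V :: "complex set"
  assumes "finite V"
  obtains \<epsilon> where "0 < \<epsilon>" "\<And>u v. u \<in> V \<Longrightarrow> v \<in> V \<Longrightarrow> u \<noteq> v \<Longrightarrow> ball u \<epsilon> \<inter> ball v \<epsilon> = {}"
proof -
  define D where "D = insert 1 ((\<lambda>(u, v). dist u v) ` {(u, v). u \<in> V \<and> v \<in> V \<and> u \<noteq> v})"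
  have "finite {(u, v). u \<in> V \<and> v \<in> V \<and> u \<noteq> v}"
    by (rule finite_subset[of _ "V \<times> V"]) (use assms in auto)
  then have fD: "finite D" unfolding D_def by simp
  have "\<forall>x\<in>D. 0 < x" by (auto simp: D_def)
  moreover have "Min D \<in> D" using fD by (intro Min_in) (auto simp: D_def)
  ultimately have "0 < Min D" by blast
  show thesis
  proof (rule that[of "Min D / 2"])
    show "0 < Min D / 2" using \<open>0 < Min D\<close> by simp
    fix u v assume uv: "u \<in> V" "v \<in> V" "u \<noteq> v"
    then have "Min D \<le> dist u v" using fD by (intro Min_le) (auto simp: D_def)
    then show "ball u (Min D / 2) \<inter> ball v (Min D / 2) = {}" by (intro disjoint_ballI) simp
  qed
qed

text \<open>The graph \<open>(p, q)\<close> on \<open>E\<close> with a new vertex, the hub, for every member of \<open>\<Phi>\<close>, joined to the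
  terminals of that member by spokes.\<close>

definition hub_edges :: "'e set \<Rightarrow> 'f set \<Rightarrow> ('f \<Rightarrow> 'v set) \<Rightarrow> ('e + 'f \<times> 'v) set" where
  "hub_edges E \<Phi> T = Inl ` E \<union> Inr ` (SIGMA F:\<Phi>. T F)"

definition hub_p :: "('e \<Rightarrow> 'v) \<Rightarrow> 'e + 'f \<times> 'v \<Rightarrow> 'v + 'f" where
  "hub_p p x = (case x of Inl e \<Rightarrow> Inl (p e) | Inr (F, v) \<Rightarrow> Inr F)"

definition hub_q :: "('e \<Rightarrow> 'v) \<Rightarrow> 'e + 'f \<times> 'v \<Rightarrow> 'v + 'f" where
  "hub_q q x = (case x of Inl e \<Rightarrow> Inl (q e) | Inr (F, v) \<Rightarrow> Inl v)"

lemma hub_simps [simp]: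
  "hub_p p (Inl e) = Inl (p e)" "hub_p p (Inr (F, v)) = Inr F"
  "hub_q q (Inl e) = Inl (q e)" "hub_q q (Inr (F, v)) = Inl v"
  "Inl e \<in> hub_edges E \<Phi> T \<longleftrightarrow> e \<in> E" "Inr (F, v) \<in> hub_edges E \<Phi> T \<longleftrightarrow> F \<in> \<Phi> \<and> v \<in> T F"
  by (auto simp: hub_p_def hub_q_def hub_edges_def)

text \<open>A terminal need not be reachable from the face by a straight line; the spoke may instead end on an edge
  very close to the terminal. Therefore every vertex is thickened to the union of short initial pieces
  of its edges. The hub of a face is a compact path-connected subset of the face.\<close>

lemma plane_graph_with_spokes:
  assumes pg: "plane_graph V E" and \<Phi>: "finite \<Phi>" "\<Phi> \<subseteq> faces V E" and T: "\<And>F. F \<in> \<Phi> \<Longrightarrow> T F \<subseteq> V \<inter> frontier F"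
  obtains a b where "dual_pair (hub_edges E \<Phi> T) (hub_p (end0 V)) (hub_q (end1 V)) a b"
    "\<And>F v. F \<in> \<Phi> \<Longrightarrow> v \<in> T F \<Longrightarrow>
      linked (hub_p (end0 V)) (hub_q (end1 V)) (hub_edges E \<Phi> T - {Inr (F, v)}) (Inr F) (Inl v) \<Longrightarrow>
      a (Inr (F, v)) \<subseteq> F \<and> b (Inr (F, v)) \<subseteq> (F :: complex set) \<and> a (Inr (F, v)) \<noteq> {} \<and> b (Inr (F, v)) \<noteq> {}"
proof -
  have fV: "finite V" and fE: "finite E" using pg by (auto simp: plane_graph_def)
  have ee: "e \<inter> e' \<subseteq> V" if "e \<in> E" "e' \<in> E" "e \<noteq> e'" for e e' using pg that by (auto simp: plane_graph_def)
  let ?G = "V \<union> \<Union>E"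
  define g where "g = edge_arc V"
  have g: "arc (g e)" "path (g e)" "path_image (g e) = e" "g e 0 = end0 V e" "g e 1 = end1 V e" "inj_on (g e) {0..1}"
    "g e ` {0..1} = e" "continuous_on {0..1} (g e)" if "e \<in> E" for e
    using edge_arc[OF pg that] by (auto simp: g_def arc_def end0_def end1_def pathstart_def pathfinish_def path_image_def path_def)
  have eV: "e \<inter> V = {g e 0, g e 1}" if "e \<in> E" for e using edge_arc(3)[OF pg that] g[OF that] by simp
  have gV: "x = 0 \<or> x = 1" if "e \<in> E" "0 \<le> x" "x \<le> 1" "g e x \<in> V" for e x
  proof -
    have "g e x \<in> e \<inter> V" using that g(7)[OF that(1)] by auto
    then have "g e x = g e 0 \<or> g e x = g e 1" using eV[OF that(1)] by auto
    then show ?thesis using g(6)[OF that(1)] that(2,3) by (auto dest: inj_onD)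
  qed
  have compE: "compact e" if "e \<in> E" for e using g(2,3)[OF that] compact_path_image by metis
  have closedG: "closed ?G" using fV fE compE by (intro closed_Un closed_Union) (auto simp: compact_imp_closed finite_imp_closed)
  obtain \<epsilon> where \<epsilon>: "0 < \<epsilon>" "\<And>u v. u \<in> V \<Longrightarrow> v \<in> V \<Longrightarrow> u \<noteq> v \<Longrightarrow> ball u \<epsilon> \<inter> ball v \<epsilon> = {}"
    using separation_radius[OF fV] by metis
  have "\<exists>s. 0 < s \<and> s < 1/2 \<and> (\<forall>x. 0 \<le> x \<longrightarrow> x \<le> s \<longrightarrow> dist (g e x) (g e 0) < \<epsilon>) \<and>
      (\<forall>x. 1 - s \<le> x \<longrightarrow> x \<le> 1 \<longrightarrow> dist (g e x) (g e 1) < \<epsilon>)" if "e \<in> E" for e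
    using uniform_near_ends[OF g(2)[OF that] \<epsilon>(1)] by metis
  then have "\<forall>e\<in>E. \<exists>s. 0 < s \<and> s < 1/2 \<and> (\<forall>x. 0 \<le> x \<longrightarrow> x \<le> s \<longrightarrow> dist (g e x) (g e 0) < \<epsilon>) \<and>
      (\<forall>x. 1 - s \<le> x \<longrightarrow> x \<le> 1 \<longrightarrow> dist (g e x) (g e 1) < \<epsilon>)" by blast
  from bchoice[OF this] obtain s where s': "\<forall>e\<in>E. 0 < s e \<and> s e < 1/2 \<and>
      (\<forall>x. 0 \<le> x \<longrightarrow> x \<le> s e \<longrightarrow> dist (g e x) (g e 0) < \<epsilon>) \<and>
      (\<forall>x. 1 - s e \<le> x \<longrightarrow> x \<le> 1 \<longrightarrow> dist (g e x) (g e 1) < \<epsilon>)" ..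
  have s: "0 < s e" "s e < 1/2" "0 \<le> x \<Longrightarrow> x \<le> s e \<Longrightarrow> dist (g e x) (g e 0) < \<epsilon>"
    "1 - s e \<le> x \<Longrightarrow> x \<le> 1 \<Longrightarrow> dist (g e x) (g e 1) < \<epsilon>" if "e \<in> E" for e x
    using s' that by blast+
  \<comment> \<open>\<open>near e v\<close> is the piece of \<open>e\<close> absorbed by the vertex
    \<open>v\<close>, a mere point if \<open>v\<close> is not an end of \<open>e\<close>. Its
    counterpart \<open>rest e v\<close> is a closed remainder of \<open>e\<close> that misses
    \<open>v\<close>.\<close>
  define near where "near e v = (if v = g e 0 then g e ` {0..s e} else if v = g e 1 then g e ` {1 - s e..1} else {v})" for e v
  define rest where "rest e v = (if v = g e 0 then g e ` {s e..1} else if v = g e 1 then g e ` {0..1 - s e} else e)" for e v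
  have near_sub: "near e v \<subseteq> insert v e" if "e \<in> E" for e v
    using g(7)[OF that] s(1,2)[OF that] by (auto simp: near_def)
  have near_v: "v \<in> near e v" if "e \<in> E" for e v using s(1)[OF that] by (auto simp: near_def)
  have near_ball: "near e v \<subseteq> ball v \<epsilon>" if "e \<in> E" for e v
    using s[OF that] \<epsilon>(1) by (auto simp: near_def dist_commute)
  have near_compact: "compact (near e v)" if "e \<in> E" for e v
    unfolding near_def using s(1,2)[OF that] g(8)[OF that]
    by (auto intro!: compact_continuous_image intro: continuous_on_subset)
  have near_pc: "path_connected (near e v)" if "e \<in> E" for e v
  proof -
    have "continuous_on {0..s e} (g e)" "continuous_on {1 - s e..1} (g e)"
      using s(1,2)[OF that] by (auto intro: continuous_on_subset[OF g(8)[OF that]])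
    then have "path_connected (g e ` {0..s e})" "path_connected (g e ` {1 - s e..1})"
      by (auto intro: path_connected_continuous_image convex_imp_path_connected)
    then show ?thesis by (simp add: near_def)
  qed
  have rest_compact: "compact (rest e v)" if "e \<in> E" for e v
    unfolding rest_def using s(1,2)[OF that] g(8)[OF that] compE[OF that]
    by (auto intro!: compact_continuous_image intro: continuous_on_subset)
  have rest_v: "v \<notin> rest e v" if "e \<in> E" "v \<in> V" for e v
  proof
    assume "v \<in> rest e v"
    have i: "g e x = g e y \<Longrightarrow> 0 \<le> x \<Longrightarrow> x \<le> 1 \<Longrightarrow> 0 \<le> y \<Longrightarrow> y \<le> 1 \<Longrightarrow> x = y" for x y
      using g(6)[OF that(1)] by (auto dest: inj_onD)
    consider "v = g e 0" "v \<in> g e ` {s e..1}" | "v = g e 1" "v \<in> g e ` {0..1 - s e}" | "v \<in> e" "v \<noteq> g e 0" "v \<noteq> g e 1"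
      using \<open>v \<in> rest e v\<close> by (auto simp: rest_def split: if_splits)
    then show False
    proof cases
      case 1
      then obtain x where "s e \<le> x" "x \<le> 1" "g e 0 = g e x" by auto
      then show False using i[of 0 x] s(1)[OF that(1)] by auto
    next
      case 2
      then obtain x where "0 \<le> x" "x \<le> 1 - s e" "g e 1 = g e x" by auto
      then show False using i[of 1 x] s(1)[OF that(1)] by auto
    next
      case 3
      then show False using eV[OF that(1)] that(2) by auto
    qed
  qed
  have near_rest: "e \<subseteq> near e v \<union> rest e v" if "e \<in> E" for e v
    using g(7)[OF that] s(1,2)[OF that] by (force simp: near_def rest_def)
  define \<beta> where "\<beta> v = insert v (\<Union>e\<in>E. near e v)" for v
  have \<beta>_ball: "\<beta> v \<subseteq> ball v \<epsilon>" for v unfolding \<beta>_def using near_ball \<epsilon>(1) by auto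
  have \<beta>_G: "\<beta> v \<subseteq> ?G" if "v \<in> V" for v unfolding \<beta>_def using near_sub that by blast
  have \<beta>_compact: "compact (\<beta> v)" for v unfolding \<beta>_def
    using fE near_compact by (intro compact_insert compact_UN) auto
  have \<beta>_pc: "path_connected (\<beta> v)" for v
  proof -
    have "path_component (\<beta> v) v z" if z: "z \<in> \<beta> v" for z
    proof (cases "z = v")
      case True
      then show ?thesis by (simp add: path_component_refl_eq \<beta>_def)
    next
      case False
      then obtain e where e: "e \<in> E" "z \<in> near e v" using z by (auto simp: \<beta>_def)
      then have "path_component (near e v) v z"
        using near_pc[OF e(1), of v] near_v[OF e(1), of v] by (simp add: path_connected_component)
      then show ?thesis by (rule path_component_of_subset[rotated]) (use e in \<open>auto simp: \<beta>_def\<close>)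
    qed
    note pc = this
    show ?thesis unfolding path_connected_component
    proof (intro ballI)
      fix x y assume "x \<in> \<beta> v" "y \<in> \<beta> v"
      then show "path_component (\<beta> v) x y" by (rule path_component_trans[OF path_component_sym[OF pc] pc])
    qed
  qed
  \<comment> \<open>All that is not absorbed by \<open>v\<close> forms a closed set missing
    \<open>v\<close>, so close to \<open>v\<close> the graph consists of the fat vertex alone. A
    spoke that stays in this ball can hit the graph only in \<open>\<beta> v\<close>.\<close>
  have "\<exists>\<delta>>0. \<delta> \<le> \<epsilon> \<and> ball v \<delta> \<inter> ?G \<subseteq> \<beta> v" if v: "v \<in> V" for v
  proof -
    define L where "L = (V - {v}) \<union> (\<Union>e\<in>E. rest e v)"
    have "closed L" unfolding L_def using fV fE rest_compact
      by (intro closed_Un closed_UN) (auto simp: finite_imp_closed compact_imp_closed)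
    then have "open (- L)" by (rule open_Compl)
    moreover have "v \<in> - L" using rest_v v by (auto simp: L_def)
    ultimately obtain d where d0: "0 < d" "ball v d \<subseteq> - L" by (rule openE)
    then have d: "0 < d" "ball v d \<inter> L = {}" by blast+
    have "ball v d \<inter> ?G \<subseteq> \<beta> v"
    proof
      fix z assume z: "z \<in> ball v d \<inter> ?G"
      then have nL: "z \<notin> L" using d(2) by blast
      show "z \<in> \<beta> v"
      proof (cases "z \<in> V")
        case True
        then show ?thesis using nL by (auto simp: L_def \<beta>_def)
      next
        case False
        then obtain e where "e \<in> E" "z \<in> e" using z by blast
        then show ?thesis using near_rest[of e v] nL by (auto simp: L_def \<beta>_def)
      qed
    qed
    then show ?thesis using d(1) \<epsilon>(1) by (intro exI[of _ "min d \<epsilon>"]) auto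
  qed
  then obtain \<delta> where \<delta>: "\<And>v. v \<in> V \<Longrightarrow> 0 < \<delta> v" "\<And>v. v \<in> V \<Longrightarrow> \<delta> v \<le> \<epsilon>" "\<And>v. v \<in> V \<Longrightarrow> ball v (\<delta> v) \<inter> ?G \<subseteq> \<beta> v"
    by metis
  have faceC: "F \<in> components (- ?G)" if "F \<in> \<Phi>" for F using \<Phi>(2) that by (auto simp: faces_def)
  have openF: "open F" if "F \<in> \<Phi>" for F using open_components[OF open_Compl[OF closedG] faceC[OF that]] .
  have connF: "connected F" if "F \<in> \<Phi>" for F using in_components_connected[OF faceC[OF that]] .
  have FG: "F \<inter> ?G = {}" if "F \<in> \<Phi>" for F using in_components_subset[OF faceC[OF that]] by blast
  have FF: "F \<inter> F' = {}" if "F \<in> \<Phi>" "F' \<in> \<Phi>" "F \<noteq> F'" for F F'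
    using components_nonoverlap[OF faceC[OF that(1)] faceC[OF that(2)]] that(3) by blast
  have TV: "v \<in> V" if "F \<in> \<Phi>" "v \<in> T F" for F v using T that by blast
  have "\<exists>x. x \<in> F \<and> x \<in> ball v (\<delta> v)" if F: "F \<in> \<Phi>" "v \<in> T F" for F v
  proof -
    have "v \<in> closure F" using T F by (auto simp: frontier_def)
    then show ?thesis using \<delta>(1)[OF TV[OF F]] unfolding closure_approachable by (auto simp: dist_commute)
  qed
  then obtain pt where pt: "\<And>F v. F \<in> \<Phi> \<Longrightarrow> v \<in> T F \<Longrightarrow> pt F v \<in> F" "\<And>F v. F \<in> \<Phi> \<Longrightarrow> v \<in> T F \<Longrightarrow> pt F v \<in> ball v (\<delta> v)"
    by metis
  have fT: "finite (T F)" if "F \<in> \<Phi>" for F using T[OF that] fV by (auto intro: finite_subset)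
  have "\<exists>Q. pt F ` T F \<subseteq> Q \<and> Q \<subseteq> F \<and> compact Q \<and> path_connected Q" if F: "F \<in> \<Phi>" for F
  proof -
    have "path_connected F" using openF[OF F] connF[OF F] connected_open_path_connected by blast
    then show ?thesis using compact_path_connected_hull[of F "pt F ` T F"] fT[OF F] pt(1)[OF F] by (metis finite_imageI image_subsetI)
  qed
  then obtain Q where Q: "\<And>F. F \<in> \<Phi> \<Longrightarrow> pt F ` T F \<subseteq> Q F" "\<And>F. F \<in> \<Phi> \<Longrightarrow> Q F \<subseteq> F"
    "\<And>F. F \<in> \<Phi> \<Longrightarrow> compact (Q F)" "\<And>F. F \<in> \<Phi> \<Longrightarrow> path_connected (Q F)"
    by metis
  \<comment> \<open>Of the segment towards \<open>v\<close> only the portion up to the first point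
    of the graph is kept, beginning at the last point in the hub before it.\<close>
  have ex_spoke: "\<exists>k. arc k \<and> path_image k \<subseteq> ball v (\<delta> v) \<and> path_image k \<inter> Q F = {pathstart k} \<and> path_image k \<inter> ?G = {pathfinish k}"
    if F: "F \<in> \<Phi>" "v \<in> T F" for F v
  proof -
    have "pt F v \<noteq> v" using pt(1)[OF F] FG[OF F(1)] TV[OF F] by auto
    then have "arc (linepath (pt F v) v)" by (rule arc_linepath)
    moreover have "closed (Q F)" using Q(3)[OF F(1)] by (rule compact_imp_closed)
    moreover have "pathstart (linepath (pt F v) v) \<in> Q F" using Q(1)[OF F(1)] F(2) by auto
    moreover have "pathfinish (linepath (pt F v) v) \<in> ?G" using TV[OF F] by simp
    moreover have "Q F \<inter> ?G = {}" using Q(2)[OF F(1)] FG[OF F(1)] by blast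
    ultimately obtain k where k: "arc k" "path_image k \<subseteq> path_image (linepath (pt F v) v)"
      "path_image k \<inter> Q F = {pathstart k}" "path_image k \<inter> ?G = {pathfinish k}"
      by (rule arc_first_hit[OF _ _ _ closedG])
    have "path_image (linepath (pt F v) v) \<subseteq> ball v (\<delta> v)"
      using pt(2)[OF F] \<delta>(1)[OF TV[OF F]] by (simp add: closed_segment_subset)
    then show ?thesis using k by blast
  qed
  define \<sigma> where "\<sigma> F v = (SOME k. arc k \<and> path_image k \<subseteq> ball v (\<delta> v) \<and>
    path_image k \<inter> Q F = {pathstart k} \<and> path_image k \<inter> ?G = {pathfinish k})" for F v
  have \<sigma>: "arc (\<sigma> F v)" "path_image (\<sigma> F v) \<subseteq> ball v (\<delta> v)" "path_image (\<sigma> F v) \<inter> Q F = {pathstart (\<sigma> F v)}"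
    "path_image (\<sigma> F v) \<inter> ?G = {pathfinish (\<sigma> F v)}" if F: "F \<in> \<Phi>" "v \<in> T F" for F v
    using someI_ex[OF ex_spoke[OF F]] unfolding \<sigma>_def by simp_all
  \<comment> \<open>An initial part of the spoke that avoids the graph is connected and starts in
    \<open>F\<close>, so it cannot leave the face.\<close>
  have \<sigma>F: "path_image (\<sigma> F v) - {pathfinish (\<sigma> F v)} \<subseteq> F" if F: "F \<in> \<Phi>" "v \<in> T F" for F v
  proof
    fix z assume z: "z \<in> path_image (\<sigma> F v) - {pathfinish (\<sigma> F v)}"
    then have "z \<in> \<sigma> F v ` {0..1}" by (simp add: path_image_def)
    then obtain t where t': "t \<in> {0..1}" "z = \<sigma> F v t" by blast
    then have t: "0 \<le> t" "t \<le> 1" "z = \<sigma> F v t" by simp_all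
    have "t \<noteq> 1" using z t(3) unfolding pathfinish_def by blast
    let ?S = "\<sigma> F v ` {0..t}"
    have "continuous_on {0..1} (\<sigma> F v)" using \<sigma>(1)[OF F] by (simp add: arc_def path_def)
    then have "continuous_on {0..t} (\<sigma> F v)" by (rule continuous_on_subset) (use t in simp)
    then have "connected ?S" by (intro connected_continuous_image connected_Icc)
    moreover have "?S \<inter> ?G = {}"
    proof (rule ccontr)
      assume "?S \<inter> ?G \<noteq> {}"
      then obtain x where x: "x \<in> {0..t}" "\<sigma> F v x \<in> ?G" by blast
      have "x \<in> {0..1}" using x(1) t by simp
      then have "\<sigma> F v x \<in> path_image (\<sigma> F v)" unfolding path_image_def by blast
      then have "\<sigma> F v x \<in> path_image (\<sigma> F v) \<inter> ?G" using x(2) by blast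
      then have "\<sigma> F v x = \<sigma> F v 1" unfolding \<sigma>(4)[OF F] pathfinish_def by blast
      then have "x = 1" using \<sigma>(1)[OF F] x t by (auto simp: arc_def dest: inj_onD)
      then show False using x(1) t \<open>t \<noteq> 1\<close> by simp
    qed
    moreover have "\<sigma> F v 0 \<in> ?S" using t by auto
    moreover have "\<sigma> F v 0 \<in> F" using \<sigma>(3)[OF F] Q(2)[OF F(1)] unfolding pathstart_def by blast
    ultimately have "?S \<subseteq> F" using components_maximal[OF faceC[OF F(1)], of ?S] by blast
    then show "z \<in> F" using t by auto
  qed
  have \<sigma>end: "pathfinish (\<sigma> F v) \<in> \<beta> v" if F: "F \<in> \<Phi>" "v \<in> T F" for F v
    using \<sigma>(2,4)[OF F] \<delta>(3)[OF TV[OF F]] by blast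
  define I where "I = (Inl ` V \<union> Inr ` \<Phi> :: (complex + complex set) set)"
  define B where "B i = (case i of Inl v \<Rightarrow> \<beta> v | Inr F \<Rightarrow> Q F)" for i
  define X where "X = hub_edges E \<Phi> T"
  \<comment> \<open>Edges are shortened to their middle parts, since their ends now belong to the
    fat vertices.\<close>
  define \<gamma> where "\<gamma> x = (case x of Inl e \<Rightarrow> subpath (s e) (1 - s e) (g e) | Inr (F, v) \<Rightarrow> \<sigma> F v)" for x
  have B_simps: "B (Inl v) = \<beta> v" "B (Inr F) = Q F" for v F by (auto simp: B_def)
  have \<gamma>_simps: "\<gamma> (Inl e) = subpath (s e) (1 - s e) (g e)" "\<gamma> (Inr (F, v)) = \<sigma> F v" for e F v by (auto simp: \<gamma>_def)
  have pq_simps: "hub_p (end0 V) (Inl e) = Inl (end0 V e)" "hub_p (end0 V) (Inr (F, v)) = Inr F"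
    "hub_q (end1 V) (Inl e) = Inl (end1 V e)" "hub_q (end1 V) (Inr (F, v)) = Inl v" for e F v
    by (auto simp: hub_p_def hub_q_def)
  have XE: "(\<exists>e\<in>E. x = Inl e) \<or> (\<exists>F\<in>\<Phi>. \<exists>v\<in>T F. x = Inr (F, v))" if "x \<in> X" for x
    using that unfolding X_def hub_edges_def by auto
  have mid: "path_image (\<gamma> (Inl e)) = g e ` {s e..1 - s e}" if "e \<in> E" for e
    unfolding \<gamma>_simps using s(1,2)[OF that] by (simp add: path_image_subpath)
  have mid_e: "path_image (\<gamma> (Inl e)) \<subseteq> e" if "e \<in> E" for e
    unfolding mid[OF that] using g(7)[OF that] s(1,2)[OF that] by auto
  have mid_V: "path_image (\<gamma> (Inl e)) \<inter> V = {}" if "e \<in> E" for e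
  proof (rule ccontr)
    assume "path_image (\<gamma> (Inl e)) \<inter> V \<noteq> {}"
    then obtain x where "x \<in> {s e..1 - s e}" "g e x \<in> V" unfolding mid[OF \<open>e \<in> E\<close>] by blast
    then show False using gV[OF that, of x] s(1,2)[OF that] by auto
  qed
  have mid_ends: "pathstart (\<gamma> (Inl e)) = g e (s e)" "pathfinish (\<gamma> (Inl e)) = g e (1 - s e)" for e
    by (simp_all add: \<gamma>_simps)
  have mid_near: "z = g e (s e) \<or> z = g e (1 - s e)"
    if ev: "e \<in> E" "v \<in> V" "z \<in> path_image (\<gamma> (Inl e))" "z \<in> near e v" for e v z
  proof -
    obtain x where x: "s e \<le> x" "x \<le> 1 - s e" "z = g e x" using ev(3) unfolding mid[OF ev(1)] by auto
    have "z \<noteq> v" using mid_V[OF ev(1)] ev by blast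
    then have "z \<in> g e ` ({0..s e} \<union> {1 - s e..1})"
      using ev(4) by (auto simp: near_def split: if_splits)
    then obtain y where y: "y \<in> {0..s e} \<union> {1 - s e..1}" "z = g e y" by blast
    have "x = y" using g(6)[OF that(1)] x y s(1,2)[OF that(1)] by (auto dest!: inj_onD)
    then show ?thesis using x y by auto
  qed
  have GX: "?G \<subseteq> (\<Union>i\<in>I. B i) \<union> (\<Union>e\<in>E. path_image (\<gamma> (Inl e)))"
  proof -
    have "z \<in> (\<Union>i\<in>I. B i) \<union> (\<Union>e\<in>E. path_image (\<gamma> (Inl e)))" if e: "e \<in> E" "z \<in> e" for z e
    proof -
      have "z \<in> g e ` {0..1}" using e g(7)[OF e(1)] by simp
      then obtain x where x: "0 \<le> x" "x \<le> 1" "z = g e x" by auto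
      consider "x \<le> s e" | "1 - s e \<le> x" | "s e \<le> x" "x \<le> 1 - s e" by linarith
      then show ?thesis
      proof cases
        case 1
        then have "z \<in> near e (end0 V e)" unfolding near_def using x g(4)[OF e(1)] by auto
        then have "z \<in> \<beta> (end0 V e)" unfolding \<beta>_def using e by blast
        then show ?thesis using edge_arc(5)[OF pg e(1)] B_simps(1) unfolding I_def by blast
      next
        case 2
        have "g e 0 \<noteq> g e 1" using edge_arc(4)[OF pg e(1)] g[OF e(1)] by simp
        then have "z \<in> near e (end1 V e)" unfolding near_def using x 2 g(5)[OF e(1)] by auto
        then have "z \<in> \<beta> (end1 V e)" unfolding \<beta>_def using e by blast
        then show ?thesis using edge_arc(6)[OF pg e(1)] B_simps(1) unfolding I_def by blast
      next
        case 3
        then have "z \<in> path_image (\<gamma> (Inl e))" using x mid[OF e(1)] by auto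
        then show ?thesis using e(1) by blast
      qed
    qed
    moreover have "v \<in> (\<Union>i\<in>I. B i)" if "v \<in> V" for v using that B_simps(1) unfolding I_def \<beta>_def by blast
    ultimately show ?thesis by blast
  qed
  have bg: "blob_graph I B X \<gamma> (hub_p (end0 V)) (hub_q (end1 V))"
  proof
    show "finite I" using fV \<Phi>(1) by (simp add: I_def)
    show "finite X" unfolding X_def hub_edges_def using fE \<Phi>(1) fT by auto
    fix i assume "i \<in> I"
    then show "compact (B i)" "path_connected (B i)"
      using \<beta>_compact \<beta>_pc Q(3,4) by (auto simp: I_def B_simps)
    fix j assume "j \<in> I" "i \<noteq> j"
    have bQ: "\<beta> v \<inter> Q F = {}" if "v \<in> V" "F \<in> \<Phi>" for v F
      using \<beta>_G[OF that(1)] Q(2)[OF that(2)] FG[OF that(2)] by blast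
    have bb: "\<beta> u \<inter> \<beta> v = {}" if "u \<in> V" "v \<in> V" "u \<noteq> v" for u v
      using \<beta>_ball[of u] \<beta>_ball[of v] \<epsilon>(2)[OF that] by blast
    have QQ: "Q F \<inter> Q F' = {}" if "F \<in> \<Phi>" "F' \<in> \<Phi>" "F \<noteq> F'" for F F'
      using Q(2)[OF that(1)] Q(2)[OF that(2)] FF[OF that] by blast
    show "B i \<inter> B j = {}"
      using \<open>i \<in> I\<close> \<open>j \<in> I\<close> \<open>i \<noteq> j\<close> unfolding I_def
    proof (elim UnE imageE)
      fix v F assume "i = Inl v" "v \<in> V" "j = Inr F" "F \<in> \<Phi>"
      then show ?thesis using bQ[of v F] by (simp add: B_simps)
    next
      fix v F assume "j = Inl v" "v \<in> V" "i = Inr F" "F \<in> \<Phi>"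
      then show ?thesis using bQ[of v F] by (simp add: B_simps Int_commute)
    qed (use bb QQ in \<open>simp_all add: B_simps\<close>)
  next
    fix x assume x: "x \<in> X"
    show "arc (\<gamma> x)" using XE[OF x]
    proof (elim disjE bexE)
      fix e assume e: "e \<in> E" "x = Inl e"
      show ?thesis unfolding e(2) \<gamma>_simps using g(1)[OF e(1)] s(1,2)[OF e(1)] by (intro arc_subpath_arc) auto
    qed (use \<sigma>(1) in \<open>auto simp: \<gamma>_simps\<close>)
    show "hub_p (end0 V) x \<in> I" "hub_q (end1 V) x \<in> I" "hub_p (end0 V) x \<noteq> hub_q (end1 V) x"
      using XE[OF x] edge_arc(4-6)[OF pg] TV by (auto simp: pq_simps I_def)
    show "pathstart (\<gamma> x) \<in> B (hub_p (end0 V) x)" using XE[OF x]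
    proof (elim disjE bexE)
      fix e assume e: "e \<in> E" "x = Inl e"
      have "g e (s e) \<in> near e (end0 V e)" unfolding near_def using g(4)[OF e(1)] s(1)[OF e(1)] by auto
      then show ?thesis unfolding e(2) mid_ends pq_simps B_simps \<beta>_def using e(1) by blast
    next
      fix F v assume "F \<in> \<Phi>" "v \<in> T F" "x = Inr (F, v)"
      then show ?thesis using \<sigma>(3) by (auto simp: \<gamma>_simps pq_simps B_simps)
    qed
    show "pathfinish (\<gamma> x) \<in> B (hub_q (end1 V) x)" using XE[OF x]
    proof (elim disjE bexE)
      fix e assume e: "e \<in> E" "x = Inl e"
      have "g e 0 \<noteq> g e 1" using edge_arc(4)[OF pg e(1)] g[OF e(1)] by simp
      then have "g e (1 - s e) \<in> near e (end1 V e)" unfolding near_def using g(5)[OF e(1)] s(1)[OF e(1)] by auto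
      then show ?thesis unfolding e(2) mid_ends pq_simps B_simps \<beta>_def using e(1) by blast
    next
      fix F v assume "F \<in> \<Phi>" "v \<in> T F" "x = Inr (F, v)"
      then show ?thesis using \<sigma>end by (auto simp: \<gamma>_simps pq_simps B_simps)
    qed
    fix i assume i: "i \<in> I"
    show "path_image (\<gamma> x) \<inter> B i \<subseteq> {pathstart (\<gamma> x), pathfinish (\<gamma> x)}" using XE[OF x]
    proof (elim disjE bexE)
      fix e assume e: "e \<in> E" "x = Inl e"
      show ?thesis
      proof
        fix z assume z: "z \<in> path_image (\<gamma> x) \<inter> B i"
        then have ze: "z \<in> e" using mid_e[OF e(1)] e(2) by blast
        consider v where "v \<in> V" "i = Inl v" | F where "F \<in> \<Phi>" "i = Inr F" using i by (auto simp: I_def)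
        then show "z \<in> {pathstart (\<gamma> x), pathfinish (\<gamma> x)}"
        proof cases
          case 1
          then have "z \<in> \<beta> v" using z by (simp add: B_simps)
          moreover have zV: "z \<notin> V" using z mid_V[OF e(1)] e(2) by blast
          ultimately obtain e' where e': "e' \<in> E" "z \<in> near e' v" unfolding \<beta>_def using 1 by blast
          then have "z \<in> e'" using near_sub[OF e'(1), of v] zV 1 by blast
          then have "e' = e" using ee[OF e(1) e'(1)] ze zV by blast
          then show ?thesis using mid_near[OF e(1) 1(1), of z] e' z e(2) mid_ends by auto
        next
          case 2
          then have "z \<in> F" using z Q(2) by (auto simp: B_simps)
          then show ?thesis using FG[OF 2(1)] ze e(1) by blast
        qed
      qed
    next
      fix F v assume F: "F \<in> \<Phi>" "v \<in> T F" "x = Inr (F, v)"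
      show ?thesis
      proof
        fix z assume z: "z \<in> path_image (\<gamma> x) \<inter> B i"
        then have zs: "z \<in> path_image (\<sigma> F v)" using F(3) by (simp add: \<gamma>_simps)
        consider u where "u \<in> V" "i = Inl u" | F' where "F' \<in> \<Phi>" "i = Inr F'" using i by (auto simp: I_def)
        then have "z = pathstart (\<sigma> F v) \<or> z = pathfinish (\<sigma> F v)"
        proof cases
          case 1
          then have "z \<in> ?G" using z \<beta>_G[OF 1(1)] by (auto simp: B_simps)
          then show ?thesis using \<sigma>(4)[OF F(1,2)] zs by blast
        next
          case 2
          then have zQ: "z \<in> Q F'" using z by (simp add: B_simps)
          show ?thesis
          proof (cases "F' = F")
            case True
            then show ?thesis using \<sigma>(3)[OF F(1,2)] zs zQ by blast
          next
            case False
            then show ?thesis using \<sigma>F[OF F(1,2)] zs zQ Q(2)[OF 2(1)] FF[OF 2(1) F(1)] by blast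
          qed
        qed
        then show "z \<in> {pathstart (\<gamma> x), pathfinish (\<gamma> x)}" by (simp add: F(3) \<gamma>_simps)
      qed
    qed
  next
    fix x y assume xy: "x \<in> X" "y \<in> X" "x \<noteq> y"
    have VI: "V \<subseteq> (\<Union>i\<in>I. B i)" using B_simps(1) unfolding I_def \<beta>_def by blast
    have \<beta>I: "\<beta> v \<subseteq> (\<Union>i\<in>I. B i)" if "v \<in> V" for v using that B_simps(1) unfolding I_def by blast
    have spoke_mid: "path_image (\<sigma> F v) \<inter> path_image (\<gamma> (Inl e)) \<subseteq> (\<Union>i\<in>I. B i)"
      if "F \<in> \<Phi>" "v \<in> T F" "e \<in> E" for F v e
    proof -
      have "path_image (\<sigma> F v) \<inter> path_image (\<gamma> (Inl e)) \<subseteq> {pathfinish (\<sigma> F v)}"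
        using \<sigma>(4)[OF that(1,2)] mid_e[OF that(3)] that(3) by blast
      then show ?thesis using \<sigma>end[OF that(1,2)] \<beta>I[OF TV[OF that(1,2)]] by blast
    qed
    \<comment> \<open>Spokes to different vertices lie in disjoint balls; two spokes to the same
      vertex lie in different faces and can only share end points on the graph.\<close>
    have spoke_spoke: "path_image (\<sigma> F v) \<inter> path_image (\<sigma> F' v') \<subseteq> (\<Union>i\<in>I. B i)"
      if F: "F \<in> \<Phi>" "v \<in> T F" and F': "F' \<in> \<Phi>" "v' \<in> T F'" and ne: "(F, v) \<noteq> (F', v')" for F v F' v'
    proof (cases "v = v'")
      case True
      then have "F \<noteq> F'" using ne by simp
      then have "path_image (\<sigma> F v) \<inter> path_image (\<sigma> F' v') \<subseteq> {pathfinish (\<sigma> F v), pathfinish (\<sigma> F' v')}"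
        using \<sigma>F[OF F] \<sigma>F[OF F'] FF[OF F(1) F'(1)] by blast
      then show ?thesis using \<sigma>end[OF F] \<beta>I[OF TV[OF F]] \<sigma>end[OF F'] \<beta>I[OF TV[OF F']] by blast
    next
      case False
      have "ball v (\<delta> v) \<subseteq> ball v \<epsilon>" "ball v' (\<delta> v') \<subseteq> ball v' \<epsilon>"
        using \<delta>(2)[OF TV[OF F]] \<delta>(2)[OF TV[OF F']] by (auto intro: subset_ball)
      then show ?thesis using \<sigma>(2)[OF F] \<sigma>(2)[OF F'] \<epsilon>(2)[OF TV[OF F] TV[OF F'] False] by blast
    qed
    show "path_image (\<gamma> x) \<inter> path_image (\<gamma> y) \<subseteq> (\<Union>i\<in>I. B i)" using XE[OF xy(1)] XE[OF xy(2)]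
    proof (elim disjE bexE)
      fix e e' assume e: "e \<in> E" "x = Inl e" "e' \<in> E" "y = Inl e'"
      then have "e \<inter> e' \<subseteq> V" using ee xy(3) by blast
      then show ?thesis using mid_e[OF e(1)] mid_e[OF e(3)] e VI by blast
    next
      fix e F v assume e: "e \<in> E" "x = Inl e" "F \<in> \<Phi>" "v \<in> T F" "y = Inr (F, v)"
      then show ?thesis using spoke_mid[OF e(3,4,1)] by (simp add: \<gamma>_simps Int_commute)
    next
      fix e F v assume e: "e \<in> E" "y = Inl e" "F \<in> \<Phi>" "v \<in> T F" "x = Inr (F, v)"
      then show ?thesis using spoke_mid[OF e(3,4,1)] by (simp add: \<gamma>_simps Int_commute)
    next
      fix F v F' v' assume e: "F \<in> \<Phi>" "v \<in> T F" "x = Inr (F, v)" "F' \<in> \<Phi>" "v' \<in> T F'" "y = Inr (F', v')"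
      then show ?thesis using spoke_spoke[OF e(1,2,4,5)] xy(3) by (simp add: \<gamma>_simps)
    qed
  qed
  interpret blob_graph I B X \<gamma> "hub_p (end0 V)" "hub_q (end1 V)" by (rule bg)
  show thesis
  proof (rule that)
    show "dual_pair (hub_edges E \<Phi> T) (hub_p (end0 V)) (hub_q (end1 V)) da db"
      using dual_pair_faces by (simp add: X_def)
    fix F v assume F: "F \<in> \<Phi>" "v \<in> T F"
      and lk: "linked (hub_p (end0 V)) (hub_q (end1 V)) (hub_edges E \<Phi> T - {Inr (F, v)}) (Inr F) (Inl v)"
    let ?x = "Inr (F, v) :: complex set + complex set \<times> complex"
    have xX: "?x \<in> X" using F by (auto simp: X_def hub_edges_def)
    \<comment> \<open>The assumed link that avoids this spoke closes a cycle through it, and an edge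
      on a Jordan curve has a face on either side.\<close>
    have "nb ?x \<noteq> {}"
    proof -
      obtain es vs where sp: "spath (hub_p (end0 V)) (hub_q (end1 V)) (X - {?x}) (hub_q (end1 V) ?x) (hub_p (end0 V) ?x) es vs"
        using linked_imp_spath[OF _ lk] fin(2) by (auto simp: X_def pq_simps)
      have es: "set es \<subseteq> X - {?x}" using spath_facts(3)[OF sp] .
      have sp': "spath (hub_p (end0 V)) (hub_q (end1 V)) X (hub_q (end1 V) ?x) (hub_p (end0 V) ?x) es vs" using sp
        by (induction rule: spath.induct) (auto intro: spath.intros)
      have nx: "?x \<notin> set es" using es by blast
      obtain A c where c: "simple_path c" "pathfinish c = pathstart c" "path_image c = path_image (\<gamma> ?x) \<union> A" "A \<subseteq> pts (set es)"
        using cycle_curve[OF xX nx sp'] by metis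
      have "A \<subseteq> pts X" using c(4) pts_mono[of "set es" X] es by blast
      moreover have "path_image (\<gamma> ?x) \<subseteq> pts X" using xX by (auto simp: pts_def)
      ultimately have "path_image c \<subseteq> pts X" using c(3) by blast
      moreover have "path_image (\<gamma> ?x) \<subseteq> path_image c" using c(3) by simp
      ultimately obtain F0 where "F0 \<in> nb ?x" using curve_both_sides[OF xX c(1,2)] by metis
      then show ?thesis by blast
    qed
    \<comment> \<open>A neighbouring face is connected, off the original graph, to an interior point
      of the spoke, and that point lies in \<open>F\<close>.\<close>
    moreover have "G0 \<subseteq> F" if G0: "G0 \<in> nb ?x" for G0
    proof -
      obtain u z where uz: "u \<in> G0" "z \<in> inner ?x" "connected_component (- pts (X - {?x})) u z" using G0 by (auto simp: nb_def)
      have sub: "?G \<subseteq> pts (X - {?x})"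
      proof -
        have "(\<Union>e\<in>E. path_image (\<gamma> (Inl e))) \<subseteq> (\<Union>y\<in>X - {?x}. path_image (\<gamma> y))"
        proof (rule UN_least)
          fix e assume "e \<in> E"
          then have "(Inl e :: complex set + complex set \<times> complex) \<in> X - {?x}" by (simp add: X_def hub_edges_def)
          then show "path_image (\<gamma> (Inl e)) \<subseteq> (\<Union>y\<in>X - {?x}. path_image (\<gamma> y))" by (rule UN_upper)
        qed
        then show ?thesis using GX unfolding pts_def by (rule_tac subset_trans[OF GX Un_mono[OF subset_refl]])
      qed
      have "inner ?x \<subseteq> path_image (\<sigma> F v) - {pathfinish (\<sigma> F v)}" unfolding inner_def \<gamma>_simps by blast
      then have "z \<in> F" using uz(2) \<sigma>F[OF F] by blast
      obtain S where S: "connected S" "S \<subseteq> - pts (X - {?x})" "u \<in> S" "z \<in> S"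
        using uz(3) unfolding connected_component_def by blast
      have "S \<subseteq> F" using components_maximal[OF faceC[OF F(1)] S(1)] S sub \<open>z \<in> F\<close> by blast
      then have uF: "u \<in> F" using S by blast
      have G0c: "G0 \<in> components (- pts X)" using G0 by (simp add: nb_def)
      have "G0 \<subseteq> - ?G" using face_facts(4)[OF G0c] sub pts_mono[of "X - {?x}" X] by blast
      then show ?thesis using components_maximal[OF faceC[OF F(1)] face_facts(2)[OF G0c]] uz(1) uF by blast
    qed
    moreover have "G0 \<noteq> {}" if "G0 \<in> nb ?x" for G0 using face_facts(3)[of G0] that by (simp add: nb_def)
    ultimately show "da ?x \<subseteq> F \<and> db ?x \<subseteq> F \<and> da ?x \<noteq> {} \<and> db ?x \<noteq> {}" using dual_ends[OF xX] by auto
  qed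
qed

section \<open>The cyclic order of the terminals\<close>

lemma sym_diff_chain: "sym_diff (sym_diff {y} {z}) (sym_diff {x} {y}) = sym_diff {x} {z}"
  by auto

lemma doubleton_sym_diff: "{x, y} = {z, w} \<Longrightarrow> sym_diff {x} {y} = sym_diff {z} {w}"
  by (auto simp: doubleton_eq_iff)

text \<open>The star of a dual vertex is an even primal set, hence meets every primal cut
  evenly.\<close>

lemma primal_cut_dual_even:
  assumes "finite X" "dual_pair X p q a b"
  shows "bdry a b (cut p q X S) = {}"
proof (rule ccontr)
  assume "bdry a b (cut p q X S) \<noteq> {}"
  then obtain w where w: "w \<in> bdry a b (cut p q X S)" by blast
  let ?C = "cut a b X {w}"
  have "odd (card (cut p q X S \<inter> ?C))"
    using odd_card_Int_cut[OF finite_cut[OF assms(1)] cut_subset, of p q S a b "{w}"] w by simp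
  moreover have "even (card (?C \<inter> cut p q X S))"
    using odd_card_Int_cut[OF finite_cut[OF assms(1)] cut_subset, of a b "{w}" p q S] assms(2)
    by (simp add: dual_pair_def)
  ultimately show False by (simp add: Int_commute)
qed

lemma spath_nth:
  assumes "spath p q E v u es vs"
  shows "length vs = Suc (length es)" "distinct vs" "distinct es" "vs ! 0 = u" "vs ! length es = v"
    "\<And>i. i < length es \<Longrightarrow> {p (es ! i), q (es ! i)} = {vs ! i, vs ! Suc i}"
proof -
  have "length vs = Suc (length es) \<and> distinct vs \<and> distinct es \<and> vs ! 0 = u \<and> vs ! length es = v \<and>
      (\<forall>i<length es. {p (es ! i), q (es ! i)} = {vs ! i, vs ! Suc i})"
    using assms
  proof (induction rule: spath.induct)
    case (step u es vs e w)
    have "e \<notin> set es" using spath_facts(4)[OF step.hyps(1), of e] step.hyps(3,4) by (auto simp: doubleton_eq_iff)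
    moreover have "{p ((e # es) ! i), q ((e # es) ! i)} = {(w # vs) ! i, (w # vs) ! Suc i}" if "i < length (e # es)" for i
      using that step.IH step.hyps(3) by (cases i) auto
    ultimately show ?case using step.IH step.hyps(4) by simp
  qed simp
  then show "length vs = Suc (length es)" "distinct vs" "distinct es" "vs ! 0 = u" "vs ! length es = v"
    "\<And>i. i < length es \<Longrightarrow> {p (es ! i), q (es ! i)} = {vs ! i, vs ! Suc i}" by auto
qed

text \<open>A minimal even set is a single cycle: one edge and a simple path between its ends
  already form an even set. The edge \<open>x0\<close> comes last and leads back to
  \<open>\<omega> 0\<close>.\<close>

lemma minimal_even_enumerate:
  assumes Q: "finite Q" "bdry a b Q = {}" and min: "\<And>R. R \<subseteq> Q \<Longrightarrow> R \<noteq> {} \<Longrightarrow> bdry a b R = {} \<Longrightarrow> R = Q"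
    and k: "card Q = k" "2 \<le> k"
  shows "\<exists>x \<omega>. bij_betw x {..<k} Q \<and> inj_on \<omega> {..<k} \<and> \<omega> k = \<omega> 0 \<and>
    (\<forall>i<k. {a (x i), b (x i)} = {\<omega> i, \<omega> (Suc i)})"
proof -
  obtain x0 where x0: "x0 \<in> Q" using k by force
  have "bdry a b (Q - {x0}) = sym_diff {a x0} {b x0}"
    using bdry_Diff[OF Q(1), of "{x0}" a b] x0 Q(2) bdry_single[of a b x0] by simp
  then have "linked a b (Q - {x0}) (a x0) (b x0)" unfolding linked_def by blast
  then obtain es vs where sp: "spath a b (Q - {x0}) (b x0) (a x0) es vs"
    using linked_imp_spath[of "Q - {x0}" a b "a x0" "b x0"] Q(1) by auto
  note n = spath_nth[OF sp]
  have es: "set es \<subseteq> Q - {x0}" using spath_facts(3)[OF sp] .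
  have "x0 \<notin> set es" using es by blast
  then have "bdry a b (insert x0 (set es)) = sym_diff (sym_diff {a x0} {b x0}) (sym_diff {a x0} {b x0})"
    using bdry_insert[of "set es" x0 a b] spath_bdry[OF sp] by simp
  then have Qe: "insert x0 (set es) = Q" using min[of "insert x0 (set es)"] es x0 by auto
  then have lk: "k = Suc (length es)" using k(1) \<open>x0 \<notin> set es\<close> distinct_card[OF n(3)] by auto
  define x where "x i = (if i < length es then es ! i else x0)" for i
  define \<omega> where "\<omega> i = (if i < k then vs ! i else vs ! 0)" for i
  have dx: "distinct (es @ [x0])" using n(3) \<open>x0 \<notin> set es\<close> by simp
  have x_nth: "x i = (es @ [x0]) ! i" if "i < k" for i using that lk by (auto simp: x_def nth_append)
  show ?thesis
  proof (intro exI[of _ x] exI[of _ \<omega>] conjI allI impI)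
    have "bij_betw ((!) (es @ [x0])) {..<k} Q"
      by (rule bij_betw_nth[OF dx]) (use lk Qe in auto)
    moreover have "bij_betw x {..<k} Q \<longleftrightarrow> bij_betw ((!) (es @ [x0])) {..<k} Q"
      by (rule bij_betw_cong) (simp add: x_nth)
    ultimately show "bij_betw x {..<k} Q" by blast
    show "inj_on \<omega> {..<k}" using n(1,2) lk by (auto simp: inj_on_def \<omega>_def nth_eq_iff_index_eq)
    show "\<omega> k = \<omega> 0" using k by (simp add: \<omega>_def)
    fix i assume i: "i < k"
    show "{a (x i), b (x i)} = {\<omega> i, \<omega> (Suc i)}"
    proof (cases "i < length es")
      case True
      then show ?thesis using n(6)[OF True] lk by (simp add: x_def \<omega>_def)
    next
      case False
      then have "i = length es" using i lk by simp
      then show ?thesis using n(4,5) lk by (auto simp: x_def \<omega>_def)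
    qed
  qed
qed

lemma connected_cut_empty:
  assumes "finite E" "linked p q E u v" "cut p q E S = {}"
  shows "u \<in> S \<longleftrightarrow> v \<in> S"
proof -
  obtain J where J: "J \<subseteq> E" "bdry p q J = sym_diff {u} {v}" using assms(2) unfolding linked_def by (elim exE conjE)
  have "finite J" using J(1) assms(1) by (rule finite_subset)
  then have ev: "even (card (bdry p q J \<inter> S))" using odd_card_Int_cut[of J E p q S] J(1) assms(3) by simp
  have one: "card (sym_diff {u} {v} \<inter> S) = 1" if "(u \<in> S) \<noteq> (v \<in> S)"
  proof -
    have "sym_diff {u} {v} \<inter> S = (if u \<in> S then {u} else {v})" using that by auto
    then show ?thesis by simp
  qed
  show ?thesis
  proof (rule ccontr)
    assume "\<not> ?thesis"
    then have "card (bdry p q J \<inter> S) = 1" unfolding J(2) by (rule one)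
    then show False using ev by simp
  qed
qed

text \<open>A bond is a minimal nonempty cut, and every cut is a disjoint union of bonds. Supply is
  additive over this union, while the demand across a symmetric difference of shores is at most the
  sum of the demands.\<close>

lemma cut_condition_bonds:
  fixes p q :: "'e \<Rightarrow> 'v" and c :: "'e \<Rightarrow> nat"
  assumes E: "finite E" and N: "finite N"
    and linked: "\<And>u v. u \<in> V \<Longrightarrow> v \<in> V \<Longrightarrow> linked p q E u v"
    and st: "\<And>d. d \<in> N \<Longrightarrow> s d \<in> V \<and> t d \<in> V"
    and bond: "\<And>S. cut p q E S \<noteq> {} \<Longrightarrow> (\<And>S'. cut p q E S' \<subseteq> cut p q E S \<Longrightarrow> cut p q E S' \<noteq> {} \<Longrightarrow> cut p q E S' = cut p q E S)
      \<Longrightarrow> card (cut s t N S) \<le> (\<Sum>e\<in>cut p q E S. c e)"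
  shows "card (cut s t N S) \<le> (\<Sum>e\<in>cut p q E S. c e)"
proof (induction "card (cut p q E S)" arbitrary: S rule: less_induct)
  case less
  have fin: "finite (cut p q E S)" for S by (rule finite_cut[OF E])
  show ?case
  proof (cases "cut p q E S = {}")
    case True
    have "cut s t N S = {}"
    proof -
      have "(s d \<in> S) = (t d \<in> S)" if "d \<in> N" for d
        using connected_cut_empty[OF E _ True] linked st[OF that] by blast
      then show ?thesis by (auto simp: cut_def)
    qed
    then show ?thesis by simp
  next
    case False
    define M where "M = {C. C \<noteq> {} \<and> C \<subseteq> cut p q E S \<and> (\<exists>S'. C = cut p q E S')}"
    have "finite M" by (rule finite_subset[of _ "Pow (cut p q E S)"]) (use fin in \<open>auto simp: M_def\<close>)
    moreover have "cut p q E S \<in> M" using False by (auto simp: M_def)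
    ultimately obtain C where C: "C \<in> M" "\<And>C'. C' \<in> M \<Longrightarrow> card C \<le> card C'"
      using ex_is_arg_min_if_finite[of M card] by (auto simp: is_arg_min_linorder)
    then obtain S' where S': "C = cut p q E S'" "C \<noteq> {}" "C \<subseteq> cut p q E S" by (auto simp: M_def)
    have "cut p q E S'' = cut p q E S'" if S'': "cut p q E S'' \<subseteq> cut p q E S'" "cut p q E S'' \<noteq> {}" for S''
    proof -
      have "cut p q E S'' \<in> M" using S'' S' by (auto simp: M_def)
      then show ?thesis using C(2) S''(1) S'(1) fin[of S'] by (simp add: card_seteq)
    qed
    then have 1: "card (cut s t N S') \<le> (\<Sum>e\<in>cut p q E S'. c e)" using bond[of S'] S' by simp
    have d: "cut p q E (sym_diff S S') = cut p q E S - cut p q E S'" using S' cut_sym_diff[of p q E S S'] by blast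
    have "card (cut p q E (sym_diff S S')) < card (cut p q E S)" unfolding d
      using S' fin[of S] by (intro psubset_card_mono) auto
    from less[OF this] have 2: "card (cut s t N (sym_diff S S')) \<le> (\<Sum>e\<in>cut p q E S - cut p q E S'. c e)" by (simp add: d)
    have "cut s t N S \<subseteq> cut s t N S' \<union> cut s t N (sym_diff S S')" by (auto simp: cut_def)
    then have "card (cut s t N S) \<le> card (cut s t N S' \<union> cut s t N (sym_diff S S'))"
      using finite_cut[OF N] by (intro card_mono) auto
    also have "\<dots> \<le> card (cut s t N S') + card (cut s t N (sym_diff S S'))" by (rule card_Un_le)
    also have "\<dots> \<le> (\<Sum>e\<in>cut p q E S'. c e) + (\<Sum>e\<in>cut p q E S - cut p q E S'. c e)" using 1 2 by simp
    also have "\<dots> = (\<Sum>e\<in>cut p q E S. c e)" using S' fin[of S] by (simp add: sum.subset_diff)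
    finally show ?thesis .
  qed
qed

text \<open>The dual vertices at the spokes of a hub are its wedges, the parts into which the spokes
  divide the face. The assumption \<open>wedges\<close> keeps those of different faces apart; the
  cyclic order within one face is derived.\<close>

locale hub_graph =
  fixes E :: "'e set" and V :: "'v set" and \<Phi> :: "'f set" and T :: "'f \<Rightarrow> 'v set" and p q :: "'e \<Rightarrow> 'v"
    and a b :: "'e + 'f \<times> 'v \<Rightarrow> 'w"
  assumes fin: "finite E" "finite V" "finite \<Phi>"
    and ends: "\<And>e. e \<in> E \<Longrightarrow> p e \<in> V \<and> q e \<in> V"
    and T: "\<And>F. F \<in> \<Phi> \<Longrightarrow> T F \<subseteq> V" "\<And>F. F \<in> \<Phi> \<Longrightarrow> 2 \<le> card (T F)"
    and linked: "\<And>u v. u \<in> V \<Longrightarrow> v \<in> V \<Longrightarrow> linked p q E u v"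
    and dual: "dual_pair (hub_edges E \<Phi> T) (hub_p p) (hub_q q) a b"
    and wedges: "\<And>F F' v v'. F \<in> \<Phi> \<Longrightarrow> F' \<in> \<Phi> \<Longrightarrow> v \<in> T F \<Longrightarrow> v' \<in> T F' \<Longrightarrow> F \<noteq> F' \<Longrightarrow>
      {a (Inr (F, v)), b (Inr (F, v))} \<inter> {a (Inr (F', v')), b (Inr (F', v'))} = {}"
begin

abbreviation X where "X \<equiv> hub_edges E \<Phi> T"
abbreviation P where "P \<equiv> hub_p p"
abbreviation Q where "Q \<equiv> hub_q q"

definition spokes :: "'f \<Rightarrow> ('e + 'f \<times> 'v) set" where "spokes F = (\<lambda>v. Inr (F, v)) ` T F"

lemma finite_T: "F \<in> \<Phi> \<Longrightarrow> finite (T F)"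
  using T(1) fin(2) by (auto intro: finite_subset)

lemma finite_X: "finite X"
  unfolding hub_edges_def using fin finite_T by auto

lemma card_spokes: "card (spokes F) = card (T F)"
  unfolding spokes_def by (intro card_image) (auto simp: inj_on_def)

lemma spokes_cut: "F \<in> \<Phi> \<Longrightarrow> spokes F = cut P Q X {Inr F}"
  unfolding cut_def spokes_def by (auto simp: hub_edges_def)

lemma cut_edges: "Inl e \<in> cut P Q X S \<longleftrightarrow> e \<in> cut p q E {v. Inl v \<in> S}"
  by (simp add: cut_def)

lemma cut_spoke: "F \<in> \<Phi> \<Longrightarrow> v \<in> T F \<Longrightarrow> Inr (F, v) \<in> cut P Q X S \<longleftrightarrow> (Inr F \<in> S) \<noteq> (Inl v \<in> S)"
  by (simp add: cut_def)

text \<open>An even part of the spokes is a primal cut without edges of \<open>E\<close>. As the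
  graph is connected, all terminals are on one side, so the hub is separated from all of them or
  from none. Thus the spokes form one dual cycle, which is the source of the cyclic order.\<close>

lemma spokes_minimal:
  assumes F: "F \<in> \<Phi>" and R: "R \<subseteq> spokes F" "R \<noteq> {}" "bdry a b R = {}"
  shows "R = spokes F"
proof -
  have "R \<subseteq> X" using R(1) F by (auto simp: spokes_def)
  then obtain S where S: "R = cut P Q X S" using dual_even_is_cut[OF finite_X dual _ R(3)] by metis
  have "Inl e \<notin> cut P Q X S" for e using R(1) S by (auto simp: spokes_def)
  then have ce: "cut p q E {v. Inl v \<in> S} = {}" using cut_edges by blast
  have same: "Inl u \<in> S \<longleftrightarrow> Inl v \<in> S" if "u \<in> V" "v \<in> V" for u v
    using connected_cut_empty[OF fin(1) linked[OF that] ce] by simp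
  obtain v where v: "v \<in> T F" "Inr (F, v) \<in> R" using R(1,2) by (auto simp: spokes_def)
  have "Inr (F, u) \<in> R" if u: "u \<in> T F" for u
    using v u S cut_spoke[OF F, of _ S] same[of u v] T(1)[OF F] by blast
  then show ?thesis using R(1) by (auto simp: spokes_def)
qed

lemma spokes_even: "F \<in> \<Phi> \<Longrightarrow> bdry a b (spokes F) = {}"
  using primal_cut_dual_even[OF finite_X dual] by (simp add: spokes_cut)

text \<open>\<open>\<tau>\<close> lists the terminals and \<open>\<omega>\<close> the wedges:
  terminal \<open>i\<close> sits between the wedges \<open>i\<close> and \<open>i + 1\<close>, and
  the last wedge is wedge 0 again.\<close>

definition order_data :: "'f \<Rightarrow> (nat \<Rightarrow> 'v) \<times> (nat \<Rightarrow> 'w) \<Rightarrow> bool" where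
  "order_data F = (\<lambda>(\<tau>, \<omega>). bij_betw \<tau> {..<card (T F)} (T F) \<and> inj_on \<omega> {..<card (T F)} \<and> \<omega> (card (T F)) = \<omega> 0 \<and>
    (\<forall>i<card (T F). {a (Inr (F, \<tau> i)), b (Inr (F, \<tau> i))} = {\<omega> i, \<omega> (Suc i)}))"

lemma order_data_ex:
  assumes F: "F \<in> \<Phi>"
  shows "\<exists>d. order_data F d"
proof -
  have f: "finite (spokes F)" unfolding spokes_def using finite_T[OF F] by simp
  have "\<exists>x \<omega>. bij_betw x {..<card (T F)} (spokes F) \<and> inj_on \<omega> {..<card (T F)} \<and>
      \<omega> (card (T F)) = \<omega> 0 \<and> (\<forall>i<card (T F). {a (x i), b (x i)} = {\<omega> i, \<omega> (Suc i)})"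
    by (rule minimal_even_enumerate[OF f spokes_even[OF F] _ card_spokes T(2)[OF F]])
      (rule spokes_minimal[OF F])
  then obtain x \<omega> where x: "bij_betw x {..<card (T F)} (spokes F)" "inj_on \<omega> {..<card (T F)}"
    "\<omega> (card (T F)) = \<omega> 0" "\<forall>i<card (T F). {a (x i), b (x i)} = {\<omega> i, \<omega> (Suc i)}"
    by (elim exE conjE)
  define \<tau> where "\<tau> i = snd (projr (x i))" for i
  have x\<tau>: "x i = Inr (F, \<tau> i)" "\<tau> i \<in> T F" if "i < card (T F)" for i
  proof -
    have "x i \<in> spokes F" using bij_betwE[OF x(1)] that by blast
    then obtain v where "v \<in> T F" "x i = Inr (F, v)" unfolding spokes_def by blast
    then show "x i = Inr (F, \<tau> i)" "\<tau> i \<in> T F" by (simp_all add: \<tau>_def)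
  qed
  have "bij_betw (\<lambda>y. snd (projr y)) (spokes F) (T F)"
    unfolding spokes_def by (rule bij_betw_byWitness[where f' = "\<lambda>v. Inr (F, v)"]) auto
  then have "bij_betw ((\<lambda>y. snd (projr y)) \<circ> x) {..<card (T F)} (T F)" by (rule bij_betw_trans[OF x(1)])
  moreover have "\<tau> = (\<lambda>y. snd (projr y)) \<circ> x" by (rule ext) (simp add: \<tau>_def)
  ultimately have "bij_betw \<tau> {..<card (T F)} (T F)" by simp
  then have "order_data F (\<tau>, \<omega>)" unfolding order_data_def using x x\<tau> by simp
  then show ?thesis by blast
qed

definition ord :: "'f \<Rightarrow> (nat \<Rightarrow> 'v) \<times> (nat \<Rightarrow> 'w)" where "ord F = (SOME d. order_data F d)"
definition \<tau> :: "'f \<Rightarrow> nat \<Rightarrow> 'v" where "\<tau> F = fst (ord F)"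
definition \<omega> :: "'f \<Rightarrow> nat \<Rightarrow> 'w" where "\<omega> F = snd (ord F)"
definition k :: "'f \<Rightarrow> nat" where "k F = card (T F)"

lemma order:
  assumes "F \<in> \<Phi>"
  shows "bij_betw (\<tau> F) {..<k F} (T F)" "inj_on (\<omega> F) {..<k F}" "\<omega> F (k F) = \<omega> F 0"
    "\<And>i. i < k F \<Longrightarrow> {a (Inr (F, \<tau> F i)), b (Inr (F, \<tau> F i))} = {\<omega> F i, \<omega> F (Suc i)}" "2 \<le> k F"
proof -
  have "order_data F (ord F)" unfolding ord_def using order_data_ex[OF assms] by (rule someI_ex)
  then show "bij_betw (\<tau> F) {..<k F} (T F)" "inj_on (\<omega> F) {..<k F}" "\<omega> F (k F) = \<omega> F 0"
    "\<And>i. i < k F \<Longrightarrow> {a (Inr (F, \<tau> F i)), b (Inr (F, \<tau> F i))} = {\<omega> F i, \<omega> F (Suc i)}"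
    unfolding order_data_def \<tau>_def \<omega>_def k_def by (auto simp: case_prod_beta)
  show "2 \<le> k F" using T(2)[OF assms] by (simp add: k_def)
qed

lemma \<tau>_in: "F \<in> \<Phi> \<Longrightarrow> i < k F \<Longrightarrow> \<tau> F i \<in> T F"
  using bij_betwE[OF order(1)] by auto

lemma \<tau>_V: "F \<in> \<Phi> \<Longrightarrow> i < k F \<Longrightarrow> \<tau> F i \<in> V"
  using \<tau>_in T(1) by blast

lemma \<tau>_inj: "F \<in> \<Phi> \<Longrightarrow> i < k F \<Longrightarrow> j < k F \<Longrightarrow> \<tau> F i = \<tau> F j \<longleftrightarrow> i = j"
  using order(1) unfolding bij_betw_def inj_on_def by auto

lemma \<omega>_inj: "F \<in> \<Phi> \<Longrightarrow> i < k F \<Longrightarrow> j < k F \<Longrightarrow> \<omega> F i = \<omega> F j \<longleftrightarrow> i = j"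
  using order(2) unfolding inj_on_def by auto

lemma T_obtain: "F \<in> \<Phi> \<Longrightarrow> v \<in> T F \<Longrightarrow> \<exists>i<k F. v = \<tau> F i"
  using order(1) unfolding bij_betw_def by auto

lemma \<omega>_wedge:
  assumes "F \<in> \<Phi>" "F' \<in> \<Phi>" "i < k F" "j < k F'" "\<omega> F i = \<omega> F' j"
  shows "F = F'" "i = j"
proof -
  show "F = F'"
  proof (rule ccontr)
    assume "F \<noteq> F'"
    have "\<omega> F i \<in> {a (Inr (F, \<tau> F i)), b (Inr (F, \<tau> F i))}" using order(4)[OF assms(1,3)] by simp
    moreover have "\<omega> F' j \<in> {a (Inr (F', \<tau> F' j)), b (Inr (F', \<tau> F' j))}" using order(4)[OF assms(2,4)] by simp
    ultimately show False
      using wedges[OF assms(1,2) \<tau>_in[OF assms(1,3)] \<tau>_in[OF assms(2,4)] \<open>F \<noteq> F'\<close>] assms(5) by auto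
  qed
  then show "i = j" using \<omega>_inj assms by blast
qed

definition arc_spokes :: "'f \<Rightarrow> nat \<Rightarrow> nat \<Rightarrow> ('e + 'f \<times> 'v) set" where
  "arc_spokes F i j = (\<lambda>l. Inr (F, \<tau> F l)) ` {i..<j}"

lemma arc_spokes_bdry:
  assumes "F \<in> \<Phi>" "i \<le> j" "j \<le> k F"
  shows "bdry a b (arc_spokes F i j) = sym_diff {\<omega> F i} {\<omega> F j}"
  using assms(2,3)
proof (induction j rule: dec_induct)
  case base
  then show ?case by (simp add: arc_spokes_def)
next
  case (step j)
  let ?x = "Inr (F, \<tau> F j)"
  have eq: "arc_spokes F i (Suc j) = insert ?x (arc_spokes F i j)"
    unfolding arc_spokes_def using step.hyps by (simp add: atLeastLessThanSuc)
  have nin: "?x \<notin> arc_spokes F i j"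
  proof
    assume "?x \<in> arc_spokes F i j"
    then obtain l where "i \<le> l" "l < j" "\<tau> F l = \<tau> F j" by (auto simp: arc_spokes_def)
    then show False using \<tau>_inj[OF assms(1), of l j] step.prems by simp
  qed
  have "sym_diff {a ?x} {b ?x} = sym_diff {\<omega> F j} {\<omega> F (Suc j)}"
    by (rule doubleton_sym_diff[OF order(4)[OF assms(1)]]) (use step.prems in simp)
  moreover have "bdry a b (arc_spokes F i j) = sym_diff {\<omega> F i} {\<omega> F j}" using step by simp
  moreover have "finite (arc_spokes F i j)" by (simp add: arc_spokes_def)
  ultimately have "bdry a b (arc_spokes F i (Suc j)) = sym_diff (sym_diff {\<omega> F j} {\<omega> F (Suc j)}) (sym_diff {\<omega> F i} {\<omega> F j})"
    unfolding eq using bdry_insert[OF _ nin, of a b] by (simp only:)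
  also have "\<dots> = sym_diff {\<omega> F i} {\<omega> F (Suc j)}" by (rule sym_diff_chain)
  finally show ?case .
qed

text \<open>With all hubs outside the shore \<open>S\<close>, the edges of the bond and the spokes
  to \<open>S\<close> form an even dual set; without the spokes of \<open>F\<close>, its odd
  vertices are the wedges of \<open>F\<close> where membership in \<open>S\<close> changes. Joining
  two of these wedges and closing up through consecutive spokes of \<open>F\<close> gives another
  primal cut. Its supply edges lie in the bond, so by minimality they are the whole bond, and on
  \<open>F\<close> the new shore is an interval up to complement.\<close>

lemma bond_interval:
  assumes D: "cut p q E S \<noteq> {}"
    and min: "\<And>S'. cut p q E S' \<subseteq> cut p q E S \<Longrightarrow> cut p q E S' \<noteq> {} \<Longrightarrow> cut p q E S' = cut p q E S"
    and F: "F \<in> \<Phi>"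
  shows "\<exists>c1 c2. (\<forall>i<k F. \<tau> F i \<in> S \<longleftrightarrow> c1 \<le> i \<and> i < c2) \<or> (\<forall>i<k F. \<tau> F i \<notin> S \<longleftrightarrow> c1 \<le> i \<and> i < c2)"
proof -
  define XS where "XS = cut P Q X (Inl ` S)"
  define PF where "PF = {x \<in> XS. \<exists>v. x = Inr (F, v)}"
  define J where "J = XS - PF"
  have XSX: "XS \<subseteq> X" unfolding XS_def by (rule cut_subset)
  have finXS: "finite XS" using XSX finite_X by (rule finite_subset)
  have PFXS: "PF \<subseteq> XS" by (auto simp: PF_def)
  have PF: "Inr (F, v) \<in> PF \<longleftrightarrow> v \<in> S" if "v \<in> T F" for v
    using cut_spoke[OF F that, of "Inl ` S"] by (auto simp: PF_def XS_def)
  have PFs: "PF \<subseteq> spokes F" using XSX by (auto simp: PF_def spokes_def)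
  have bXS: "bdry a b XS = {}" unfolding XS_def by (rule primal_cut_dual_even[OF finite_X dual])
  have finJ: "finite J" unfolding J_def using finXS by simp
  have bJ: "bdry a b J = bdry a b PF"
    unfolding J_def using bdry_Diff[OF finXS PFXS, of a b] bXS by simp
  show ?thesis
  proof (cases "bdry a b PF = {}")
    case True
    then have "PF = {} \<or> PF = spokes F" using spokes_minimal[OF F PFs] by blast
    then show ?thesis
    proof
      assume "PF = {}"
      then have "\<forall>i<k F. \<tau> F i \<in> S \<longleftrightarrow> 0 \<le> i \<and> i < 0" using PF \<tau>_in[OF F] by auto
      then show ?thesis by blast
    next
      assume "PF = spokes F"
      then have "\<forall>i<k F. \<tau> F i \<in> S \<longleftrightarrow> 0 \<le> i \<and> i < k F" using PF \<tau>_in[OF F] by (auto simp: spokes_def)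
      then show ?thesis by blast
    qed
  next
    case False
    have sub: "bdry a b PF \<subseteq> \<omega> F ` {..<k F}"
    proof
      fix w assume "w \<in> bdry a b PF"
      then have "w \<in> a ` spokes F \<union> b ` spokes F"
        using bdry_subset[of a b PF] image_mono[OF PFs, of a] image_mono[OF PFs, of b] by blast
      then obtain v where v: "v \<in> T F" "w \<in> {a (Inr (F, v)), b (Inr (F, v))}" unfolding spokes_def by blast
      then obtain i where i: "i < k F" "v = \<tau> F i" using T_obtain[OF F] by blast
      then have "w = \<omega> F i \<or> w = \<omega> F (Suc i)" using order(4)[OF F i(1)] v(2) by auto
      moreover have "\<omega> F (Suc i) \<in> \<omega> F ` {..<k F}"
      proof (cases "Suc i = k F")
        case True
        then have "\<omega> F (Suc i) = \<omega> F 0" using order(3)[OF F] by simp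
        then show ?thesis using i by auto
      qed (use i in auto)
      ultimately show "w \<in> \<omega> F ` {..<k F}" using i by auto
    qed
    obtain o1 where o1: "o1 \<in> bdry a b J" using False bJ by blast
    obtain J1 o2 where J1: "J1 \<subseteq> J" "o2 \<in> bdry a b J" "o2 \<noteq> o1" "bdry a b J1 = {o1, o2}"
      using exists_subjoin[OF finJ o1] by metis
    obtain i1 i2 where i12: "i1 < k F" "i2 < k F" "o1 = \<omega> F i1" "o2 = \<omega> F i2" using o1 J1(2) sub bJ by blast
    define i where "i = min i1 i2"
    define j where "j = max i1 i2"
    have "i1 \<noteq> i2" using i12 J1(3) by auto
    then have ij: "i < j" "j < k F" "{o1, o2} = {\<omega> F i, \<omega> F j}" using i12 J1(3) by (auto simp: i_def j_def min_def max_def)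
    define A where "A = arc_spokes F i j"
    have Jno: "Inr (F, v) \<notin> J1" for v using J1(1) by (auto simp: J_def PF_def)
    have disj: "J1 \<inter> A = {}" using Jno by (auto simp: A_def arc_spokes_def)
    have finJ1: "finite J1" using J1(1) finJ by (rule finite_subset)
    have finA: "finite A" by (simp add: A_def arc_spokes_def)
    have AX: "A \<subseteq> X" unfolding A_def arc_spokes_def using \<tau>_in[OF F] ij F by auto
    have "\<omega> F i \<noteq> \<omega> F j" using \<omega>_inj[OF F, of i j] ij by simp
    then have bA: "bdry a b A = {o1, o2}"
      unfolding A_def using arc_spokes_bdry[OF F, of i j] ij by auto
    have ev1: "bdry a b (J1 \<union> A) = {}" using bdry_Un[OF finJ1 finA disj, of a b] bA J1(4) by simp
    have sub1: "J1 \<union> A \<subseteq> X" using J1(1) XSX AX unfolding J_def by blast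
    obtain S1 where S1: "J1 \<union> A = cut P Q X S1" by (rule dual_even_is_cut[OF finite_X dual sub1 ev1])
    have inA: "Inr (F, \<tau> F l) \<in> A \<longleftrightarrow> i \<le> l \<and> l < j" if "l < k F" for l
    proof
      assume "Inr (F, \<tau> F l) \<in> A"
      then obtain l' where "l' \<in> {i..<j}" "\<tau> F l = \<tau> F l'" unfolding A_def arc_spokes_def by blast
      then show "i \<le> l \<and> l < j" using \<tau>_inj[OF F that, of l'] ij by simp
    next
      assume "i \<le> l \<and> l < j"
      then have "l \<in> {i..<j}" by simp
      then show "Inr (F, \<tau> F l) \<in> A" unfolding A_def arc_spokes_def by blast
    qed
    have spoke: "(Inr F \<in> S1) \<noteq> (Inl (\<tau> F l) \<in> S1) \<longleftrightarrow> i \<le> l \<and> l < j" if "l < k F" for l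
    proof -
      have "Inr (F, \<tau> F l) \<in> cut P Q X S1 \<longleftrightarrow> Inr (F, \<tau> F l) \<in> A" using S1 Jno by blast
      then show ?thesis using cut_spoke[OF F \<tau>_in[OF F that], of S1] inA[OF that] by simp
    qed
    let ?S1 = "{v. Inl v \<in> S1}"
    have D1: "cut p q E ?S1 \<subseteq> cut p q E S"
    proof
      fix e assume e: "e \<in> cut p q E ?S1"
      then have "Inl e \<in> J1 \<union> A" using cut_edges S1 by blast
      then have "Inl e \<in> XS" using J1(1) by (auto simp: A_def arc_spokes_def J_def)
      then show "e \<in> cut p q E S" using cut_edges[of e "Inl ` S"] by (auto simp: XS_def image_iff)
    qed
    \<comment> \<open>Of the positions \<open>i\<close> and \<open>j\<close> only \<open>i\<close>
      belongs to the interval, so the new shore separates two terminals of a connected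
      graph.\<close>
    have ne: "cut p q E ?S1 \<noteq> {}"
    proof
      assume ce: "cut p q E ?S1 = {}"
      have same: "Inl u \<in> S1 \<longleftrightarrow> Inl v \<in> S1" if "u \<in> V" "v \<in> V" for u v
        using connected_cut_empty[OF fin(1) linked[OF that] ce] by simp
      have "Inl (\<tau> F i) \<in> S1 \<longleftrightarrow> Inl (\<tau> F j) \<in> S1" using same \<tau>_V[OF F] ij by simp
      then show False using spoke[of i] spoke[of j] ij by auto
    qed
    have ce: "cut p q E (sym_diff ?S1 S) = {}" using min[OF D1 ne] cut_sym_diff[of p q E ?S1 S] by simp
    have same: "u \<in> sym_diff ?S1 S \<longleftrightarrow> v \<in> sym_diff ?S1 S" if "u \<in> V" "v \<in> V" for u v
      by (rule connected_cut_empty[OF fin(1) linked[OF that] ce])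
    have "\<tau> F l \<in> S \<longleftrightarrow> (Inl (\<tau> F l) \<in> S1) \<noteq> (\<tau> F i \<in> sym_diff ?S1 S)" if "l < k F" for l
      using same[of "\<tau> F l" "\<tau> F i"] \<tau>_V[OF F] that ij by auto
    then have eq: "\<tau> F l \<in> S \<longleftrightarrow> ((i \<le> l \<and> l < j) \<noteq> (Inr F \<in> S1)) \<noteq> (\<tau> F i \<in> sym_diff ?S1 S)" if "l < k F" for l
      using spoke[OF that] that by blast
    show ?thesis
    proof (cases "(Inr F \<in> S1) = (\<tau> F i \<in> sym_diff ?S1 S)")
      case True
      then have "\<forall>l<k F. \<tau> F l \<in> S \<longleftrightarrow> i \<le> l \<and> l < j" using eq by blast
      then show ?thesis by blast
    next
      case False
      then have "\<forall>l<k F. \<tau> F l \<notin> S \<longleftrightarrow> i \<le> l \<and> l < j" using eq by blast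
      then show ?thesis by blast
    qed
  qed
qed

end

section \<open>Non-crossing demands\<close>

context hub_graph
begin

lemma hub_bdry_vertex:
  assumes "Z \<subseteq> X"
  shows "Inl v \<in> bdry P Q Z \<longleftrightarrow> (v \<in> bdry p q {e. Inl e \<in> Z}) \<noteq> odd (card {F. Inr (F, v) \<in> Z})"
proof -
  have 1: "{x \<in> Z. P x = Inl v} = Inl ` {e \<in> {e. Inl e \<in> Z}. p e = v}"
  proof (rule set_eqI)
    fix x show "x \<in> {x \<in> Z. P x = Inl v} \<longleftrightarrow> x \<in> Inl ` {e \<in> {e. Inl e \<in> Z}. p e = v}"
    proof (cases x)
      case (Inr y)
      then show ?thesis by (cases y) auto
    qed auto
  qed
  have 2: "{x \<in> Z. Q x = Inl v} = Inl ` {e \<in> {e. Inl e \<in> Z}. q e = v} \<union> (\<lambda>F. Inr (F, v)) ` {F. Inr (F, v) \<in> Z}"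
  proof (rule set_eqI)
    fix x show "x \<in> {x \<in> Z. Q x = Inl v} \<longleftrightarrow> x \<in> Inl ` {e \<in> {e. Inl e \<in> Z}. q e = v} \<union> (\<lambda>F. Inr (F, v)) ` {F. Inr (F, v) \<in> Z}"
    proof (cases x)
      case (Inr y)
      then show ?thesis by (cases y) auto
    qed auto
  qed
  have finZ: "finite Z" using assms finite_X by (rule finite_subset)
  have fe: "finite {e. Inl e \<in> Z}" using finite_vimageI[OF finZ, of Inl] by (simp add: vimage_def)
  have ff: "finite {F. Inr (F, v) \<in> Z}" using finite_vimageI[OF finZ, of "\<lambda>F. Inr (F, v)"] by (simp add: vimage_def inj_on_def)
  have "card {x \<in> Z. P x = Inl v} = card {e \<in> {e. Inl e \<in> Z}. p e = v}" unfolding 1 by (simp add: card_image)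
  moreover have "card {x \<in> Z. Q x = Inl v} = card {e \<in> {e. Inl e \<in> Z}. q e = v} + card {F. Inr (F, v) \<in> Z}"
    unfolding 2 using fe ff by (subst card_Un_disjoint) (auto simp: card_image inj_on_def)
  ultimately show ?thesis unfolding bdry_def by auto
qed

lemma hub_bdry_hub:
  assumes "Z \<subseteq> X"
  shows "Inr F \<in> bdry P Q Z \<longleftrightarrow> odd (card {v. Inr (F, v) \<in> Z})"
proof -
  have 1: "{x \<in> Z. P x = Inr F} = (\<lambda>v. Inr (F, v)) ` {v. Inr (F, v) \<in> Z}"
  proof (rule set_eqI)
    fix x show "x \<in> {x \<in> Z. P x = Inr F} \<longleftrightarrow> x \<in> (\<lambda>v. Inr (F, v)) ` {v. Inr (F, v) \<in> Z}"
    proof (cases x)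
      case (Inr y)
      then show ?thesis by (cases y) auto
    qed auto
  qed
  have 2: "{x \<in> Z. Q x = Inr F} = {}"
  proof (rule set_eqI)
    fix x show "x \<in> {x \<in> Z. Q x = Inr F} \<longleftrightarrow> x \<in> {}"
    proof (cases x)
      case (Inr y)
      then show ?thesis by (cases y) auto
    qed auto
  qed
  have "card {x \<in> Z. P x = Inr F} = card {v. Inr (F, v) \<in> Z}" unfolding 1 by (simp add: card_image inj_on_def)
  then show ?thesis unfolding bdry_def mem_Collect_eq 2 by simp
qed

end

text \<open>Pairwise non-crossing chords drawn inside the members of \<open>\<Phi>\<close>. The chord \<open>n\<close> joins the terminals at
  positions \<open>lo n\<close> and \<open>hi n\<close> and covers the wedges \<open>lo n + 1, \<dots>, hi n\<close>.\<close>

locale chords = hub_graph E V \<Phi> T p q a b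
  for E :: "'e set" and V :: "'v set" and \<Phi> :: "'f set" and T :: "'f \<Rightarrow> 'v set" and p q :: "'e \<Rightarrow> 'v"
    and a b :: "'e + 'f \<times> 'v \<Rightarrow> 'w" +
  fixes N :: "'n set" and fc :: "'n \<Rightarrow> 'f" and lo hi :: "'n \<Rightarrow> nat"
  assumes finN: "finite N"
    and fc: "\<And>n. n \<in> N \<Longrightarrow> fc n \<in> \<Phi>"
    and lohi: "\<And>n. n \<in> N \<Longrightarrow> lo n < hi n" "\<And>n. n \<in> N \<Longrightarrow> hi n < k (fc n)"
    and laminar: "\<And>n m. n \<in> N \<Longrightarrow> m \<in> N \<Longrightarrow> fc n = fc m \<Longrightarrow> lo n < lo m \<Longrightarrow> lo m < hi n \<Longrightarrow> hi m \<le> hi n"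
begin

text \<open>Width with an injective tie-break, so that parallel chords get a definite nesting order.
  The tie-break is at most \<open>card N\<close> and never outweighs a difference in width.\<close>

definition size :: "'n \<Rightarrow> nat" where
  "size n = (hi n - lo n) * Suc (card N) + (SOME f. inj_on f N \<and> f ` N \<subseteq> {..card N}) n"

lemma size:
  assumes "n \<in> N" "m \<in> N"
  shows "size n = size m \<longleftrightarrow> n = m" "hi n - lo n < hi m - lo m \<Longrightarrow> size n < size m"
proof -
  define f where "f = (SOME f. inj_on f N \<and> f ` N \<subseteq> {..card N})"
  have "\<exists>f. inj_on f N \<and> f ` N \<subseteq> {..card N}"
  proof -
    obtain f where "bij_betw f N {0..<card N}" using ex_bij_betw_finite_nat[OF finN] by blast
    then have "inj_on f N" "f ` N \<subseteq> {..card N}" unfolding bij_betw_def by auto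
    then show ?thesis by blast
  qed
  then have "inj_on f N \<and> f ` N \<subseteq> {..card N}" unfolding f_def by (rule someI_ex)
  then have f: "inj_on f N" "f n \<le> card N" "f m \<le> card N" using assms by auto
  have s: "size x = (hi x - lo x) * Suc (card N) + f x" for x by (simp add: size_def f_def)
  have mono: "size x < size y" if "hi x - lo x < hi y - lo y" "f x \<le> card N" for x y
  proof -
    have "size x < Suc (hi x - lo x) * Suc (card N)" unfolding s using that(2) by simp
    also have "\<dots> \<le> (hi y - lo y) * Suc (card N)" using that(1) by (intro mult_le_mono1) simp
    also have "\<dots> \<le> size y" unfolding s by simp
    finally show ?thesis .
  qed
  show "hi n - lo n < hi m - lo m \<Longrightarrow> size n < size m" using mono f by blast
  show "size n = size m \<longleftrightarrow> n = m"
  proof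
    assume eq: "size n = size m"
    then have "hi n - lo n = hi m - lo m" using mono[of n m] mono[of m n] f by (metis less_irrefl nat_neq_iff)
    then have "f n = f m" using eq unfolding s by simp
    then show "n = m" using f(1) assms by (auto dest: inj_onD)
  qed simp
qed

section \<open>Nesting of the chords\<close>

definition above :: "'n \<Rightarrow> 'n set" where
  "above n = {m \<in> N. fc m = fc n \<and> lo m \<le> lo n \<and> hi n \<le> hi m \<and> size n < size m}"

definition covering :: "'f \<Rightarrow> nat \<Rightarrow> 'n set" where
  "covering F i = {n \<in> N. fc n = F \<and> lo n < i \<and> i \<le> hi n}"

text \<open>The dual vertices of a face with chords are its cells: \<open>Inr n\<close> is the cell
  directly below chord \<open>n\<close>, and \<open>Inl (\<omega> F 0)\<close> is the outermost
  cell, because no chord covers wedge 0.\<close>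

definition innermost :: "'f \<Rightarrow> 'n set \<Rightarrow> 'w + 'n" where
  "innermost F A = (if A = {} then Inl (\<omega> F 0) else Inr (SOME n. n \<in> A \<and> (\<forall>m\<in>A. size n \<le> size m)))"

lemma innermost:
  assumes "A \<subseteq> N" "A \<noteq> {}"
  obtains n where "n \<in> A" "innermost F A = Inr n" "\<And>m. m \<in> A \<Longrightarrow> m = n \<or> size n < size m"
proof -
  have "finite A" using assms(1) finN by (rule finite_subset)
  then obtain n where "is_arg_min size (\<lambda>x. x \<in> A) n" using ex_is_arg_min_if_finite assms(2) by blast
  then have "n \<in> A \<and> (\<forall>m\<in>A. size n \<le> size m)" by (auto simp: is_arg_min_linorder)
  from someI[of "\<lambda>n. n \<in> A \<and> (\<forall>m\<in>A. size n \<le> size m)", OF this]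
  obtain n where n: "n \<in> A" "\<forall>m\<in>A. size n \<le> size m" "innermost F A = Inr n"
    using assms(2) unfolding innermost_def by (auto intro: exI)
  have "m = n \<or> size n < size m" if m: "m \<in> A" for m
    using n(1,2) m size(1)[of n m] assms(1) by (metis le_neq_implies_less subsetD)
  then show thesis using that n by blast
qed

text \<open>Non-crossing chords over a common wedge form a chain, in which \<open>size\<close>
  decides the outer one.\<close>

lemma covering_nested:
  assumes "n \<in> covering F i" "m \<in> covering F i" "size n < size m"
  shows "m \<in> above n"
proof -
  have n: "n \<in> N" "fc n = F" "lo n < i" "i \<le> hi n" and m: "m \<in> N" "fc m = F" "lo m < i" "i \<le> hi m"
    using assms by (auto simp: covering_def)
  have ns: "\<not> hi m - lo m < hi n - lo n" using size(2)[OF m(1) n(1)] assms(3) by auto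
  have "lo m \<le> lo n"
  proof (rule ccontr)
    assume "\<not> lo m \<le> lo n"
    then have l: "lo n < lo m" by simp
    have "hi m \<le> hi n" by (rule laminar[OF n(1) m(1)]) (use n m l in auto)
    then show False using l ns lohi(1)[OF m(1)] lohi(1)[OF n(1)] by linarith
  qed
  moreover have "hi n \<le> hi m"
  proof (cases "lo m < lo n")
    case True
    show ?thesis by (rule laminar[OF m(1) n(1)]) (use n m True in auto)
  next
    case False
    then have "lo m = lo n" using calculation by simp
    then show ?thesis using ns lohi(1)[OF m(1)] lohi(1)[OF n(1)] by linarith
  qed
  ultimately show ?thesis using n m assms(3) by (simp add: above_def)
qed

lemma above_covering: "n \<in> N \<Longrightarrow> insert n (above n) \<subseteq> covering (fc n) (hi n)"
  using lohi(1)[of n] by (auto simp: above_def covering_def)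

lemma above_trans: "m \<in> above n \<Longrightarrow> m' \<in> above m \<Longrightarrow> m' \<in> above n"
  by (auto simp: above_def)

lemma above_innermost:
  assumes n: "n \<in> N" "above n \<noteq> {}"
  obtains m where "m \<in> above n" "innermost (fc n) (above n) = Inr m" "above n = insert m (above m)"
proof -
  have "above n \<subseteq> N" by (auto simp: above_def)
  from innermost[OF this n(2), of "fc n"]
  obtain m where m: "m \<in> above n" "innermost (fc n) (above n) = Inr m"
    "\<And>m'. m' \<in> above n \<Longrightarrow> m' = m \<or> size m < size m'" by metis
  have "above n = insert m (above m)"
  proof (intro equalityI subsetI)
    fix m' assume m': "m' \<in> above n"
    show "m' \<in> insert m (above m)"
    proof (cases "m' = m")
      case False
      then have "m' \<in> above m"
        using covering_nested[of m "fc n" "hi n" m'] above_covering[OF n(1)] m m' by blast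
      then show ?thesis by simp
    qed simp
  next
    fix m' assume "m' \<in> insert m (above m)"
    then show "m' \<in> above n" using m(1) above_trans by blast
  qed
  then show thesis using that m by blast
qed

lemma covering_innermost:
  assumes "covering F i \<noteq> {}"
  obtains n where "n \<in> covering F i" "innermost F (covering F i) = Inr n" "covering F i = insert n (above n)"
proof -
  have "covering F i \<subseteq> N" by (auto simp: covering_def)
  from innermost[OF this assms, of F]
  obtain n where n: "n \<in> covering F i" "innermost F (covering F i) = Inr n"
    "\<And>m. m \<in> covering F i \<Longrightarrow> m = n \<or> size n < size m" by metis
  have "covering F i = insert n (above n)"
  proof (intro equalityI subsetI)
    fix m assume m: "m \<in> covering F i"
    then show "m \<in> insert n (above n)" using n covering_nested[OF n(1) m] by blast
  next
    fix m assume "m \<in> insert n (above n)"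
    then show "m \<in> covering F i" using n(1) by (auto simp: above_def covering_def)
  qed
  then show thesis using that n by blast
qed

lemma finite_covering: "finite (covering F i)" and finite_above: "finite (above n)"
  using finN by (auto simp: covering_def above_def)

section \<open>The graph with chords and its dual\<close>

definition X' :: "('e + 'n) set" where "X' = Inl ` E \<union> Inr ` N"

definition p' :: "'e + 'n \<Rightarrow> 'v" where
  "p' x = (case x of Inl e \<Rightarrow> p e | Inr n \<Rightarrow> \<tau> (fc n) (lo n))"

definition q' :: "'e + 'n \<Rightarrow> 'v" where
  "q' x = (case x of Inl e \<Rightarrow> q e | Inr n \<Rightarrow> \<tau> (fc n) (hi n))"

lemma p'_q'_simps [simp]:
  "p' (Inl e) = p e" "p' (Inr n) = \<tau> (fc n) (lo n)" "q' (Inl e) = q e" "q' (Inr n) = \<tau> (fc n) (hi n)"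
  by (simp_all add: p'_def q'_def)

definition wedge_face :: "'w \<Rightarrow> 'f" where
  "wedge_face w = (SOME F. F \<in> \<Phi> \<and> (\<exists>i<k F. w = \<omega> F i))"

definition wedge_pos :: "'w \<Rightarrow> nat" where
  "wedge_pos w = (SOME i. i < k (wedge_face w) \<and> w = \<omega> (wedge_face w) i)"

text \<open>Erasing the hub and its spokes merges the wedges of a face into the cells between the
  chords; all other dual vertices stay.\<close>

definition cell :: "'w \<Rightarrow> 'w + 'n" where
  "cell w = (if \<exists>F i. F \<in> \<Phi> \<and> i < k F \<and> w = \<omega> F i
     then innermost (wedge_face w) (covering (wedge_face w) (wedge_pos w)) else Inl w)"

definition a' :: "'e + 'n \<Rightarrow> 'w + 'n" where
  "a' x = (case x of Inl e \<Rightarrow> cell (a (Inl e)) | Inr n \<Rightarrow> Inr n)"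

text \<open>A chord separates the cell below it from the cell below the next chord above it, or from
  the outermost cell.\<close>

definition b' :: "'e + 'n \<Rightarrow> 'w + 'n" where
  "b' x = (case x of Inl e \<Rightarrow> cell (b (Inl e)) | Inr n \<Rightarrow> innermost (fc n) (above n))"

lemma cell_wedge:
  assumes "F \<in> \<Phi>" "i \<le> k F"
  shows "cell (\<omega> F i) = innermost F (covering F i)"
proof -
  have *: "cell (\<omega> F i) = innermost F (covering F i)" if i: "i < k F" for i
  proof -
    have f: "wedge_face (\<omega> F i) = F" unfolding wedge_face_def
    proof (rule some_equality)
      show "F \<in> \<Phi> \<and> (\<exists>i'<k F. \<omega> F i = \<omega> F i')" using assms(1) i by blast
      fix F' assume "F' \<in> \<Phi> \<and> (\<exists>i'<k F'. \<omega> F i = \<omega> F' i')"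
      then show "F' = F" using \<omega>_wedge(1)[OF assms(1) _ i] by metis
    qed
    moreover have "wedge_pos (\<omega> F i) = i" unfolding wedge_pos_def f
    proof (rule some_equality)
      show "i < k F \<and> \<omega> F i = \<omega> F i" using i by simp
      fix i' assume "i' < k F \<and> \<omega> F i = \<omega> F i'"
      then show "i' = i" using \<omega>_inj[OF assms(1) i, of i'] by simp
    qed
    moreover have "\<exists>F' i'. F' \<in> \<Phi> \<and> i' < k F' \<and> \<omega> F i = \<omega> F' i'" using assms i by blast
    ultimately show ?thesis unfolding cell_def by simp
  qed
  show ?thesis
  proof (cases "i = k F")
    case True
    have "covering F (k F) = {}"
    proof -
      have "\<not> k F \<le> hi n" if "n \<in> N" "fc n = F" for n using lohi(2)[OF that(1)] that(2) by simp
      then show ?thesis by (auto simp: covering_def)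
    qed
    moreover have "covering F 0 = {}" by (auto simp: covering_def)
    moreover have "0 < k F" using order(5)[OF assms(1)] by simp
    ultimately show ?thesis using *[of 0] order(3)[OF assms(1)] True by simp
  qed (use * assms(2) in simp)
qed

lemma cell_other: "\<not> (\<exists>F i. F \<in> \<Phi> \<and> i < k F \<and> w = \<omega> F i) \<Longrightarrow> cell w = Inl w"
  unfolding cell_def by (rule if_not_P)

definition chords_at :: "'f \<Rightarrow> nat \<Rightarrow> 'n set" where
  "chords_at F i = {n \<in> N. fc n = F \<and> (lo n = i \<or> hi n = i)}"

text \<open>Passing the terminal at \<open>i\<close> leaves the chords that end there and enters
  those that start there.\<close>

lemma covering_step: "sym_diff (covering F i) (covering F (Suc i)) = chords_at F i"
  using lohi(1) by (fastforce simp: covering_def chords_at_def)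

lemma odd_covering_step:
  "odd (card {n \<in> chords_at F i. Inr n \<in> Z}) \<longleftrightarrow>
    odd (card {n \<in> covering F i. Inr n \<in> Z}) \<noteq> odd (card {n \<in> covering F (Suc i). Inr n \<in> Z})"
proof -
  have f: "finite {n \<in> covering F j. Inr n \<in> Z}" for j using finite_covering by simp
  have "{n \<in> chords_at F i. Inr n \<in> Z} = sym_diff {n \<in> covering F i. Inr n \<in> Z} {n \<in> covering F (Suc i). Inr n \<in> Z}"
    unfolding covering_step[symmetric] by blast
  then show ?thesis using odd_card_sym_diff[OF f f, of i "Suc i"] by simp
qed

text \<open>The ends of a chord are two different terminals, so the chords starting and those ending
  at \<open>v\<close> can be counted together, face by face; in each face \<open>v\<close> has at
  most one position.\<close>

lemma bdry_chords:
  assumes Z: "Z \<subseteq> X'"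
  shows "v \<in> bdry p' q' Z \<longleftrightarrow> (v \<in> bdry p q {e. Inl e \<in> Z}) \<noteq>
    odd (card {F \<in> \<Phi>. \<exists>i<k F. \<tau> F i = v \<and> odd (card {n \<in> chords_at F i. Inr n \<in> Z})})"
proof -
  have finZ: "finite Z" using Z fin(1) finN unfolding X'_def by (auto intro: finite_subset)
  have fe: "finite {e. Inl e \<in> Z}" using finite_vimageI[OF finZ, of Inl] by (simp add: vimage_def)
  have fn: "finite {n. Inr n \<in> Z}" using finite_vimageI[OF finZ, of Inr] by (simp add: vimage_def)
  have ZN: "n \<in> N" if "Inr n \<in> Z" for n using that Z by (auto simp: X'_def)
  let ?lo = "{n. Inr n \<in> Z \<and> \<tau> (fc n) (lo n) = v}" and ?hi = "{n. Inr n \<in> Z \<and> \<tau> (fc n) (hi n) = v}"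
  have 1: "{x \<in> Z. p' x = v} = Inl ` {e \<in> {e. Inl e \<in> Z}. p e = v} \<union> Inr ` ?lo"
  proof (rule set_eqI)
    fix x show " x \<in> {x \<in> Z. p' x = v} \<longleftrightarrow> x \<in> Inl ` {e \<in> {e. Inl e \<in> Z}. p e = v} \<union> Inr ` ?lo"
      by (cases x) (simp_all add: image_iff)
  qed
  have 2: "{x \<in> Z. q' x = v} = Inl ` {e \<in> {e. Inl e \<in> Z}. q e = v} \<union> Inr ` ?hi"
  proof (rule set_eqI)
    fix x show " x \<in> {x \<in> Z. q' x = v} \<longleftrightarrow> x \<in> Inl ` {e \<in> {e. Inl e \<in> Z}. q e = v} \<union> Inr ` ?hi"
      by (cases x) (simp_all add: image_iff)
  qed
  have fl: "finite ?lo" "finite ?hi" using fn by (auto intro: finite_subset[OF _ fn])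
  have c1: "card {x \<in> Z. p' x = v} = card {e \<in> {e. Inl e \<in> Z}. p e = v} + card ?lo"
    unfolding 1 using fe fl by (subst card_Un_disjoint) (auto simp: card_image)
  have c2: "card {x \<in> Z. q' x = v} = card {e \<in> {e. Inl e \<in> Z}. q e = v} + card ?hi"
    unfolding 2 using fe fl by (subst card_Un_disjoint) (auto simp: card_image)
  have disj: "?lo \<inter> ?hi = {}"
  proof -
    have False if "Inr n \<in> Z" "\<tau> (fc n) (lo n) = \<tau> (fc n) (hi n)" for n
      using \<tau>_inj[OF fc, of n "lo n" "hi n"] lohi[of n] ZN[OF that(1)] that(2) by auto
    then show ?thesis by (simp only: disjoint_iff mem_Collect_eq) blast
  qed
  have "v \<in> bdry p' q' Z \<longleftrightarrow> (v \<in> bdry p q {e. Inl e \<in> Z}) \<noteq> odd (card ?lo + card ?hi)"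
    unfolding bdry_def using c1 c2 by auto
  moreover have "card ?lo + card ?hi = card (?lo \<union> ?hi)" using fl disj by (simp add: card_Un_disjoint)
  moreover have "?lo \<union> ?hi = (\<Union>F\<in>\<Phi>. {n \<in> N. fc n = F \<and> Inr n \<in> Z \<and> (\<tau> F (lo n) = v \<or> \<tau> F (hi n) = v)})"
    using ZN fc by auto
  moreover have "card (\<Union>F\<in>\<Phi>. {n \<in> N. fc n = F \<and> Inr n \<in> Z \<and> (\<tau> F (lo n) = v \<or> \<tau> F (hi n) = v)}) =
      (\<Sum>F\<in>\<Phi>. card {n \<in> N. fc n = F \<and> Inr n \<in> Z \<and> (\<tau> F (lo n) = v \<or> \<tau> F (hi n) = v)})"
    using fin(3) finN by (intro card_UN_disjoint) auto
  moreover have "odd (\<Sum>F\<in>\<Phi>. card {n \<in> N. fc n = F \<and> Inr n \<in> Z \<and> (\<tau> F (lo n) = v \<or> \<tau> F (hi n) = v)}) \<longleftrightarrow>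
      odd (card {F \<in> \<Phi>. odd (card {n \<in> N. fc n = F \<and> Inr n \<in> Z \<and> (\<tau> F (lo n) = v \<or> \<tau> F (hi n) = v)})})"
    by (simp only: even_sum_iff[OF fin(3)])
  ultimately have main: "v \<in> bdry p' q' Z \<longleftrightarrow> (v \<in> bdry p q {e. Inl e \<in> Z}) \<noteq>
      odd (card {F \<in> \<Phi>. odd (card {n \<in> N. fc n = F \<and> Inr n \<in> Z \<and> (\<tau> F (lo n) = v \<or> \<tau> F (hi n) = v)})})"
    by (simp only:)
  have key: "odd (card {n \<in> N. fc n = F \<and> Inr n \<in> Z \<and> (\<tau> F (lo n) = v \<or> \<tau> F (hi n) = v)}) \<longleftrightarrow>
      (\<exists>i<k F. \<tau> F i = v \<and> odd (card {n \<in> chords_at F i. Inr n \<in> Z}))" if F: "F \<in> \<Phi>" for F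
  proof (cases "\<exists>i<k F. \<tau> F i = v")
    case True
    then obtain i where i: "i < k F" "\<tau> F i = v" by blast
    have lk: "lo n < k F" "hi n < k F" if "n \<in> N" "fc n = F" for n
      using lohi[OF that(1)] that(2) by auto
    have "{n \<in> N. fc n = F \<and> Inr n \<in> Z \<and> (\<tau> F (lo n) = v \<or> \<tau> F (hi n) = v)} = {n \<in> chords_at F i. Inr n \<in> Z}"
      unfolding chords_at_def i(2)[symmetric] using \<tau>_inj[OF F _ i(1)] lk by blast
    moreover have "j = i" if "j < k F" "\<tau> F j = v" for j using \<tau>_inj[OF F that(1) i(1)] that(2) i(2) by simp
    moreover have "(\<exists>i'<k F. \<tau> F i' = v \<and> odd (card {n \<in> chords_at F i'. Inr n \<in> Z})) \<longleftrightarrow>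
        odd (card {n \<in> chords_at F i. Inr n \<in> Z})"
    proof (intro iffI)
      assume "\<exists>i'<k F. \<tau> F i' = v \<and> odd (card {n \<in> chords_at F i'. Inr n \<in> Z})"
      then obtain i' where "i' < k F" "\<tau> F i' = v" "odd (card {n \<in> chords_at F i'. Inr n \<in> Z})" by (elim exE conjE)
      then show "odd (card {n \<in> chords_at F i. Inr n \<in> Z})" using calculation(2)[of i'] by simp
    next
      assume "odd (card {n \<in> chords_at F i. Inr n \<in> Z})"
      then show "\<exists>i'<k F. \<tau> F i' = v \<and> odd (card {n \<in> chords_at F i'. Inr n \<in> Z})" using i by (intro exI[of _ i] conjI)
    qed
    ultimately show ?thesis by simp
  next
    case False
    have "\<not> (\<tau> F (lo n) = v \<or> \<tau> F (hi n) = v)" if "n \<in> N" "fc n = F" for n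
      using False lohi[OF that(1)] that(2) by (metis order.strict_trans)
    then have "{n \<in> N. fc n = F \<and> Inr n \<in> Z \<and> (\<tau> F (lo n) = v \<or> \<tau> F (hi n) = v)} = {}" by blast
    then have "\<not> odd (card {n \<in> N. fc n = F \<and> Inr n \<in> Z \<and> (\<tau> F (lo n) = v \<or> \<tau> F (hi n) = v)})" by (simp only: card.empty) simp
    moreover have "\<not> (\<exists>i<k F. \<tau> F i = v \<and> odd (card {n \<in> chords_at F i. Inr n \<in> Z}))" using False by (simp only: not_ex de_Morgan_conj) blast
    ultimately show ?thesis by (simp only:)
  qed
  have "{F \<in> \<Phi>. odd (card {n \<in> N. fc n = F \<and> Inr n \<in> Z \<and> (\<tau> F (lo n) = v \<or> \<tau> F (hi n) = v)})} = {F \<in> \<Phi>. (\<exists>i<k F. \<tau> F i = v \<and> odd (card {n \<in> chords_at F i. Inr n \<in> Z}))}"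
    by (rule Collect_cong) (rule conj_cong[OF refl key])
  then show ?thesis using main by (simp only:)
qed

text \<open>Every chord is replaced by the two spokes at its ends, added modulo 2. This keeps the
  parity of the degree at every vertex and makes every hub even, so evenness is transported between
  the graph with chords and the graph with hubs.\<close>

definition to_spokes :: "('e + 'n) set \<Rightarrow> ('e + 'f \<times> 'v) set" where
  "to_spokes Z = Inl ` {e. Inl e \<in> Z} \<union>
     {Inr (F, \<tau> F i) | F i. F \<in> \<Phi> \<and> i < k F \<and> odd (card {n \<in> chords_at F i. Inr n \<in> Z})}"

lemma to_spokes_edge [simp]: "Inl e \<in> to_spokes Z \<longleftrightarrow> Inl e \<in> Z"
  by (auto simp: to_spokes_def)

lemma to_spokes_spoke:
  "Inr (F, v) \<in> to_spokes Z \<longleftrightarrow> F \<in> \<Phi> \<and> (\<exists>i<k F. \<tau> F i = v \<and> odd (card {n \<in> chords_at F i. Inr n \<in> Z}))"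
  by (auto simp: to_spokes_def)

lemma to_spokes_at:
  "F \<in> \<Phi> \<Longrightarrow> i < k F \<Longrightarrow> Inr (F, \<tau> F i) \<in> to_spokes Z \<longleftrightarrow> odd (card {n \<in> chords_at F i. Inr n \<in> Z})"
  unfolding to_spokes_spoke using \<tau>_inj by blast

lemma to_spokes_X: "Z \<subseteq> X' \<Longrightarrow> to_spokes Z \<subseteq> X"
proof
  fix x assume "Z \<subseteq> X'" "x \<in> to_spokes Z"
  then show "x \<in> X" unfolding to_spokes_def X'_def using \<tau>_in by auto
qed

lemma bdry_to_spokes:
  assumes Z: "Z \<subseteq> X'"
  shows "v \<in> bdry p' q' Z \<longleftrightarrow> Inl v \<in> bdry P Q (to_spokes Z)"
proof -
  have "{F. Inr (F, v) \<in> to_spokes Z} = {F \<in> \<Phi>. \<exists>i<k F. \<tau> F i = v \<and> odd (card {n \<in> chords_at F i. Inr n \<in> Z})}"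
    unfolding to_spokes_spoke by blast
  then show ?thesis
    using bdry_chords[OF Z, of v] hub_bdry_vertex[OF to_spokes_X[OF Z], of v] by simp
qed

text \<open>The parities of the chords at successive positions telescope to those over the wedges 0
  and \<open>k F\<close>, which no chord covers.\<close>

lemma to_spokes_hub:
  assumes Z: "Z \<subseteq> X'"
  shows "Inr F \<notin> bdry P Q (to_spokes Z)"
proof (cases "F \<in> \<Phi>")
  case False
  then have "{v. Inr (F, v) \<in> to_spokes Z} = {}" by (simp add: to_spokes_spoke)
  then show ?thesis using hub_bdry_hub[OF to_spokes_X[OF Z], of F] by simp
next
  case True
  have "{v. Inr (F, v) \<in> to_spokes Z} = \<tau> F ` {i \<in> {..<k F}. odd (card {n \<in> chords_at F i. Inr n \<in> Z})}"
    unfolding to_spokes_spoke using True by blast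
  moreover have "inj_on (\<tau> F) {i \<in> {..<k F}. odd (card {n \<in> chords_at F i. Inr n \<in> Z})}"
    using \<tau>_inj[OF True] by (auto simp: inj_on_def)
  ultimately have "card {v. Inr (F, v) \<in> to_spokes Z} = card {i \<in> {..<k F}. odd (card {n \<in> chords_at F i. Inr n \<in> Z})}"
    by (simp add: card_image)
  moreover have "even (card {i \<in> {..<k F}. odd (card {n \<in> chords_at F i. Inr n \<in> Z})}) \<longleftrightarrow>
      even (\<Sum>i<k F. card {n \<in> chords_at F i. Inr n \<in> Z})"
    using even_sum_iff[of "{..<k F}" "\<lambda>i. card {n \<in> chords_at F i. Inr n \<in> Z}"] by simp
  moreover have "even (\<Sum>i<j. card {n \<in> chords_at F i. Inr n \<in> Z}) \<longleftrightarrow>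
      (odd (card {n \<in> covering F 0. Inr n \<in> Z}) = odd (card {n \<in> covering F j. Inr n \<in> Z}))" for j
  proof (induction j)
    case (Suc j)
    then show ?case using odd_covering_step[of F j Z] by auto
  qed simp
  moreover have "covering F 0 = {}" "covering F (k F) = {}" using lohi(2) by (fastforce simp: covering_def)+
  ultimately have "even (card {v. Inr (F, v) \<in> to_spokes Z})" by simp
  then show ?thesis using hub_bdry_hub[OF to_spokes_X[OF Z], of F] by simp
qed

text \<open>Crossing the boundaries of all chords above a cell leads to the outermost cell.\<close>

lemma cell_parity:
  assumes Y: "\<And>n. n \<in> N \<Longrightarrow> (Inr n \<in> Y) \<noteq> (innermost (fc n) (above n) \<in> Y) \<longleftrightarrow> Inr n \<in> Z"
  shows "n \<in> N \<Longrightarrow> Inr n \<in> Y \<longleftrightarrow> (Inl (\<omega> (fc n) 0) \<in> Y) \<noteq> odd (card {m \<in> insert n (above n). Inr m \<in> Z})"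
    "innermost F (covering F i) \<in> Y \<longleftrightarrow> (Inl (\<omega> F 0) \<in> Y) \<noteq> odd (card {m \<in> covering F i. Inr m \<in> Z})"
proof -
  show 1: "Inr n \<in> Y \<longleftrightarrow> (Inl (\<omega> (fc n) 0) \<in> Y) \<noteq> odd (card {m \<in> insert n (above n). Inr m \<in> Z})" if "n \<in> N" for n
    using that
  proof (induction "card (above n)" arbitrary: n rule: less_induct)
    case (less n)
    have nn: "n \<notin> above n" by (simp add: above_def)
    have f: "finite {m \<in> above n. Inr m \<in> Z}" using finite_above by simp
    have "{m \<in> insert n (above n). Inr m \<in> Z} = (if Inr n \<in> Z then insert n {m \<in> above n. Inr m \<in> Z} else {m \<in> above n. Inr m \<in> Z})"
      by auto
    then have odd: "odd (card {m \<in> insert n (above n). Inr m \<in> Z}) \<longleftrightarrow> (Inr n \<in> Z) \<noteq> odd (card {m \<in> above n. Inr m \<in> Z})"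
      using nn f by simp
    show ?case
    proof (cases "above n = {}")
      case True
      then have "innermost (fc n) (above n) = Inl (\<omega> (fc n) 0)" by (simp add: innermost_def)
      then show ?thesis using Y[OF less.prems] odd True by auto
    next
      case False
      obtain m where m: "m \<in> above n" "innermost (fc n) (above n) = Inr m" "above n = insert m (above m)"
        by (rule above_innermost[OF less.prems False])
      have mN: "m \<in> N" "fc m = fc n" using m(1) by (auto simp: above_def)
      have "m \<notin> above m" by (simp add: above_def)
      then have "card (above m) < card (above n)" using m(3) finite_above[of m] by simp
      then have "Inr m \<in> Y \<longleftrightarrow> (Inl (\<omega> (fc n) 0) \<in> Y) \<noteq> odd (card {m' \<in> above n. Inr m' \<in> Z})"
        using less.hyps[of m] mN m(3) by simp
      then show ?thesis using Y[OF less.prems] odd m(2) by auto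
    qed
  qed
  show "innermost F (covering F i) \<in> Y \<longleftrightarrow> (Inl (\<omega> F 0) \<in> Y) \<noteq> odd (card {m \<in> covering F i. Inr m \<in> Z})"
  proof (cases "covering F i = {}")
    case True
    then show ?thesis by (simp add: innermost_def)
  next
    case False
    obtain n where n: "n \<in> covering F i" "innermost F (covering F i) = Inr n" "covering F i = insert n (above n)"
      by (rule covering_innermost[OF False])
    have "n \<in> N" "fc n = F" using n(1) by (auto simp: covering_def)
    then show ?thesis using 1[of n] n(2,3) by simp
  qed
qed

text \<open>Chords correspond to spokes under \<open>to_spokes\<close>, and wedges to cells under
  \<open>cell\<close>. A cut of cells, pulled back to the dual with hubs, is cut out by the
  corresponding spokes; conversely a shore in that dual extends to the cells below the chords by
  counting the crossed chords modulo 2.\<close>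

lemma chords_dual: "dual_pair X' p' q' a' b'"
  unfolding dual_pair_def
proof (intro conjI allI impI)
  fix Y' :: "('w + 'n) set"
  define Z where "Z = cut a' b' X' Y'"
  have ZX: "Z \<subseteq> X'" unfolding Z_def by (rule cut_subset)
  have zN: "(Inr n \<in> Y') \<noteq> (innermost (fc n) (above n) \<in> Y') \<longleftrightarrow> Inr n \<in> Z" if "n \<in> N" for n
    using that by (auto simp: Z_def cut_def a'_def b'_def X'_def)
  have "to_spokes Z = cut a b X {w. cell w \<in> Y'}"
  proof (rule set_eqI)
    fix x
    show "x \<in> to_spokes Z \<longleftrightarrow> x \<in> cut a b X {w. cell w \<in> Y'}"
    proof (cases x)
      case (Inl e)
      then show ?thesis by (auto simp: Z_def cut_def a'_def b'_def X'_def)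
    next
      case (Inr y)
      obtain F v where y: "y = (F, v)" by (cases y)
      show ?thesis
      proof (cases "F \<in> \<Phi> \<and> v \<in> T F")
        case False
        then have "x \<notin> to_spokes Z" using \<tau>_in by (auto simp: Inr y to_spokes_spoke)
        moreover have "x \<notin> X" using False by (simp add: Inr y)
        ultimately show ?thesis by (auto simp: cut_def)
      next
        case True
        then obtain i where i: "i < k F" "v = \<tau> F i" using T_obtain by blast
        have F: "F \<in> \<Phi>" using True by simp
        have "x \<in> cut a b X {w. cell w \<in> Y'} \<longleftrightarrow> (cell (a x) \<in> Y') \<noteq> (cell (b x) \<in> Y')"
          using True by (simp add: cut_def Inr y)
        also have "\<dots> \<longleftrightarrow> (cell (\<omega> F i) \<in> Y') \<noteq> (cell (\<omega> F (Suc i)) \<in> Y')"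
          using order(4)[OF F i(1)] by (auto simp: Inr y i(2) doubleton_eq_iff)
        also have "\<dots> \<longleftrightarrow> odd (card {m \<in> covering F i. Inr m \<in> Z}) \<noteq> odd (card {m \<in> covering F (Suc i). Inr m \<in> Z})"
          using cell_wedge[OF F, of i] cell_wedge[OF F, of "Suc i"] i(1) cell_parity(2)[OF zN] by auto
        also have "\<dots> \<longleftrightarrow> x \<in> to_spokes Z"
          using odd_covering_step[of F i Z] to_spokes_at[OF F i(1), of Z] by (simp add: Inr y i(2))
        finally show ?thesis by simp
      qed
    qed
  qed
  then have "bdry P Q (to_spokes Z) = {}" using dual by (simp add: dual_pair_def)
  then have "v \<notin> bdry p' q' Z" for v using bdry_to_spokes[OF ZX, of v] by simp
  then show "bdry p' q' (cut a' b' X' Y') = {}" unfolding Z_def by (intro equals0I) (simp only:)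
next
  fix Z assume Z: "Z \<subseteq> X'" "bdry p' q' Z = {}"
  have "bdry P Q (to_spokes Z) = {}"
  proof -
    have "x \<notin> bdry P Q (to_spokes Z)" for x
      using bdry_to_spokes[OF Z(1)] to_spokes_hub[OF Z(1)] Z(2) by (cases x) auto
    then show ?thesis by blast
  qed
  then have "\<exists>Y. to_spokes Z = cut a b X Y"
    by (rule dual[unfolded dual_pair_def, THEN conjunct2, rule_format, OF to_spokes_X[OF Z(1)]])
  then obtain Y where Y: "to_spokes Z = cut a b X Y" ..
  define Y' where "Y' = Inl ` Y \<union> Inr ` {n \<in> N. (\<omega> (fc n) 0 \<in> Y) \<noteq> odd (card {m \<in> insert n (above n). Inr m \<in> Z})}"
  have YL: "Inl w \<in> Y' \<longleftrightarrow> w \<in> Y" for w by (auto simp: Y'_def)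
  have YR: "Inr n \<in> Y' \<longleftrightarrow> (\<omega> (fc n) 0 \<in> Y) \<noteq> odd (card {m \<in> insert n (above n). Inr m \<in> Z})" if "n \<in> N" for n
    using that by (auto simp: Y'_def)
  have zN: "(Inr n \<in> Y') \<noteq> (innermost (fc n) (above n) \<in> Y') \<longleftrightarrow> Inr n \<in> Z" if n: "n \<in> N" for n
  proof -
    have nn: "n \<notin> above n" by (simp add: above_def)
    have "{m \<in> insert n (above n). Inr m \<in> Z} = (if Inr n \<in> Z then insert n {m \<in> above n. Inr m \<in> Z} else {m \<in> above n. Inr m \<in> Z})"
      by auto
    then have odd: "odd (card {m \<in> insert n (above n). Inr m \<in> Z}) \<longleftrightarrow> (Inr n \<in> Z) \<noteq> odd (card {m \<in> above n. Inr m \<in> Z})"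
      using nn finite_above[of n] by simp
    have "innermost (fc n) (above n) \<in> Y' \<longleftrightarrow> (\<omega> (fc n) 0 \<in> Y) \<noteq> odd (card {m \<in> above n. Inr m \<in> Z})"
    proof (cases "above n = {}")
      case True
      then show ?thesis by (simp add: innermost_def YL)
    next
      case False
      obtain m where m: "m \<in> above n" "innermost (fc n) (above n) = Inr m" "above n = insert m (above m)"
        by (rule above_innermost[OF n False])
      have "m \<in> N" "fc m = fc n" using m(1) by (auto simp: above_def)
      then show ?thesis using YR[of m] m(2,3) by simp
    qed
    then show ?thesis using YR[OF n] odd by auto
  qed
  have wedge: "cell (\<omega> F i) \<in> Y' \<longleftrightarrow> \<omega> F i \<in> Y" if F: "F \<in> \<Phi>" and i: "i \<le> k F" for F i
  proof -
    have "\<omega> F i \<in> Y \<longleftrightarrow> (\<omega> F 0 \<in> Y) \<noteq> odd (card {m \<in> covering F i. Inr m \<in> Z})" using i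
    proof (induction i)
      case 0
      then show ?case by (simp add: covering_def)
    next
      case (Suc i)
      then have ik: "i < k F" by simp
      have "Inr (F, \<tau> F i) \<in> cut a b X Y \<longleftrightarrow> (\<omega> F i \<in> Y) \<noteq> (\<omega> F (Suc i) \<in> Y)"
        using order(4)[OF F ik] F \<tau>_in[OF F ik] by (auto simp: cut_def doubleton_eq_iff)
      then have "(\<omega> F i \<in> Y) \<noteq> (\<omega> F (Suc i) \<in> Y) \<longleftrightarrow> odd (card {n \<in> chords_at F i. Inr n \<in> Z})"
        using Y to_spokes_at[OF F ik, of Z] by simp
      then show ?case using Suc odd_covering_step[of F i Z] by auto
    qed
    then show ?thesis using cell_wedge[OF F i] cell_parity(2)[OF zN, of F i] YL by simp
  qed
  have cell: "cell w \<in> Y' \<longleftrightarrow> w \<in> Y" for w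
  proof (cases "\<exists>F i. F \<in> \<Phi> \<and> i < k F \<and> w = \<omega> F i")
    case True
    then obtain F i where "F \<in> \<Phi>" "i < k F" "w = \<omega> F i" by blast
    then show ?thesis using wedge[of F i] by simp
  next
    case False
    then show ?thesis using cell_other[OF False] YL by simp
  qed
  have "Z = cut a' b' X' Y'"
  proof (rule set_eqI)
    fix x
    show "x \<in> Z \<longleftrightarrow> x \<in> cut a' b' X' Y'"
    proof (cases x)
      case (Inl e)
      have "x \<in> cut a' b' X' Y' \<longleftrightarrow> Inl e \<in> cut a b X Y"
        by (auto simp: Inl cut_def a'_def b'_def X'_def cell)
      then show ?thesis using Y[symmetric] by (simp add: Inl)
    next
      case (Inr n)
      show ?thesis
      proof (cases "n \<in> N")
        case True
        then show ?thesis using zN[OF True] by (auto simp: Inr cut_def a'_def b'_def X'_def)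
      next
        case False
        then show ?thesis using Z(1) by (auto simp: Inr cut_def X'_def)
      qed
    qed
  qed
  then show "\<exists>Y. Z = cut a' b' X' Y" by (rule exI)
qed

text \<open>The bound for abstract duals, applied to supply edges and chords in one sum type.
  Distances and supply cuts involve supply edges alone, so the values 0 given to chords have no
  effect.\<close>

lemma chords_bound:
  assumes cutc: "\<And>S. card (cut (\<lambda>n. \<tau> (fc n) (lo n)) (\<lambda>n. \<tau> (fc n) (hi n)) N S) \<le> (\<Sum>e\<in>cut p q E S. c e)"
    and l: "\<And>e. e \<in> E \<Longrightarrow> 0 \<le> l e"
  shows "(\<Sum>n\<in>N. jdist p q E l (\<tau> (fc n) (lo n)) (\<tau> (fc n) (hi n))) \<le> (\<Sum>e\<in>E. real (c e) * l e)"
proof -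
  define c' where "c' x = (case x of Inl e \<Rightarrow> c e | Inr n \<Rightarrow> 0)" for x :: "'e + 'n"
  define l' where "l' x = (case x of Inl e \<Rightarrow> l e | Inr n \<Rightarrow> 0)" for x :: "'e + 'n"
  let ?E = "Inl ` E :: ('e + 'n) set" and ?N = "Inr ` N :: ('e + 'n) set"
  have cE: "cut p' q' ?E S = Inl ` cut p q E S" for S by (auto simp: cut_def p'_def q'_def)
  have cN: "cut p' q' ?N S = Inr ` cut (\<lambda>n. \<tau> (fc n) (lo n)) (\<lambda>n. \<tau> (fc n) (hi n)) N S" for S
    by (auto simp: cut_def p'_def q'_def)
  have b: "bdry p' q' (Inl ` J) = bdry p q J" for J :: "'e set"
  proof -
    have "{x \<in> Inl ` J. p' x = v} = Inl ` {e \<in> J. p e = v}" "{x \<in> Inl ` J. q' x = v} = Inl ` {e \<in> J. q e = v}" for v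
      by force+
    then show ?thesis unfolding bdry_def by (simp add: card_image)
  qed
  have jd: "jdist p' q' ?E l' u v = jdist p q E l u v" for u v
  proof -
    have eq: "{J. J \<subseteq> ?E \<and> bdry p' q' J = sym_diff {u} {v}} = image Inl ` {J. J \<subseteq> E \<and> bdry p q J = sym_diff {u} {v}}"
    proof (intro equalityI subsetI)
      fix K :: "('e + 'n) set" assume K: "K \<in> {J. J \<subseteq> ?E \<and> bdry p' q' J = sym_diff {u} {v}}"
      then obtain J where J: "J \<subseteq> E" "K = Inl ` J" by (auto simp: subset_image_iff)
      then show "K \<in> image Inl ` {J. J \<subseteq> E \<and> bdry p q J = sym_diff {u} {v}}" using K b[of J] by auto
    next
      fix K :: "('e + 'n) set" assume "K \<in> image Inl ` {J. J \<subseteq> E \<and> bdry p q J = sym_diff {u} {v}}"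
      then obtain J where "J \<subseteq> E" "bdry p q J = sym_diff {u} {v}" "K = Inl ` J" by blast
      then show "K \<in> {J. J \<subseteq> ?E \<and> bdry p' q' J = sym_diff {u} {v}}" using b[of J] by auto
    qed
    have "sum l' (Inl ` J) = sum l J" for J by (simp add: sum.reindex l'_def)
    then show ?thesis unfolding jdist_def eq by (simp add: image_image)
  qed
  have "(\<Sum>n\<in>?N. jdist p' q' ?E l' (p' n) (q' n)) \<le> (\<Sum>e\<in>?E. real (c' e) * l' e)"
  proof (rule dual_pair_demand_bound)
    show "finite ?E" "finite ?N" using fin finN by auto
    show "?E \<inter> ?N = {}" by auto
    show "dual_pair (?E \<union> ?N) p' q' a' b'" using chords_dual by (simp add: X'_def)
    show "card (cut p' q' ?N S) \<le> (\<Sum>e\<in>cut p' q' ?E S. c' e)" for S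
      using cutc[of S] unfolding cE cN by (simp add: card_image sum.reindex c'_def)
    show "\<And>e. e \<in> ?E \<Longrightarrow> 0 \<le> l' e" using l by (auto simp: l'_def)
  qed
  then show ?thesis by (simp add: sum.reindex jd p'_def q'_def c'_def l'_def)
qed

end

section \<open>Permutations and non-crossing matchings\<close>

definition nc_matching :: "(nat \<times> nat) set \<Rightarrow> bool" where
  "nc_matching M \<longleftrightarrow> finite M \<and> (\<forall>u v. (u, v) \<in> M \<longrightarrow> u < v) \<and>
     (\<forall>u v u' v'. (u, v) \<in> M \<longrightarrow> (u', v') \<in> M \<longrightarrow> (u, v) \<noteq> (u', v') \<longrightarrow>
        u \<noteq> u' \<and> v \<noteq> v' \<and> u \<noteq> v' \<and> v \<noteq> u' \<and> \<not> (u < u' \<and> u' < v \<and> v < v'))"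

lemma nc_matchingD:
  assumes "nc_matching M"
  shows "finite M" "(u, v) \<in> M \<Longrightarrow> u < v"
    "(u, v) \<in> M \<Longrightarrow> (u', v') \<in> M \<Longrightarrow> (u, v) \<noteq> (u', v') \<Longrightarrow>
        u \<noteq> u' \<and> v \<noteq> v' \<and> u \<noteq> v' \<and> v \<noteq> u' \<and> \<not> (u < u' \<and> u' < v \<and> v < v')"
proof -
  note a = assms[unfolded nc_matching_def]
  show "finite M" by (rule a[THEN conjunct1])
  show "u < v" if "(u, v) \<in> M" using that by (rule a[THEN conjunct2, THEN conjunct1, rule_format])
  show "u \<noteq> u' \<and> v \<noteq> v' \<and> u \<noteq> v' \<and> v \<noteq> u' \<and> \<not> (u < u' \<and> u' < v \<and> v < v')"
    if "(u, v) \<in> M" "(u', v') \<in> M" "(u, v) \<noteq> (u', v')"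
    using that by (rule a[THEN conjunct2, THEN conjunct2, rule_format])
qed

lemma nc_matchingI:
  assumes "finite M" "\<And>u v. (u, v) \<in> M \<Longrightarrow> u < v"
    "\<And>u v u' v'. (u, v) \<in> M \<Longrightarrow> (u', v') \<in> M \<Longrightarrow> (u, v) \<noteq> (u', v') \<Longrightarrow>
        u \<noteq> u' \<and> v \<noteq> v' \<and> u \<noteq> v' \<and> v \<noteq> u' \<and> \<not> (u < u' \<and> u' < v \<and> v < v')"
  shows "nc_matching M"
  unfolding nc_matching_def
proof (intro conjI)
  show "\<forall>u v. (u, v) \<in> M \<longrightarrow> u < v" by (intro allI impI assms(2))
  show "\<forall>u v u' v'. (u, v) \<in> M \<longrightarrow> (u', v') \<in> M \<longrightarrow> (u, v) \<noteq> (u', v') \<longrightarrow>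
        u \<noteq> u' \<and> v \<noteq> v' \<and> u \<noteq> v' \<and> v \<noteq> u' \<and> \<not> (u < u' \<and> u' < v \<and> v < v')"
    by (intro allI impI assms(3))
qed (rule assms(1))

text \<open>\<open>q\<close> stands for the gap between the positions \<open>q - 1\<close> and
  \<open>q\<close>, the same convention as for wedges and the chords covering them.\<close>

definition load :: "(nat \<times> nat) set \<Rightarrow> nat \<Rightarrow> nat" where
  "load M q = card {(u, v) \<in> M. u < q \<and> q \<le> v}"

definition total :: "(nat \<Rightarrow> nat \<Rightarrow> real) \<Rightarrow> (nat \<times> nat) set \<Rightarrow> real" where
  "total d M = (\<Sum>(u, v)\<in>M. d u v)"

text \<open>The matchings live on disjoint intervals, so at most one of them has pairs over a given
  gap: loads do not add up, while totals do.\<close>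

lemma nc_matching_Union:
  fixes K :: "nat set" and x y :: "nat \<Rightarrow> nat"
  assumes K: "finite K"
    and M: "\<And>j. j \<in> (K :: nat set) \<Longrightarrow> nc_matching (M j)" "\<And>j u v. j \<in> K \<Longrightarrow> (u, v) \<in> M j \<Longrightarrow> x j \<le> u \<and> v < y j"
    and disj: "\<And>i j. i \<in> K \<Longrightarrow> j \<in> K \<Longrightarrow> i < j \<Longrightarrow> y i \<le> x j"
    and load: "\<And>j. j \<in> K \<Longrightarrow> load (M j) q \<le> b q"
  shows "nc_matching (\<Union>j\<in>K. M j)" "load (\<Union>j\<in>K. M j) q \<le> b q"
    "total d (\<Union>j\<in>K. M j) = (\<Sum>j\<in>K. total d (M j))"
proof -
  have lt: "u < v" if "j \<in> K" "(u, v) \<in> M j" for j u v using nc_matchingD(2)[OF M(1)[OF that(1)] that(2)] .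
  have far: "v < u' \<or> v' < u" if "i \<in> K" "j \<in> K" "i \<noteq> j" "(u, v) \<in> M i" "(u', v') \<in> M j" for i j u v u' v'
  proof (cases "i < j")
    case True
    then show ?thesis using disj[OF that(1,2) True] M(2)[OF that(1,4)] M(2)[OF that(2,5)] by linarith
  next
    case False
    then have "j < i" using that(3) by simp
    then show ?thesis using disj[OF that(2,1)] M(2)[OF that(1,4)] M(2)[OF that(2,5)] by fastforce
  qed
  have fM: "finite (M j)" if "j \<in> K" for j using nc_matchingD(1)[OF M(1)[OF that]] .
  show "nc_matching (\<Union>j\<in>K. M j)"
  proof (rule nc_matchingI)
    show "finite (\<Union>j\<in>K. M j)" using K fM by (rule finite_UN_I)
  next
    fix u v assume "(u, v) \<in> (\<Union>j\<in>K. M j)"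
    then show "u < v" by (elim UN_E) (rule lt)
  next
    fix u v u' v' assume uv: "(u, v) \<in> (\<Union>j\<in>K. M j)" "(u', v') \<in> (\<Union>j\<in>K. M j)" and ne: "(u, v) \<noteq> (u', v')"
    from uv obtain i j where ij: "i \<in> K" "(u, v) \<in> M i" "j \<in> K" "(u', v') \<in> M j" by (elim UN_E)
    have l: "u < v" "u' < v'" using lt ij by auto
    show "u \<noteq> u' \<and> v \<noteq> v' \<and> u \<noteq> v' \<and> v \<noteq> u' \<and> \<not> (u < u' \<and> u' < v \<and> v < v')"
    proof (cases "i = j")
      case True
      then show ?thesis using nc_matchingD(3)[OF M(1)[OF ij(1)] ij(2) _ ne] ij(4) by simp
    next
      case False
      then show ?thesis using far[OF ij(1,3) False ij(2,4)] l by auto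
    qed
  qed
  show "load (\<Union>j\<in>K. M j) q \<le> b q"
  proof (cases "\<exists>j\<in>K. \<exists>u v. (u, v) \<in> M j \<and> u < q \<and> q \<le> v")
    case True
    then obtain j u v where j: "j \<in> K" "(u, v) \<in> M j" "u < q" "q \<le> v" by blast
    have "(u', v') \<in> M j" if "i \<in> K" "(u', v') \<in> M i" "u' < q" "q \<le> v'" for i u' v'
    proof (cases "i = j")
      case False
      then show ?thesis using far[OF that(1) j(1) False that(2) j(2)] that j by linarith
    qed (use that in simp)
    then have "{(u, v) \<in> (\<Union>j\<in>K. M j). u < q \<and> q \<le> v} \<subseteq> {(u, v) \<in> M j. u < q \<and> q \<le> v}" by auto
    moreover have "finite {(u, v) \<in> M j. u < q \<and> q \<le> v}" by (rule finite_subset[OF _ fM[OF j(1)]]) auto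
    ultimately have "load (\<Union>j\<in>K. M j) q \<le> load (M j) q" unfolding load_def by (intro card_mono)
    then show ?thesis using load[OF j(1)] by simp
  next
    case False
    then have "{(u, v) \<in> (\<Union>j\<in>K. M j). u < q \<and> q \<le> v} = {}" by auto
    then show ?thesis unfolding load_def by (simp only: card.empty le0)
  qed
  show "total d (\<Union>j\<in>K. M j) = (\<Sum>j\<in>K. total d (M j))"
    unfolding total_def
  proof (rule sum.UNION_disjoint[OF K])
    show "\<forall>i\<in>K. finite (M i)" by (intro ballI fM)
    have "M i \<inter> M j = {}" if "i \<in> K" "j \<in> K" "i \<noteq> j" for i j
    proof (rule ccontr)
      assume "M i \<inter> M j \<noteq> {}"
      then obtain u v where "(u, v) \<in> M i" "(u, v) \<in> M j" by auto
      then show False using far[OF that, of u v u v] lt[OF that(1), of u v] by simp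
    qed
    then show "\<forall>i\<in>K. \<forall>j\<in>K. i \<noteq> j \<longrightarrow> M i \<inter> M j = {}" by (intro ballI impI)
  qed
qed

section \<open>Antidiagonals of at least average weight\<close>

lemma average_le:
  fixes f :: "'b \<Rightarrow> real"
  assumes "finite S" "S \<noteq> {}"
  obtains s where "s \<in> S" "sum f S \<le> real (card S) * f s"
proof -
  have "Max (f ` S) \<in> f ` S" using assms by (intro Max_in) auto
  then obtain s where s: "s \<in> S" "f s = Max (f ` S)" by auto
  have "f x \<le> f s" if "x \<in> S" for x unfolding s(2) using assms(1) that by (intro Max_ge) auto
  then have "sum f S \<le> real (card S) * f s" by (rule sum_bounded_above)
  then show thesis using that s(1) by blast
qed

text \<open>Pairs with a fixed sum are nested, and one of the sums carries at least the average weight.\<close>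

lemma antidiagonal:
  fixes d :: "nat \<Rightarrow> nat \<Rightarrow> real"
  assumes d: "\<And>u v. u \<in> {x..<x + L} \<Longrightarrow> v \<in> {y..<y + L'} \<Longrightarrow> 0 \<le> d u v" and L: "0 < L"
  obtains s where "(\<Sum>u\<in>{x..<x + L}. \<Sum>v\<in>{y..<y + L'}. d u v) \<le>
    real (L + L') * (\<Sum>(u, v)\<in>{(u, v). u \<in> {x..<x + L} \<and> v \<in> {y..<y + L'} \<and> u + v = s}. d u v)"
proof -
  let ?A = "{x..<x + L} \<times> {y..<y + L'}"
  let ?S = "{x + y..<x + y + (L + L')}"
  let ?f = "\<lambda>s. \<Sum>(u, v)\<in>{(u, v). u \<in> {x..<x + L} \<and> v \<in> {y..<y + L'} \<and> u + v = s}. d u v"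
  have eq: "{(u, v). u \<in> {x..<x + L} \<and> v \<in> {y..<y + L'} \<and> u + v = s} = {z \<in> ?A. (\<lambda>(u, v). u + v) z = s}" for s by auto
  have "(\<Sum>s\<in>?S. ?f s) = (\<Sum>z\<in>?A. case z of (u, v) \<Rightarrow> d u v)"
    unfolding eq by (rule sum.group) auto
  also have "\<dots> = (\<Sum>u\<in>{x..<x + L}. \<Sum>v\<in>{y..<y + L'}. d u v)" by (subst sum.cartesian_product) simp
  finally have tot: "(\<Sum>s\<in>?S. ?f s) = (\<Sum>u\<in>{x..<x + L}. \<Sum>v\<in>{y..<y + L'}. d u v)" .
  obtain s where "(\<Sum>s\<in>?S. ?f s) \<le> real (card ?S) * ?f s"
    using average_le[of ?S ?f] L by auto
  then show thesis using that[of s] unfolding tot by simp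
qed

lemma nc_matching_antidiagonal:
  assumes "M \<subseteq> {(u, v). u < v \<and> u + v = s}" "finite M"
  shows "nc_matching M"
proof -
  have "u < v \<and> u + v = s" if "(u, v) \<in> M" for u v using assms(1) that by auto
  then have lt: "(u, v) \<in> M \<Longrightarrow> u < v" and sum: "(u, v) \<in> M \<Longrightarrow> u + v = s" for u v by simp_all
  have *: "u \<noteq> u' \<and> v \<noteq> v' \<and> u \<noteq> v' \<and> v \<noteq> u' \<and> \<not> (u < u' \<and> u' < v \<and> v < v')"
    if "(u, v) \<in> M" "(u', v') \<in> M" "(u, v) \<noteq> (u', v')" for u v u' v'
    using lt[OF that(1)] sum[OF that(1)] lt[OF that(2)] sum[OF that(2)] that(3) by auto
  show ?thesis by (rule nc_matchingI[OF assms(2)]) (erule lt, rule *)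
qed

text \<open>With a fixed sum either coordinate determines the pair.\<close>

lemma load_le_antidiagonal:
  assumes M: "M \<subseteq> {(u, v). u \<in> A \<and> v \<in> B \<and> u + v = s}" and "finite A" "finite B"
  shows "load M q \<le> card A" "load M q \<le> card B"
proof -
  let ?L = "{(u, v) \<in> M. u < q \<and> q \<le> v}"
  have mem: "u \<in> A" "v \<in> B" "u + v = s" if "(u, v) \<in> M" for u v using subsetD[OF M that] by simp_all
  have i1: "inj_on fst ?L" and i2: "inj_on snd ?L" by (rule inj_onI, auto dest!: mem(3))+
  have "card ?L = card (fst ` ?L)" using i1 by (simp add: card_image)
  also have "\<dots> \<le> card A" using assms(2) by (intro card_mono) (auto dest: mem(1))
  finally show "load M q \<le> card A" by (simp add: load_def)
  have "card ?L = card (snd ` ?L)" using i2 by (simp add: card_image)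
  also have "\<dots> \<le> card B" using assms(3) by (intro card_mono) (auto dest: mem(2))
  finally show "load M q \<le> card B" by (simp add: load_def)
qed

locale perm_metric =
  fixes n :: nat and \<sigma> :: "nat \<Rightarrow> nat" and d :: "nat \<Rightarrow> nat \<Rightarrow> real"
  assumes perm: "bij_betw \<sigma> {..<n} {..<n}"
    and d_nonneg: "\<And>u v. u < n \<Longrightarrow> v < n \<Longrightarrow> 0 \<le> d u v"
    and d_zero: "\<And>u. u < n \<Longrightarrow> d u u = 0"
    and d_sym: "\<And>u v. u < n \<Longrightarrow> v < n \<Longrightarrow> d u v = d v u"
    and d_tri: "\<And>u v w. u < n \<Longrightarrow> v < n \<Longrightarrow> w < n \<Longrightarrow> d u w \<le> d u v + d v w"
begin

definition h :: "nat \<Rightarrow> nat" where "h q = card {i. i < n \<and> i < q \<and> q \<le> \<sigma> i}"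

lemma \<sigma>_lt: "i < n \<Longrightarrow> \<sigma> i < n" using bij_betwE[OF perm] by auto

lemma \<sigma>_inj: "i < n \<Longrightarrow> j < n \<Longrightarrow> \<sigma> i = \<sigma> j \<longleftrightarrow> i = j"
  using perm unfolding bij_betw_def inj_on_def by auto

text \<open>A permutation moves as many positions up over a gap as down over it.\<close>

lemma h_back: "card {i. i < n \<and> q \<le> i \<and> \<sigma> i < q} = h q"
proof (cases "q \<le> n")
  case True
  have fin: "finite {i. i < n \<and> R i}" for R by simp
  have "bij_betw \<sigma> {i. i < n \<and> \<sigma> i < q} {..<q}"
  proof (rule bij_betw_subset[OF perm])
    show "\<sigma> ` {i. i < n \<and> \<sigma> i < q} = {..<q}"
    proof (intro equalityI subsetI)
      fix y assume "y \<in> {..<q}"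
      then have "y \<in> \<sigma> ` {..<n}" using True perm by (auto simp: bij_betw_def)
      then show "y \<in> \<sigma> ` {i. i < n \<and> \<sigma> i < q}" using \<open>y \<in> {..<q}\<close> by auto
    qed auto
  qed auto
  then have c: "card {i. i < n \<and> \<sigma> i < q} = q" using bij_betw_same_card by fastforce
  have "{i. i < n \<and> \<sigma> i < q} = {i. i < n \<and> i < q \<and> \<sigma> i < q} \<union> {i. i < n \<and> q \<le> i \<and> \<sigma> i < q}" by auto
  from arg_cong[OF this, of card]
  have "q = card ({i. i < n \<and> i < q \<and> \<sigma> i < q} \<union> {i. i < n \<and> q \<le> i \<and> \<sigma> i < q})" unfolding c .
  also have "\<dots> = card {i. i < n \<and> i < q \<and> \<sigma> i < q} + card {i. i < n \<and> q \<le> i \<and> \<sigma> i < q}"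
    by (rule card_Un_disjoint) auto
  finally have 1: "q = card {i. i < n \<and> i < q \<and> \<sigma> i < q} + card {i. i < n \<and> q \<le> i \<and> \<sigma> i < q}" .
  have "{..<q} = {i. i < n \<and> i < q \<and> \<sigma> i < q} \<union> {i. i < n \<and> i < q \<and> q \<le> \<sigma> i}"
  proof (rule set_eqI)
    fix i show "i \<in> {..<q} \<longleftrightarrow> i \<in> {i. i < n \<and> i < q \<and> \<sigma> i < q} \<union> {i. i < n \<and> i < q \<and> q \<le> \<sigma> i}"
      using True by (simp only: Un_iff mem_Collect_eq lessThan_iff) linarith
  qed
  from arg_cong[OF this, of card]
  have "card {..<q} = card ({i. i < n \<and> i < q \<and> \<sigma> i < q} \<union> {i. i < n \<and> i < q \<and> q \<le> \<sigma> i})" .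
  also have "\<dots> = card {i. i < n \<and> i < q \<and> \<sigma> i < q} + card {i. i < n \<and> i < q \<and> q \<le> \<sigma> i}"
    by (rule card_Un_disjoint) auto
  finally show ?thesis using 1 unfolding h_def by simp
next
  case False
  have a: "{i. i < n \<and> q \<le> i \<and> \<sigma> i < q} = {}" using False by auto
  have b: "{i. i < n \<and> i < q \<and> q \<le> \<sigma> i} = {}" using False \<sigma>_lt by fastforce
  show ?thesis unfolding h_def a b by simp
qed

lemma h_le: "h q \<le> n - q"
proof -
  have "h q = card (\<sigma> ` {i. i < n \<and> i < q \<and> q \<le> \<sigma> i})" unfolding h_def
    by (subst card_image) (auto simp: inj_on_def \<sigma>_inj)
  also have "\<dots> \<le> card {q..<n}" using \<sigma>_lt by (intro card_mono) auto
  finally show ?thesis by simp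
qed

lemma h_step: "h (Suc q) \<le> Suc (h q)" "h q \<le> Suc (h (Suc q))"
proof -
  have "{i. i < n \<and> i < Suc q \<and> Suc q \<le> \<sigma> i} \<subseteq> insert q {i. i < n \<and> i < q \<and> q \<le> \<sigma> i}" by auto
  then have "h (Suc q) \<le> card (insert q {i. i < n \<and> i < q \<and> q \<le> \<sigma> i})" unfolding h_def by (intro card_mono) auto
  also have "\<dots> \<le> Suc (h q)" unfolding h_def by (simp add: card_insert_if)
  finally show "h (Suc q) \<le> Suc (h q)" .
  have one: "card {i. i < n \<and> \<sigma> i = q} \<le> 1"
    by (rule card_le_Suc0_iff_eq[THEN iffD2, unfolded One_nat_def[symmetric]]) (auto simp: \<sigma>_inj[symmetric])
  have "{i. i < n \<and> i < q \<and> q \<le> \<sigma> i} \<subseteq> {i. i < n \<and> \<sigma> i = q} \<union> {i. i < n \<and> i < Suc q \<and> Suc q \<le> \<sigma> i}" by auto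
  then have "h q \<le> card ({i. i < n \<and> \<sigma> i = q} \<union> {i. i < n \<and> i < Suc q \<and> Suc q \<le> \<sigma> i})"
    unfolding h_def by (intro card_mono) auto
  also have "\<dots> \<le> card {i. i < n \<and> \<sigma> i = q} + h (Suc q)" unfolding h_def by (rule card_Un_le)
  finally show "h q \<le> Suc (h (Suc q))" using one by simp
qed

lemma h_lipschitz: "h (q + t) \<le> h q + t" "h q \<le> h (q + t) + t"
proof (induction t)
  case (Suc t)
  { case 1 then show ?case using Suc(1) h_step(1)[of "q + t"] by simp }
  { case 2 then show ?case using Suc(2) h_step(2)[of "q + t"] by simp }
qed simp_all

text \<open>Block lengths follow the load, so the load is constant up to a factor inside each block.\<close>

primrec bd :: "nat \<Rightarrow> nat" where
  "bd 0 = 0"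
| "bd (Suc j) = bd j + max 1 (h (bd j) div 4)"

definition len :: "nat \<Rightarrow> nat" where "len j = max 1 (h (bd j) div 4)"

lemma bd_Suc: "bd (Suc j) = bd j + len j" by (simp add: len_def)

declare bd.simps(2) [simp del]

lemma len_pos: "0 < len j" by (simp add: len_def)

lemma bd_strict: "i < j \<Longrightarrow> bd i < bd j"
proof (rule lift_Suc_mono_less[of bd])
  show "bd i < bd (Suc i)" for i unfolding bd_Suc using len_pos[of i] by linarith
qed

lemma bd_mono: "i \<le> j \<Longrightarrow> bd i \<le> bd j"
  using bd_strict[of i j] by (cases "i = j") auto

lemma bd_ge: "j \<le> bd j"
proof (induction j)
  case (Suc j)
  then show ?case using len_pos[of j] unfolding bd_Suc by linarith
qed simp

text \<open>The load at \<open>q\<close> is at most \<open>n - q\<close>, so no block overshoots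
  \<open>n\<close> and the last boundary is exactly \<open>n\<close>.\<close>

lemma bd_le: "bd j < n \<Longrightarrow> bd (Suc j) \<le> n"
  using h_le[of "bd j"] by (auto simp: max_def bd_Suc len_def)

definition m :: nat where "m = (LEAST j. n \<le> bd j)"

lemma bd_m: "bd m = n" "j < m \<Longrightarrow> bd j < n"
proof -
  have ex: "n \<le> bd n" by (rule bd_ge)
  have ge: "n \<le> bd m" unfolding m_def by (rule LeastI[of "\<lambda>j. n \<le> bd j", OF ex])
  show lt: "bd j < n" if "j < m" for j using not_less_Least[OF that[unfolded m_def]] by simp
  show "bd m = n"
  proof (cases m)
    case 0
    show ?thesis using ge unfolding 0 bd.simps(1) by (simp only: le_zero_eq)
  next
    case (Suc j)
    then show ?thesis using bd_le[OF lt[of j]] ge by simp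
  qed
qed

lemma bd_Suc_le: "j < m \<Longrightarrow> bd (Suc j) \<le> n"
  using bd_le bd_m(2) by blast

text \<open>A block takes a quarter of the load at its start. The load changes by at most 1 per
  step, so at least \<open>3 * len j\<close> of it is left anywhere in the block. Length 1 is
  excluded because the \<open>max\<close> may then exceed the load.\<close>

lemma block_load: "2 \<le> len j \<Longrightarrow> bd j \<le> q \<Longrightarrow> q \<le> bd (Suc j) \<Longrightarrow> len j \<le> h q"
proof -
  assume a: "2 \<le> len j" "bd j \<le> q" "q \<le> bd (Suc j)"
  then have l: "len j = h (bd j) div 4" by (simp add: len_def)
  have "h (bd j) \<le> h q + (q - bd j)" using h_lipschitz(2)[of "bd j" "q - bd j"] a by simp
  moreover have "q - bd j \<le> len j" using a by (simp add: bd_Suc)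
  moreover have "4 * len j \<le> h (bd j)" using l by simp
  ultimately show ?thesis by linarith
qed

text \<open>Rounding in the division by 4 costs less than a further factor 2 once the length is at
  least 1, hence 8; moving to the end of the block adds at most one more length.\<close>

lemma boundary_load: "h (bd (Suc j)) \<le> 9 * len j" "h (bd j) \<le> 8 * len j"
proof -
  show 8: "h (bd j) \<le> 8 * len j" unfolding len_def by linarith
  show "h (bd (Suc j)) \<le> 9 * len j"
    using h_lipschitz(1)[of "bd j" "len j"] 8 by (simp add: bd_Suc)
qed

lemma len_le_load: "0 < h (bd j) \<Longrightarrow> len j \<le> h (bd j)"
  unfolding len_def by linarith

definition blk :: "nat \<Rightarrow> nat set" where "blk j = {bd j..<bd j + len j}"

lemma blk_lt: "j < m \<Longrightarrow> u \<in> blk j \<Longrightarrow> u < n"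
  using bd_Suc_le[of j] by (auto simp: blk_def bd_Suc)

lemma card_blk [simp]: "card (blk j) = len j" "finite (blk j)"
  by (simp_all add: blk_def)

lemma blk_ex: "i < n \<Longrightarrow> \<exists>j<m. i \<in> blk j"
proof -
  assume i: "i < n"
  have ex: "\<exists>j. i < bd (Suc j)" using bd_ge[of "Suc i"] by (intro exI[of _ i]) simp
  define j where "j = (LEAST j. i < bd (Suc j))"
  have j: "i < bd (Suc j)" unfolding j_def by (rule LeastI_ex[OF ex])
  have least: "\<not> i < bd (Suc j')" if "j' < j" for j' using not_less_Least[OF that[unfolded j_def]] .
  have "bd j \<le> i"
  proof (cases j)
    case 0 then show ?thesis by simp
  next
    case (Suc j') then show ?thesis using least[of j'] by simp
  qed
  moreover have "j < m"
  proof (rule ccontr)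
    assume "\<not> j < m"
    then have "bd m \<le> bd j" by (intro bd_mono) simp
    then show False using bd_m(1) calculation i by simp
  qed
  ultimately show ?thesis using j by (intro exI[of _ j]) (simp add: blk_def bd_Suc)
qed

section \<open>Distances averaged over blocks\<close>

definition D :: "nat \<Rightarrow> nat \<Rightarrow> real" where "D i j = (\<Sum>u\<in>blk j. d i u) / real (len j)"
definition E :: "nat \<Rightarrow> real" where "E r = (\<Sum>u\<in>blk r. \<Sum>v\<in>blk (Suc r). d u v) / (real (len r) * real (len (Suc r)))"

lemma avg_le:
  assumes "j < m" "i < n" "y < n"
  shows "d i y \<le> D i j + D y j"
proof -
  have "(\<Sum>u\<in>blk j. d i y) \<le> (\<Sum>u\<in>blk j. d i u + d y u)"
    using d_tri[OF assms(2) _ assms(3)] d_sym[OF _ assms(3)] blk_lt[OF assms(1)] by (intro sum_mono) fastforce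
  then have "real (len j) * d i y \<le> (\<Sum>u\<in>blk j. d i u) + (\<Sum>u\<in>blk j. d y u)" by (simp add: sum.distrib)
  then have "d i y \<le> ((\<Sum>u\<in>blk j. d i u) + (\<Sum>u\<in>blk j. d y u)) / real (len j)"
    using len_pos[of j] by (simp add: field_simps)
  then show ?thesis by (simp add: D_def add_divide_distrib)
qed

text \<open>The triangle inequality through independent random points, one in each block from
  \<open>j\<close> to \<open>l\<close>; the expected distance between neighbouring points is
  \<open>E r\<close>.\<close>

lemma chain_le:
  assumes "j \<le> l" "l < m" "i < n" "y < n"
  shows "d i y \<le> D i j + (\<Sum>r\<in>{j..<l}. E r) + D y l"
  using assms(1,2,4)
proof (induction l arbitrary: y rule: dec_induct)
  case base
  then show ?case using avg_le[of j i y] assms(3) by simp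
next
  case (step l)
  have "D i (Suc l) \<le> (\<Sum>u\<in>blk (Suc l). D i j + (\<Sum>r\<in>{j..<l}. E r) + D u l) / real (len (Suc l))"
    unfolding D_def[of i "Suc l"] using step blk_lt[of "Suc l"] by (intro divide_right_mono sum_mono) auto
  also have "\<dots> = D i j + (\<Sum>r\<in>{j..<l}. E r) + (\<Sum>u\<in>blk (Suc l). D u l) / real (len (Suc l))"
    using len_pos[of "Suc l"] by (simp add: sum.distrib add_divide_distrib)
  also have "(\<Sum>u\<in>blk (Suc l). D u l) / real (len (Suc l)) = E l"
  proof -
    have "(\<Sum>u\<in>blk (Suc l). \<Sum>v\<in>blk l. d u v) = (\<Sum>v\<in>blk l. \<Sum>u\<in>blk (Suc l). d v u)"
      unfolding sum.swap[of _ "blk (Suc l)"] using step.prems(1) blk_lt[of l] blk_lt[of "Suc l"] d_sym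
      by (intro sum.cong) auto
    then show ?thesis unfolding E_def D_def by (simp add: sum_divide_distrib[symmetric] mult.commute)
  qed
  finally have "D i (Suc l) \<le> D i j + (\<Sum>r\<in>{j..<Suc l}. E r)" using step.hyps by simp
  moreover have "d i y \<le> D i (Suc l) + D y (Suc l)" using avg_le step.prems assms(3) by blast
  ultimately show ?case by simp
qed

definition sep :: "nat \<Rightarrow> nat \<Rightarrow> bool" where "sep i r \<longleftrightarrow> (i < bd (Suc r)) \<noteq> (\<sigma> i < bd (Suc r))"

lemma blk_lt_iff: "i \<in> blk j \<Longrightarrow> i < bd (Suc r) \<longleftrightarrow> j \<le> r"
proof
  assume i: "i \<in> blk j" "i < bd (Suc r)"
  show "j \<le> r"
  proof (rule ccontr)
    assume "\<not> j \<le> r"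
    then have "bd (Suc r) \<le> bd j" by (intro bd_mono) simp
    then show False using i by (auto simp: blk_def)
  qed
next
  assume i: "i \<in> blk j" "j \<le> r"
  have "bd (Suc j) \<le> bd (Suc r)" using i by (intro bd_mono) simp
  then show "i < bd (Suc r)" using i(1) by (auto simp: blk_def bd_Suc)
qed

lemma E_nonneg: "Suc r < m \<Longrightarrow> 0 \<le> E r"
  unfolding E_def using blk_lt[of r] blk_lt[of "Suc r"] d_nonneg
  by (intro divide_nonneg_nonneg sum_nonneg) auto

lemma single_le:
  assumes "i < n"
  shows "\<exists>j l. i \<in> blk j \<and> \<sigma> i \<in> blk l \<and> j < m \<and> l < m \<and> d i (\<sigma> i) \<le> D i j + D (\<sigma> i) l + (\<Sum>r | Suc r < m \<and> sep i r. E r)"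
proof -
  obtain j where j: "j < m" "i \<in> blk j" using blk_ex assms by blast
  obtain l where l: "l < m" "\<sigma> i \<in> blk l" using blk_ex \<sigma>_lt assms by blast
  have sep: "{r. Suc r < m \<and> sep i r} = {min j l..<max j l}"
  proof (rule set_eqI)
    fix r
    have "sep i r \<longleftrightarrow> (j \<le> r) \<noteq> (l \<le> r)" unfolding sep_def using blk_lt_iff[OF j(2)] blk_lt_iff[OF l(2)] by simp
    then show "r \<in> {r. Suc r < m \<and> sep i r} \<longleftrightarrow> r \<in> {min j l..<max j l}" using j(1) l(1) by auto
  qed
  have "d i (\<sigma> i) \<le> D i j + D (\<sigma> i) l + (\<Sum>r\<in>{min j l..<max j l}. E r)"
  proof (cases "j \<le> l")
    case True
    then show ?thesis using chain_le[OF True l(1) assms \<sigma>_lt[OF assms]] by simp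
  next
    case False
    then have "l \<le> j" by simp
    then have "d (\<sigma> i) i \<le> D (\<sigma> i) l + (\<Sum>r\<in>{l..<j}. E r) + D i j" using chain_le[of l j "\<sigma> i" i] j(1) assms \<sigma>_lt by blast
    then show ?thesis using False d_sym[OF assms \<sigma>_lt[OF assms]] by simp
  qed
  then show ?thesis using j l sep by auto
qed

definition J :: "nat \<Rightarrow> nat" where "J i = (THE j. i \<in> blk j)"

lemma J_eq: "i \<in> blk j \<Longrightarrow> J i = j"
  unfolding J_def
proof (rule the_equality)
  fix j' assume "i \<in> blk j" "i \<in> blk j'"
  then show "j' = j" using blk_lt_iff by (metis le_antisym le_refl)
qed

text \<open>The first factor 2 arises because both end terms have the same sum,
  \<open>\<sigma>\<close> being a permutation; the second because the boundary after block
  \<open>r\<close> is crossed \<open>h\<close> times in each direction.\<close>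

lemma perm_sum_le:
  "(\<Sum>i<n. d i (\<sigma> i)) \<le> 2 * (\<Sum>j<m. (\<Sum>u\<in>blk j. \<Sum>v\<in>blk j. d u v) / real (len j)) +
    (\<Sum>r | Suc r < m. 2 * real (h (bd (Suc r))) * E r)"
proof -
  have "(\<Sum>i<n. d i (\<sigma> i)) \<le> (\<Sum>i<n. D i (J i) + D (\<sigma> i) (J (\<sigma> i)) + (\<Sum>r | Suc r < m \<and> sep i r. E r))"
  proof (rule sum_mono)
    fix i assume "i \<in> {..<n}"
    then obtain j l where "i \<in> blk j" "\<sigma> i \<in> blk l" "d i (\<sigma> i) \<le> D i j + D (\<sigma> i) l + (\<Sum>r | Suc r < m \<and> sep i r. E r)"
      using single_le[of i] by blast
    moreover from this have "J i = j" "J (\<sigma> i) = l" using J_eq by simp_all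
    ultimately show "d i (\<sigma> i) \<le> D i (J i) + D (\<sigma> i) (J (\<sigma> i)) + (\<Sum>r | Suc r < m \<and> sep i r. E r)"
      by simp
  qed
  also have "\<dots> = (\<Sum>i<n. D i (J i)) + (\<Sum>i<n. D (\<sigma> i) (J (\<sigma> i))) + (\<Sum>i<n. \<Sum>r | Suc r < m \<and> sep i r. E r)"
    by (simp add: sum.distrib)
  also have "(\<Sum>i<n. D (\<sigma> i) (J (\<sigma> i))) = (\<Sum>i<n. D i (J i))"
    using sum.reindex_bij_betw[OF perm, of "\<lambda>i. D i (J i)"] .
  also have "(\<Sum>i<n. D i (J i)) = (\<Sum>j<m. (\<Sum>u\<in>blk j. \<Sum>v\<in>blk j. d u v) / real (len j))"
  proof -
    have fib: "{i \<in> {..<n}. J i = j} = blk j" if "j < m" for j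
      using J_eq blk_ex blk_lt[OF that] by fastforce
    have "(\<Sum>i<n. D i (J i)) = (\<Sum>j<m. \<Sum>i\<in>{i \<in> {..<n}. J i = j}. D i (J i))"
    proof (rule sum.group[symmetric])
      show "J ` {..<n} \<subseteq> {..<m}" using blk_ex J_eq by fastforce
    qed auto
    also have "\<dots> = (\<Sum>j<m. \<Sum>i\<in>blk j. D i j)"
      using fib J_eq by (intro sum.cong) auto
    finally show ?thesis unfolding D_def by (simp add: sum_divide_distrib)
  qed
  also have "(\<Sum>i<n. \<Sum>r | Suc r < m \<and> sep i r. E r) = (\<Sum>r | Suc r < m. 2 * real (h (bd (Suc r))) * E r)"
  proof -
    have fm: "finite {r. Suc r < m}" by (rule finite_subset[of _ "{..<m}"]) auto
    have "(\<Sum>i<n. \<Sum>r | Suc r < m \<and> sep i r. E r) = (\<Sum>i<n. \<Sum>r\<in>{r. Suc r < m}. if sep i r then E r else 0)"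
    proof (rule sum.cong[OF refl])
      fix i show "(\<Sum>r | Suc r < m \<and> sep i r. E r) = (\<Sum>r\<in>{r. Suc r < m}. if sep i r then E r else 0)"
        using sum.inter_filter[OF fm, of E "sep i"] by simp
    qed
    also have "\<dots> = (\<Sum>r\<in>{r. Suc r < m}. \<Sum>i<n. if sep i r then E r else 0)" by (rule sum.swap)
    also have "\<dots> = (\<Sum>r | Suc r < m. 2 * real (h (bd (Suc r))) * E r)"
    proof (rule sum.cong[OF refl])
      fix r
      let ?q = "bd (Suc r)"
      have "{i \<in> {..<n}. sep i r} = {i. i < n \<and> i < ?q \<and> ?q \<le> \<sigma> i} \<union> {i. i < n \<and> ?q \<le> i \<and> \<sigma> i < ?q}"
        by (auto simp: sep_def)
      then have "card {i \<in> {..<n}. sep i r} = card ({i. i < n \<and> i < ?q \<and> ?q \<le> \<sigma> i} \<union> {i. i < n \<and> ?q \<le> i \<and> \<sigma> i < ?q})" by simp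
      also have "\<dots> = card {i. i < n \<and> i < ?q \<and> ?q \<le> \<sigma> i} + card {i. i < n \<and> ?q \<le> i \<and> \<sigma> i < ?q}"
        by (rule card_Un_disjoint) auto
      also have "\<dots> = 2 * h ?q" unfolding h_back unfolding h_def by simp
      finally have c: "card {i \<in> {..<n}. sep i r} = 2 * h ?q" .
      have "(\<Sum>i<n. if sep i r then E r else 0) = (\<Sum>i\<in>{i \<in> {..<n}. sep i r}. E r)" by (subst sum.inter_filter) auto
      then show "(\<Sum>i<n. if sep i r then E r else 0) = 2 * real (h ?q) * E r" using c by simp
    qed
    finally show ?thesis .
  qed
  finally show ?thesis by simp
qed

text \<open>The constant is 4 = 2 * 2: there are \<open>2 * len j\<close> competing sums, and an
  antidiagonal of the block contains every pair in both orientations. A pair over some gap forces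
  length at least 2, where the load suffices.\<close>

lemma block_matching:
  assumes j: "j < m"
  obtains M where "nc_matching M" "M \<subseteq> {(u, v). u \<in> blk j \<and> v \<in> blk j}" "\<And>q. load M q \<le> h q"
    "(\<Sum>u\<in>blk j. \<Sum>v\<in>blk j. d u v) / real (len j) \<le> 4 * total d M"
proof -
  obtain s where s: "(\<Sum>u\<in>blk j. \<Sum>v\<in>blk j. d u v) \<le>
      real (len j + len j) * (\<Sum>(u, v)\<in>{(u, v). u \<in> blk j \<and> v \<in> blk j \<and> u + v = s}. d u v)"
    unfolding blk_def
    by (rule antidiagonal[of "bd j" "len j" "bd j" "len j" d, OF _ len_pos])
      (use d_nonneg blk_lt[OF j] in \<open>auto simp: blk_def\<close>)
  define M where "M = {(u, v). u \<in> blk j \<and> v \<in> blk j \<and> u + v = s \<and> u < v}"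
  define M' where "M' = {(u, v). u \<in> blk j \<and> v \<in> blk j \<and> u + v = s}"
  define W where "W = {(u, v). u \<in> blk j \<and> v \<in> blk j \<and> u + v = s \<and> u = v}"
  have M_iff: "(u, v) \<in> M \<longleftrightarrow> u \<in> blk j \<and> v \<in> blk j \<and> u + v = s \<and> u < v" for u v
    by (simp only: M_def mem_Collect_eq prod.case)
  have subM: "M \<subseteq> {(u, v). u < v \<and> u + v = s}" "M \<subseteq> {(u, v). u \<in> blk j \<and> v \<in> blk j}"
    "M \<subseteq> {(u, v). u \<in> blk j \<and> v \<in> blk j \<and> u + v = s}"
    by (intro subrelI; simp only: M_iff mem_Collect_eq prod.case simp_thms)+
  have fM': "finite M'" by (rule finite_subset[of _ "blk j \<times> blk j"]) (auto simp: M'_def)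
  have fM: "finite M" and fW: "finite W" using fM' by (auto intro: finite_subset[of _ M'] simp: M_def M'_def W_def)
  have "M' = M \<union> (\<lambda>(u, v). (v, u)) ` M \<union> W"
    unfolding M'_def M_def W_def by (auto simp: image_iff)
  then have "(\<Sum>(u, v)\<in>M'. d u v) = (\<Sum>(u, v)\<in>M \<union> (\<lambda>(u, v). (v, u)) ` M \<union> W. d u v)" by simp
  also have "\<dots> = (\<Sum>(u, v)\<in>M \<union> (\<lambda>(u, v). (v, u)) ` M. d u v) + (\<Sum>(u, v)\<in>W. d u v)"
    by (rule sum.union_disjoint) (use fM fW in \<open>auto simp: M_def W_def\<close>)
  also have "(\<Sum>(u, v)\<in>M \<union> (\<lambda>(u, v). (v, u)) ` M. d u v) = (\<Sum>(u, v)\<in>M. d u v) + (\<Sum>(u, v)\<in>(\<lambda>(u, v). (v, u)) ` M. d u v)"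
    by (rule sum.union_disjoint) (use fM in \<open>auto simp: M_def\<close>)
  also have "(\<Sum>(u, v)\<in>(\<lambda>(u, v). (v, u)) ` M. d u v) = (\<Sum>(u, v)\<in>M. d v u)"
    by (subst sum.reindex) (auto simp: inj_on_def case_prod_beta)
  also have "\<dots> = (\<Sum>(u, v)\<in>M. d u v)"
  proof (rule sum.cong[OF refl])
    fix z assume "z \<in> M"
    moreover obtain u v where z: "z = (u, v)" by (cases z)
    ultimately have "u < n" "v < n" using blk_lt[OF j] by (simp_all only: M_iff)
    then show "(case z of (u, v) \<Rightarrow> d v u) = (case z of (u, v) \<Rightarrow> d u v)" unfolding z prod.case by (rule d_sym[symmetric])
  qed
  also have "(\<Sum>(u, v)\<in>W. d u v) = 0"
  proof (rule sum.neutral, rule ballI)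
    fix z assume "z \<in> W"
    moreover obtain u v where z: "z = (u, v)" by (cases z)
    ultimately have "u \<in> blk j" "v = u" by (simp_all only: W_def mem_Collect_eq prod.case)
    then show "(case z of (u, v) \<Rightarrow> d u v) = 0" unfolding z prod.case using d_zero[OF blk_lt[OF j]] by simp
  qed
  finally have M': "(\<Sum>(u, v)\<in>M'. d u v) = 2 * total d M" by (simp add: total_def)
  show thesis
  proof (rule that[of M])
    show "nc_matching M" by (rule nc_matching_antidiagonal[OF subM(1) fM])
    show "M \<subseteq> {(u, v). u \<in> blk j \<and> v \<in> blk j}" by (rule subM(2))
    have "(\<Sum>u\<in>blk j. \<Sum>v\<in>blk j. d u v) \<le> 2 * real (len j) * (2 * total d M)"
      using s unfolding M'_def[symmetric] M' by (simp only: of_nat_add mult_2)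
    then show "(\<Sum>u\<in>blk j. \<Sum>v\<in>blk j. d u v) / real (len j) \<le> 4 * total d M"
      using len_pos[of j] by (simp add: field_simps)
    fix q
    have l: "load M q \<le> len j"
      using load_le_antidiagonal(1)[OF subM(3) card_blk(2) card_blk(2), of q] unfolding card_blk(1) .
    show "load M q \<le> h q"
    proof (cases "\<exists>(u, v)\<in>M. u < q \<and> q \<le> v")
      case True
      then obtain u v where "(u, v) \<in> M" "u < q" "q \<le> v" by (elim bexE) (auto split: prod.splits)
      then have uv: "u \<in> blk j" "v \<in> blk j" "u < q" "q \<le> v" by (simp_all only: M_iff)
      have "len j \<le> h q" using uv by (intro block_load) (auto simp: blk_def bd_Suc)
      then show ?thesis using l by (rule order_trans[rotated])
    next
      case False
      then have "{(u, v) \<in> M. u < q \<and> q \<le> v} = {}" by auto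
      then show ?thesis unfolding load_def by (simp only: card.empty le0)
    qed
  qed
qed

text \<open>The constant is 36 = 2 * 9 * 2: two directions, a boundary load of at most 9 times the
  smaller length, and \<open>len j + len (Suc j)\<close> competing sums, at most twice the larger
  length. For a boundary without load the left side is 0 and the empty matching does.\<close>

lemma cross_matching:
  assumes j: "Suc j < m"
  obtains M where "nc_matching M" "M \<subseteq> {(u, v). u \<in> blk j \<and> v \<in> blk (Suc j)}" "\<And>q. load M q \<le> h q"
    "2 * real (h (bd (Suc j))) * E j \<le> 36 * total d M"
proof (cases "h (bd (Suc j)) = 0")
  case True
  show thesis by (rule that[of "{}"]) (simp_all add: nc_matching_def load_def total_def True)
next
  case False
  let ?L = "len j" and ?L' = "len (Suc j)"
  have jm: "j < m" using j by simp
  obtain s where s: "(\<Sum>u\<in>blk j. \<Sum>v\<in>blk (Suc j). d u v) \<le>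
      real (?L + ?L') * (\<Sum>(u, v)\<in>{(u, v). u \<in> blk j \<and> v \<in> blk (Suc j) \<and> u + v = s}. d u v)"
    unfolding blk_def
    by (rule antidiagonal[of "bd j" "len j" "bd (Suc j)" "len (Suc j)" d, OF _ len_pos])
      (use d_nonneg blk_lt[OF jm] blk_lt[OF j] in \<open>auto simp: blk_def\<close>)
  define M where "M = {(u, v). u \<in> blk j \<and> v \<in> blk (Suc j) \<and> u + v = s}"
  have M_iff: "(u, v) \<in> M \<longleftrightarrow> u \<in> blk j \<and> v \<in> blk (Suc j) \<and> u + v = s" for u v
    by (simp only: M_def mem_Collect_eq prod.case)
  have fM: "finite M" by (rule finite_subset[of _ "blk j \<times> blk (Suc j)"]) (auto simp: M_def)
  have lt: "u < v" if "u \<in> blk j" "v \<in> blk (Suc j)" for u v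
    using that by (auto simp: blk_def bd_Suc)
  have subM: "M \<subseteq> {(u, v). u \<in> blk j \<and> v \<in> blk (Suc j)}"
    "M \<subseteq> {(u, v). u \<in> blk j \<and> v \<in> blk (Suc j) \<and> u + v = s}"
    by (intro subrelI; simp only: M_iff mem_Collect_eq prod.case simp_thms)+
  have subM': "M \<subseteq> {(u, v). u < v \<and> u + v = s}"
    by (intro subrelI) (simp only: M_iff mem_Collect_eq prod.case simp_thms lt)
  show thesis
  proof (rule that[of M])
    show "nc_matching M" by (rule nc_matching_antidiagonal[OF subM' fM])
    show "M \<subseteq> {(u, v). u \<in> blk j \<and> v \<in> blk (Suc j)}" by (rule subM(1))
    have tot: "0 \<le> total d M" unfolding total_def
    proof (rule sum_nonneg)
      fix z assume "z \<in> M"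
      moreover obtain u v where "z = (u, v)" by (cases z)
      ultimately show "0 \<le> (case z of (u, v) \<Rightarrow> d u v)"
        using d_nonneg[OF blk_lt[OF jm] blk_lt[OF j], of u v] by (simp add: M_def)
    qed
    have "E j * (real ?L * real ?L') \<le> real (?L + ?L') * total d M"
      using s len_pos[of j] len_pos[of "Suc j"] by (simp add: E_def M_def total_def)
    also have "\<dots> \<le> 2 * real (max ?L ?L') * total d M" using tot by (intro mult_right_mono) auto
    finally have "E j * (real ?L * real ?L') \<le> 2 * real (max ?L ?L') * total d M" .
    moreover have "real ?L * real ?L' = real (min ?L ?L') * real (max ?L ?L')" by (simp add: min_def max_def)
    ultimately have "real (max ?L ?L') * (E j * real (min ?L ?L')) \<le> real (max ?L ?L') * (2 * total d M)"
      by (simp add: algebra_simps)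
    then have Em: "E j * real (min ?L ?L') \<le> 2 * total d M"
      using len_pos[of j] by (subst (asm) mult_le_cancel_left_pos) auto
    have "h (bd (Suc j)) \<le> 9 * min ?L ?L'"
      using boundary_load(1)[of j] boundary_load(2)[of "Suc j"] by (simp add: min_def)
    then have "real (h (bd (Suc j))) \<le> 9 * real (min ?L ?L')" by linarith
    then have "2 * real (h (bd (Suc j))) * E j \<le> 2 * (9 * real (min ?L ?L')) * E j"
      using E_nonneg[OF j] by (intro mult_right_mono) auto
    also have "\<dots> \<le> 36 * total d M" using Em by simp
    finally show "2 * real (h (bd (Suc j))) * E j \<le> 36 * total d M" .
    fix q
    show "load M q \<le> h q"
    proof (cases "\<exists>(u, v)\<in>M. u < q \<and> q \<le> v")
      case True
      then obtain u v where "(u, v) \<in> M" "u < q" "q \<le> v" by (elim bexE) (auto split: prod.splits)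
      then have uv: "u \<in> blk j" "v \<in> blk (Suc j)" "u < q" "q \<le> v" by (simp_all only: M_iff)
      have l: "load M q \<le> ?L" "load M q \<le> ?L'"
        using load_le_antidiagonal[OF subM(2) card_blk(2) card_blk(2), of q] unfolding card_blk(1) .
      \<comment> \<open>Strictly inside either block the pair itself shows that the block has length
        at least 2; at the boundary a positive load bounds the length of the next block.\<close>
      consider "q < bd (Suc j)" | "q = bd (Suc j)" | "bd (Suc j) < q" by linarith
      then show ?thesis
      proof cases
        case 1
        then have "2 \<le> ?L" "bd j \<le> q" using uv by (auto simp: blk_def bd_Suc)
        then show ?thesis using block_load[of j q] 1 l by linarith
      next
        case 2
        then show ?thesis using len_le_load[of "Suc j"] False l by simp
      next
        case 3
        then have "2 \<le> ?L'" "q \<le> bd (Suc (Suc j))" using uv by (auto simp: blk_def bd_Suc[of "Suc j"])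
        then show ?thesis using block_load[of "Suc j" q] 3 l by linarith
      qed
    next
      case False
      then have "{(u, v) \<in> M. u < q \<and> q \<le> v} = {}" by auto
      then show ?thesis unfolding load_def by (simp only: card.empty le0)
    qed
  qed
qed

text \<open>One matching collects the pairs inside blocks. The pairs between neighbouring blocks are
  divided by the parity of the first block, so that the intervals within one matching are
  disjoint.\<close>

theorem permutation_matchings:
  "\<exists>M1 M2 M3. (\<forall>M\<in>{M1, M2, M3}. nc_matching M \<and> M \<subseteq> {..<n} \<times> {..<n} \<and> (\<forall>q. load M q \<le> h q)) \<and>
    (\<Sum>i<n. d i (\<sigma> i)) \<le> 8 * total d M1 + 36 * (total d M2 + total d M3)"
proof -
  have "\<forall>j\<in>{..<m}. \<exists>M. nc_matching M \<and> M \<subseteq> {(u, v). u \<in> blk j \<and> v \<in> blk j} \<and> (\<forall>q. load M q \<le> h q) \<and>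
      (\<Sum>u\<in>blk j. \<Sum>v\<in>blk j. d u v) / real (len j) \<le> 4 * total d M"
  proof
    fix j assume "j \<in> {..<m}"
    then have "j < m" by simp
    then show "\<exists>M. nc_matching M \<and> M \<subseteq> {(u, v). u \<in> blk j \<and> v \<in> blk j} \<and> (\<forall>q. load M q \<le> h q) \<and>
      (\<Sum>u\<in>blk j. \<Sum>v\<in>blk j. d u v) / real (len j) \<le> 4 * total d M"
    proof (rule block_matching)
      fix M assume "nc_matching M" "M \<subseteq> {(u, v). u \<in> blk j \<and> v \<in> blk j}" "\<And>q. load M q \<le> h q" "(\<Sum>u\<in>blk j. \<Sum>v\<in>blk j. d u v) / real (len j) \<le> 4 * total d M"
      then show ?thesis by (intro exI[of _ M] conjI allI)
    qed
  qed
  from bchoice[OF this] obtain A where A: "\<forall>j\<in>{..<m}. nc_matching (A j) \<and> A j \<subseteq> {(u, v). u \<in> blk j \<and> v \<in> blk j} \<and>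
      (\<forall>q. load (A j) q \<le> h q) \<and> (\<Sum>u\<in>blk j. \<Sum>v\<in>blk j. d u v) / real (len j) \<le> 4 * total d (A j)" ..
  have "\<forall>j\<in>{j. Suc j < m}. \<exists>M. nc_matching M \<and> M \<subseteq> {(u, v). u \<in> blk j \<and> v \<in> blk (Suc j)} \<and> (\<forall>q. load M q \<le> h q) \<and>
      2 * real (h (bd (Suc j))) * E j \<le> 36 * total d M"
  proof
    fix j assume "j \<in> {j. Suc j < m}"
    then have "Suc j < m" by simp
    then show "\<exists>M. nc_matching M \<and> M \<subseteq> {(u, v). u \<in> blk j \<and> v \<in> blk (Suc j)} \<and> (\<forall>q. load M q \<le> h q) \<and>
      2 * real (h (bd (Suc j))) * E j \<le> 36 * total d M"
    proof (rule cross_matching)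
      fix M assume "nc_matching M" "M \<subseteq> {(u, v). u \<in> blk j \<and> v \<in> blk (Suc j)}" "\<And>q. load M q \<le> h q" "2 * real (h (bd (Suc j))) * E j \<le> 36 * total d M"
      then show ?thesis by (intro exI[of _ M] conjI allI)
    qed
  qed
  from bchoice[OF this] obtain C where C: "\<forall>j\<in>{j. Suc j < m}. nc_matching (C j) \<and> C j \<subseteq> {(u, v). u \<in> blk j \<and> v \<in> blk (Suc j)} \<and>
      (\<forall>q. load (C j) q \<le> h q) \<and> 2 * real (h (bd (Suc j))) * E j \<le> 36 * total d (C j)" ..
  have nA: "nc_matching (A j)" and subA: "A j \<subseteq> {(u, v). u \<in> blk j \<and> v \<in> blk j}" and lA: "load (A j) q \<le> h q"
    and sA: "(\<Sum>u\<in>blk j. \<Sum>v\<in>blk j. d u v) / real (len j) \<le> 4 * total d (A j)" if "j \<in> {..<m}" for j q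
  proof -
    note * = bspec[OF A that]
    show "nc_matching (A j)" by (rule *[THEN conjunct1])
    show "A j \<subseteq> {(u, v). u \<in> blk j \<and> v \<in> blk j}" by (rule *[THEN conjunct2, THEN conjunct1])
    show "load (A j) q \<le> h q" by (rule *[THEN conjunct2, THEN conjunct2, THEN conjunct1, THEN spec])
    show "(\<Sum>u\<in>blk j. \<Sum>v\<in>blk j. d u v) / real (len j) \<le> 4 * total d (A j)"
      by (rule *[THEN conjunct2, THEN conjunct2, THEN conjunct2])
  qed
  have nC: "nc_matching (C j)" and subC: "C j \<subseteq> {(u, v). u \<in> blk j \<and> v \<in> blk (Suc j)}" and lC: "load (C j) q \<le> h q"
    and sC: "2 * real (h (bd (Suc j))) * E j \<le> 36 * total d (C j)" if "j \<in> {j. Suc j < m}" for j q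
  proof -
    note * = bspec[OF C that]
    show "nc_matching (C j)" by (rule *[THEN conjunct1])
    show "C j \<subseteq> {(u, v). u \<in> blk j \<and> v \<in> blk (Suc j)}" by (rule *[THEN conjunct2, THEN conjunct1])
    show "load (C j) q \<le> h q" by (rule *[THEN conjunct2, THEN conjunct2, THEN conjunct1, THEN spec])
    show "2 * real (h (bd (Suc j))) * E j \<le> 36 * total d (C j)"
      by (rule *[THEN conjunct2, THEN conjunct2, THEN conjunct2])
  qed
  have fm: "finite {j. Suc j < m \<and> R j}" for R by (rule finite_subset[of _ "{..<m}"]) auto
  have inA: "u \<in> blk j" "v \<in> blk j" if "j \<in> {..<m}" "(u, v) \<in> A j" for j u v
    using subsetD[OF subA[OF that(1)] that(2)] by (simp_all only: mem_Collect_eq prod.case)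
  have inC: "u \<in> blk j" "v \<in> blk (Suc j)" if "j \<in> {j. Suc j < m}" "(u, v) \<in> C j" for j u v
    using subsetD[OF subC[OF that(1)] that(2)] by (simp_all only: mem_Collect_eq prod.case)
  have intA: "bd j \<le> u \<and> v < bd (Suc j)" if "j \<in> {..<m}" "(u, v) \<in> A j" for j u v
    using inA[OF that] by (simp add: blk_def bd_Suc)
  have dA: "bd (Suc i) \<le> bd j" if "i \<in> {..<m}" "j \<in> {..<m}" "i < j" for i j
    using that(3) by (intro bd_mono Suc_leI)
  have U1: "nc_matching (\<Union>j\<in>{..<m}. A j)" "load (\<Union>j\<in>{..<m}. A j) q \<le> h q"
    "total d (\<Union>j\<in>{..<m}. A j) = (\<Sum>j<m. total d (A j))" for q
    by (rule nc_matching_Union[where x = bd and y = "\<lambda>j. bd (Suc j)" and b = h and q = q],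
        rule finite_lessThan, erule nA, erule (1) intA, erule (2) dA, erule lA)+
  have U2: "nc_matching (\<Union>j\<in>{j. Suc j < m \<and> R j}. C j)" "load (\<Union>j\<in>{j. Suc j < m \<and> R j}. C j) q \<le> h q"
    "total d (\<Union>j\<in>{j. Suc j < m \<and> R j}. C j) = (\<Sum>j | Suc j < m \<and> R j. total d (C j))"
    if R: "R = even \<or> R = odd" for R q
  proof -
    have mem: "j \<in> {j. Suc j < m}" if "j \<in> {j. Suc j < m \<and> R j}" for j using that by simp
    have dC: "bd (Suc (Suc i)) \<le> bd j" if "i \<in> {j. Suc j < m \<and> R j}" "j \<in> {j. Suc j < m \<and> R j}" "i < j" for i j
    proof (rule bd_mono)
      have "Suc i \<noteq> j" using R that(1,2) by auto
      then show "Suc (Suc i) \<le> j" using that(3) by simp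
    qed
    have intC: "bd j \<le> u \<and> v < bd (Suc (Suc j))" if "j \<in> {j. Suc j < m \<and> R j}" "(u, v) \<in> C j" for j u v
      using inC[OF mem[OF that(1)] that(2)] by (simp add: blk_def bd_Suc)
    show "nc_matching (\<Union>j\<in>{j. Suc j < m \<and> R j}. C j)" "load (\<Union>j\<in>{j. Suc j < m \<and> R j}. C j) q \<le> h q"
      "total d (\<Union>j\<in>{j. Suc j < m \<and> R j}. C j) = (\<Sum>j | Suc j < m \<and> R j. total d (C j))"
      by (rule nc_matching_Union[where x = bd and y = "\<lambda>j. bd (Suc (Suc j))" and b = h and q = q],
        rule fm, rule nC, erule mem, erule (1) intC, erule (2) dC, rule lC, erule mem)+
  qed
  define M1 where "M1 = (\<Union>j\<in>{..<m}. A j)"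
  define M2 where "M2 = (\<Union>j\<in>{j. Suc j < m \<and> even j}. C j)"
  define M3 where "M3 = (\<Union>j\<in>{j. Suc j < m \<and> odd j}. C j)"
  have subn: "A j \<subseteq> {..<n} \<times> {..<n}" if "j \<in> {..<m}" for j
    by (rule subrelI) (use inA[OF that] blk_lt[of j] that in simp)
  have subnC: "C j \<subseteq> {..<n} \<times> {..<n}" if "j \<in> {j. Suc j < m}" for j
    by (rule subrelI) (use inC[OF that] blk_lt[of j] blk_lt[of "Suc j"] that in simp)
  have "M1 \<subseteq> {..<n} \<times> {..<n}" unfolding M1_def by (rule UN_least) (rule subn)
  moreover have "M2 \<subseteq> {..<n} \<times> {..<n}" unfolding M2_def by (rule UN_least, rule subnC) simp
  moreover have "M3 \<subseteq> {..<n} \<times> {..<n}" unfolding M3_def by (rule UN_least, rule subnC) simp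
  moreover have "(\<Sum>i<n. d i (\<sigma> i)) \<le> 8 * total d M1 + 36 * (total d M2 + total d M3)"
  proof -
    have "(\<Sum>j<m. (\<Sum>u\<in>blk j. \<Sum>v\<in>blk j. d u v) / real (len j)) \<le> (\<Sum>j<m. 4 * total d (A j))"
      by (rule sum_mono) (rule sA)
    also have "\<dots> = 4 * total d M1" unfolding M1_def U1(3) by (simp add: sum_distrib_left)
    finally have 1: "(\<Sum>j<m. (\<Sum>u\<in>blk j. \<Sum>v\<in>blk j. d u v) / real (len j)) \<le> 4 * total d M1" .
    have "(\<Sum>r | Suc r < m. 2 * real (h (bd (Suc r))) * E r) \<le> (\<Sum>r | Suc r < m. 36 * total d (C r))"
      by (rule sum_mono) (rule sC)
    also have "(\<Sum>r | Suc r < m. 36 * total d (C r)) =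
        (\<Sum>r\<in>{j. Suc j < m \<and> even j} \<union> {j. Suc j < m \<and> odd j}. 36 * total d (C r))" by (rule sum.cong) auto
    also have "(\<Sum>r\<in>{j. Suc j < m \<and> even j} \<union> {j. Suc j < m \<and> odd j}. 36 * total d (C r)) =
        (\<Sum>r | Suc r < m \<and> even r. 36 * total d (C r)) + (\<Sum>r | Suc r < m \<and> odd r. 36 * total d (C r))"
      by (rule sum.union_disjoint[OF fm fm]) auto
    also have "\<dots> = 36 * (total d M2 + total d M3)"
      unfolding M2_def M3_def using U2(3)[of even] U2(3)[of odd] by (simp add: sum_distrib_left algebra_simps)
    finally show ?thesis using perm_sum_le 1 by linarith
  qed
  moreover have "nc_matching M1 \<and> (\<forall>q. load M1 q \<le> h q)" "nc_matching M2 \<and> (\<forall>q. load M2 q \<le> h q)"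
    "nc_matching M3 \<and> (\<forall>q. load M3 q \<le> h q)"
    unfolding M1_def M2_def M3_def using U1 U2[of even] U2[of odd] by auto
  ultimately show ?thesis by (intro exI[of _ M1] exI[of _ M2] exI[of _ M3]) blast
qed

end

section \<open>Demands crossing the middle of a block\<close>

lemma ranking_ex:
  fixes f :: "'d \<Rightarrow> nat"
  assumes "finite B"
  shows "\<exists>g. bij_betw g {..<card B} B \<and> (\<forall>r s. r < s \<longrightarrow> s < card B \<longrightarrow> f (g r) \<le> f (g s))"
proof -
  obtain xs where xs: "set xs = B" "distinct xs" using finite_distinct_list[OF assms] by blast
  let ?ys = "sort_key f xs"
  have len: "length ?ys = card B" using xs distinct_card[of xs] by simp
  have "bij_betw (\<lambda>i. ?ys ! i) {..<card B} B"
    by (rule bij_betw_nth) (use xs len in auto)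
  moreover have "f (?ys ! r) \<le> f (?ys ! s)" if "r < s" "s < card B" for r s
  proof -
    have "sorted (map f ?ys)" by simp
    then have "map f ?ys ! r \<le> map f ?ys ! s" using that len by (intro sorted_nth_mono) auto
    then show ?thesis using that len by simp
  qed
  ultimately show ?thesis by (intro exI[of _ "\<lambda>i. ?ys ! i"] conjI allI impI)
qed

definition between :: "nat \<Rightarrow> nat \<Rightarrow> nat \<Rightarrow> bool" where "between c1 c2 i \<longleftrightarrow> c1 \<le> i \<and> i < c2"

text \<open>A laminar family of chords on the positions \<open>{A..<Z} \<inter> U\<close> that crosses no interval more often than the
  pairs \<open>(x d, y d)\<close>, \<open>d \<in> B\<close>, do.\<close>

definition laminar_system ::
    "nat set \<Rightarrow> nat \<Rightarrow> nat \<Rightarrow> 'd set \<Rightarrow> ('d \<Rightarrow> nat) \<Rightarrow> ('d \<Rightarrow> nat) \<Rightarrow> 'n set \<Rightarrow> ('n \<Rightarrow> nat) \<Rightarrow> ('n \<Rightarrow> nat) \<Rightarrow> bool"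
  where
  "laminar_system U A Z B x y N lo hi \<longleftrightarrow> finite N \<and>
     (\<forall>n\<in>N. lo n < hi n \<and> A \<le> lo n \<and> hi n < Z \<and> lo n \<in> U \<and> hi n \<in> U) \<and>
     (\<forall>n\<in>N. \<forall>m\<in>N. lo n < lo m \<longrightarrow> lo m < hi n \<longrightarrow> hi m \<le> hi n) \<and>
     (\<forall>c1 c2. card {n \<in> N. between c1 c2 (lo n) \<noteq> between c1 c2 (hi n)} \<le>
        card {d \<in> B. between c1 c2 (x d) \<noteq> between c1 c2 (y d)})"

text \<open>The demands of a block go from the left half \<open>{A..<M}\<close> to the right half \<open>{M..<Z}\<close>. Here they are
  listed by their left ends from the right to the left, and \<open>y r\<close> is the \<open>r\<close>-th right end from the left; the
  demand of rank \<open>r\<close> ends at \<open>y (\<sigma> r)\<close>.\<close>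

locale ranked_block =
  fixes n :: nat and x y \<sigma> :: "nat \<Rightarrow> nat" and A M Z :: nat and U :: "nat set" and dd :: "nat \<Rightarrow> nat \<Rightarrow> real"
  assumes perm: "bij_betw \<sigma> {..<n} {..<n}"
    and x: "\<And>r. r < n \<Longrightarrow> A \<le> x r \<and> x r < M \<and> x r \<in> U" "\<And>r s. r < s \<Longrightarrow> s < n \<Longrightarrow> x s \<le> x r"
    and y: "\<And>r. r < n \<Longrightarrow> M \<le> y r \<and> y r < Z \<and> y r \<in> U" "\<And>r s. r < s \<Longrightarrow> s < n \<Longrightarrow> y r \<le> y s"
    and dd: "\<And>u v. u \<in> U \<Longrightarrow> v \<in> U \<Longrightarrow> 0 \<le> dd u v" "\<And>u. u \<in> U \<Longrightarrow> dd u u = 0"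
      "\<And>u v. u \<in> U \<Longrightarrow> v \<in> U \<Longrightarrow> dd u v = dd v u"
      "\<And>u v w. u \<in> U \<Longrightarrow> v \<in> U \<Longrightarrow> w \<in> U \<Longrightarrow> dd u w \<le> dd u v + dd v w"
begin

sublocale perm_metric n \<sigma> "\<lambda>u v. dd (y u) (y v)"
  by unfold_locales (use perm y(1) dd in auto)

definition crossing :: "nat \<Rightarrow> nat \<Rightarrow> nat set" where
  "crossing c1 c2 = {r \<in> {..<n}. between c1 c2 (x r) \<noteq> between c1 c2 (y (\<sigma> r))}"

lemma y_le: "r \<le> s \<Longrightarrow> s < n \<Longrightarrow> y r \<le> y s" using y(2)[of r s] by (cases "r = s") auto

lemma x_le: "r \<le> s \<Longrightarrow> s < n \<Longrightarrow> x s \<le> x r" using x(2)[of r s] by (cases "r = s") auto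

lemma card_\<sigma>: "card {r \<in> {..<n}. R (\<sigma> r)} = card {r \<in> {..<n}. R r}"
proof -
  have "\<sigma> ` {r \<in> {..<n}. R (\<sigma> r)} = {r \<in> {..<n}. R r}"
  proof (intro equalityI subsetI)
    fix u assume "u \<in> {r \<in> {..<n}. R r}"
    then have "u \<in> \<sigma> ` {..<n}" "R u" using perm by (auto simp: bij_betw_def)
    then show "u \<in> \<sigma> ` {r \<in> {..<n}. R (\<sigma> r)}" by auto
  qed (use \<sigma>_lt in auto)
  moreover have "inj_on \<sigma> {r \<in> {..<n}. R (\<sigma> r)}" using \<sigma>_inj by (auto simp: inj_on_def)
  ultimately show ?thesis using card_image by fastforce
qed

lemma initial_segment:
  assumes "\<And>r s. r < s \<Longrightarrow> s < n \<Longrightarrow> R s \<Longrightarrow> R r"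
  shows "\<exists>p\<le>n. \<forall>r<n. R r \<longleftrightarrow> r < p"
proof (cases "\<exists>r<n. \<not> R r")
  case True
  define p where "p = (LEAST r. r < n \<and> \<not> R r)"
  have p: "p < n \<and> \<not> R p" unfolding p_def by (rule LeastI_ex) (use True in blast)
  have "R r \<longleftrightarrow> r < p" if r: "r < n" for r
  proof
    assume R: "R r"
    show "r < p"
    proof (rule ccontr)
      assume "\<not> r < p"
      then have "p < r \<or> p = r" by linarith
      then show False using assms[of p r] r p R by blast
    qed
  next
    assume "r < p"
    then show "R r" using not_less_Least[of r "\<lambda>r. r < n \<and> \<not> R r"] r unfolding p_def by blast
  qed
  then show ?thesis using p by (intro exI[of _ p]) simp
next
  case False
  then show ?thesis by (intro exI[of _ n]) auto
qed

text \<open>An interval on one side of the middle is crossed by every pair with an end in it. An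
  interval reaching over the middle contains initial segments of both rankings, because these start
  at the middle.\<close>

lemma crossing_cases:
  obtains (left) "c2 \<le> M" "card (crossing c1 c2) = card {r \<in> {..<n}. between c1 c2 (x r)}"
  | (right) "M \<le> c1" "card (crossing c1 c2) = card {r \<in> {..<n}. between c1 c2 (y r)}"
  | (both) p q where "p \<le> n" "q \<le> n"
      "\<And>r. r < n \<Longrightarrow> between c1 c2 (x r) \<longleftrightarrow> r < p" "\<And>r. r < n \<Longrightarrow> between c1 c2 (y r) \<longleftrightarrow> r < q"
      "card (crossing c1 c2) = card {r \<in> {..<n}. (r < p) \<noteq> (\<sigma> r < q)}"
proof -
  consider (l) "c2 \<le> M" | (r) "M \<le> c1" | (b) "c1 < M" "M < c2" by linarith
  then show thesis
  proof cases
    case l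
    have "\<not> between c1 c2 (y (\<sigma> r))" if "r < n" for r using y(1)[OF \<sigma>_lt[OF that]] l by (auto simp: between_def)
    then have "crossing c1 c2 = {r \<in> {..<n}. between c1 c2 (x r)}" by (auto simp: crossing_def)
    then show thesis using left[OF l] by simp
  next
    case r
    have "\<not> between c1 c2 (x s)" if "s < n" for s using x(1)[OF that] r by (auto simp: between_def)
    then have "crossing c1 c2 = {r \<in> {..<n}. between c1 c2 (y (\<sigma> r))}" by (auto simp: crossing_def)
    then show thesis using right[OF r] card_\<sigma>[of "\<lambda>u. between c1 c2 (y u)"] by simp
  next
    case b
    have bx: "between c1 c2 (x r) \<longleftrightarrow> c1 \<le> x r" if "r < n" for r using x(1)[OF that] b by (auto simp: between_def)
    have bY: "between c1 c2 (y r) \<longleftrightarrow> y r < c2" if "r < n" for r using y(1)[OF that] b by (auto simp: between_def)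
    have "\<exists>p\<le>n. \<forall>r<n. c1 \<le> x r \<longleftrightarrow> r < p"
      by (rule initial_segment) (use x(2) order_trans in blast)
    then obtain p where p: "p \<le> n" "\<forall>r<n. c1 \<le> x r \<longleftrightarrow> r < p" by blast
    have "\<exists>q\<le>n. \<forall>r<n. y r < c2 \<longleftrightarrow> r < q"
      by (rule initial_segment) (use y(2) le_less_trans in blast)
    then obtain q where q: "q \<le> n" "\<forall>r<n. y r < c2 \<longleftrightarrow> r < q" by blast
    have "crossing c1 c2 = {r \<in> {..<n}. (r < p) \<noteq> (\<sigma> r < q)}"
      unfolding crossing_def using bx bY p q \<sigma>_lt by (intro Collect_cong conj_cong refl) simp
    then show thesis using both[of p q] p q bx bY by simp
  qed
qed

text \<open>Any pairing with \<open>p\<close> left ends and \<open>q\<close> right ends inside the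
  interval crosses it at least as often as the difference of \<open>p\<close> and \<open>q\<close>;
  the nested pairing attains this.\<close>

lemma nested_crossing:
  assumes "p \<le> n" "q \<le> n"
  shows "card {r \<in> {..<n}. (r < p) \<noteq> (r < q)} \<le> card {r \<in> {..<n}. (r < p) \<noteq> (\<sigma> r < q)}" (is "_ \<le> card ?C")
proof -
  have cq: "card {r \<in> {..<n}. \<sigma> r < q} = q"
  proof -
    have "{r \<in> {..<n}. r < q} = {..<q}" using assms(2) by auto
    then show ?thesis using card_\<sigma>[of "\<lambda>u. u < q"] by simp
  qed
  have "q \<le> card ({..<p} \<union> ?C)" using cq card_mono[of "{..<p} \<union> ?C" "{r \<in> {..<n}. \<sigma> r < q}"] by fastforce
  also have "\<dots> \<le> p + card ?C" using card_Un_le[of "{..<p}" ?C] by simp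
  finally have 1: "q \<le> p + card ?C" .
  have "p \<le> card ({r \<in> {..<n}. \<sigma> r < q} \<union> ?C)"
    using card_mono[of "{r \<in> {..<n}. \<sigma> r < q} \<union> ?C" "{..<p}"] assms(1) by fastforce
  also have "\<dots> \<le> q + card ?C" using card_Un_le[of "{r \<in> {..<n}. \<sigma> r < q}" ?C] cq by simp
  finally have 2: "p \<le> q + card ?C" .
  have "{r \<in> {..<n}. (r < p) \<noteq> (r < q)} \<subseteq> {min p q..<max p q}" by auto
  then have "card {r \<in> {..<n}. (r < p) \<noteq> (r < q)} \<le> card {min p q..<max p q}" by (intro card_mono) auto
  also have "\<dots> = max p q - min p q" by simp
  finally show ?thesis using 1 2 by linarith
qed

text \<open>Depending on the order of \<open>p\<close> and \<open>q\<close>, all pairs going up over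
  \<open>q\<close> or all pairs coming down over it are counted; both are \<open>h q\<close>
  many.\<close>

lemma load_crossing: "h q \<le> card {r \<in> {..<n}. (r < p) \<noteq> (\<sigma> r < q)}"
proof (cases "q \<le> p")
  case True
  have "{i. i < n \<and> i < q \<and> q \<le> \<sigma> i} \<subseteq> {r \<in> {..<n}. (r < p) \<noteq> (\<sigma> r < q)}" using True by auto
  then show ?thesis unfolding h_def by (intro card_mono) auto
next
  case False
  have "{i. i < n \<and> q \<le> i \<and> \<sigma> i < q} \<subseteq> {r \<in> {..<n}. (r < p) \<noteq> (\<sigma> r < q)}" using False by auto
  then show ?thesis unfolding h_back[symmetric] by (intro card_mono) auto
qed

lemma nested_system: "laminar_system U A Z {..<n} x (\<lambda>r. y (\<sigma> r)) ((\<lambda>r. (r, r)) ` {..<n}) (\<lambda>(u, v). x u) (\<lambda>(u, v). y v)"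
  unfolding laminar_system_def
proof (intro conjI allI)
  show "\<forall>m\<in>(\<lambda>r. (r, r)) ` {..<n}. (case m of (u, v) \<Rightarrow> x u) < (case m of (u, v) \<Rightarrow> y v) \<and> A \<le> (case m of (u, v) \<Rightarrow> x u) \<and>
     (case m of (u, v) \<Rightarrow> y v) < Z \<and> (case m of (u, v) \<Rightarrow> x u) \<in> U \<and> (case m of (u, v) \<Rightarrow> y v) \<in> U"
    using x(1) y(1) by fastforce
  have "y s \<le> y r" if "r < n" "s < n" "x r < x s" for r s
  proof -
    have "\<not> r \<le> s" using x_le[of r s] that by auto
    then show ?thesis using y_le[of s r] that by simp
  qed
  then show "\<forall>r\<in>(\<lambda>r. (r, r)) ` {..<n}. \<forall>m\<in>(\<lambda>r. (r, r)) ` {..<n}. (case r of (u, v) \<Rightarrow> x u) < (case m of (u, v) \<Rightarrow> x u) \<longrightarrow>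
      (case m of (u, v) \<Rightarrow> x u) < (case r of (u, v) \<Rightarrow> y v) \<longrightarrow> (case m of (u, v) \<Rightarrow> y v) \<le> (case r of (u, v) \<Rightarrow> y v)"
    by auto
  fix c1 c2
  let ?N = "{r \<in> {..<n}. between c1 c2 (x r) \<noteq> between c1 c2 (y r)}"
  have "{m \<in> (\<lambda>r. (r, r)) ` {..<n}. between c1 c2 (case m of (u, v) \<Rightarrow> x u) \<noteq> between c1 c2 (case m of (u, v) \<Rightarrow> y v)} =
      (\<lambda>r. (r, r)) ` ?N" by auto
  then have "card {m \<in> (\<lambda>r. (r, r)) ` {..<n}. between c1 c2 (case m of (u, v) \<Rightarrow> x u) \<noteq> between c1 c2 (case m of (u, v) \<Rightarrow> y v)} =
      card ?N" by (simp add: card_image inj_on_def)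
  also have "\<dots> \<le> card (crossing c1 c2)"
  proof (cases rule: crossing_cases[of c2 c1])
    case left
    have "\<not> between c1 c2 (y r)" if "r < n" for r using y(1)[OF that] left(1) by (auto simp: between_def)
    then have "?N = {r \<in> {..<n}. between c1 c2 (x r)}" by auto
    then show ?thesis using left by simp
  next
    case right
    have "\<not> between c1 c2 (x r)" if "r < n" for r using x(1)[OF that] right(1) by (auto simp: between_def)
    then have "?N = {r \<in> {..<n}. between c1 c2 (y r)}" by auto
    then show ?thesis using right by simp
  next
    case (both p q)
    have "?N = {r \<in> {..<n}. (r < p) \<noteq> (r < q)}" using both(3,4) by (intro Collect_cong conj_cong refl) simp
    then show ?thesis using nested_crossing[OF both(1,2)] both(5) by simp
  qed
  finally show "card {m \<in> (\<lambda>r. (r, r)) ` {..<n}. between c1 c2 (case m of (u, v) \<Rightarrow> x u) \<noteq> between c1 c2 (case m of (u, v) \<Rightarrow> y v)}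
     \<le> card {r \<in> {..<n}. between c1 c2 (x r) \<noteq> between c1 c2 (y (\<sigma> r))}" unfolding crossing_def .
qed simp

text \<open>A crossing pair has exactly one end in \<open>I\<close>, and different pairs of a
  matching share no ends.\<close>

lemma matching_crossing:
  assumes "nc_matching W" "finite I"
  shows "card {(u, v) \<in> W. (u \<in> I) \<noteq> (v \<in> I)} \<le> card I"
proof (rule card_inj_on_le[OF _ _ assms(2)])
  let ?f = "\<lambda>(u, v). if u \<in> I then u else v"
  have W: "u \<noteq> u' \<and> v \<noteq> v' \<and> u \<noteq> v' \<and> v \<noteq> u'" if "(u, v) \<in> W" "(u', v') \<in> W" "(u, v) \<noteq> (u', v')" for u v u' v'
  proof -
    show ?thesis using nc_matchingD(3)[OF assms(1) that] by simp
  qed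
  show "inj_on ?f {(u, v) \<in> W. (u \<in> I) \<noteq> (v \<in> I)}"
  proof (rule inj_onI)
    fix z z' assume z: "z \<in> {(u, v) \<in> W. (u \<in> I) \<noteq> (v \<in> I)}" "z' \<in> {(u, v) \<in> W. (u \<in> I) \<noteq> (v \<in> I)}" "?f z = ?f z'"
    obtain u v u' v' where e: "z = (u, v)" "z' = (u', v')" by (cases z, cases z')
    show "z = z'"
    proof (rule ccontr)
      assume "z \<noteq> z'"
      then have "u \<noteq> u' \<and> v \<noteq> v' \<and> u \<noteq> v' \<and> v \<noteq> u'" using z e by (intro W) auto
      then show False using z(3) e by (simp split: if_splits)
    qed
  qed
  show "?f ` {(u, v) \<in> W. (u \<in> I) \<noteq> (v \<in> I)} \<subseteq> I" by auto
qed

text \<open>Different ranks may be the same terminal: pairs with equal positions are dropped, as a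
  chord needs two ends, and their distance is 0. Disjointness of the pairs settles intervals to the
  right of the middle, the load bound those reaching over it.\<close>

lemma matching_system:
  assumes W: "nc_matching W" "W \<subseteq> {..<n} \<times> {..<n}" "\<And>q. load W q \<le> h q"
  shows "laminar_system U A Z {..<n} x (\<lambda>r. y (\<sigma> r)) {(u, v) \<in> W. y u < y v} (\<lambda>(u, v). y u) (\<lambda>(u, v). y v)"
  unfolding laminar_system_def
proof (intro conjI allI)
  have finW: "finite W" using nc_matchingD(1)[OF W(1)] .
  then show "finite {(u, v) \<in> W. y u < y v}" by (rule finite_subset[rotated]) auto
  have Wn: "u < n" "v < n" "u < v" if "(u, v) \<in> W" for u v using nc_matchingD(2)[OF W(1) that] W(2) that by auto
  show "\<forall>m\<in>{(u, v) \<in> W. y u < y v}. (case m of (u, v) \<Rightarrow> y u) < (case m of (u, v) \<Rightarrow> y v) \<and> A \<le> (case m of (u, v) \<Rightarrow> y u) \<and>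
     (case m of (u, v) \<Rightarrow> y v) < Z \<and> (case m of (u, v) \<Rightarrow> y u) \<in> U \<and> (case m of (u, v) \<Rightarrow> y v) \<in> U"
  proof (clarify, goal_cases)
    case (1 u v)
    then show ?case using x(1)[OF Wn(1)] y(1)[OF Wn(1)] y(1)[OF Wn(2)] by fastforce
  qed
  have "y v' \<le> y v" if W': "(u, v) \<in> W" "(u', v') \<in> W" and l: "y u < y u'" "y u' < y v" for u v u' v'
  proof (rule y_le)
    have "\<not> u' \<le> u" using y_le[of u' u] Wn[OF W'(1)] l by auto
    moreover have "\<not> v \<le> u'" using y_le[of v u'] Wn[OF W'(2)] l by auto
    ultimately show "v' \<le> v" using nc_matchingD(3)[OF W(1) W'] by fastforce
    show "v < n" using Wn W' by blast
  qed
  then show "\<forall>m\<in>{(u, v) \<in> W. y u < y v}. \<forall>m'\<in>{(u, v) \<in> W. y u < y v}. (case m of (u, v) \<Rightarrow> y u) < (case m' of (u, v) \<Rightarrow> y u) \<longrightarrow>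
      (case m' of (u, v) \<Rightarrow> y u) < (case m of (u, v) \<Rightarrow> y v) \<longrightarrow> (case m' of (u, v) \<Rightarrow> y v) \<le> (case m of (u, v) \<Rightarrow> y v)"
    by (clarify, simp only: prod.case)
  fix c1 c2
  let ?C = "{(u, v) \<in> W. between c1 c2 (y u) \<noteq> between c1 c2 (y v)}"
  have fC: "finite ?C" using finW by (rule finite_subset[rotated]) auto
  have "{m \<in> {(u, v) \<in> W. y u < y v}. between c1 c2 (case m of (u, v) \<Rightarrow> y u) \<noteq> between c1 c2 (case m of (u, v) \<Rightarrow> y v)} \<subseteq> ?C"
    by auto
  then have "card {m \<in> {(u, v) \<in> W. y u < y v}. between c1 c2 (case m of (u, v) \<Rightarrow> y u) \<noteq> between c1 c2 (case m of (u, v) \<Rightarrow> y v)}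
      \<le> card ?C" by (rule card_mono[OF fC])
  also have "\<dots> \<le> card (crossing c1 c2)"
  proof (cases rule: crossing_cases[of c2 c1])
    case left
    have "\<not> between c1 c2 (y r)" if "r < n" for r using y(1)[OF that] left(1) by (auto simp: between_def)
    then have "?C = {}" using Wn by blast
    then show ?thesis by (simp only: card.empty le0)
  next
    case right
    let ?I = "{r \<in> {..<n}. between c1 c2 (y r)}"
    have "?C = {(u, v) \<in> W. (u \<in> ?I) \<noteq> (v \<in> ?I)}" using Wn by auto
    then show ?thesis using matching_crossing[OF W(1), of ?I] right by simp
  next
    case (both p q)
    have "?C = {(u, v) \<in> W. u < q \<and> q \<le> v}"
    proof (rule set_eqI)
      fix z :: "nat \<times> nat"
      obtain u v where z: "z = (u, v)" by (cases z)
      show "z \<in> ?C \<longleftrightarrow> z \<in> {(u, v) \<in> W. u < q \<and> q \<le> v}"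
      proof (cases "z \<in> W")
        case True
        then have "(u < q) \<noteq> (v < q) \<longleftrightarrow> u < q \<and> q \<le> v" using Wn[of u v] z by auto
        then show ?thesis using True Wn[of u v] both(4)[of u] both(4)[of v] z by simp
      qed (simp add: z)
    qed
    then have "card ?C = load W q" by (simp add: load_def)
    then show ?thesis using W(3)[of q] load_crossing[of q p] both(5) by linarith
  qed
  finally show "card {m \<in> {(u, v) \<in> W. y u < y v}. between c1 c2 (case m of (u, v) \<Rightarrow> y u) \<noteq> between c1 c2 (case m of (u, v) \<Rightarrow> y v)}
     \<le> card {r \<in> {..<n}. between c1 c2 (x r) \<noteq> between c1 c2 (y (\<sigma> r))}" unfolding crossing_def .
qed

text \<open>From the left end \<open>x r\<close> a nested chord leads to \<open>y r\<close>, and the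
  permutation from there to \<open>y (\<sigma> r)\<close>. Index 0 is the nested system, and 1, 2, 3
  are the matchings; 36 dominates the coefficients 1, 8 and 36.\<close>

lemma systems_ex:
  "\<exists>N lo hi. (\<forall>t<4. laminar_system U A Z {..<n} x (\<lambda>r. y (\<sigma> r)) (N t) (lo t) (hi t)) \<and>
     (\<Sum>r<n. dd (x r) (y (\<sigma> r))) \<le> 36 * (\<Sum>t<4::nat. \<Sum>z\<in>N t. dd (lo t z) (hi t (z :: nat \<times> nat)))"
proof -
  obtain M1 M2 M3 where W: "\<forall>W\<in>{M1, M2, M3}. nc_matching W \<and> W \<subseteq> {..<n} \<times> {..<n} \<and> (\<forall>q. load W q \<le> h q)"
    and tot: "(\<Sum>i<n. dd (y i) (y (\<sigma> i))) \<le> 8 * total (\<lambda>u v. dd (y u) (y v)) M1 +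
      36 * (total (\<lambda>u v. dd (y u) (y v)) M2 + total (\<lambda>u v. dd (y u) (y v)) M3)"
    using permutation_matchings by (elim exE conjE)
  define N where "N t = (if t = 0 then (\<lambda>r. (r, r)) ` {..<n}
    else {(u, v) \<in> (if t = 1 then M1 else if t = 2 then M2 else M3). y u < y v})" for t :: nat
  define lo where "lo t = (\<lambda>(u, v :: nat). if t = 0 then x u else y u)" for t :: nat
  define hi where "hi t = (\<lambda>(u :: nat, v). y v)" for t :: nat
  have sum: "(\<Sum>z | z \<in> W \<and> (case z of (u, v) \<Rightarrow> y u < y v). case z of (u, v) \<Rightarrow> dd (y u) (y v)) = total (\<lambda>u v. dd (y u) (y v)) W"
    "0 \<le> total (\<lambda>u v. dd (y u) (y v)) W" if "W \<in> {M1, M2, M3}" for W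
  proof -
    have nc: "nc_matching W" and sub: "W \<subseteq> {..<n} \<times> {..<n}" using W that by auto
    have uv: "u < v" "v < n" "u < n" if "(u, v) \<in> W" for u v using nc_matchingD(2)[OF nc that] sub that by auto
    have z: "dd (y u) (y v) = 0" if "(u, v) \<in> W" "\<not> y u < y v" for u v
    proof -
      have "y u = y v" using y_le[of u v] uv[OF that(1)] that(2) by simp
      then show ?thesis using dd(2)[of "y v"] y(1)[OF uv(2)[OF that(1)]] by simp
    qed
    show "(\<Sum>z | z \<in> W \<and> (case z of (u, v) \<Rightarrow> y u < y v). case z of (u, v) \<Rightarrow> dd (y u) (y v)) = total (\<lambda>u v. dd (y u) (y v)) W"
      unfolding total_def using nc_matchingD(1)[OF nc] z by (intro sum.mono_neutral_left) auto
    show "0 \<le> total (\<lambda>u v. dd (y u) (y v)) W"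
      unfolding total_def using dd(1) y(1) uv by (intro sum_nonneg) (auto split: prod.splits)
  qed
  have sys: "laminar_system U A Z {..<n} x (\<lambda>r. y (\<sigma> r)) (N t) (lo t) (hi t)" if "t < 4" for t
  proof (cases "t = 0")
    case True
    then show ?thesis using nested_system by (simp add: N_def lo_def hi_def)
  next
    case False
    obtain W' where W': "N t = {(u, v) \<in> W'. y u < y v}" "W' \<in> {M1, M2, M3}" using False by (auto simp: N_def)
    have "nc_matching W'" "W' \<subseteq> {..<n} \<times> {..<n}" "\<And>q. load W' q \<le> h q" using bspec[OF W W'(2)] by auto
    note sys = matching_system[OF this]
    have lo: "lo t = (\<lambda>(u, v). y u)" using False by (simp only: lo_def if_False)
    show ?thesis unfolding W'(1) hi_def lo by (rule sys)
  qed
  have S: "{..<4::nat} = {0, 1, 2, 3}" by auto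
  have s0: "(\<Sum>z\<in>N 0. dd (lo 0 z) (hi 0 z)) = (\<Sum>r<n. dd (x r) (y r))"
    by (simp add: N_def lo_def hi_def sum.reindex inj_on_def)
  have st: "(\<Sum>z\<in>N 1. dd (lo 1 z) (hi 1 z)) = total (\<lambda>u v. dd (y u) (y v)) M1"
    "(\<Sum>z\<in>N 2. dd (lo 2 z) (hi 2 z)) = total (\<lambda>u v. dd (y u) (y v)) M2"
    "(\<Sum>z\<in>N 3. dd (lo 3 z) (hi 3 z)) = total (\<lambda>u v. dd (y u) (y v)) M3"
    using sum(1)[of M1] sum(1)[of M2] sum(1)[of M3] by (simp_all add: N_def lo_def hi_def case_prod_beta')
  have "(\<Sum>r<n. dd (x r) (y (\<sigma> r))) \<le> (\<Sum>r<n. dd (x r) (y r) + dd (y r) (y (\<sigma> r)))"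
    using dd(4) x(1) y(1) \<sigma>_lt by (intro sum_mono) auto
  also have "\<dots> = (\<Sum>r<n. dd (x r) (y r)) + (\<Sum>r<n. dd (y r) (y (\<sigma> r)))" by (rule sum.distrib)
  finally have "(\<Sum>r<n. dd (x r) (y (\<sigma> r))) \<le> (\<Sum>r<n. dd (x r) (y r)) + (8 * total (\<lambda>u v. dd (y u) (y v)) M1 +
      36 * (total (\<lambda>u v. dd (y u) (y v)) M2 + total (\<lambda>u v. dd (y u) (y v)) M3))" using tot by linarith
  moreover have "0 \<le> (\<Sum>r<n. dd (x r) (y r))" using dd(1) x(1) y(1) by (intro sum_nonneg) auto
  moreover have "(\<Sum>t<4::nat. \<Sum>z\<in>N t. dd (lo t z) (hi t z)) = (\<Sum>z\<in>N 0. dd (lo 0 z) (hi 0 z)) + (\<Sum>z\<in>N 1. dd (lo 1 z) (hi 1 z)) +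
      (\<Sum>z\<in>N 2. dd (lo 2 z) (hi 2 z)) + (\<Sum>z\<in>N 3. dd (lo 3 z) (hi 3 z))" by (simp add: S)
  ultimately have "(\<Sum>r<n. dd (x r) (y (\<sigma> r))) \<le> 36 * (\<Sum>t<4::nat. \<Sum>z\<in>N t. dd (lo t z) (hi t z))"
    unfolding s0 st using sum(2)[of M1] by simp
  then show ?thesis using sys by (intro exI[of _ N] exI[of _ lo] exI[of _ hi] conjI) auto
qed

end

lemma block_systems:
  fixes i j :: "'d \<Rightarrow> nat"
  assumes B: "finite B" "\<And>d. d \<in> B \<Longrightarrow> A \<le> i d \<and> i d < M \<and> i d \<in> U" "\<And>d. d \<in> B \<Longrightarrow> M \<le> j d \<and> j d < Z \<and> j d \<in> U"
    and dd: "\<And>u v. u \<in> U \<Longrightarrow> v \<in> U \<Longrightarrow> 0 \<le> dd u v" "\<And>u. u \<in> U \<Longrightarrow> dd u u = (0 :: real)"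
      "\<And>u v. u \<in> U \<Longrightarrow> v \<in> U \<Longrightarrow> dd u v = dd v u"
      "\<And>u v w. u \<in> U \<Longrightarrow> v \<in> U \<Longrightarrow> w \<in> U \<Longrightarrow> dd u w \<le> dd u v + dd v w"
  shows "\<exists>N lo hi. (\<forall>t<4. laminar_system U A Z B i j (N t) (lo t) (hi t)) \<and>
     (\<Sum>d\<in>B. dd (i d) (j d)) \<le> 36 * (\<Sum>t<4::nat. \<Sum>z\<in>N t. dd (lo t z) (hi t (z :: nat \<times> nat)))"
proof -
  let ?n = "card B"
  \<comment> \<open>Sorting by the distance to the middle lists the left ends from right to left,
    although \<open>ranking_ex\<close> sorts increasingly.\<close>
  obtain f where f: "bij_betw f {..<?n} B" "\<And>r s. r < s \<Longrightarrow> s < ?n \<Longrightarrow> M - i (f r) \<le> M - i (f s)"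
    using ranking_ex[OF B(1), of "\<lambda>d. M - i d"] by (elim exE conjE) simp
  obtain g where g: "bij_betw g {..<?n} B" "\<And>r s. r < s \<Longrightarrow> s < ?n \<Longrightarrow> j (g r) \<le> j (g s)"
    using ranking_ex[OF B(1), of j] by (elim exE conjE) simp
  define \<sigma> where "\<sigma> r = inv_into {..<?n} g (f r)" for r
  have fB: "f r \<in> B" if "r < ?n" for r using bij_betwE[OF f(1)] that by auto
  have gB: "g r \<in> B" if "r < ?n" for r using bij_betwE[OF g(1)] that by auto
  have "\<sigma> = inv_into {..<?n} g \<circ> f" by (simp add: fun_eq_iff \<sigma>_def)
  then have perm: "bij_betw \<sigma> {..<?n} {..<?n}"
    using bij_betw_trans[OF f(1) bij_betw_inv_into[OF g(1)]] by (simp only:)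
  have g\<sigma>: "g (\<sigma> r) = f r" if "r < ?n" for r
    unfolding \<sigma>_def using fB[OF that] g(1) by (intro f_inv_into_f) (simp add: bij_betw_def)
  interpret ranked_block ?n "\<lambda>r. i (f r)" "\<lambda>r. j (g r)" \<sigma> A M Z U dd
  proof
    fix r s assume rs: "r < s" "s < ?n"
    show "i (f s) \<le> i (f r)" using f(2)[OF rs] B(2)[OF fB, of r] B(2)[OF fB, of s] rs by fastforce
  qed (use perm B(2) B(3) fB gB g(2) dd in auto)
  obtain N lo hi where N: "\<forall>t<4. laminar_system U A Z {..<?n} (\<lambda>r. i (f r)) (\<lambda>r. j (g (\<sigma> r))) (N t) (lo t) (hi t)"
    and s: "(\<Sum>r<?n. dd (i (f r)) (j (g (\<sigma> r)))) \<le> 36 * (\<Sum>t<4::nat. \<Sum>z\<in>N t. dd (lo t z) (hi t (z :: nat \<times> nat)))"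
    using systems_ex by (elim exE conjE)
  have "(\<Sum>r<?n. dd (i (f r)) (j (g (\<sigma> r)))) = (\<Sum>r<?n. dd (i (f r)) (j (f r)))" using g\<sigma> by (intro sum.cong) auto
  also have "\<dots> = (\<Sum>d\<in>B. dd (i d) (j d))" by (rule sum.reindex_bij_betw[OF f(1)])
  finally have sum: "(\<Sum>d\<in>B. dd (i d) (j d)) \<le> 36 * (\<Sum>t<4::nat. \<Sum>z\<in>N t. dd (lo t z) (hi t (z :: nat \<times> nat)))" using s by simp
  have c: "card {r \<in> {..<?n}. between c1 c2 (i (f r)) \<noteq> between c1 c2 (j (g (\<sigma> r)))} =
      card {d \<in> B. between c1 c2 (i d) \<noteq> between c1 c2 (j d)}" for c1 c2
  proof -
    have "f ` {r \<in> {..<?n}. between c1 c2 (i (f r)) \<noteq> between c1 c2 (j (g (\<sigma> r)))} =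
        {d \<in> f ` {..<?n}. between c1 c2 (i d) \<noteq> between c1 c2 (j d)}" using g\<sigma> by auto
    moreover have B: "f ` {..<?n} = B" using f(1) by (simp add: bij_betw_def)
    moreover have inj: "inj_on f {r \<in> {..<?n}. between c1 c2 (i (f r)) \<noteq> between c1 c2 (j (g (\<sigma> r)))}"
      using f(1) by (auto simp: bij_betw_def intro: inj_on_subset)
    ultimately show ?thesis using card_image[OF inj] by (simp only:)
  qed
  have "laminar_system U A Z B i j (N t) (lo t) (hi t)" if "t < 4" for t
    using N[rule_format, OF that] unfolding laminar_system_def c .
  then show ?thesis using sum by (intro exI[of _ N] exI[of _ lo] exI[of _ hi] conjI) auto
qed

section \<open>Dyadic levels\<close>

text \<open>The quotients by \<open>2 ^ m\<close> differ but agree after halving, so they are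
  \<open>2 * b\<close> and \<open>2 * b + 1\<close>.\<close>

lemma halves_of_block:
  fixes i j :: nat
  assumes "i < j" "i div 2 ^ Suc m = b" "j div 2 ^ Suc m = b" "i div 2 ^ m \<noteq> j div 2 ^ m"
  shows "b * 2 ^ Suc m \<le> i \<and> i < b * 2 ^ Suc m + 2 ^ m" "b * 2 ^ Suc m + 2 ^ m \<le> j \<and> j < Suc b * 2 ^ Suc m"
proof -
  define K :: nat where "K = 2 ^ m"
  have K: "0 < K" "2 ^ Suc m = K * 2" by (simp_all add: K_def)
  have "(i div K) div 2 = b" "(j div K) div 2 = b" using assms(2,3) by (simp_all only: K(2) div_mult2_eq)
  moreover have "i div K \<le> j div K" using assms(1) by (intro div_le_mono) simp
  moreover have "i div K \<noteq> j div K" using assms(4) unfolding K_def .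
  ultimately have x: "i div K = 2 * b" "j div K = 2 * b + 1" by linarith+
  have "i div K * K \<le> i" "i < K + i div K * K" "j div K * K \<le> j" "j < K + j div K * K"
    using K(1) by (simp_all add: div_times_less_eq_dividend dividend_less_div_times)
  then have "2 * b * K \<le> i" "i < K + 2 * b * K" "(2 * b + 1) * K \<le> j" "j < K + (2 * b + 1) * K" unfolding x .
  then show "b * 2 ^ Suc m \<le> i \<and> i < b * 2 ^ Suc m + 2 ^ m" "b * 2 ^ Suc m + 2 ^ m \<le> j \<and> j < Suc b * 2 ^ Suc m"
    unfolding K(2) K_def[symmetric] by (simp_all add: algebra_simps)
qed

context hub_graph
begin

lemma bond_between:
  assumes D: "cut p q E S \<noteq> {}"
    and min: "\<And>S'. cut p q E S' \<subseteq> cut p q E S \<Longrightarrow> cut p q E S' \<noteq> {} \<Longrightarrow> cut p q E S' = cut p q E S"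
    and F: "F \<in> \<Phi>"
  shows "\<exists>c1 c2. \<forall>u<k F. \<forall>v<k F. (\<tau> F u \<in> S) \<noteq> (\<tau> F v \<in> S) \<longleftrightarrow> between c1 c2 u \<noteq> between c1 c2 v"
proof -
  have "\<exists>c1 c2. (\<forall>i<k F. \<tau> F i \<in> S \<longleftrightarrow> between c1 c2 i) \<or> (\<forall>i<k F. \<tau> F i \<notin> S \<longleftrightarrow> between c1 c2 i)"
    unfolding between_def by (rule bond_interval[OF D _ F]) (rule min)
  then obtain c1 c2 where c: "(\<forall>i<k F. \<tau> F i \<in> S \<longleftrightarrow> between c1 c2 i) \<or> (\<forall>i<k F. \<tau> F i \<notin> S \<longleftrightarrow> between c1 c2 i)"
    by (elim exE)
  have "(\<tau> F u \<in> S) \<noteq> (\<tau> F v \<in> S) \<longleftrightarrow> between c1 c2 u \<noteq> between c1 c2 v" if "u < k F" "v < k F" for u v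
    using c
  proof
    assume "\<forall>i<k F. \<tau> F i \<in> S \<longleftrightarrow> between c1 c2 i"
    then have "\<tau> F u \<in> S \<longleftrightarrow> between c1 c2 u" "\<tau> F v \<in> S \<longleftrightarrow> between c1 c2 v" using that by blast+
    then show ?thesis by simp
  next
    assume "\<forall>i<k F. \<tau> F i \<notin> S \<longleftrightarrow> between c1 c2 i"
    then have "\<tau> F u \<notin> S \<longleftrightarrow> between c1 c2 u" "\<tau> F v \<notin> S \<longleftrightarrow> between c1 c2 v" using that by blast+
    then show ?thesis by blast
  qed
  then show ?thesis by (intro exI[of _ c1] exI[of _ c2] allI impI)
qed

text \<open>All blocks of all faces are treated at once: for each of the four kinds, the systems of
  the blocks are united into one chord system, non-crossing because the blocks of a face occupy
  disjoint intervals. The shore of a bond is an interval on each face up to complement, so the union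
  inherits the cut condition from the demands. The constant is 144 = 4 * 36.\<close>

lemma level_bound:
  fixes fd :: "'d \<Rightarrow> 'f" and i j :: "'d \<Rightarrow> nat" and c :: "'e \<Rightarrow> nat" and l :: "'e \<Rightarrow> real"
  assumes D: "finite D" "\<And>d. d \<in> D \<Longrightarrow> fd d \<in> \<Phi>" "\<And>d. d \<in> D \<Longrightarrow> i d < j d" "\<And>d. d \<in> D \<Longrightarrow> j d < k (fd d)"
    and level: "\<And>d. d \<in> D \<Longrightarrow> i d div 2 ^ Suc m = j d div 2 ^ Suc m" "\<And>d. d \<in> D \<Longrightarrow> i d div 2 ^ m \<noteq> j d div 2 ^ m"
    and cutc: "\<And>S. card (cut (\<lambda>d. \<tau> (fd d) (i d)) (\<lambda>d. \<tau> (fd d) (j d)) D S) \<le> (\<Sum>e\<in>cut p q E S. c e)"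
    and l: "\<And>e. e \<in> E \<Longrightarrow> 0 \<le> l e"
  shows "(\<Sum>d\<in>D. jdist p q E l (\<tau> (fd d) (i d)) (\<tau> (fd d) (j d))) \<le> 144 * (\<Sum>e\<in>E. real (c e) * l e)"
proof -
  define key where "key d = (fd d, i d div 2 ^ Suc m)" for d
  define I where "I = key ` D"
  define B where "B z = {d \<in> D. key d = z}" for z
  define dd where "dd F u v = jdist p q E l (\<tau> F u) (\<tau> F v)" for F u v
  define A where "A z = snd z * 2 ^ Suc m" for z :: "'f \<times> nat"
  define Z where "Z z = Suc (snd z) * 2 ^ Suc m" for z :: "'f \<times> nat"
  have finI: "finite I" using D(1) by (simp add: I_def)
  have I\<Phi>: "fst z \<in> \<Phi>" if "z \<in> I" for z using that D(2) by (auto simp: I_def key_def)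
  have BD: "d \<in> D" "fd d = fst z" "i d div 2 ^ Suc m = snd z" if "d \<in> B z" for d z
    using that by (auto simp: B_def key_def)
  have "\<exists>N lo hi. (\<forall>t<4. laminar_system {..<k (fst z)} (A z) (Z z) (B z) i j (N t) (lo t) (hi t)) \<and>
     (\<Sum>d\<in>B z. dd (fst z) (i d) (j d)) \<le> 36 * (\<Sum>t<4::nat. \<Sum>w\<in>N t. dd (fst z) (lo t w) (hi t (w :: nat \<times> nat)))"
    if z: "z \<in> I" for z
  proof (rule block_systems)
    show "finite (B z)" using D(1) by (simp add: B_def)
    have V: "\<tau> (fst z) u \<in> V" if "u < k (fst z)" for u using \<tau>_V[OF I\<Phi>[OF z] that] .
    fix d assume d: "d \<in> B z"
    have jb: "j d div 2 ^ Suc m = snd z" using BD(3)[OF d] level(1)[OF BD(1)[OF d]] by simp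
    note h = halves_of_block[OF D(3)[OF BD(1)[OF d]] BD(3)[OF d] jb level(2)[OF BD(1)[OF d]]]
    have k: "i d < k (fst z)" "j d < k (fst z)" using D(3,4)[OF BD(1)[OF d]] BD(2)[OF d] by auto
    show "A z \<le> i d \<and> i d < A z + 2 ^ m \<and> i d \<in> {..<k (fst z)}" unfolding A_def using h(1) k by (simp only: lessThan_iff simp_thms)
    show "A z + 2 ^ m \<le> j d \<and> j d < Z z \<and> j d \<in> {..<k (fst z)}" unfolding A_def Z_def using h(2) k by (simp only: lessThan_iff simp_thms)
  next
    have V: "\<tau> (fst z) u \<in> V" if "u < k (fst z)" for u using \<tau>_V[OF I\<Phi>[OF z] that] .
    fix u v w assume "u \<in> {..<k (fst z)}" "v \<in> {..<k (fst z)}"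
    then have uv: "linked p q E (\<tau> (fst z) u) (\<tau> (fst z) v)" using linked V by simp
    then show "0 \<le> dd (fst z) u v" unfolding dd_def by (rule jdist_nonneg[OF fin(1) _ l])
    assume "w \<in> {..<k (fst z)}"
    then have "linked p q E (\<tau> (fst z) v) (\<tau> (fst z) w)" using linked V \<open>v \<in> _\<close> by simp
    then show "dd (fst z) u w \<le> dd (fst z) u v + dd (fst z) v w" unfolding dd_def
      by (rule jdist_triangle[OF fin(1) uv _ l])
  qed (simp_all add: dd_def jdist_refl[OF fin(1) l] jdist_commute)
  then have "\<forall>z\<in>I. \<exists>N lo hi. (\<forall>t<4. laminar_system {..<k (fst z)} (A z) (Z z) (B z) i j (N t) (lo t) (hi t)) \<and>
     (\<Sum>d\<in>B z. dd (fst z) (i d) (j d)) \<le> 36 * (\<Sum>t<4::nat. \<Sum>w\<in>N t. dd (fst z) (lo t w) (hi t (w :: nat \<times> nat)))"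
    by (intro ballI)
  from bchoice[OF this] obtain N where "\<forall>z\<in>I. \<exists>lo hi. (\<forall>t<4. laminar_system {..<k (fst z)} (A z) (Z z) (B z) i j (N z t) (lo t) (hi t)) \<and>
     (\<Sum>d\<in>B z. dd (fst z) (i d) (j d)) \<le> 36 * (\<Sum>t<4::nat. \<Sum>w\<in>N z t. dd (fst z) (lo t w) (hi t (w :: nat \<times> nat)))" ..
  from bchoice[OF this] obtain lo where "\<forall>z\<in>I. \<exists>hi. (\<forall>t<4. laminar_system {..<k (fst z)} (A z) (Z z) (B z) i j (N z t) (lo z t) (hi t)) \<and>
     (\<Sum>d\<in>B z. dd (fst z) (i d) (j d)) \<le> 36 * (\<Sum>t<4::nat. \<Sum>w\<in>N z t. dd (fst z) (lo z t w) (hi t (w :: nat \<times> nat)))" ..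
  from bchoice[OF this] obtain hi where N: "\<forall>z\<in>I. (\<forall>t<4. laminar_system {..<k (fst z)} (A z) (Z z) (B z) i j (N z t) (lo z t) (hi z t)) \<and>
     (\<Sum>d\<in>B z. dd (fst z) (i d) (j d)) \<le> 36 * (\<Sum>t<4::nat. \<Sum>w\<in>N z t. dd (fst z) (lo z t w) (hi z t (w :: nat \<times> nat)))" ..
  have sys: "laminar_system {..<k (fst z)} (A z) (Z z) (B z) i j (N z t) (lo z t) (hi z t)" if "z \<in> I" "t < 4" for z t
    using bspec[OF N that(1)] that(2) by (elim conjE allE[of _ t]) (rule mp)
  have dem: "(\<Sum>d\<in>B z. dd (fst z) (i d) (j d)) \<le> 36 * (\<Sum>t<4::nat. \<Sum>w\<in>N z t. dd (fst z) (lo z t w) (hi z t w))" if "z \<in> I" for z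
    using bspec[OF N that] by (rule conjunct2)
  have finN: "finite (N z t)" if "z \<in> I" "t < 4" for z t using sys[OF that] by (simp add: laminar_system_def)
  have pos: "lo z t w < hi z t w" "A z \<le> lo z t w" "hi z t w < Z z" "lo z t w < k (fst z)" "hi z t w < k (fst z)"
    if "z \<in> I" "t < 4" "w \<in> N z t" for z t w
  proof -
    have "\<forall>n\<in>N z t. lo z t n < hi z t n \<and> A z \<le> lo z t n \<and> hi z t n < Z z \<and> lo z t n \<in> {..<k (fst z)} \<and> hi z t n \<in> {..<k (fst z)}"
      using sys[OF that(1,2)] unfolding laminar_system_def by (elim conjE)
    from bspec[OF this that(3)] show "lo z t w < hi z t w" "A z \<le> lo z t w" "hi z t w < Z z" "lo z t w < k (fst z)" "hi z t w < k (fst z)"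
      by simp_all
  qed
  have bnd: "(\<Sum>n\<in>Sigma I (\<lambda>z. N z t). jdist p q E l (\<tau> (fst (fst n)) (lo (fst n) t (snd n))) (\<tau> (fst (fst n)) (hi (fst n) t (snd n))))
      \<le> (\<Sum>e\<in>E. real (c e) * l e)" if t: "t < 4" for t
  proof (rule chords.chords_bound[where \<Phi> = \<Phi> and T = T and a = a and b = b and V = V])
    have finS: "finite (Sigma I (\<lambda>z. N z t))" using finI finN t by (intro finite_SigmaI) auto
    show "chords E V \<Phi> T p q a b (Sigma I (\<lambda>z. N z t)) (\<lambda>n. fst (fst n)) (\<lambda>n. lo (fst n) t (snd n)) (\<lambda>n. hi (fst n) t (snd n))"
    proof (rule chords.intro[OF hub_graph_axioms], rule chords_axioms.intro)
      show "finite (Sigma I (\<lambda>z. N z t))" by (rule finS)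
      fix n assume n: "n \<in> Sigma I (\<lambda>z. N z t)"
      then have nI: "fst n \<in> I" "snd n \<in> N (fst n) t" by auto
      show "fst (fst n) \<in> \<Phi>" using I\<Phi>[OF nI(1)] .
      show "lo (fst n) t (snd n) < hi (fst n) t (snd n)" "hi (fst n) t (snd n) < k (fst (fst n))"
        using pos[OF nI(1) t nI(2)] by simp_all
      fix n' assume n': "n' \<in> Sigma I (\<lambda>z. N z t)" and F: "fst (fst n) = fst (fst n')"
        and lt: "lo (fst n) t (snd n) < lo (fst n') t (snd n')" "lo (fst n') t (snd n') < hi (fst n) t (snd n)"
      from n' have nI': "fst n' \<in> I" "snd n' \<in> N (fst n') t" by auto
      show "hi (fst n') t (snd n') \<le> hi (fst n) t (snd n)"
      proof (cases "fst n = fst n'")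
        case True
        have "\<forall>m\<in>N (fst n) t. \<forall>m'\<in>N (fst n) t. lo (fst n) t m < lo (fst n) t m' \<longrightarrow> lo (fst n) t m' < hi (fst n) t m \<longrightarrow> hi (fst n) t m' \<le> hi (fst n) t m"
          using sys[OF nI(1) t] unfolding laminar_system_def by (elim conjE)
        then show ?thesis using nI nI' lt unfolding True by simp
      next
        case False
        then have ne: "snd (fst n) \<noteq> snd (fst n')" using F by (metis prod.collapse)
        have far: "Z z \<le> A z'" if "snd z < snd z'" for z z'
          unfolding A_def Z_def using that by (intro mult_le_mono1) simp
        show ?thesis using pos[OF nI(1) t nI(2)] pos[OF nI'(1) t nI'(2)] lt ne
            far[of "fst n" "fst n'"] far[of "fst n'" "fst n"] by linarith
      qed
    qed
    show "card (cut (\<lambda>n. \<tau> (fst (fst n)) (lo (fst n) t (snd n))) (\<lambda>n. \<tau> (fst (fst n)) (hi (fst n) t (snd n))) (Sigma I (\<lambda>z. N z t)) S)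
        \<le> (\<Sum>e\<in>cut p q E S. c e)" for S
    proof (rule cut_condition_bonds[OF fin(1) finS linked])
      fix n assume "n \<in> Sigma I (\<lambda>z. N z t)"
      then have nI: "fst n \<in> I" "snd n \<in> N (fst n) t" by auto
      show "\<tau> (fst (fst n)) (lo (fst n) t (snd n)) \<in> V \<and> \<tau> (fst (fst n)) (hi (fst n) t (snd n)) \<in> V"
        using \<tau>_V[OF I\<Phi>[OF nI(1)]] pos[OF nI(1) t nI(2)] by blast
    next
      fix S assume S: "cut p q E S \<noteq> {}"
        "\<And>S'. cut p q E S' \<subseteq> cut p q E S \<Longrightarrow> cut p q E S' \<noteq> {} \<Longrightarrow> cut p q E S' = cut p q E S"
      let ?R = "\<lambda>F u v. (\<tau> F u \<in> S) \<noteq> (\<tau> F v \<in> S)"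
      have "cut (\<lambda>n. \<tau> (fst (fst n)) (lo (fst n) t (snd n))) (\<lambda>n. \<tau> (fst (fst n)) (hi (fst n) t (snd n))) (Sigma I (\<lambda>z. N z t)) S
          = Sigma I (\<lambda>z. {w \<in> N z t. ?R (fst z) (lo z t w) (hi z t w)})" by (auto simp: cut_def)
      then have "card (cut (\<lambda>n. \<tau> (fst (fst n)) (lo (fst n) t (snd n))) (\<lambda>n. \<tau> (fst (fst n)) (hi (fst n) t (snd n))) (Sigma I (\<lambda>z. N z t)) S)
          = (\<Sum>z\<in>I. card {w \<in> N z t. ?R (fst z) (lo z t w) (hi z t w)})"
        using finI finN t by (simp add: card_SigmaI)
      also have "\<dots> \<le> (\<Sum>z\<in>I. card {d \<in> B z. ?R (fst z) (i d) (j d)})"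
      proof (rule sum_mono)
        fix z assume z: "z \<in> I"
        have "\<exists>c1 c2. \<forall>u<k (fst z). \<forall>v<k (fst z). ?R (fst z) u v \<longleftrightarrow> between c1 c2 u \<noteq> between c1 c2 v"
          by (rule bond_between[OF S(1) _ I\<Phi>[OF z]]) (rule S(2))
        then obtain c1 c2 where "\<forall>u<k (fst z). \<forall>v<k (fst z). ?R (fst z) u v \<longleftrightarrow> between c1 c2 u \<noteq> between c1 c2 v"
          by (elim exE)
        then have c: "?R (fst z) u v \<longleftrightarrow> between c1 c2 u \<noteq> between c1 c2 v" if "u < k (fst z)" "v < k (fst z)" for u v
          using that by simp
        have "{w \<in> N z t. ?R (fst z) (lo z t w) (hi z t w)} = {w \<in> N z t. between c1 c2 (lo z t w) \<noteq> between c1 c2 (hi z t w)}"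
          using pos[OF z t] by (intro Collect_cong conj_cong refl c) auto
        moreover have "{d \<in> B z. ?R (fst z) (i d) (j d)} = {d \<in> B z. between c1 c2 (i d) \<noteq> between c1 c2 (j d)}"
        proof (intro Collect_cong conj_cong refl c)
          fix d assume "d \<in> B z"
          then show "i d < k (fst z)" "j d < k (fst z)" using BD[of d z] D(3,4)[of d] by auto
        qed
        moreover have "\<forall>c1 c2. card {n \<in> N z t. between c1 c2 (lo z t n) \<noteq> between c1 c2 (hi z t n)} \<le>
            card {d \<in> B z. between c1 c2 (i d) \<noteq> between c1 c2 (j d)}"
          using sys[OF z t] unfolding laminar_system_def by (elim conjE)
        ultimately show "card {w \<in> N z t. ?R (fst z) (lo z t w) (hi z t w)} \<le> card {d \<in> B z. ?R (fst z) (i d) (j d)}"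
          by (simp only:)
      qed
      also have "\<dots> = (\<Sum>z\<in>I. card {d \<in> cut (\<lambda>d. \<tau> (fd d) (i d)) (\<lambda>d. \<tau> (fd d) (j d)) D S. key d = z})"
        by (intro sum.cong refl arg_cong[of _ _ card]) (auto simp: B_def cut_def key_def)
      also have "\<dots> = (\<Sum>z\<in>I. \<Sum>d\<in>{d \<in> cut (\<lambda>d. \<tau> (fd d) (i d)) (\<lambda>d. \<tau> (fd d) (j d)) D S. key d = z}. 1)" by (simp only: card_eq_sum)
      also have "\<dots> = (\<Sum>d\<in>cut (\<lambda>d. \<tau> (fd d) (i d)) (\<lambda>d. \<tau> (fd d) (j d)) D S. 1)"
        by (rule sum.group[OF finite_cut[OF D(1)] finI]) (auto simp: I_def cut_def)
      also have "\<dots> = card (cut (\<lambda>d. \<tau> (fd d) (i d)) (\<lambda>d. \<tau> (fd d) (j d)) D S)" by (simp only: card_eq_sum)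
      also have "\<dots> \<le> (\<Sum>e\<in>cut p q E S. c e)" by (rule cutc)
      finally show "card (cut (\<lambda>n. \<tau> (fst (fst n)) (lo (fst n) t (snd n))) (\<lambda>n. \<tau> (fst (fst n)) (hi (fst n) t (snd n))) (Sigma I (\<lambda>z. N z t)) S)
        \<le> (\<Sum>e\<in>cut p q E S. c e)" .
    qed
  qed (rule l)
  have "(\<Sum>d\<in>D. jdist p q E l (\<tau> (fd d) (i d)) (\<tau> (fd d) (j d))) = (\<Sum>z\<in>I. \<Sum>d\<in>B z. jdist p q E l (\<tau> (fd d) (i d)) (\<tau> (fd d) (j d)))"
    unfolding B_def by (rule sum.group[symmetric]) (use D(1) finI in \<open>auto simp: I_def\<close>)
  also have "\<dots> = (\<Sum>z\<in>I. \<Sum>d\<in>B z. dd (fst z) (i d) (j d))"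
    unfolding dd_def using BD(2) by (intro sum.cong refl) (simp only:)
  also have "\<dots> \<le> (\<Sum>z\<in>I. 36 * (\<Sum>t<4::nat. \<Sum>w\<in>N z t. dd (fst z) (lo z t w) (hi z t w)))" by (rule sum_mono) (rule dem)
  also have "\<dots> = 36 * (\<Sum>z\<in>I. \<Sum>t<4::nat. \<Sum>w\<in>N z t. dd (fst z) (lo z t w) (hi z t w))" by (rule sum_distrib_left[symmetric])
  also have "(\<Sum>z\<in>I. \<Sum>t<4::nat. \<Sum>w\<in>N z t. dd (fst z) (lo z t w) (hi z t w)) = (\<Sum>t<4::nat. \<Sum>z\<in>I. \<Sum>w\<in>N z t. dd (fst z) (lo z t w) (hi z t w))"
    by (rule sum.swap)
  also have "\<dots> \<le> (\<Sum>t<4::nat. \<Sum>e\<in>E. real (c e) * l e)"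
  proof (rule sum_mono)
    fix t :: nat assume "t \<in> {..<4}"
    then have t: "t < 4" by simp
    have "(\<Sum>z\<in>I. \<Sum>w\<in>N z t. dd (fst z) (lo z t w) (hi z t w)) =
        (\<Sum>n\<in>Sigma I (\<lambda>z. N z t). dd (fst (fst n)) (lo (fst n) t (snd n)) (hi (fst n) t (snd n)))"
      using finI finN[OF _ t] by (subst sum.Sigma) (auto simp: case_prod_beta)
    then show "(\<Sum>z\<in>I. \<Sum>w\<in>N z t. dd (fst z) (lo z t w) (hi z t w)) \<le> (\<Sum>e\<in>E. real (c e) * l e)"
      using bnd[OF t] unfolding dd_def by (simp only:)
  qed
  also have "\<dots> = 4 * (\<Sum>e\<in>E. real (c e) * l e)" by simp
  finally show ?thesis by simp
qed

text \<open>The level of a demand is given by the smallest dyadic block that contains both its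
  positions. All positions are below \<open>2 ^ L\<close>, so only \<open>L\<close> levels
  occur.\<close>

lemma levels_bound:
  fixes fd :: "'d \<Rightarrow> 'f" and i j :: "'d \<Rightarrow> nat" and c :: "'e \<Rightarrow> nat" and l :: "'e \<Rightarrow> real"
  assumes D: "finite D" "\<And>d. d \<in> D \<Longrightarrow> fd d \<in> \<Phi>" "\<And>d. d \<in> D \<Longrightarrow> i d < j d" "\<And>d. d \<in> D \<Longrightarrow> j d < k (fd d)"
    and L: "\<And>d. d \<in> D \<Longrightarrow> k (fd d) \<le> 2 ^ L"
    and cutc: "\<And>S. card (cut (\<lambda>d. \<tau> (fd d) (i d)) (\<lambda>d. \<tau> (fd d) (j d)) D S) \<le> (\<Sum>e\<in>cut p q E S. c e)"
    and l: "\<And>e. e \<in> E \<Longrightarrow> 0 \<le> l e"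
  shows "(\<Sum>d\<in>D. jdist p q E l (\<tau> (fd d) (i d)) (\<tau> (fd d) (j d))) \<le> 144 * real L * (\<Sum>e\<in>E. real (c e) * l e)"
proof -
  define lev where "lev d = (LEAST m. i d div 2 ^ Suc m = j d div 2 ^ Suc m)" for d
  have lev: "lev d < L" "i d div 2 ^ Suc (lev d) = j d div 2 ^ Suc (lev d)" "i d div 2 ^ lev d \<noteq> j d div 2 ^ lev d" if d: "d \<in> D" for d
  proof -
    have lt: "i d < 2 ^ L" "j d < 2 ^ L" using D(3,4)[OF d] L[OF d] by linarith+
    have L0: "0 < L"
    proof (rule ccontr)
      assume "\<not> 0 < L"
      then show False using lt D(3)[OF d] by simp
    qed
    have ex: "i d div 2 ^ Suc (L - 1) = j d div 2 ^ Suc (L - 1)" using lt L0 by simp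
    show "i d div 2 ^ Suc (lev d) = j d div 2 ^ Suc (lev d)" unfolding lev_def by (rule LeastI[of _ "L - 1"]) (rule ex)
    have "lev d \<le> L - 1" unfolding lev_def by (rule Least_le) (rule ex)
    then show "lev d < L" using L0 by simp
    show "i d div 2 ^ lev d \<noteq> j d div 2 ^ lev d"
    proof (cases "lev d")
      case 0
      then show ?thesis using D(3)[OF d] by simp
    next
      case (Suc m)
      then have "m < (LEAST m. i d div 2 ^ Suc m = j d div 2 ^ Suc m)" by (simp add: lev_def)
      from not_less_Least[OF this] show ?thesis unfolding Suc .
    qed
  qed
  have "(\<Sum>d\<in>D. jdist p q E l (\<tau> (fd d) (i d)) (\<tau> (fd d) (j d))) =
      (\<Sum>m<L. \<Sum>d\<in>{d \<in> D. lev d = m}. jdist p q E l (\<tau> (fd d) (i d)) (\<tau> (fd d) (j d)))"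
    by (rule sum.group[symmetric]) (use D(1) lev(1) in auto)
  also have "\<dots> \<le> (\<Sum>m<L. 144 * (\<Sum>e\<in>E. real (c e) * l e))"
  proof (rule sum_mono, rule level_bound)
    fix m S
    have "card (cut (\<lambda>d. \<tau> (fd d) (i d)) (\<lambda>d. \<tau> (fd d) (j d)) {d \<in> D. lev d = m} S) \<le>
        card (cut (\<lambda>d. \<tau> (fd d) (i d)) (\<lambda>d. \<tau> (fd d) (j d)) D S)"
      using D(1) by (intro card_mono finite_cut) (auto simp: cut_def)
    also have "\<dots> \<le> (\<Sum>e\<in>cut p q E S. c e)" by (rule cutc)
    finally show "card (cut (\<lambda>d. \<tau> (fd d) (i d)) (\<lambda>d. \<tau> (fd d) (j d)) {d \<in> D. lev d = m} S) \<le> (\<Sum>e\<in>cut p q E S. c e)" .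
  next
    show "finite {d \<in> D. lev d = m}" for m using D(1) by simp
  next
    fix m d assume "d \<in> {d \<in> D. lev d = m}"
    then have d: "d \<in> D" "lev d = m" by auto
    show "fd d \<in> \<Phi>" "i d < j d" "j d < k (fd d)" using D(2-4)[OF d(1)] .
    show "i d div 2 ^ Suc m = j d div 2 ^ Suc m" "i d div 2 ^ m \<noteq> j d div 2 ^ m" using lev(2,3)[OF d(1)] unfolding d(2) .
  qed (rule l)
  also have "\<dots> = 144 * real L * (\<Sum>e\<in>E. real (c e) * l e)" by simp
  finally show ?thesis .
qed

end

section \<open>Linear programming duality\<close>

text \<open>Nonnegative combinations of inequalities, generated inductively so that properties of
  derived inequalities can be proved by induction on the derivation.\<close>

inductive_set cone :: "(('x \<Rightarrow> real) \<times> real) set \<Rightarrow> (('x \<Rightarrow> real) \<times> real) set" for S where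
  base: "(a, b) \<in> S \<Longrightarrow> (a, b) \<in> cone S"
| add: "(a, b) \<in> cone S \<Longrightarrow> (a', b') \<in> cone S \<Longrightarrow> (\<lambda>x. a x + a' x, b + b') \<in> cone S"
| scale: "(a, b) \<in> cone S \<Longrightarrow> 0 \<le> r \<Longrightarrow> (\<lambda>x. r * a x, r * b) \<in> cone S"

lemma cone_cone:
  assumes "S' \<subseteq> cone S" "(a, b) \<in> cone S'"
  shows "(a, b) \<in> cone S"
  using assms(2)
proof induction
  case (base a b)
  then show ?case using assms(1) by blast
qed (rule cone.add cone.scale; assumption)+

lemma between_finite_sets:
  fixes A B :: "real set"
  assumes "finite A" "finite B" "\<And>x y. x \<in> A \<Longrightarrow> y \<in> B \<Longrightarrow> x \<le> y"
  shows "\<exists>t. (\<forall>x\<in>A. x \<le> t) \<and> (\<forall>y\<in>B. t \<le> y)"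
proof (cases "A = {}")
  case True
  show ?thesis
  proof (cases "B = {}")
    case False
    then show ?thesis using True assms(2) by (intro exI[of _ "Min B"]) auto
  qed (use True in auto)
next
  case False
  then have "Max A \<in> A" using assms(1) by simp
  then show ?thesis using assms(1,3) False by (intro exI[of _ "Max A"]) auto
qed

text \<open>An element \<open>(a, b)\<close> of \<open>S\<close> stands for the inequality \<open>\<Sum>x\<in>X. a x * f x \<le> b\<close>. Eliminating
  a variable replaces \<open>S\<close> by a subset of its cone.\<close>

lemma farkas:
  assumes "finite X" "finite S" "\<And>a b. (a, b) \<in> cone S \<Longrightarrow> (\<forall>x\<in>X. a x = 0) \<Longrightarrow> 0 \<le> b"
  shows "\<exists>f. \<forall>(a, b)\<in>S. (\<Sum>x\<in>X. a x * f x) \<le> b"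
  using assms
proof (induction X arbitrary: S rule: finite_induct)
  case empty
  have "0 \<le> b" if "(a, b) \<in> S" for a b using empty(2)[OF cone.base[OF that]] by simp
  then show ?case by auto
next
  case (insert x X)
  define Z where "Z = {s \<in> S. fst s x = 0}"
  \<comment> \<open>Fourier-Motzkin elimination: with these nonnegative multipliers a positive and a
    negative coefficient of \<open>x\<close> cancel.\<close>
  define comb where "comb s s' = ((\<lambda>y. - fst s' x * fst s y + fst s x * fst s' y), - fst s' x * snd s + fst s x * snd s')"
    for s s' :: "('a \<Rightarrow> real) \<times> real"
  define S' where "S' = Z \<union> (\<lambda>(s, s'). comb s s') ` ({s \<in> S. 0 < fst s x} \<times> {s \<in> S. fst s x < 0})"
  have finS': "finite S'" unfolding S'_def Z_def using insert.prems(1) by auto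
  have comb: "comb s s' \<in> cone S" if "s \<in> S" "s' \<in> S" "0 < fst s x" "fst s' x < 0" for s s'
    unfolding comb_def using that by (intro cone.add cone.scale cone.base) auto
  have sub: "S' \<subseteq> cone S"
  proof
    fix z assume "z \<in> S'"
    then consider "z \<in> Z" | s s' where "z = comb s s'" "s \<in> S" "s' \<in> S" "0 < fst s x" "fst s' x < 0"
      unfolding S'_def by auto
    then show "z \<in> cone S"
    proof cases
      case 1
      then show ?thesis by (cases z) (auto simp: Z_def intro: cone.base)
    qed (use comb in simp)
  qed
  have zero: "a x = 0" if "(a, b) \<in> cone S'" for a b using that
  proof induction
    case (base a b)
    then show ?case by (auto simp: S'_def Z_def comb_def)
  qed simp_all
  obtain f where f: "\<forall>(a, b)\<in>S'. (\<Sum>x\<in>X. a x * f x) \<le> b"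
  proof -
    have "0 \<le> b" if "(a, b) \<in> cone S'" "\<forall>y\<in>X. a y = 0" for a b
      using insert.prems(2)[OF cone_cone[OF sub that(1)]] that(2) zero[OF that(1)] by simp
    then show thesis using insert.IH[OF finS'] that by blast
  qed
  define r where "r s = snd s - (\<Sum>x\<in>X. fst s x * f x)" for s :: "('a \<Rightarrow> real) \<times> real"
  have f': "0 \<le> r s" if "s \<in> S'" for s using bspec[OF f that] by (simp add: r_def case_prod_beta)
  have r_comb: "r (comb s s') = - fst s' x * r s + fst s x * r s'" for s s'
    by (simp add: r_def comb_def sum.distrib sum_distrib_left sum_subtractf sum_negf algebra_simps)
  \<comment> \<open>A value for the eliminated variable: the combined inequalities say that every
    lower bound is at most every upper bound.\<close>
  have "\<exists>t. (\<forall>l\<in>(\<lambda>s. r s / fst s x) ` {s \<in> S. fst s x < 0}. l \<le> t) \<and> (\<forall>u\<in>(\<lambda>s. r s / fst s x) ` {s \<in> S. 0 < fst s x}. t \<le> u)"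
  proof (rule between_finite_sets)
    fix l u assume "l \<in> (\<lambda>s. r s / fst s x) ` {s \<in> S. fst s x < 0}" "u \<in> (\<lambda>s. r s / fst s x) ` {s \<in> S. 0 < fst s x}"
    then obtain s s' where s: "s' \<in> S" "fst s' x < 0" "l = r s' / fst s' x" "s \<in> S" "0 < fst s x" "u = r s / fst s x" by auto
    then have "comb s s' \<in> S'" unfolding S'_def by auto
    then have "0 \<le> - fst s' x * r s + fst s x * r s'" using f' r_comb by metis
    then show "l \<le> u" unfolding s(3,6) using s(2,5) by (simp add: field_simps)
  qed (use insert.prems(1) in auto)
  then obtain t where tl: "\<forall>l\<in>(\<lambda>s. r s / fst s x) ` {s \<in> S. fst s x < 0}. l \<le> t" and tu: "\<forall>u\<in>(\<lambda>s. r s / fst s x) ` {s \<in> S. 0 < fst s x}. t \<le> u"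
    by (elim exE conjE)
  have t1: "r s / fst s x \<le> t" if "s \<in> S" "fst s x < 0" for s
    by (rule bspec[OF tl], rule imageI) (use that in simp)
  have t2: "t \<le> r s / fst s x" if "s \<in> S" "0 < fst s x" for s
    by (rule bspec[OF tu], rule imageI) (use that in simp)
  have le: "fst s x * t \<le> r s" if "s \<in> S" for s
  proof -
    consider "fst s x = 0" | "fst s x < 0" | "0 < fst s x" by linarith
    then show ?thesis
    proof cases
      case 1
      then show ?thesis using f'[of s] that by (simp add: S'_def Z_def)
    next
      case 2
      then show ?thesis using t1[OF that] by (simp add: field_simps)
    next
      case 3
      then show ?thesis using t2[OF that] by (simp add: field_simps)
    qed
  qed
  have "(\<Sum>y\<in>insert x X. a y * (f(x := t)) y) \<le> b" if "(a, b) \<in> S" for a b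
  proof -
    have "(\<Sum>y\<in>X. a y * (f(x := t)) y) = (\<Sum>y\<in>X. a y * f y)" using insert.hyps(2) by (intro sum.cong) auto
    then show ?thesis using le[OF that] insert.hyps by (simp add: r_def)
  qed
  then show ?case by blast
qed

text \<open>\<open>l\<close> are dual lengths of the edges and \<open>\<alpha>\<close> the dual
  variables of the demands, of arbitrary sign because the flow values are prescribed by equations.
  The assumed bound says that no contradiction can be derived from the constraints.\<close>

lemma feasible_if_dual_bound:
  assumes pg: "plane_graph V E" and D: "finite D"
    and dual: "\<And>l \<alpha>. (\<And>e. e \<in> E \<Longrightarrow> 0 \<le> l e) \<Longrightarrow>
      (\<And>d P. d \<in> D \<Longrightarrow> P \<in> paths_between V E (fst (h d)) (snd (h d)) \<Longrightarrow> \<alpha> d \<le> (\<Sum>e\<in>set (snd P). l e)) \<Longrightarrow>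
      (\<Sum>d\<in>D. \<alpha> d) \<le> (\<Sum>e\<in>E. C e * l e)"
  shows "feasible V E C D h"
proof -
  define PB where "PB d = paths_between V E (fst (h d)) (snd (h d))" for d
  define X where "X = Sigma D PB"
  have finE: "finite E" and finV: "finite V" using pg by (auto simp: plane_graph_def)
  have finP: "finite (PB d)" for d unfolding PB_def by (rule finite_paths_between[OF finV finE])
  have finX: "finite X" unfolding X_def using D finP by auto
  \<comment> \<open>The rows in their order: nonnegativity of the path variables, demand at most 1,
    demand at least 1, capacity.\<close>
  define S :: "((nat \<times> complex list \<times> complex set list \<Rightarrow> real) \<times> real) set" where "S = (\<lambda>x. (\<lambda>y. if y = x then -1 else 0, 0)) ` X \<union>
    (\<lambda>d. (\<lambda>y. if fst y = d then 1 else 0, 1)) ` D \<union> (\<lambda>d. (\<lambda>y. if fst y = d then -1 else 0, -1)) ` D \<union>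
    (\<lambda>e. (\<lambda>y. if e \<in> set (snd (snd y)) then 1 else 0, C e)) ` E"
  have setE: "set (snd P) \<subseteq> E" if "P \<in> PB d" for d P using that by (auto simp: PB_def paths_between_def)
  \<comment> \<open>Every derived inequality reveals its multipliers: capacity rows contribute to
    \<open>l\<close> and demand rows to \<open>\<alpha>\<close>, while nonnegativity rows only lower
    coefficients, hence an inequality for \<open>a x\<close>.\<close>
  have inv: "\<exists>l \<alpha>. (\<forall>e\<in>E. 0 \<le> l e) \<and> (\<forall>x\<in>X. a x \<le> (\<Sum>e\<in>set (snd (snd x)). l e) - \<alpha> (fst x)) \<and>
      b = (\<Sum>e\<in>E. C e * l e) - (\<Sum>d\<in>D. \<alpha> d)" if "(a, b) \<in> cone S" for a b
    using that
  proof induction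
    case (base a b)
    then consider x where "x \<in> X" "a = (\<lambda>y. if y = x then -1 else 0)" "b = 0"
      | d where "d \<in> D" "a = (\<lambda>y. if fst y = d then 1 else 0)" "b = 1"
      | d where "d \<in> D" "a = (\<lambda>y. if fst y = d then -1 else 0)" "b = -1"
      | e where "e \<in> E" "a = (\<lambda>y. if e \<in> set (snd (snd y)) then 1 else 0)" "b = C e"
      unfolding S_def by blast
    then show ?case
    proof cases
      case 1
      then show ?thesis by (intro exI[of _ "\<lambda>_. 0"]) auto
    next
      case (2 d)
      then show ?thesis using D by (intro exI[of _ "\<lambda>_. 0"] exI[of _ "\<lambda>d'. if d' = d then -1 else 0"]) auto
    next
      case (3 d)
      then show ?thesis using D by (intro exI[of _ "\<lambda>_. 0"] exI[of _ "\<lambda>d'. if d' = d then 1 else 0"]) auto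
    next
      case (4 e)
      then show ?thesis using finE
        by (intro exI[of _ "\<lambda>e'. if e' = e then 1 else 0"] exI[of _ "\<lambda>_. 0"]) (auto simp: if_distrib cong: if_cong)
    qed
  next
    case (add a b a' b')
    obtain l \<alpha> where 1: "\<forall>e\<in>E. 0 \<le> l e" "\<forall>x\<in>X. a x \<le> (\<Sum>e\<in>set (snd (snd x)). l e) - \<alpha> (fst x)"
      "b = (\<Sum>e\<in>E. C e * l e) - (\<Sum>d\<in>D. \<alpha> d)" using add.IH(1) by (elim exE conjE)
    obtain l' \<alpha>' where 2: "\<forall>e\<in>E. 0 \<le> l' e" "\<forall>x\<in>X. a' x \<le> (\<Sum>e\<in>set (snd (snd x)). l' e) - \<alpha>' (fst x)"
      "b' = (\<Sum>e\<in>E. C e * l' e) - (\<Sum>d\<in>D. \<alpha>' d)" using add.IH(2) by (elim exE conjE)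
    show ?case
    proof (intro exI[of _ "\<lambda>e. l e + l' e"] exI[of _ "\<lambda>d. \<alpha> d + \<alpha>' d"] conjI ballI)
      fix x assume "x \<in> X"
      then have "a x \<le> (\<Sum>e\<in>set (snd (snd x)). l e) - \<alpha> (fst x)" "a' x \<le> (\<Sum>e\<in>set (snd (snd x)). l' e) - \<alpha>' (fst x)"
        using 1(2) 2(2) by simp_all
      then show "a x + a' x \<le> (\<Sum>e\<in>set (snd (snd x)). l e + l' e) - (\<alpha> (fst x) + \<alpha>' (fst x))"
        by (simp add: sum.distrib)
    qed (use 1 2 in \<open>simp_all add: sum.distrib algebra_simps\<close>)
  next
    case (scale a b r)
    obtain l \<alpha> where 1: "\<forall>e\<in>E. 0 \<le> l e" "\<forall>x\<in>X. a x \<le> (\<Sum>e\<in>set (snd (snd x)). l e) - \<alpha> (fst x)"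
      "b = (\<Sum>e\<in>E. C e * l e) - (\<Sum>d\<in>D. \<alpha> d)" using scale.IH by (elim exE conjE)
    show ?case
    proof (intro exI[of _ "\<lambda>e. r * l e"] exI[of _ "\<lambda>d. r * \<alpha> d"] conjI ballI)
      fix x assume "x \<in> X"
      then have "r * a x \<le> r * ((\<Sum>e\<in>set (snd (snd x)). l e) - \<alpha> (fst x))"
        using 1(2) scale.hyps(2) by (intro mult_left_mono) simp_all
      then show "r * a x \<le> (\<Sum>e\<in>set (snd (snd x)). r * l e) - r * \<alpha> (fst x)"
        by (simp add: sum_distrib_left right_diff_distrib)
    qed (use 1 scale.hyps(2) in \<open>simp_all add: sum_distrib_left right_diff_distrib mult.left_commute\<close>)
  qed
  have "\<exists>f. \<forall>(a, b)\<in>S. (\<Sum>x\<in>X. a x * f x) \<le> b"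
  proof (rule farkas[OF finX])
    show "finite S" unfolding S_def using finX D finE by auto
    fix a b assume ab: "(a, b) \<in> cone S" "\<forall>x\<in>X. a x = 0"
    obtain l \<alpha> where l: "\<forall>e\<in>E. 0 \<le> l e" "\<forall>x\<in>X. a x \<le> (\<Sum>e\<in>set (snd (snd x)). l e) - \<alpha> (fst x)"
      "b = (\<Sum>e\<in>E. C e * l e) - (\<Sum>d\<in>D. \<alpha> d)" using inv[OF ab(1)] by (elim exE conjE)
    have "(\<Sum>d\<in>D. \<alpha> d) \<le> (\<Sum>e\<in>E. C e * l e)"
    proof (rule dual)
      fix d P assume "d \<in> D" "P \<in> paths_between V E (fst (h d)) (snd (h d))"
      then have "(d, P) \<in> X" by (simp add: X_def PB_def)
      then show "\<alpha> d \<le> (\<Sum>e\<in>set (snd P). l e)" using l(2) ab(2) by fastforce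
    qed (use l(1) in blast)
    then show "0 \<le> b" using l(3) by simp
  qed
  then obtain f where f: "\<forall>(a, b)\<in>S. (\<Sum>x\<in>X. a x * f x) \<le> b" ..
  have fS: "(\<Sum>x\<in>X. a x * f x) \<le> b" if "(a, b) \<in> S" for a b using bspec[OF f that] by simp
  have sumX: "(\<Sum>x\<in>X. g x) = (\<Sum>d\<in>D. \<Sum>P\<in>PB d. g (d, P))" for g :: "_ \<Rightarrow> real"
    unfolding X_def using D finP by (subst sum.Sigma) auto
  have one: "(\<Sum>x\<in>X. (if fst x = d then z else 0) * f x) = z * (\<Sum>P\<in>PB d. f (d, P))" if "d \<in> D" for d and z :: real
  proof -
    have "(\<Sum>x\<in>X. (if fst x = d then z else 0) * f x) = (\<Sum>d'\<in>D. if d' = d then z * (\<Sum>P\<in>PB d. f (d, P)) else 0)"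
      unfolding sumX by (intro sum.cong refl) (auto simp: sum_distrib_left)
    then show ?thesis using that D by simp
  qed
  show ?thesis unfolding feasible_def PB_def[symmetric]
  proof (intro exI[of _ "\<lambda>d P. f (d, P)"] conjI ballI)
    fix d P assume "d \<in> D" "P \<in> PB d"
    then have dP: "(d, P) \<in> X" by (simp add: X_def)
    have "(\<Sum>x\<in>X. (if x = (d, P) then -1 else 0) * f x) \<le> 0" by (rule fS) (use dP in \<open>auto simp: S_def\<close>)
    moreover have "(\<Sum>x\<in>X. (if x = (d, P) then -1 else 0) * f x) = (\<Sum>x\<in>X. if x = (d, P) then - f (d, P) else 0)"
      by (rule sum.cong) auto
    ultimately show "0 \<le> f (d, P)" using dP finX by simp
  next
    fix d assume d: "d \<in> D"
    have "(\<Sum>x\<in>X. (if fst x = d then 1 else 0) * f x) \<le> 1" by (rule fS) (use d in \<open>auto simp: S_def\<close>)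
    moreover have "(\<Sum>x\<in>X. (if fst x = d then -1 else 0) * f x) \<le> -1" by (rule fS) (use d in \<open>auto simp: S_def\<close>)
    ultimately show "(\<Sum>P\<in>PB d. f (d, P)) = 1" unfolding one[OF d] by simp
  next
    fix e assume e: "e \<in> E"
    have "(\<Sum>x\<in>X. (if e \<in> set (snd (snd x)) then 1 else 0) * f x) \<le> C e" by (rule fS) (use e in \<open>auto simp: S_def\<close>)
    moreover have "(\<Sum>x\<in>X. (if e \<in> set (snd (snd x)) then 1 else 0) * f x) =
        (\<Sum>d\<in>D. \<Sum>P | P \<in> PB d \<and> e \<in> set (snd P). f (d, P))"
    proof -
      have "(\<Sum>P | P \<in> PB d \<and> e \<in> set (snd P). f (d, P)) = (\<Sum>P\<in>PB d. (if e \<in> set (snd P) then 1 else 0) * f (d, P))" for d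
        by (subst sum.inter_filter[OF finP]) (auto intro: sum.cong)
      then show ?thesis unfolding sumX by simp
    qed
    ultimately show "(\<Sum>d\<in>D. \<Sum>P | P \<in> PB d \<and> e \<in> set (snd P). f (d, P)) \<le> C e" by simp
  qed
qed

section \<open>Instances in terms of joins and cuts\<close>

lemma linked_transfer:
  assumes "finite E" "linked p q E u v" "finite E'" "\<And>e. e \<in> E \<Longrightarrow> linked p' q' E' (f (p e)) (f (q e))"
  shows "linked p' q' E' (f u) (f v)"
proof -
  let ?R = "{w. linked p' q' E' (f u) (f w)}"
  have "p e \<in> ?R \<longleftrightarrow> q e \<in> ?R" if e: "e \<in> E" for e
    using linked_trans[OF assms(3) _ assms(4)[OF e], of "f u"]
      linked_trans[OF assms(3) _ linked_sym[OF assms(4)[OF e]], of "f u"] by blast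
  then have "cut p q E ?R = {}" by (auto simp: cut_def)
  then have "u \<in> ?R \<longleftrightarrow> v \<in> ?R" by (rule connected_cut_empty[OF assms(1,2)])
  moreover have "u \<in> ?R" by (simp add: linked_refl)
  ultimately show ?thesis by simp
qed

text \<open>Leads from joins back to the flow problem: a join contains a simple path between its odd
  vertices, and with nonnegative lengths this path is not longer.\<close>

lemma path_in_join:
  assumes pg: "plane_graph V E" and u: "u \<in> V" and J: "J \<subseteq> E" "bdry (end0 V) (end1 V) J = sym_diff {u} {v}"
  obtains P where "P \<in> paths_between V E u v" "set (snd P) \<subseteq> J"
proof -
  have finJ: "finite J" using pg J(1) by (auto simp: plane_graph_def intro: finite_subset)
  have "linked (end0 V) (end1 V) J u v" unfolding linked_def using J(2) by (intro exI[of _ J]) (simp only: subset_refl simp_thms)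
  from linked_imp_spath[OF finJ this] obtain es vs where sp: "spath (end0 V) (end1 V) J v u es vs" by (elim exE)
  note n = spath_nth[OF sp]
  have es: "set es \<subseteq> J" using spath_facts(3)[OF sp] .
  have esE: "es ! i \<in> E" if "i < length es" for i using es J(1) nth_mem[OF that] by blast
  have inV: "vs ! i \<in> V" if "i < length vs" for i
  proof (cases i)
    case 0
    then show ?thesis using n(4) u by simp
  next
    case (Suc i')
    then have i': "i' < length es" using that n(1) by simp
    then have "vs ! Suc i' \<in> {end0 V (es ! i'), end1 V (es ! i')}" using n(6) by simp
    then show ?thesis using edge_arc(5,6)[OF pg esE[OF i']] Suc by auto
  qed
  have "(vs, es) \<in> paths_between V E u v"
    unfolding paths_between_def mem_Collect_eq prod.case
  proof (intro conjI allI impI)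
    have ne: "vs \<noteq> []" using n(1) by auto
    show "hd vs = u" using n(4) hd_conv_nth[OF ne] by simp
    show "last vs = v" using n(1,5) last_conv_nth[OF ne] by simp
    show "set vs \<subseteq> V" using inV by (auto simp: in_set_conv_nth)
    show "set es \<subseteq> E" using es J(1) by blast
    fix i assume i: "i < length es"
    show "es ! i \<inter> V = {vs ! i, vs ! Suc i}" using edge_arc(3)[OF pg esE[OF i]] n(6)[OF i] by simp
  qed (use n(1,2) in simp_all)
  then show thesis using that[of "(vs, es)"] es by simp
qed

lemma supply_cut_eq:
  assumes "plane_graph V E"
  shows "supply_cut V E c (S \<inter> V) = (\<Sum>e\<in>cut (end0 V) (end1 V) E S. c e)"
  unfolding supply_cut_def
proof (rule sum.cong[OF _ refl])
  have "e \<inter> V \<inter> (S \<inter> V) \<noteq> {} \<and> e \<inter> V - S \<inter> V \<noteq> {} \<longleftrightarrow> (end0 V e \<in> S) \<noteq> (end1 V e \<in> S)" if "e \<in> E" for e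
    unfolding edge_arc(3)[OF assms that] using edge_arc(5,6)[OF assms that] by auto
  then show "{e \<in> E. e \<inter> V \<inter> (S \<inter> V) \<noteq> {} \<and> e \<inter> V - S \<inter> V \<noteq> {}} = cut (end0 V) (end1 V) E S" unfolding cut_def by blast
qed

lemma demand_cut_Int:
  assumes "demand_multigraph V D h"
  shows "demand_cut D h (S \<inter> V) = demand_cut D h S"
proof -
  have "{d \<in> D. (fst (h d) \<in> S \<inter> V) \<noteq> (snd (h d) \<in> S \<inter> V)} = {d \<in> D. (fst (h d) \<in> S) \<noteq> (snd (h d) \<in> S)}"
    using assms by (auto simp: demand_multigraph_def)
  then show ?thesis by (simp only: demand_cut_def)
qed

text \<open>The vertices reachable from one end form a shore that no supply edge leaves, so by the
  cut condition no demand leaves it.\<close>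

lemma demand_linked:
  assumes pg: "plane_graph V E" and dm: "demand_multigraph V D h" and cc: "cut_condition V E c D h" and d: "d \<in> D"
  shows "linked (end0 V) (end1 V) E (fst (h d)) (snd (h d))"
proof -
  let ?R = "{w. linked (end0 V) (end1 V) E (fst (h d)) w}"
  have finE: "finite E" using pg by (simp add: plane_graph_def)
  have "end0 V e \<in> ?R \<longleftrightarrow> end1 V e \<in> ?R" if e: "e \<in> E" for e
    using linked_trans[OF finE _ linked_edge[OF e], of "end0 V" "end1 V" "fst (h d)"]
      linked_trans[OF finE _ linked_sym[OF linked_edge[OF e]], of "end0 V" "end1 V" "fst (h d)"] by blast
  then have "cut (end0 V) (end1 V) E ?R = {}" by (auto simp: cut_def)
  then have "supply_cut V E c (?R \<inter> V) = 0" unfolding supply_cut_eq[OF pg] by simp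
  moreover have "demand_cut D h (?R \<inter> V) \<le> supply_cut V E c (?R \<inter> V)" using cc by (simp add: cut_condition_def)
  ultimately have "demand_cut D h (?R \<inter> V) = 0" by (simp only: le_zero_eq)
  then have "card {d \<in> D. (fst (h d) \<in> ?R) \<noteq> (snd (h d) \<in> ?R)} = 0"
    unfolding demand_cut_Int[OF dm] unfolding demand_cut_def .
  moreover have "finite D" using dm by (simp add: demand_multigraph_def)
  ultimately have "{d \<in> D. (fst (h d) \<in> ?R) \<noteq> (snd (h d) \<in> ?R)} = {}" by simp
  then have "(fst (h d) \<in> ?R) = (snd (h d) \<in> ?R)" using d by blast
  moreover have "fst (h d) \<in> ?R" by (simp add: linked_refl)
  ultimately show ?thesis by simp
qed

section \<open>The flow-cut gap\<close>

lemma connected_instance_bound: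
  fixes c :: "complex set \<Rightarrow> nat"
  assumes pg: "plane_graph V E" and dm: "demand_multigraph V D h" and fi: "face_instance V E D h \<phi>"
    and cc: "cut_condition V E c D h"
    and lnk: "\<And>u v. u \<in> V \<Longrightarrow> v \<in> V \<Longrightarrow> linked (end0 V) (end1 V) E u v"
    and few: "\<And>F. card (face_terminals D h \<phi> F) \<le> 2 ^ L"
    and l: "\<And>e. e \<in> E \<Longrightarrow> 0 \<le> l e"
    and \<alpha>: "\<And>d P. d \<in> D \<Longrightarrow> P \<in> paths_between V E (fst (h d)) (snd (h d)) \<Longrightarrow> \<alpha> d \<le> (\<Sum>e\<in>set (snd P). l e)"
  shows "(\<Sum>d\<in>D. \<alpha> d) \<le> 144 * real L * (\<Sum>e\<in>E. real (c e) * l e)"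
proof -
  \<comment> \<open>Demands with equal ends are set aside: each remaining one brings two terminals
    to its face, so every hub has at least two spokes.\<close>
  define D1 where "D1 = {d \<in> D. fst (h d) \<noteq> snd (h d)}"
  define \<Phi> where "\<Phi> = \<phi> ` D1"
  define T where "T F = face_terminals D1 h \<phi> F" for F
  have finV: "finite V" and finE: "finite E" using pg by (auto simp: plane_graph_def)
  have finD: "finite D" using dm by (simp add: demand_multigraph_def)
  have dends: "fst (h d) \<in> V" "snd (h d) \<in> V" if "d \<in> D" for d using dm that by (auto simp: demand_multigraph_def)
  have D1: "d \<in> D" "fst (h d) \<noteq> snd (h d)" if "d \<in> D1" for d using that by (auto simp: D1_def)
  have finD1: "finite D1" using finD by (simp add: D1_def)
  have fin\<Phi>: "finite \<Phi>" using finD1 by (simp add: \<Phi>_def)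
  have sub\<Phi>: "\<Phi> \<subseteq> faces V E" using fi D1 by (auto simp: \<Phi>_def face_instance_def)
  have TF: "T F \<subseteq> V \<inter> frontier F" for F
    using fi dends D1 by (auto simp: T_def face_terminals_def face_instance_def)
  have Tle: "card (T F) \<le> 2 ^ L" for F
  proof -
    have "face_terminals D h \<phi> F \<subseteq> V" using dends by (auto simp: face_terminals_def)
    then have "finite (face_terminals D h \<phi> F)" using finV by (rule finite_subset)
    then have "card (T F) \<le> card (face_terminals D h \<phi> F)"
      using D1 by (intro card_mono) (auto simp: T_def face_terminals_def)
    then show ?thesis using few[of F] by simp
  qed
  have T_ends: "fst (h d) \<in> T (\<phi> d)" "snd (h d) \<in> T (\<phi> d)" if "d \<in> D1" for d
    using that by (auto simp: T_def face_terminals_def)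
  have T2: "2 \<le> card (T F)" if F: "F \<in> \<Phi>" for F
  proof -
    obtain d where d: "d \<in> D1" "F = \<phi> d" using F by (auto simp: \<Phi>_def)
    have "finite (T F)" using TF[of F] finV by (auto intro: finite_subset)
    then have "card {fst (h d), snd (h d)} \<le> card (T F)" using T_ends[OF d(1)] d(2) by (intro card_mono) auto
    then show ?thesis using D1(2)[OF d(1)] by simp
  qed
  have main: "(\<Sum>d\<in>D1. \<alpha> d) \<le> 144 * real L * (\<Sum>e\<in>E. real (c e) * l e)"
  proof (rule plane_graph_with_spokes[OF pg fin\<Phi> sub\<Phi> TF])
    fix a b
    assume dual: "dual_pair (hub_edges E \<Phi> T) (hub_p (end0 V)) (hub_q (end1 V)) a b"
      and spoke: "\<And>F v. F \<in> \<Phi> \<Longrightarrow> v \<in> T F \<Longrightarrow>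
        linked (hub_p (end0 V)) (hub_q (end1 V)) (hub_edges E \<Phi> T - {Inr (F, v)}) (Inr F) (Inl v) \<Longrightarrow>
        a (Inr (F, v)) \<subseteq> F \<and> b (Inr (F, v)) \<subseteq> F \<and> a (Inr (F, v)) \<noteq> {} \<and> b (Inr (F, v)) \<noteq> {}"
    have finT: "finite (T F)" for F using TF[of F] finV by (auto intro: finite_subset)
    have finX: "finite (hub_edges E \<Phi> T)" unfolding hub_edges_def using finE fin\<Phi> finT by auto
    \<comment> \<open>The hub can also be reached through a second terminal and the connected graph,
      which puts the spoke on a cycle; hence its dual ends are faces inside
      \<open>F\<close>.\<close>
    have sp: "a (Inr (F, v)) \<subseteq> F \<and> b (Inr (F, v)) \<subseteq> F \<and> a (Inr (F, v)) \<noteq> {} \<and> b (Inr (F, v)) \<noteq> {}"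
      if F: "F \<in> \<Phi>" and v: "v \<in> T F" for F v
    proof (rule spoke[OF F v])
      let ?X = "hub_edges E \<Phi> T - {Inr (F, v)}"
      have "\<not> T F \<subseteq> {v}" using T2[OF F] card_mono[of "{v}" "T F"] by auto
      then obtain v' where v': "v' \<in> T F" "v' \<noteq> v" by blast
      have "Inr (F, v') \<in> ?X" using F v' by simp
      from linked_edge[OF this, of "hub_p (end0 V)" "hub_q (end1 V)"]
      have 1: "linked (hub_p (end0 V)) (hub_q (end1 V)) ?X (Inr F) (Inl v')" by simp
      have 2: "linked (hub_p (end0 V)) (hub_q (end1 V)) ?X (Inl v') (Inl v)"
      proof (rule linked_transfer[OF finE lnk])
        show "v' \<in> V" "v \<in> V" using v v' TF by auto
        show "finite ?X" using finX by simp
        fix e assume "e \<in> E"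
        then have "Inl e \<in> ?X" by simp
        from linked_edge[OF this, of "hub_p (end0 V)" "hub_q (end1 V)"]
        show "linked (hub_p (end0 V)) (hub_q (end1 V)) ?X (Inl (end0 V e)) (Inl (end1 V e))" by simp
      qed
      have "finite ?X" using finX by (rule finite_Diff)
      then show "linked (hub_p (end0 V)) (hub_q (end1 V)) ?X (Inr F) (Inl v)" by (rule linked_trans[OF _ 1 2])
    qed
    interpret hub_graph E V \<Phi> T "end0 V" "end1 V" a b
    proof
      \<comment> \<open>Wedges are nonempty subsets of their faces, and different faces are
        disjoint.\<close>
      fix F F' v v' assume F: "F \<in> \<Phi>" "F' \<in> \<Phi>" "v \<in> T F" "v' \<in> T F'" "F \<noteq> F'"
      have "F \<in> components (- (V \<union> \<Union>E))" "F' \<in> components (- (V \<union> \<Union>E))" using F(1,2) sub\<Phi> by (auto simp: faces_def)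
      then have "F \<inter> F' = {}" using components_eq F(5) by blast
      then show "{a (Inr (F, v)), b (Inr (F, v))} \<inter> {a (Inr (F', v')), b (Inr (F', v'))} = {}"
        using sp[OF F(1,3)] sp[OF F(2,4)] by blast
    qed (use finV finE fin\<Phi> TF T2 lnk dual edge_arc(5,6)[OF pg] in \<open>auto\<close>)
    have "\<exists>i j. i < j \<and> j < k (\<phi> d) \<and> {fst (h d), snd (h d)} = {\<tau> (\<phi> d) i, \<tau> (\<phi> d) j}" if d: "d \<in> D1" for d
    proof -
      have F: "\<phi> d \<in> \<Phi>" using d by (simp add: \<Phi>_def)
      obtain i j where ij: "i < k (\<phi> d)" "fst (h d) = \<tau> (\<phi> d) i" "j < k (\<phi> d)" "snd (h d) = \<tau> (\<phi> d) j"
        using T_obtain[OF F T_ends(1)[OF d]] T_obtain[OF F T_ends(2)[OF d]] by (elim exE conjE)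
      then have "i \<noteq> j" using D1(2)[OF d] by auto
      then consider "i < j" | "j < i" by linarith
      then show ?thesis
      proof cases
        case 1
        then show ?thesis using ij by (intro exI[of _ i] exI[of _ j]) simp
      next
        case 2
        then show ?thesis using ij by (intro exI[of _ j] exI[of _ i]) (simp add: insert_commute)
      qed
    qed
    then have "\<forall>d\<in>D1. \<exists>i j. i < j \<and> j < k (\<phi> d) \<and> {fst (h d), snd (h d)} = {\<tau> (\<phi> d) i, \<tau> (\<phi> d) j}" by (intro ballI)
    from bchoice[OF this] obtain i where "\<forall>d\<in>D1. \<exists>j. i d < j \<and> j < k (\<phi> d) \<and> {fst (h d), snd (h d)} = {\<tau> (\<phi> d) (i d), \<tau> (\<phi> d) j}" ..
    from bchoice[OF this] obtain j where "\<forall>d\<in>D1. i d < j d \<and> j d < k (\<phi> d) \<and> {fst (h d), snd (h d)} = {\<tau> (\<phi> d) (i d), \<tau> (\<phi> d) (j d)}" ..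
    then have ij: "i d < j d" "j d < k (\<phi> d)" "{fst (h d), snd (h d)} = {\<tau> (\<phi> d) (i d), \<tau> (\<phi> d) (j d)}" if "d \<in> D1" for d
      using that by simp_all
    have dist: "(\<Sum>d\<in>D1. jdist (end0 V) (end1 V) E l (\<tau> (\<phi> d) (i d)) (\<tau> (\<phi> d) (j d))) \<le> 144 * real L * (\<Sum>e\<in>E. real (c e) * l e)"
    proof (rule levels_bound)
      fix d assume d: "d \<in> D1"
      show "\<phi> d \<in> \<Phi>" using d by (simp add: \<Phi>_def)
      show "i d < j d" "j d < k (\<phi> d)" using ij(1,2)[OF d] .
      show "k (\<phi> d) \<le> 2 ^ L" using Tle by (simp add: k_def)
    next
      fix S
      have "(\<tau> (\<phi> d) (i d) \<in> S) \<noteq> (\<tau> (\<phi> d) (j d) \<in> S) \<longleftrightarrow> (fst (h d) \<in> S) \<noteq> (snd (h d) \<in> S)" if d: "d \<in> D1" for d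
        using ij(3)[OF d] by (auto simp: doubleton_eq_iff)
      then have "card (cut (\<lambda>d. \<tau> (\<phi> d) (i d)) (\<lambda>d. \<tau> (\<phi> d) (j d)) D1 S) \<le> demand_cut D h S"
        unfolding demand_cut_def cut_def using finD D1(1) by (intro card_mono) auto
      also have "\<dots> = demand_cut D h (S \<inter> V)" using demand_cut_Int[OF dm] by simp
      also have "\<dots> \<le> supply_cut V E c (S \<inter> V)" using cc by (simp add: cut_condition_def)
      also have "\<dots> = (\<Sum>e\<in>cut (end0 V) (end1 V) E S. c e)" by (rule supply_cut_eq[OF pg])
      finally show "card (cut (\<lambda>d. \<tau> (\<phi> d) (i d)) (\<lambda>d. \<tau> (\<phi> d) (j d)) D1 S) \<le> (\<Sum>e\<in>cut (end0 V) (end1 V) E S. c e)" .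
    qed (use finD1 l in auto)
    have le: "\<alpha> d \<le> jdist (end0 V) (end1 V) E l (\<tau> (\<phi> d) (i d)) (\<tau> (\<phi> d) (j d))" if d: "d \<in> D1" for d
    proof -
      have dD: "d \<in> D" using D1(1)[OF d] .
      obtain J where J: "J \<subseteq> E" "bdry (end0 V) (end1 V) J = sym_diff {fst (h d)} {snd (h d)}"
        "jdist (end0 V) (end1 V) E l (fst (h d)) (snd (h d)) = sum l J"
        by (rule jdist_obtain[OF finE lnk[OF dends[OF dD]]])
      obtain P where P: "P \<in> paths_between V E (fst (h d)) (snd (h d))" "set (snd P) \<subseteq> J"
        by (rule path_in_join[OF pg dends(1)[OF dD] J(1,2)])
      have "\<alpha> d \<le> (\<Sum>e\<in>set (snd P). l e)" by (rule \<alpha>[OF dD P(1)])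
      also have "\<dots> \<le> sum l J" using P(2) J(1) finE l by (intro sum_mono2) (auto intro: finite_subset)
      finally have "\<alpha> d \<le> jdist (end0 V) (end1 V) E l (fst (h d)) (snd (h d))" using J(3) by simp
      moreover have "jdist (end0 V) (end1 V) E l (fst (h d)) (snd (h d)) = jdist (end0 V) (end1 V) E l (\<tau> (\<phi> d) (i d)) (\<tau> (\<phi> d) (j d))"
        using ij(3)[OF d] jdist_commute by (auto simp: doubleton_eq_iff)
      ultimately show ?thesis by simp
    qed
    have "(\<Sum>d\<in>D1. \<alpha> d) \<le> (\<Sum>d\<in>D1. jdist (end0 V) (end1 V) E l (\<tau> (\<phi> d) (i d)) (\<tau> (\<phi> d) (j d)))"
      by (rule sum_mono) (rule le)
    also note dist
    finally show ?thesis .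
  qed
  have "\<alpha> d \<le> 0" if d: "d \<in> D - D1" for d
  proof -
    \<comment> \<open>A demand with equal ends has the path without edges, of length 0.\<close>
    have "([fst (h d)], []) \<in> paths_between V E (fst (h d)) (snd (h d))"
      using d dends(1)[of d] by (auto simp: paths_between_def D1_def)
    from \<alpha>[OF _ this] d show ?thesis by simp
  qed
  then have "(\<Sum>d\<in>D - D1. \<alpha> d) \<le> 0" by (rule sum_nonpos)
  moreover have "(\<Sum>d\<in>D. \<alpha> d) = (\<Sum>d\<in>D - D1. \<alpha> d) + (\<Sum>d\<in>D1. \<alpha> d)"
    using finD by (intro sum.subset_diff) (auto simp: D1_def)
  ultimately show ?thesis using main by simp
qed

text \<open>Restriction of an instance to a connected component \<open>K\<close> of the graph. By Janiszewski's theorem, two faces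
  that both touch \<open>K\<close> remain different faces when the rest of the graph is removed.\<close>

locale component_instance =
  fixes V E c D h \<phi> K EK DK
  assumes pg: "plane_graph V E" and dm: "demand_multigraph V D h" and fi: "face_instance V E D h \<phi>"
    and cc: "cut_condition V E c D h"
    and K: "K \<subseteq> V" "\<And>u v. u \<in> K \<Longrightarrow> v \<in> K \<Longrightarrow> linked (end0 V) (end1 V) E u v"
      "\<And>e. e \<in> E \<Longrightarrow> end0 V e \<in> K \<longleftrightarrow> end1 V e \<in> K"
    and EK: "EK = {e \<in> E. end0 V e \<in> K}" and DK: "DK = {d \<in> D. fst (h d) \<in> K}"
begin

definition A where "A = K \<union> \<Union>EK"
definition B where "B = (V - K) \<union> \<Union>(E - EK)"

lemma fin: "finite V" "finite E" "finite K" "finite EK"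
  using pg K(1) EK by (auto simp: plane_graph_def intro: finite_subset)

lemma EK_edge: "e \<in> EK \<Longrightarrow> e \<in> E" "e \<in> EK \<Longrightarrow> e \<inter> V \<subseteq> K" "e \<in> EK \<Longrightarrow> e \<inter> K = e \<inter> V"
proof -
  show E: "e \<in> EK \<Longrightarrow> e \<in> E" using EK by simp
  show s: "e \<in> EK \<Longrightarrow> e \<inter> V \<subseteq> K" using edge_arc(3)[OF pg E] K(3)[OF E] EK by auto
  show "e \<in> EK \<Longrightarrow> e \<inter> K = e \<inter> V" using s K(1) by blast
qed

lemma other_edge: "e \<in> E \<Longrightarrow> e \<notin> EK \<Longrightarrow> e \<inter> K = {}"
proof -
  assume e: "e \<in> E" "e \<notin> EK"
  then have "end0 V e \<notin> K" "end1 V e \<notin> K" using K(3)[OF e(1)] EK by auto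
  then have "e \<inter> V \<inter> K = {}" using edge_arc(3)[OF pg e(1)] by auto
  then show ?thesis using K(1) by blast
qed

lemma plane_graph_component: "plane_graph K EK"
  unfolding plane_graph_def
proof (intro conjI ballI impI)
  fix e assume e: "e \<in> EK"
  show "\<exists>g. arc g \<and> path_image g = e \<and> e \<inter> K = {pathstart g, pathfinish g}"
    using pg EK_edge(1)[OF e] unfolding EK_edge(3)[OF e] plane_graph_def by simp
  fix e' assume e': "e' \<in> EK" "e \<noteq> e'"
  have "e \<inter> e' \<subseteq> V" using pg EK_edge(1)[OF e] EK_edge(1)[OF e'(1)] e'(2) by (simp add: plane_graph_def)
  then show "e \<inter> e' \<subseteq> K" using EK_edge(2)[OF e] by blast
qed (rule fin)+

lemma AB: "A \<inter> B = {}" "A \<union> B = V \<union> \<Union>E"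
proof -
  have "e \<inter> e' = {}" if "e \<in> EK" "e' \<in> E" "e' \<notin> EK" for e e'
  proof -
    have "e \<noteq> e'" using that by blast
    then have "e \<inter> e' \<subseteq> V" using pg EK_edge(1)[OF that(1)] that(2) by (simp add: plane_graph_def)
    then show ?thesis using EK_edge(2)[OF that(1)] other_edge[OF that(2,3)] by blast
  qed
  then show "A \<inter> B = {}" unfolding A_def B_def using EK_edge(2) other_edge by blast
  show "A \<union> B = V \<union> \<Union>E" unfolding A_def B_def using K(1) EK by blast
qed

lemma compact_AB: "compact A" "closed B"
proof -
  have e: "compact e" if "e \<in> E" for e
    using compact_arc_image[OF edge_arc(1)[OF pg that]] edge_arc(2)[OF pg that] by simp
  have "compact (\<Union>EK)" using fin(4) e EK_edge(1) by (intro compact_Union) auto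
  then show "compact A" unfolding A_def by (rule compact_Un[OF finite_imp_compact[OF fin(3)]])
  have "compact (\<Union>(E - EK))" using fin(2) e by (intro compact_Union) auto
  then show "closed B" unfolding B_def by (intro closed_Un finite_imp_closed[OF finite_Diff[OF fin(1)]] compact_imp_closed)
qed

lemma connected_component_K:
  assumes "u \<in> K" "v \<in> K"
  shows "connected_component (- B) u v"
proof -
  let ?R = "{w \<in> K. connected_component (- B) u w}"
  have "end0 V e \<in> ?R \<longleftrightarrow> end1 V e \<in> ?R" if e: "e \<in> E" for e
  proof (cases "e \<in> EK")
    case True
    have "connected e" using connected_arc_image[OF edge_arc(1)[OF pg e]] edge_arc(2)[OF pg e] by simp
    moreover have "e \<subseteq> - B" using True AB(1) by (auto simp: A_def)
    moreover have "end0 V e \<in> e" "end1 V e \<in> e" using edge_arc(3)[OF pg e] by auto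
    ultimately have "connected_component (- B) (end0 V e) (end1 V e)" unfolding connected_component_def by blast
    then show ?thesis using K(3)[OF e] connected_component_trans connected_component_sym by blast
  next
    case False
    then show ?thesis using K(3)[OF e] e EK by auto
  qed
  then have "cut (end0 V) (end1 V) E ?R = {}" by (auto simp: cut_def)
  then have "u \<in> ?R \<longleftrightarrow> v \<in> ?R" by (rule connected_cut_empty[OF fin(2) K(2)[OF assms]])
  moreover have "u \<in> - B" using assms(1) AB(1) by (auto simp: A_def)
  ultimately show ?thesis using assms by simp
qed

lemma linked_component:
  assumes "u \<in> K" "v \<in> K"
  shows "linked (end0 K) (end1 K) EK u v"
proof -
  let ?R = "{w \<in> K. linked (end0 K) (end1 K) EK u w}"
  have "end0 V e \<in> ?R \<longleftrightarrow> end1 V e \<in> ?R" if e: "e \<in> E" for e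
  proof (cases "e \<in> EK")
    case True
    have "{end0 K e, end1 K e} = {end0 V e, end1 V e}"
      using edge_arc(3)[OF pg e] edge_arc(3)[OF plane_graph_component True] EK_edge(3)[OF True] by simp
    then have "end0 K e = end0 V e \<and> end1 K e = end1 V e \<or> end0 K e = end1 V e \<and> end1 K e = end0 V e"
      unfolding doubleton_eq_iff .
    moreover note l = linked_edge[OF True, of "end0 K" "end1 K"]
    ultimately have lk: "linked (end0 K) (end1 K) EK (end0 V e) (end1 V e)"
      using linked_sym[OF l] by (elim disjE conjE) (simp_all only:)
    have "linked (end0 K) (end1 K) EK u (end0 V e) \<longleftrightarrow> linked (end0 K) (end1 K) EK u (end1 V e)"
      using linked_trans[OF fin(4) _ lk, of u] linked_trans[OF fin(4) _ linked_sym[OF lk], of u] by blast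
    then show ?thesis using K(3)[OF e] by simp
  next
    case False
    then show ?thesis using K(3)[OF e] e EK by auto
  qed
  then have "cut (end0 V) (end1 V) E ?R = {}" by (auto simp: cut_def)
  then have "u \<in> ?R \<longleftrightarrow> v \<in> ?R" by (rule connected_cut_empty[OF fin(2) K(2)[OF assms]])
  then show ?thesis using assms linked_refl[of "end0 K" "end1 K" EK u] by simp
qed

lemma DK_ends: "d \<in> DK \<Longrightarrow> fst (h d) \<in> K" "d \<in> DK \<Longrightarrow> snd (h d) \<in> K"
proof -
  show 1: "d \<in> DK \<Longrightarrow> fst (h d) \<in> K" using DK by simp
  assume d: "d \<in> DK"
  then have lk: "linked (end0 V) (end1 V) E (fst (h d)) (snd (h d))" using demand_linked[OF pg dm cc] DK by simp
  have "cut (end0 V) (end1 V) E K = {}" using K(3) by (auto simp: cut_def)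
  then have "fst (h d) \<in> K \<longleftrightarrow> snd (h d) \<in> K" by (rule connected_cut_empty[OF fin(2) lk])
  then show "snd (h d) \<in> K" using 1[OF d] by simp
qed

lemma demand_component: "demand_multigraph K DK h"
  using dm DK_ends by (simp add: demand_multigraph_def DK)

lemma cut_condition_component: "cut_condition K EK c DK h"
  unfolding cut_condition_def
proof (intro allI impI)
  fix S assume S: "S \<subseteq> K"
  have "demand_cut DK h S \<le> demand_cut D h S"
    unfolding demand_cut_def using dm by (intro card_mono) (auto simp: demand_multigraph_def DK)
  also have "\<dots> \<le> supply_cut V E c S" using cc S K(1) by (simp add: cut_condition_def)
  also have "\<dots> = supply_cut K EK c S"
    unfolding supply_cut_def
  proof (rule sum.cong[OF _ refl])
    have "e \<in> E \<and> e \<inter> V \<inter> S \<noteq> {} \<and> e \<inter> V - S \<noteq> {} \<longleftrightarrow> e \<in> EK \<and> e \<inter> K \<inter> S \<noteq> {} \<and> e \<inter> K - S \<noteq> {}" for e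
    proof (cases "e \<in> EK")
      case True
      then show ?thesis using EK_edge(1,3)[of e] by simp
    next
      case False
      then show ?thesis using other_edge[of e] S by blast
    qed
    then show "{e \<in> E. e \<inter> V \<inter> S \<noteq> {} \<and> e \<inter> V - S \<noteq> {}} = {e \<in> EK. e \<inter> K \<inter> S \<noteq> {} \<and> e \<inter> K - S \<noteq> {}}" by simp
  qed
  finally show "supply_cut K EK c S \<ge> demand_cut DK h S" .
qed

lemma paths_component: "paths_between K EK u v \<subseteq> paths_between V E u v"
proof
  fix P assume P: "P \<in> paths_between K EK u v"
  obtain vs es where e: "P = (vs, es)" by (cases P)
  have "es ! i \<inter> V = {vs ! i, vs ! Suc i}" if "i < length es" for i
  proof -
    have "es ! i \<in> EK" using P e that nth_mem[OF that] by (auto simp: paths_between_def)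
    from EK_edge(3)[OF this] show ?thesis using P e that by (simp add: paths_between_def)
  qed
  then show "P \<in> paths_between V E u v" using P e K(1) EK by (auto simp: paths_between_def)
qed

definition pt :: "_ \<Rightarrow> complex" where "pt d = (SOME x. x \<in> \<phi> d)"
text \<open>The face of the component that contains the original face.\<close>

definition \<phi>' where "\<phi>' d = connected_component_set (- A) (pt d)"

lemma face_facts:
  assumes "d \<in> D"
  shows "\<phi> d \<in> components (- (V \<union> \<Union>E))" "pt d \<in> \<phi> d" "connected (\<phi> d)" "\<phi> d \<inter> A = {}" "\<phi> d \<inter> B = {}" "\<phi> d \<subseteq> \<phi>' d"
proof -
  show comp: "\<phi> d \<in> components (- (V \<union> \<Union>E))" using fi assms by (auto simp: face_instance_def faces_def)
  then have "\<phi> d \<noteq> {}" by (rule in_components_nonempty)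
  then show pt: "pt d \<in> \<phi> d" unfolding pt_def by (simp add: some_in_eq)
  show conn: "connected (\<phi> d)" using comp by (rule in_components_connected)
  have "\<phi> d \<subseteq> - (A \<union> B)" using in_components_subset[OF comp] unfolding AB(2) .
  then show "\<phi> d \<inter> A = {}" "\<phi> d \<inter> B = {}" by blast+
  then have "\<phi> d \<subseteq> - A" by blast
  then show "\<phi> d \<subseteq> \<phi>' d" unfolding \<phi>'_def by (rule connected_component_maximal[OF pt conn])
qed

lemma face_instance_component: "face_instance K EK DK h \<phi>'"
  unfolding face_instance_def
proof (intro ballI conjI)
  fix d assume d: "d \<in> DK"
  then have dD: "d \<in> D" by (simp add: DK)
  note f = face_facts[OF dD]
  show "\<phi>' d \<in> faces K EK"
    unfolding \<phi>'_def faces_def A_def[symmetric] using f(2,4) by (intro componentsI) blast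
  have fr: "u \<in> frontier (\<phi>' d)" if u: "u \<in> frontier (\<phi> d)" "u \<in> K" for u
  proof -
    have "u \<in> closure (\<phi>' d)" using u(1) closure_mono[OF f(6)] by (auto simp: frontier_def)
    moreover have "u \<notin> \<phi>' d" using connected_component_subset[of "- A" "pt d"] u(2) by (auto simp: \<phi>'_def A_def)
    ultimately show ?thesis using interior_subset by (auto simp: frontier_def)
  qed
  show "fst (h d) \<in> frontier (\<phi>' d)" "snd (h d) \<in> frontier (\<phi>' d)"
    using fi dD DK_ends[OF d] by (auto intro!: fr simp: face_instance_def)
qed

text \<open>Both original faces have a terminal in \<open>K\<close>, so they are connected to each
  other off \<open>B\<close> through the component itself; equality of the new faces connects them
  off \<open>A\<close>. As \<open>A\<close> and \<open>B\<close> are disjoint, Janiszewski's theorem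
  connects them off both. This keeps the terminal count of a face from growing.\<close>

lemma \<phi>'_inj:
  assumes d: "d \<in> DK" "d' \<in> DK" and eq: "\<phi>' d = \<phi>' d'"
  shows "\<phi> d = \<phi> d'"
proof -
  have dD: "d \<in> D" "d' \<in> D" using d by (simp_all add: DK)
  have to_K: "connected_component (- B) (pt d) (fst (h d))" if d: "d \<in> DK" for d
  proof -
    have dD: "d \<in> D" using d by (simp add: DK)
    note f = face_facts[OF dD]
    have "fst (h d) \<in> closure (\<phi> d)" using fi dD by (auto simp: face_instance_def frontier_def)
    then have "connected (insert (fst (h d)) (\<phi> d))"
      using closure_subset by (intro connected_intermediate_closure[OF f(3)]) auto
    moreover have "insert (fst (h d)) (\<phi> d) \<subseteq> - B" using f(5) DK_ends(1)[OF d] AB(1) by (auto simp: A_def)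
    ultimately show ?thesis unfolding connected_component_def using f(2) by blast
  qed
  have c1: "connected_component (- B) (pt d) (pt d')"
    using to_K[OF d(1)] to_K[OF d(2)] connected_component_K[OF DK_ends(1)[OF d(1)] DK_ends(1)[OF d(2)]]
    by (meson connected_component_sym connected_component_trans)
  have c2: "connected_component (- A) (pt d) (pt d')"
    using face_facts(2,6)[OF dD(2)] eq by (auto simp: \<phi>'_def)
  have "connected (A \<inter> B)" by (simp add: AB(1))
  from Janiszewski[OF compact_AB this c2 c1] have "connected_component (- (A \<union> B)) (pt d) (pt d')" .
  then have c: "connected_component (- (V \<union> \<Union>E)) (pt d) (pt d')" unfolding AB(2) .
  let ?C = "connected_component_set (- (V \<union> \<Union>E)) (pt d)"
  show ?thesis
  proof (rule joinable_components_eq[of ?C "- (V \<union> \<Union>E)"], intro conjI)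
    show "\<phi> d \<in> components (- (V \<union> \<Union>E))" by (rule face_facts(1)[OF dD(1)])
    show "\<phi> d' \<in> components (- (V \<union> \<Union>E))" by (rule face_facts(1)[OF dD(2)])
    have "pt d \<in> ?C" using connected_component_in[OF c] by simp
    then show "\<phi> d \<inter> ?C \<noteq> {}" using face_facts(2)[OF dD(1)] by blast
    show "\<phi> d' \<inter> ?C \<noteq> {}" using c face_facts(2)[OF dD(2)] by blast
    show "connected ?C" by simp
    show "?C \<subseteq> - (V \<union> \<Union>E)" by (rule connected_component_subset)
  qed
qed

lemma component_bound:
  assumes few: "\<And>F. card (face_terminals D h \<phi> F) \<le> 2 ^ L"
    and l: "\<And>e. e \<in> E \<Longrightarrow> 0 \<le> l e"
    and \<alpha>: "\<And>d P. d \<in> D \<Longrightarrow> P \<in> paths_between V E (fst (h d)) (snd (h d)) \<Longrightarrow> \<alpha> d \<le> (\<Sum>e\<in>set (snd P). l e)"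
  shows "(\<Sum>d\<in>DK. \<alpha> d) \<le> 144 * real L * (\<Sum>e\<in>EK. real (c e) * l e)"
proof (rule connected_instance_bound[OF plane_graph_component demand_component face_instance_component cut_condition_component])
  show "card (face_terminals DK h \<phi>' F) \<le> 2 ^ L" for F
  proof (cases "\<exists>d\<in>DK. \<phi>' d = F")
    case True
    then obtain d0 where d0: "d0 \<in> DK" "\<phi>' d0 = F" by blast
    have "\<phi> d = \<phi> d0" if "d \<in> DK" "\<phi>' d = F" for d using \<phi>'_inj[OF that(1) d0(1)] that(2) d0(2) by simp
    then have sub: "face_terminals DK h \<phi>' F \<subseteq> face_terminals D h \<phi> (\<phi> d0)"
      by (auto simp: face_terminals_def DK)
    have "face_terminals D h \<phi> (\<phi> d0) \<subseteq> V" using dm by (auto simp: face_terminals_def demand_multigraph_def)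
    then have "finite (face_terminals D h \<phi> (\<phi> d0))" using fin(1) by (rule finite_subset)
    from card_mono[OF this sub] show ?thesis using few[of "\<phi> d0"] by simp
  next
    case False
    then have "face_terminals DK h \<phi>' F = {}" by (auto simp: face_terminals_def)
    then show ?thesis by simp
  qed
  fix d P assume "d \<in> DK" "P \<in> paths_between K EK (fst (h d)) (snd (h d))"
  then show "\<alpha> d \<le> (\<Sum>e\<in>set (snd P). l e)" using \<alpha>[of d P] paths_component by (auto simp: DK)
qed (use linked_component l EK_edge(1) in auto)

end

text \<open>Supply edges stay within a component, and by the cut condition so do demands; hence the
  bounds for the components add up.\<close>

lemma instance_bound:
  fixes c :: "complex set \<Rightarrow> nat"
  assumes pg: "plane_graph V E" and dm: "demand_multigraph V D h" and fi: "face_instance V E D h \<phi>"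
    and cc: "cut_condition V E c D h"
    and few: "\<And>F. card (face_terminals D h \<phi> F) \<le> 2 ^ L"
    and l: "\<And>e. e \<in> E \<Longrightarrow> 0 \<le> l e"
    and \<alpha>: "\<And>d P. d \<in> D \<Longrightarrow> P \<in> paths_between V E (fst (h d)) (snd (h d)) \<Longrightarrow> \<alpha> d \<le> (\<Sum>e\<in>set (snd P). l e)"
  shows "(\<Sum>d\<in>D. \<alpha> d) \<le> 144 * real L * (\<Sum>e\<in>E. real (c e) * l e)"
proof -
  define comp where "comp u = {v \<in> V. linked (end0 V) (end1 V) E u v}" for u
  have fin: "finite V" "finite E" using pg by (auto simp: plane_graph_def)
  have finD: "finite D" using dm by (simp add: demand_multigraph_def)
  have comp_eq: "comp u = comp v \<longleftrightarrow> v \<in> comp u" if "u \<in> V" "v \<in> V" for u v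
  proof
    assume "comp u = comp v"
    then show "v \<in> comp u" using that by (auto simp: comp_def linked_refl)
  next
    assume "v \<in> comp u"
    then have uv: "linked (end0 V) (end1 V) E u v" by (simp add: comp_def)
    show "comp u = comp v" unfolding comp_def
      using linked_trans[OF fin(2) uv] linked_trans[OF fin(2) linked_sym[OF uv]] by blast
  qed
  have bnd: "(\<Sum>d\<in>{d \<in> D. comp (fst (h d)) = K}. \<alpha> d) \<le> 144 * real L * (\<Sum>e\<in>{e \<in> E. comp (end0 V e) = K}. real (c e) * l e)"
    if "K \<in> comp ` V" for K
  proof -
    obtain r where r: "r \<in> V" "K = comp r" using \<open>K \<in> comp ` V\<close> by blast
    have mem: "comp u = K \<longleftrightarrow> u \<in> K" if "u \<in> V" for u using comp_eq[OF r(1) that] unfolding r(2) by blast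
    have ends: "end0 V e \<in> V" "end1 V e \<in> V" if "e \<in> E" for e using edge_arc(5,6)[OF pg that] .
    interpret component_instance V E c D h \<phi> K "{e \<in> E. comp (end0 V e) = K}" "{d \<in> D. comp (fst (h d)) = K}"
    proof
      show "K \<subseteq> V" unfolding r(2) comp_def by (rule Collect_restrict)
      show "linked (end0 V) (end1 V) E u v" if "u \<in> K" "v \<in> K" for u v
      proof -
        have 1: "linked (end0 V) (end1 V) E r u" and 2: "linked (end0 V) (end1 V) E r v"
          using that unfolding r(2) comp_def by simp_all
        show ?thesis by (rule linked_trans[OF fin(2) linked_sym[OF 1] 2])
      qed
      show "end0 V e \<in> K \<longleftrightarrow> end1 V e \<in> K" if e: "e \<in> E" for e
      proof -
        have "comp (end0 V e) = comp (end1 V e)"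
          using comp_eq[OF ends[OF e]] linked_edge[OF e, of "end0 V" "end1 V"] ends[OF e] by (simp add: comp_def)
        then show ?thesis using mem[OF ends(1)[OF e]] mem[OF ends(2)[OF e]] by simp
      qed
      show "{e \<in> E. comp (end0 V e) = K} = {e \<in> E. end0 V e \<in> K}" using mem ends by blast
      show "{d \<in> D. comp (fst (h d)) = K} = {d \<in> D. fst (h d) \<in> K}" using mem dm by (auto simp: demand_multigraph_def)
    qed (rule pg dm fi cc)+
    show ?thesis by (rule component_bound[OF few l \<alpha>])
  qed
  have "(\<Sum>d\<in>D. \<alpha> d) = (\<Sum>K\<in>comp ` V. \<Sum>d\<in>{d \<in> D. comp (fst (h d)) = K}. \<alpha> d)"
    by (rule sum.group[symmetric]) (use finD fin dm in \<open>auto simp: demand_multigraph_def\<close>)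
  also have "\<dots> \<le> (\<Sum>K\<in>comp ` V. 144 * real L * (\<Sum>e\<in>{e \<in> E. comp (end0 V e) = K}. real (c e) * l e))"
    by (rule sum_mono) (rule bnd)
  also have "\<dots> = 144 * real L * (\<Sum>K\<in>comp ` V. \<Sum>e\<in>{e \<in> E. comp (end0 V e) = K}. real (c e) * l e)"
    by (rule sum_distrib_left[symmetric])
  also have "(\<Sum>K\<in>comp ` V. \<Sum>e\<in>{e \<in> E. comp (end0 V e) = K}. real (c e) * l e) = (\<Sum>e\<in>E. real (c e) * l e)"
    by (rule sum.group) (use fin edge_arc(5)[OF pg] in auto)
  finally show ?thesis .
qed

text \<open>For \<open>t\<close> at least 2 the binary logarithm is at least 1, so rounding up at
  most doubles it: 288 = 2 * 144. For smaller \<open>t\<close> the choice \<open>L = 0\<close> makes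
  both sides vanish, with \<open>ln 0 = 0\<close>; in such an instance every demand has equal
  ends.\<close>

lemma logarithm_bound:
  "\<exists>L. t \<le> 2 ^ L \<and> 144 * real L \<le> 288 / ln 2 * ln (real t)"
proof (cases "t \<le> 1")
  case True
  then have "t = 0 \<or> t = 1" by auto
  then show ?thesis by (intro exI[of _ 0]) auto
next
  case False
  define L where "L = nat \<lceil>log 2 (real t)\<rceil>"
  have log1: "1 \<le> log 2 (real t)" using False by (simp add: le_log_iff)
  then have L: "real L = of_int \<lceil>log 2 (real t)\<rceil>" unfolding L_def by simp
  have "log 2 (real t) \<le> real L" unfolding L by (rule le_of_int_ceiling)
  then have "real t \<le> 2 powr real L" using False by (subst (asm) log_le_iff) auto
  then have "real t \<le> real (2 ^ L)" by (simp add: powr_realpow)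
  then have "t \<le> 2 ^ L" by (simp only: of_nat_le_iff)
  moreover have "real L \<le> log 2 (real t) + 1" unfolding L by linarith
  then have "144 * real L \<le> 288 * log 2 (real t)" using log1 by linarith
  then have "144 * real L \<le> 288 / ln 2 * ln (real t)" by (simp add: log_def)
  ultimately show ?thesis by blast
qed

theorem theorem5:
  "\<exists>C::real. C > 0 \<and>
     (\<forall>(V :: complex set) (E :: complex set set) (c :: complex set \<Rightarrow> nat)
       (D :: nat set) (h :: nat \<Rightarrow> complex \<times> complex) (\<phi> :: nat \<Rightarrow> complex set) (t :: nat).
        plane_graph V E \<longrightarrow> demand_multigraph V D h \<longrightarrow> face_instance V E D h \<phi> \<longrightarrow>
        cut_condition V E c D h \<longrightarrow> t = max_face_terminals V E D h \<phi> \<longrightarrow>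
        feasible V E (\<lambda>e. C * ln (real t) * real (c e)) D h \<and>
        flow_cut_gap V E c D h \<le> C * ln (real t))"
proof (intro exI[of _ "288 / ln 2 :: real"] conjI allI impI)
  let ?C = "288 / ln 2 :: real"
  show "0 < ?C" by simp
  fix V :: "complex set" and E D h \<phi> and c :: "complex set \<Rightarrow> nat" and t :: nat
  assume pg: "plane_graph V E" and dm: "demand_multigraph V D h" and fi: "face_instance V E D h \<phi>"
    and cc: "cut_condition V E c D h" and t: "t = max_face_terminals V E D h \<phi>"
  obtain L where L: "t \<le> 2 ^ L" "144 * real L \<le> ?C * ln (real t)" using logarithm_bound by blast
  \<comment> \<open>Sets that are not faces carry no demand, so the bound extends from faces to all
    \<open>F\<close>.\<close>
  have few: "card (face_terminals D h \<phi> F) \<le> 2 ^ L" for F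
  proof (cases "F \<in> faces V E")
    case True
    then have "card (face_terminals D h \<phi> F) \<le> t" unfolding t max_face_terminals_def
      using face_terminal_counts_finite_nonempty(1)[OF pg dm] by (intro Max_ge) auto
    then show ?thesis using L(1) by simp
  next
    case False
    then have "face_terminals D h \<phi> F = {}" using fi by (auto simp: face_terminals_def face_instance_def)
    then show ?thesis by simp
  qed
  show feas: "feasible V E (\<lambda>e. ?C * ln (real t) * real (c e)) D h"
  proof (rule feasible_if_dual_bound[OF pg])
    show "finite D" using dm by (simp add: demand_multigraph_def)
    fix l :: "complex set \<Rightarrow> real" and \<alpha> :: "nat \<Rightarrow> real"
    assume l: "\<And>e. e \<in> E \<Longrightarrow> 0 \<le> l e"
      and \<alpha>: "\<And>d P. d \<in> D \<Longrightarrow> P \<in> paths_between V E (fst (h d)) (snd (h d)) \<Longrightarrow> \<alpha> d \<le> (\<Sum>e\<in>set (snd P). l e)"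
    have "(\<Sum>d\<in>D. \<alpha> d) \<le> 144 * real L * (\<Sum>e\<in>E. real (c e) * l e)"
      by (rule instance_bound[OF pg dm fi cc few l \<alpha>])
    also have "\<dots> \<le> ?C * ln (real t) * (\<Sum>e\<in>E. real (c e) * l e)"
      using L(2) l by (intro mult_right_mono sum_nonneg) auto
    finally show "(\<Sum>d\<in>D. \<alpha> d) \<le> (\<Sum>e\<in>E. ?C * ln (real t) * real (c e) * l e)"
      by (simp add: sum_distrib_left mult.assoc)
  qed
  \<comment> \<open>The infimum ranges over nonnegative factors only, so this makes the factor
    admissible.\<close>
  have "0 \<le> ?C * ln (real t)" using L(2) by (rule order_trans[rotated]) simp
  then show "flow_cut_gap V E c D h \<le> ?C * ln (real t)"
    unfolding flow_cut_gap_def using feas by (intro cInf_lower bdd_belowI[of _ 0]) auto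
qed

end
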